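(* Let $k$ be a field with $\operatorname{char}(k)\neq 2$. Each orbit in $V^{ss}_k/G_k$ represents exactly one isomorphism class of maximal flags $(k\subset K\subset Q\subset C)$ of composition algebras over $k$, and every isomorphism class of maximal flags of composition algebras over $k$ is represented by some orbit in $V^{ss}_k/G_k$. (In other words, "represents" defines a surjective map $f_1^{ss}$ from $V^{ss}_k/G_k$ onto the set of isomorphism classes of maximal flags of composition algebras over $k$.)
   Context: Setting. $V_6$ is the $6$-dimensional space of column vectors over $k$ with standard basis $e_1,\dots,e_6$; $J$ is the alternating bilinear form on $V_6$ with matrix $M_J=\begin{pmatrix}0&I_3\\-I_3&0\end{pmatrix}$; $G=Sp_6=\{g\in GL_6: gM_Jg^t=M_J\}$. $G$ acts on $V=\wedge^3V_6$; write $e_ie_je_l=e_i\wedge e_j\wedge e_l$. Let $\psi:\wedge^3V_6\to V_6$, $\psi(v_1\wedge v_2\wedge v_3)=J(v_2,v_3)v_1-J(v_1,v_3)v_2+J(v_1,v_2)v_3$, and $X=\ker\psi$ (dimension $14$). The subspace $W=\{v\wedge(e_1e_4+e_2e_5+e_3e_6):v\in V_6\}$ is $G$-stable, $\wedge^3V_6=X\oplus W$, and $\psi|_W:W\to V_6$ is a $G$-isomorphism; through it write $V=X\oplus V_6$, with elements $\tilde x=(x,v)$ and $g.(x,v)=(gx,gv)$. Invariants. Let $\partial/\partial e_m$ be the operator with $\frac{\partial}{\partial e_m}(e_i\wedge e_j\wedge e_l)=\delta_{im}e_j\wedge e_l-\delta_{jm}e_i\wedge e_l+\delta_{lm}e_i\wedge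 e_j$, let $\tau=e_1\wedge\cdots\wedge e_6$, and for $w\in\wedge^3V_6$ define $\phi(w)=(\phi_{ij}(w))_{6\times6}$ by $w\wedge\frac{\partial}{\partial e_i}(w)\wedge e_j=\phi_{ij}(w)\tau$. Then $\phi(w)^2=f(w)I_6$ for a quartic form $f$. Put $f_1=-\frac14 f|_X$ and $f_2((x,v))=-\frac12 v^tM_J\phi(x)v$; both are $G$-invariant. $V^{ss}=\{(x,v): f_1(x)\ne0,\ f_2((x,v))\neq0\}$. A subscript $k$ denotes $k$-rational points; $V^{ss}_k/G_k$ is the set of $G_k$-orbits in $V^{ss}_k$. Composition algebras. A composition algebra is a unital, not necessarily associative, $k$-algebra $C$ with a non-degenerate multiplicative quadratic form $N_C$ (the norm). Those of dimension $2,4,8$ are called quadratic, quaternion, octonion algebras (split ones included; the split ones are $k\times k$, $M_2(k)$, and the Zorn algebra $Zorn(k)$). A maximal flag is a chain $(k\subset K\subset Q\subset C)$ of composition subalgebras of dimensions $1,2,4,8$. An isomorphism of maximal flags $(k\subset K\subset Q\subset C)\to(k\subset K'\subset Q'\subset C')$ is an algebra isomorphism $\theta:C\to C'$ with $\theta(Q)=Q'$, $\theta(K)=K'$. $SL_1(Q)$ is the algebraic group of norm-one elements of $Q$. For $i\in k^\times$, $k(\sqrt{-i})$ means $k[t]/\langle t^2+i\rangle$ (so $\simeq k\times k$ if $-i\in k^{\times2}$). The $2$-flag attached to $x$. For $x\in X_k$ with $f_1(x)=i\in k^\times$, a $2$-flag $(K\subset C)$ (with $\dim K=2$, $\dim C=8$)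 is attached, up to isomorphism, as follows. If $-i\in k^{\times2}$, it is $(k\times k\subset Zorn(k))$. If $-i\notin k^{\times2}$, then $x$ is $G_k$-equivalent to an element $-e_1e_2e_3-y_0e_4e_5e_6+y_1e_1e_5e_6+y_2e_4e_2e_6+y_3e_4e_5e_3$ with $y_0\in k$, $y_1,y_2,y_3\in k^\times$ and $y_1y_2y_3-\frac14y_0^2=i$; then $K=k(\sqrt{-i})$ and $C$ is the octonion algebra containing $K$ whose norm is $N_K\perp y_1N_K\perp y_2N_K\perp y_3N_K$. "Represents". The $G_k$-orbit of $\tilde x=(x,v)\in V^{ss}_k$ represents the isomorphism class of $(k\subset K\subset Q\subset C)$ if $(K\subset C)$ is isomorphic to the $2$-flag attached to $x$ and the stabilizer of $\tilde x$ in $G=Sp_6$ is isomorphic over $k$ to $SL_1(Q)$. *)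

theory Defs
  imports "HOL-Algebra.Algebraic_Closure_Type" "HOL-Analysis.Analysis"
begin

section \<open>The exterior algebra of a six-dimensional space\<close>

text \<open>
  The exterior algebra of \<open>V\<^sub>6\<close> has the type \<open>'a ^ (6 set)\<close>: the coordinate at a set \<open>S\<close> is the
  coefficient of the product of the \<open>e\<^sub>i\<close>, \<open>i \<in> S\<close>, taken in increasing order.  The order is the one
  of the numeral type \<open>6\<close>, where \<open>6 = 0\<close> is the least element.  No definition below
  depends on this choice, as everything is expressed through the product \<open>wedge\<close>; in particular
  \<open>tau\<close> is the product \<open>e\<^sub>1 \<and> \<dots> \<and> e\<^sub>6\<close> in this order, and not the coordinate vector at \<open>UNIV\<close>.
\<close>

definition ext_sign :: "6 set \<Rightarrow> 6 set \<Rightarrow> 'a::comm_ring_1" where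
  "ext_sign S T = (- 1) ^ card {(i, j). i \<in> S \<and> j \<in> T \<and> j < i}"

definition wedge :: "'a::comm_ring_1 ^ (6 set) \<Rightarrow> 'a ^ (6 set) \<Rightarrow> 'a ^ (6 set)"
    (infixr "\<and>\<^sub>w" 67) where
  "a \<and>\<^sub>w b = (\<chi> S. \<Sum>T\<in>Pow S. ext_sign T (S - T) * a $ T * b $ (S - T))"

definition ext1 :: "'a::comm_ring_1 ^ 6 \<Rightarrow> 'a ^ (6 set)" where
  "ext1 v = (\<chi> S. \<Sum>i\<in>UNIV. if S = {i} then v $ i else 0)"

definition bv :: "6 \<Rightarrow> 'a::comm_ring_1 ^ 6" where
  "bv i = axis i 1"

definition wedge3 :: "'a::comm_ring_1 ^ 6 \<Rightarrow> 'a ^ 6 \<Rightarrow> 'a ^ 6 \<Rightarrow> 'a ^ (6 set)" where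
  "wedge3 u v w = ext1 u \<and>\<^sub>w ext1 v \<and>\<^sub>w ext1 w"

definition tau :: "'a::comm_ring_1 ^ (6 set)" where
  "tau = ext1 (bv 1) \<and>\<^sub>w ext1 (bv 2) \<and>\<^sub>w ext1 (bv 3) \<and>\<^sub>w ext1 (bv 4) \<and>\<^sub>w ext1 (bv 5) \<and>\<^sub>w ext1 (bv 6)"

definition Ext3 :: "('a::comm_ring_1 ^ (6 set)) set" where
  "Ext3 = {w. \<forall>S. card S \<noteq> 3 \<longrightarrow> w $ S = 0}"

text \<open>
  The linear map on \<open>\<and>\<^sup>3 V\<^sub>6\<close> with \<open>e\<^sub>i \<and> e\<^sub>j \<and> e\<^sub>l \<mapsto> h i j l\<close>; it is only used for functions \<open>h\<close>
  that are alternating.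
\<close>

definition ext3_lin :: "(6 \<Rightarrow> 6 \<Rightarrow> 6 \<Rightarrow> 'a ^ 'n) \<Rightarrow> 'a::comm_ring_1 ^ (6 set) \<Rightarrow> 'a ^ 'n" where
  "ext3_lin h w = (\<Sum>(i, j, l)\<in>{(i, j, l). i < j \<and> j < l}. w $ {i, j, l} *s h i j l)"

section \<open>The symplectic group and the representation\<close>

definition MJ :: "'a::comm_ring_1 ^ 6 ^ 6" where
  "MJ = (\<chi> i j. if (i, j) \<in> {(1, 4), (2, 5), (3, 6)} then 1
                else if (i, j) \<in> {(4, 1), (5, 2), (6, 3)} then - 1 else 0)"

definition dotp :: "'a::comm_ring_1 ^ 'n \<Rightarrow> 'a ^ 'n \<Rightarrow> 'a" where
  "dotp u v = (\<Sum>i\<in>UNIV. u $ i * v $ i)"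

definition Jform :: "'a::comm_ring_1 ^ 6 \<Rightarrow> 'a ^ 6 \<Rightarrow> 'a" where
  "Jform u v = dotp u (MJ *v v)"

definition Sp6 :: "('a::field ^ 6 ^ 6) set" where
  "Sp6 = {g. invertible g \<and> g ** MJ ** transpose g = MJ}"

definition act3 :: "'a::comm_ring_1 ^ 6 ^ 6 \<Rightarrow> 'a ^ (6 set) \<Rightarrow> 'a ^ (6 set)" where
  "act3 g = ext3_lin (\<lambda>i j l. wedge3 (g *v bv i) (g *v bv j) (g *v bv l))"

definition psi :: "'a::comm_ring_1 ^ (6 set) \<Rightarrow> 'a ^ 6" where
  "psi = ext3_lin (\<lambda>i j l. Jform (bv j) (bv l) *s bv i - Jform (bv i) (bv l) *s bv j + Jform (bv i) (bv j) *s bv l)"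

definition Xspace :: "('a::comm_ring_1 ^ (6 set)) set" where
  "Xspace = {w \<in> Ext3. psi w = 0}"

text \<open>The representation space is \<open>X \<oplus> V\<^sub>6\<close>, with elements written as pairs.\<close>

definition act :: "'a::comm_ring_1 ^ 6 ^ 6 \<Rightarrow> ('a ^ (6 set)) \<times> ('a ^ 6) \<Rightarrow> ('a ^ (6 set)) \<times> ('a ^ 6)" where
  "act g = (\<lambda>(x, v). (act3 g x, g *v v))"

section \<open>The invariants\<close>

definition delta :: "6 \<Rightarrow> 6 \<Rightarrow> 'a::comm_ring_1" where
  "delta i j = (if i = j then 1 else 0)"

definition pd :: "6 \<Rightarrow> 'a::comm_ring_1 ^ (6 set) \<Rightarrow> 'a ^ (6 set)" where
  "pd m = ext3_lin (\<lambda>i j l. delta i m *s (ext1 (bv j) \<and>\<^sub>w ext1 (bv l))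
            - delta j m *s (ext1 (bv i) \<and>\<^sub>w ext1 (bv l)) + delta l m *s (ext1 (bv i) \<and>\<^sub>w ext1 (bv j)))"

definition phi :: "'a::comm_ring_1 ^ (6 set) \<Rightarrow> 'a ^ 6 ^ 6" where
  "phi w = (\<chi> i j. THE c. w \<and>\<^sub>w pd i w \<and>\<^sub>w ext1 (bv j) = c *s tau)"

definition quartic :: "'a::comm_ring_1 ^ (6 set) \<Rightarrow> 'a" where
  "quartic w = (THE c. phi w ** phi w = mat c)"

definition f1 :: "'a::field ^ (6 set) \<Rightarrow> 'a" where
  "f1 x = - (1 / 4) * quartic x"

definition f2 :: "('a::field ^ (6 set)) \<times> ('a ^ 6) \<Rightarrow> 'a" where
  "f2 = (\<lambda>(x, v). - (1 / 2) * dotp v (MJ *v (phi x *v v)))"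

definition Vss :: "(('a::field ^ (6 set)) \<times> ('a ^ 6)) set" where
  "Vss = {(x, v). x \<in> Xspace \<and> f1 x \<noteq> 0 \<and> f2 (x, v) \<noteq> 0}"

definition Vss_orbits :: "(('a::field ^ (6 set)) \<times> ('a ^ 6)) set set" where
  "Vss_orbits = (\<lambda>p. {act g p | g. g \<in> Sp6}) ` Vss"

section \<open>Composition algebras and maximal flags\<close>

text \<open>A \<open>'a\<close>-algebra with a quadratic form, on the additive group of the type \<open>'c\<close>.\<close>

record ('a, 'c) calg =
  scl :: "'a \<Rightarrow> 'c \<Rightarrow> 'c"
  mul :: "'c \<Rightarrow> 'c \<Rightarrow> 'c"
  unt :: "'c"
  nrm :: "'c \<Rightarrow> 'a"

definition polar :: "('a::field, 'c::ab_group_add) calg \<Rightarrow> 'c \<Rightarrow> 'c \<Rightarrow> 'a" where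
  "polar C x y = nrm C (x + y) - nrm C x - nrm C y"

definition nondegenerate_on :: "('a::field, 'c::ab_group_add) calg \<Rightarrow> 'c set \<Rightarrow> bool" where
  "nondegenerate_on C S \<longleftrightarrow> (\<forall>x\<in>S. (\<forall>y\<in>S. polar C x y = 0) \<longrightarrow> x = 0)"

definition composition_algebra :: "('a::field, 'c::ab_group_add) calg \<Rightarrow> bool" where
  "composition_algebra C \<longleftrightarrow>
     vector_space (scl C) \<and>
     (\<forall>x. Vector_Spaces.linear (scl C) (scl C) (\<lambda>y. mul C x y)) \<and>
     (\<forall>y. Vector_Spaces.linear (scl C) (scl C) (\<lambda>x. mul C x y)) \<and>
     (\<forall>x. mul C (unt C) x = x \<and> mul C x (unt C) = x) \<and>
     (\<forall>s x. nrm C (scl C s x) = s\<^sup>2 * nrm C x) \<and>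
     (\<forall>x. Vector_Spaces.linear (scl C) (*) (\<lambda>y. polar C x y)) \<and>
     nondegenerate_on C UNIV \<and>
     (\<forall>x y. nrm C (mul C x y) = nrm C x * nrm C y)"

definition composition_subalgebra :: "('a::field, 'c::ab_group_add) calg \<Rightarrow> 'c set \<Rightarrow> bool" where
  "composition_subalgebra C S \<longleftrightarrow>
     module.subspace (scl C) S \<and> unt C \<in> S \<and> (\<forall>x\<in>S. \<forall>y\<in>S. mul C x y \<in> S) \<and>
     nondegenerate_on C S"

definition dim_on :: "('a::field, 'c::ab_group_add) calg \<Rightarrow> 'c set \<Rightarrow> nat" where
  "dim_on C S = vector_space.dim (scl C) S"

text \<open>
  A composition subalgebra contains the unit, so the one-dimensional member of a
  maximal flag is the line spanned by the unit and is not part of the data.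
\<close>

definition two_flag :: "('a::field, 'c::ab_group_add) calg \<Rightarrow> 'c set \<Rightarrow> bool" where
  "two_flag C K \<longleftrightarrow> composition_algebra C \<and> dim_on C UNIV = 8 \<and>
     composition_subalgebra C K \<and> dim_on C K = 2"

definition maximal_flag :: "('a::field, 'c::ab_group_add) calg \<Rightarrow> 'c set \<Rightarrow> 'c set \<Rightarrow> bool" where
  "maximal_flag C K Q \<longleftrightarrow> two_flag C K \<and>
     composition_subalgebra C Q \<and> dim_on C Q = 4 \<and> K \<subseteq> Q"

definition alg_iso :: "('a::field, 'c::ab_group_add) calg \<Rightarrow> 'c set \<Rightarrow>
    ('a, 'd::ab_group_add) calg \<Rightarrow> 'd set \<Rightarrow> ('c \<Rightarrow> 'd) \<Rightarrow> bool" where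
  "alg_iso A S B T \<theta> \<longleftrightarrow> bij_betw \<theta> S T \<and>
     (\<forall>x\<in>S. \<forall>y\<in>S. \<theta> (x + y) = \<theta> x + \<theta> y \<and> \<theta> (mul A x y) = mul B (\<theta> x) (\<theta> y)) \<and>
     (\<forall>s. \<forall>x\<in>S. \<theta> (scl A s x) = scl B s (\<theta> x)) \<and> \<theta> (unt A) = unt B"

definition flag_iso :: "('a::field, 'c::ab_group_add) calg \<Rightarrow> 'c set \<Rightarrow> 'c set \<Rightarrow>
    ('a, 'd::ab_group_add) calg \<Rightarrow> 'd set \<Rightarrow> 'd set \<Rightarrow> bool" where
  "flag_iso C K Q C' K' Q' \<longleftrightarrow> (\<exists>\<theta>. alg_iso C UNIV C' UNIV \<theta> \<and> \<theta> ` Q = Q' \<and> \<theta> ` K = K')"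

section \<open>The 2-flag attached to a vector\<close>

text \<open>Zorn's vector matrices; \<open>(a, u, v, b)\<close> is the matrix with rows \<open>(a, u)\<close> and \<open>(v, b)\<close>.\<close>

definition cross :: "'a::comm_ring_1 ^ 3 \<Rightarrow> 'a ^ 3 \<Rightarrow> 'a ^ 3" where
  "cross u v = vector [u $ 2 * v $ 3 - u $ 3 * v $ 2,
                       u $ 3 * v $ 1 - u $ 1 * v $ 3,
                       u $ 1 * v $ 2 - u $ 2 * v $ 1]"

definition Zorn :: "('a::field, 'a \<times> ('a ^ 3) \<times> ('a ^ 3) \<times> 'a) calg" where
  "Zorn = \<lparr>
     scl = (\<lambda>s (a, u, v, b). (s * a, s *s u, s *s v, s * b)),
     mul = (\<lambda>(a, u, v, b) (a', u', v', b').
              (a * a' + dotp u v', a *s u' + b' *s u - cross v v',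
               a' *s v + b *s v' + cross u u', b * b' + dotp v u')),
     unt = (1, 0, 0, 1),
     nrm = (\<lambda>(a, u, v, b). a * b - dotp u v)\<rparr>"

definition Zorn_diag :: "('a::field \<times> ('a ^ 3) \<times> ('a ^ 3) \<times> 'a) set" where
  "Zorn_diag = {(a, 0, 0, b) | a b. True}"

text \<open>\<open>k[t]/\<langle>t\<^sup>2 + i\<rangle>\<close>; the pair \<open>(a, b)\<close> stands for the class of \<open>a + b t\<close>.\<close>

definition quad_alg :: "'a::field \<Rightarrow> ('a, 'a \<times> 'a) calg" where
  "quad_alg i = \<lparr>
     scl = (\<lambda>s (a, b). (s * a, s * b)),
     mul = (\<lambda>(a, b) (a', b'). (a * a' - i * b * b', a * b' + b * a')),
     unt = (1, 0),
     nrm = (\<lambda>(a, b). a\<^sup>2 + i * b\<^sup>2)\<rparr>"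

text \<open>The norm of \<open>C\<close> is isometric to \<open>N\<^sub>K \<bottom> y\<^sub>1 N\<^sub>K \<bottom> y\<^sub>2 N\<^sub>K \<bottom> y\<^sub>3 N\<^sub>K\<close>.\<close>

definition norm_decomposes ::
    "('a::field, 'c::ab_group_add) calg \<Rightarrow> 'c set \<Rightarrow> 'a \<Rightarrow> 'a \<Rightarrow> 'a \<Rightarrow> bool" where
  "norm_decomposes C K y1 y2 y3 \<longleftrightarrow>
     (\<exists>T. bij_betw T (K \<times> K \<times> K \<times> K) UNIV \<and>
        (\<forall>p \<in> K \<times> K \<times> K \<times> K. \<forall>q \<in> K \<times> K \<times> K \<times> K. T (p + q) = T p + T q) \<and>
        (\<forall>s. \<forall>a\<in>K. \<forall>b\<in>K. \<forall>c\<in>K. \<forall>d\<in>K.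
           T (scl C s a, scl C s b, scl C s c, scl C s d) = scl C s (T (a, b, c, d))) \<and>
        (\<forall>a\<in>K. \<forall>b\<in>K. \<forall>c\<in>K. \<forall>d\<in>K.
           nrm C (T (a, b, c, d)) = nrm C a + y1 * nrm C b + y2 * nrm C c + y3 * nrm C d))"

definition normal_form :: "'a::field \<Rightarrow> 'a \<Rightarrow> 'a \<Rightarrow> 'a \<Rightarrow> 'a ^ (6 set)" where
  "normal_form y0 y1 y2 y3 =
     - wedge3 (bv 1) (bv 2) (bv 3) - y0 *s wedge3 (bv 4) (bv 5) (bv 6) +
     y1 *s wedge3 (bv 1) (bv 5) (bv 6) + y2 *s wedge3 (bv 4) (bv 2) (bv 6) +
     y3 *s wedge3 (bv 4) (bv 5) (bv 3)"

text \<open>\<open>(K \<subset> C)\<close> is isomorphic to the 2-flag attached to \<open>x\<close>.\<close>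

definition attached :: "'a::field ^ (6 set) \<Rightarrow> ('a, 'c::ab_group_add) calg \<Rightarrow> 'c set \<Rightarrow> bool" where
  "attached x C K \<longleftrightarrow> two_flag C K \<and>
     (if \<exists>r. r\<^sup>2 = - f1 x
      then \<exists>\<theta>. alg_iso C UNIV Zorn UNIV \<theta> \<and> \<theta> ` K = Zorn_diag
      else (\<exists>\<theta>. alg_iso C K (quad_alg (f1 x)) UNIV \<theta>) \<and>
           (\<exists>y0 y1 y2 y3. y1 \<noteq> 0 \<and> y2 \<noteq> 0 \<and> y3 \<noteq> 0 \<and>
              y1 * y2 * y3 - 1 / 4 * y0\<^sup>2 = f1 x \<and>
              (\<exists>g\<in>Sp6. act3 g x = normal_form y0 y1 y2 y3) \<and>
              norm_decomposes C K y1 y2 y3))"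

section \<open>Stabilizers and norm-one groups as algebraic groups\<close>

text \<open>
  A linear algebraic group over \<open>k\<close> is given by its points over the algebraic closure, embedded in
  an affine space; morphisms over \<open>k\<close> are restrictions of polynomial maps with coefficients in \<open>k\<close>.
  \<open>poly_funs cs\<close> is the \<open>k\<close>-algebra of functions generated by a set \<open>cs\<close> of
  coordinate functions.
\<close>

inductive_set poly_funs :: "('x \<Rightarrow> 'a::field alg_closure) set \<Rightarrow> ('x \<Rightarrow> 'a alg_closure) set"
  for cs :: "('x \<Rightarrow> 'a alg_closure) set" where
  coord: "c \<in> cs \<Longrightarrow> c \<in> poly_funs cs"
| const: "(\<lambda>_. to_ac a) \<in> poly_funs cs"
| add: "p \<in> poly_funs cs \<Longrightarrow> q \<in> poly_funs cs \<Longrightarrow> (\<lambda>x. p x + q x) \<in> poly_funs cs"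
| mult: "p \<in> poly_funs cs \<Longrightarrow> q \<in> poly_funs cs \<Longrightarrow> (\<lambda>x. p x * q x) \<in> poly_funs cs"

definition mat_coords :: "('a::field alg_closure ^ 6 ^ 6 \<Rightarrow> 'a alg_closure) set" where
  "mat_coords = {(\<lambda>g. g $ i $ j) | i j. True}"

definition vec_coords :: "('a::field alg_closure ^ 4 \<Rightarrow> 'a alg_closure) set" where
  "vec_coords = {(\<lambda>s. s $ i) | i. True}"

definition stabilizer :: "('a::field ^ (6 set)) \<times> ('a ^ 6) \<Rightarrow> ('a alg_closure ^ 6 ^ 6) set" where
  "stabilizer = (\<lambda>(x, v). {g \<in> Sp6.
     act g (\<chi> S. to_ac (x $ S), \<chi> i. to_ac (v $ i)) = (\<chi> S. to_ac (x $ S), \<chi> i. to_ac (v $ i))})"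

definition basis_of :: "('a::field, 'c::ab_group_add) calg \<Rightarrow> 'c set \<Rightarrow> ('n \<Rightarrow> 'c) \<Rightarrow> bool" where
  "basis_of C Q b \<longleftrightarrow> inj b \<and> \<not> module.dependent (scl C) (range b) \<and>
     module.span (scl C) (range b) = Q"

text \<open>
  Multiplication and norm of the base change of a subalgebra with basis \<open>b\<close>, in
  coordinates with respect to \<open>b\<close>.
\<close>

definition ext_mul :: "('a::field, 'c::ab_group_add) calg \<Rightarrow> (4 \<Rightarrow> 'c) \<Rightarrow>
    'a alg_closure ^ 4 \<Rightarrow> 'a alg_closure ^ 4 \<Rightarrow> 'a alg_closure ^ 4" where
  "ext_mul C b s t = (\<chi> l. \<Sum>i\<in>UNIV. \<Sum>j\<in>UNIV. s $ i * t $ j *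
     to_ac (module.representation (scl C) (range b) (mul C (b i) (b j)) (b l)))"

definition ext_nrm :: "('a::field, 'c::ab_group_add) calg \<Rightarrow> (4 \<Rightarrow> 'c) \<Rightarrow>
    'a alg_closure ^ 4 \<Rightarrow> 'a alg_closure" where
  "ext_nrm C b s = (\<Sum>i\<in>UNIV. (s $ i)\<^sup>2 * to_ac (nrm C (b i))) +
     (\<Sum>(i, j)\<in>{(i, j). i < j}. s $ i * s $ j * to_ac (polar C (b i) (b j)))"

definition SL1 :: "('a::field, 'c::ab_group_add) calg \<Rightarrow> (4 \<Rightarrow> 'c) \<Rightarrow> ('a alg_closure ^ 4) set" where
  "SL1 C b = {s. ext_nrm C b s = 1}"

text \<open>
  The choice of the basis \<open>b\<close> is immaterial: a change of basis is a linear
  isomorphism over \<open>k\<close> of the resulting groups.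
\<close>

definition stabilizer_iso_SL1 ::
    "('a::field ^ (6 set)) \<times> ('a ^ 6) \<Rightarrow> ('a, 'c::ab_group_add) calg \<Rightarrow> 'c set \<Rightarrow> bool" where
  "stabilizer_iso_SL1 p C Q \<longleftrightarrow>
     (\<exists>b F G. basis_of C Q b \<and>
        (\<forall>i. (\<lambda>g. F g $ i) \<in> poly_funs mat_coords) \<and>
        (\<forall>i j. (\<lambda>s. G s $ i $ j) \<in> poly_funs vec_coords) \<and>
        (\<forall>g\<in>stabilizer p. F g \<in> SL1 C b \<and> G (F g) = g) \<and>
        (\<forall>s\<in>SL1 C b. G s \<in> stabilizer p \<and> F (G s) = s) \<and>
        (\<forall>g\<in>stabilizer p. \<forall>h\<in>stabilizer p. F (g ** h) = ext_mul C b (F g) (F h)))"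

text \<open>The orbit of \<open>(x, v)\<close> represents the isomorphism class of \<open>(k \<subset> K \<subset> Q \<subset> C)\<close>.\<close>

definition represents :: "('a::field ^ (6 set)) \<times> ('a ^ 6) \<Rightarrow>
    ('a, 'c::ab_group_add) calg \<Rightarrow> 'c set \<Rightarrow> 'c set \<Rightarrow> bool" where
  "represents = (\<lambda>(x, v) C K Q. attached x C K \<and> stabilizer_iso_SL1 (x, v) C Q)"

end

theory Submission
  imports Defs
begin

text \<open>
  Every orbit in \<open>V\<^sup>s\<^sup>s\<close> contains a vector \<open>(x, e\<^sub>4)\<close> with \<open>x\<close> in the normal form with \<open>y\<^sub>0 = 0\<close>. Put
  \<open>i = y\<^sub>1 y\<^sub>2 y\<^sub>3\<close>. The flag of the orbit is the Cayley-Dickson tower with parameters \<open>i, y\<^sub>1, y\<^sub>2\<close>: the stabilizer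
  of \<open>(x, e\<^sub>4)\<close> is the norm-one group of the quaternion algebra with parameters \<open>i, y\<^sub>1\<close>, and the norm of the
  octonion algebra is \<open>\<langle>1, i\<rangle> \<bottom> - f\<^sub>2(x, _)\<close>.

  Conversely a flag represented by the orbit has these parameters. The attached 2-flag determines \<open>K\<close> and,
  through \<open>f\<^sub>2\<close>, the norm of \<open>C\<close>. An isomorphism of norm-one groups over \<open>k\<close> preserves the square of the trace,
  because it intertwines the adjoint representations; hence its differential at 1, computed
  along Cayley curves, is an isometry of the pure parts of the two quaternion algebras. By Witt cancellation
  inside \<open>C\<close> the flag is determined up to isomorphism by \<open>K\<close> and by the isometry classes of the norms of
  \<open>Q\<close> and \<open>C\<close>.
\<close>

text \<open>A trivector x together with J defines an alternating product [u, v] =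
  \<open>cross6 x u v\<close> on V_6. For x in X its double product is governed by phi: 2 [u,
  [u, v]] = J(u, phi v) u + J(u, v) phi u - J(u, phi u) v. This identity and the symmetry of J(u,
  phi v) are checked in coordinates; that phi^2 is a scalar, that phi is conjugate linear for the
  product and that phi is equivariant are then deduced from them. The product also explains the
  normal form: two orthogonal anisotropic vectors, their product and the images of the three under
  phi give a symplectic basis in which every constant is forced. For the norm-one groups the
  obstacle is that an isomorphism is only a polynomial bijection over the closure and comes from no
  map of algebras. Conjugation by g on the quaternions has trace equal to the square of the trace of
  g, so preserving this number takes only a linear intertwiner, and the differential supplies one.
  Cayley curves replace one-parameter subgroups because they are rational in every characteristic
  other than 2.\<close>

no_notation fps_nth (infixl "$" 75)

section \<open>The exterior algebra and the map \<open>phi\<close> in coordinates\<close>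

lemma UNIV_6: "(UNIV :: 6 set) = {0, 1, 2, 3, 4, 5}"
  by (rule sym, rule card_subset_eq) simp_all

lemma sum_6: "(\<Sum>i\<in>UNIV. f i) = f 0 + f 1 + f 2 + f 3 + f 4 + f (5::6)"
  unfolding UNIV_6 by (simp add: add.assoc)

lemma all_6: "(\<forall>i::6. P i) \<longleftrightarrow> P 0 \<and> P 1 \<and> P 2 \<and> P 3 \<and> P 4 \<and> P 5"
proof -
  have "(\<forall>i. P i) \<longleftrightarrow> (\<forall>i\<in>UNIV. P i)" by simp
  then show ?thesis unfolding UNIV_6 by simp
qed

lemma less_6 [simp]:
  "(0::6) < 1" "(0::6) < 2" "(0::6) < 3" "(0::6) < 4" "(0::6) < 5" "(1::6) < 2" "(1::6) < 3" "(1::6) < 4" "(1::6) < 5" "(2::6) < 3" "(2::6) < 4" "(2::6) < 5" "(3::6) < 4" "(3::6) < 5" "(4::6) < 5"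
  by (simp_all add: less_bit0_def bit0.Rep_numeral bit0.Rep_0 bit0.Rep_1)

lemma not_less_6 [simp]:
  "\<not> (0::6) < 0" "\<not> (1::6) < 0" "\<not> (1::6) < 1" "\<not> (2::6) < 0" "\<not> (2::6) < 1" "\<not> (2::6) < 2" "\<not> (3::6) < 0" "\<not> (3::6) < 1" "\<not> (3::6) < 2" "\<not> (3::6) < 3" "\<not> (4::6) < 0" "\<not> (4::6) < 1" "\<not> (4::6) < 2" "\<not> (4::6) < 3" "\<not> (4::6) < 4" "\<not> (5::6) < 0" "\<not> (5::6) < 1" "\<not> (5::6) < 2" "\<not> (5::6) < 3" "\<not> (5::6) < 4" "\<not> (5::6) < 5"
  by (simp_all add: less_bit0_def bit0.Rep_numeral bit0.Rep_0 bit0.Rep_1)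

lemma sum_triples:
  "(\<Sum>(i, j, l)\<in>{(i, j, l). i < j \<and> j < l}. f i j l) =
    (\<Sum>i\<in>UNIV. \<Sum>j\<in>UNIV. \<Sum>l\<in>UNIV. if i < j \<and> j < l then f i j l else 0)"
  for f :: "6 \<Rightarrow> 6 \<Rightarrow> 6 \<Rightarrow> 'b::comm_monoid_add"
proof -
  have "(\<Sum>(i, j, l)\<in>{(i, j, l). i < j \<and> j < l}. f i j l) =
      (\<Sum>(i, j, l)\<in>UNIV. if i < j \<and> j < l then f i j l else 0)"
    by (rule sum.mono_neutral_cong_left) (auto split: if_splits)
  then show ?thesis
    unfolding sum.cartesian_product by simp
qed

lemma sum_triples_expand:
  "(\<Sum>(i, j, l)\<in>{(i, j, l). i < j \<and> j < l}. f i j l) =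
    f 0 1 2 + f 0 1 3 + f 0 1 4 + f 0 1 5 + f 0 2 3 + f 0 2 4 + f 0 2 5 + f 0 3 4 + f 0 3 5 + f 0 4 5 + f 1 2 3 + f 1 2 4 + f 1 2 5 + f 1 3 4 + f 1 3 5 + f 1 4 5 + f 2 3 4 + f 2 3 5 + f 2 4 5 + f 3 4 5"
  for f :: "6 \<Rightarrow> 6 \<Rightarrow> 6 \<Rightarrow> 'b::comm_monoid_add"
  unfolding sum_triples sum_6 by (simp add: add.assoc)

lemma ext_sign_singleton: "ext_sign {i} T = (- 1) ^ card {j \<in> T. j < i}"
proof -
  have "{(a, b). a \<in> {i} \<and> b \<in> T \<and> b < a} = Pair i ` {j \<in> T. j < i}" by auto
  then show ?thesis by (simp add: ext_sign_def card_image inj_on_def)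
qed

lemma ext1_singleton [simp]: "ext1 v $ {i} = v $ i"
  by (simp add: ext1_def)

lemma ext1_eq_0: "card S \<noteq> 1 \<Longrightarrow> ext1 v $ S = 0"
  by (auto simp: ext1_def intro!: sum.neutral)

lemma wedge_ext1_left:
  "(ext1 v \<and>\<^sub>w b) $ S = (\<Sum>i\<in>S. ext_sign {i} (S - {i}) * v $ i * b $ (S - {i}))"
proof -
  have "(ext1 v \<and>\<^sub>w b) $ S = (\<Sum>T\<in>(\<lambda>i. {i}) ` S. ext_sign T (S - T) * ext1 v $ T * b $ (S - T))"
    unfolding wedge_def vec_lambda_beta
  proof (rule sum.mono_neutral_right)
    show "\<forall>T\<in>Pow S - (\<lambda>i. {i}) ` S. ext_sign T (S - T) * ext1 v $ T * b $ (S - T) = 0"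
    proof
      fix T assume T: "T \<in> Pow S - (\<lambda>i. {i}) ` S"
      then have "card T \<noteq> 1" by (auto simp: card_1_singleton_iff)
      then show "ext_sign T (S - T) * ext1 v $ T * b $ (S - T) = 0" by (simp add: ext1_eq_0)
    qed
  qed auto
  also have "\<dots> = (\<Sum>i\<in>S. ext_sign {i} (S - {i}) * v $ i * b $ (S - {i}))"
    by (subst sum.reindex) auto
  finally show ?thesis .
qed

lemma wedge_ext1_right:
  "(a \<and>\<^sub>w ext1 v) $ S = (\<Sum>i\<in>S. ext_sign (S - {i}) {i} * a $ (S - {i}) * v $ i)"
proof -
  have eq: "S - (S - {i}) = {i}" if "i \<in> S" for i using that by auto
  have "(a \<and>\<^sub>w ext1 v) $ S = (\<Sum>T\<in>(\<lambda>i. S - {i}) ` S. ext_sign T (S - T) * a $ T * ext1 v $ (S - T))"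
    unfolding wedge_def vec_lambda_beta
  proof (rule sum.mono_neutral_right)
    show "\<forall>T\<in>Pow S - (\<lambda>i. S - {i}) ` S. ext_sign T (S - T) * a $ T * ext1 v $ (S - T) = 0"
    proof
      fix T assume T: "T \<in> Pow S - (\<lambda>i. S - {i}) ` S"
      have "card (S - T) \<noteq> 1"
      proof
        assume "card (S - T) = 1"
        then obtain i where "S - T = {i}" by (auto simp: card_1_singleton_iff)
        then have "i \<in> S" "T = S - {i}" using T by auto
        then show False using T by auto
      qed
      then show "ext_sign T (S - T) * a $ T * ext1 v $ (S - T) = 0" by (simp add: ext1_eq_0)
    qed
  qed auto
  also have "\<dots> = (\<Sum>i\<in>S. ext_sign (S - {i}) {i} * a $ (S - {i}) * v $ i)"
    by (subst sum.reindex) (auto simp: inj_on_def eq)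
  finally show ?thesis .
qed

section \<open>Homogeneous elements and the coordinates of products\<close>

definition homog :: "nat \<Rightarrow> 'a::comm_ring_1 ^ (6 set) \<Rightarrow> bool" where
  "homog n w \<longleftrightarrow> (\<forall>S. card S \<noteq> n \<longrightarrow> w $ S = 0)"

lemma homog_ext1: "homog 1 (ext1 v)"
  by (simp add: homog_def ext1_eq_0)

lemma homog_wedge:
  assumes "homog m a" "homog n b"
  shows "homog (m + n) (a \<and>\<^sub>w b)"
  unfolding homog_def wedge_def
proof (intro allI impI)
  fix S :: "6 set" assume S: "card S \<noteq> m + n"
  have "a $ T * b $ (S - T) = 0" if "T \<subseteq> S" for T
  proof -
    have "card S = card T + card (S - T)" using that by (simp add: card_Diff_subset card_mono)
    then have "card T \<noteq> m \<or> card (S - T) \<noteq> n" using S by auto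
    then show ?thesis using assms by (auto simp: homog_def)
  qed
  then show "(\<chi> S. \<Sum>T\<in>Pow S. ext_sign T (S - T) * a $ T * b $ (S - T)) $ S = 0"
    by (auto intro!: sum.neutral simp: mult.assoc)
qed

lemma homog_sum: "(\<And>i. i \<in> A \<Longrightarrow> homog n (f i)) \<Longrightarrow> homog n (sum f A)"
  by (simp add: homog_def)

lemma homog_linear:
  "homog n a \<Longrightarrow> homog n (c *s a)"
  "homog n a \<Longrightarrow> homog n b \<Longrightarrow> homog n (a + b)"
  "homog n a \<Longrightarrow> homog n b \<Longrightarrow> homog n (a - b)"
  "homog n a \<Longrightarrow> homog n (- a)"
  "homog n 0"
  by (simp_all add: homog_def)

lemma Ext3_iff: "w \<in> Ext3 \<longleftrightarrow> homog 3 w"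
  by (simp add: Ext3_def homog_def)

text \<open>The minor on the rows i, j, l of the matrix with columns u, v, w, expanded along
  u.\<close>

definition det3 :: "'a::comm_ring_1 ^ 6 \<Rightarrow> 'a ^ 6 \<Rightarrow> 'a ^ 6 \<Rightarrow> 6 \<Rightarrow> 6 \<Rightarrow> 6 \<Rightarrow> 'a" where
  "det3 u v w i j l = u $ i * (v $ j * w $ l - v $ l * w $ j) -
     u $ j * (v $ i * w $ l - v $ l * w $ i) + u $ l * (v $ i * w $ j - v $ j * w $ i)"

lemma wedge2_pair:
  assumes "i < j"
  shows "(ext1 u \<and>\<^sub>w ext1 v) $ {i, j} = u $ i * v $ j - u $ j * v $ i"
proof -
  have d: "{i, j} - {i} = {j}" "{i, j} - {j} = {i}" using assms by auto
  have c: "{k. (k = i \<or> k = j) \<and> k \<noteq> i \<and> k < i} = {}"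
    "{k. (k = i \<or> k = j) \<and> k \<noteq> j \<and> k < j} = {i}" using assms by auto
  have "i \<noteq> j" using assms by auto
  then show ?thesis
    unfolding wedge_ext1_left ext_sign_singleton by (simp add: d c)
qed

lemma homog_wedge2: "homog 2 (ext1 u \<and>\<^sub>w ext1 v)"
  using homog_wedge[OF homog_ext1 homog_ext1, of u v] unfolding one_add_one .

lemma homog_wedge3: "homog 3 (wedge3 u v w)"
  using homog_wedge[OF homog_ext1 homog_wedge2, of u v w] by (simp add: wedge3_def eval_nat_numeral)

lemma wedge3_triple:
  assumes "i < j" "j < l"
  shows "wedge3 u v w $ {i, j, l} = det3 u v w i j l"
proof -
  have il: "i < l" using assms by simp
  have d: "{i, j, l} - {i} = {j, l}" "{i, j, l} - {j} = {i, l}" "{i, j, l} - {l} = {i, j}"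
    using assms il by auto
  have c: "{k. (k = i \<or> k = j \<or> k = l) \<and> k \<noteq> i \<and> k < i} = {}"
    "{k. (k = i \<or> k = j \<or> k = l) \<and> k \<noteq> j \<and> k < j} = {i}"
    "{k. (k = i \<or> k = j \<or> k = l) \<and> k \<noteq> l \<and> k < l} = {i, j}"
    using assms il by auto
  have n: "i \<noteq> j" "j \<noteq> l" "i \<noteq> l" using assms by auto
  show ?thesis
    unfolding wedge3_def wedge_ext1_left[of u] ext_sign_singleton
    using n by (simp add: d c wedge2_pair assms il det3_def)
qed



lemma ext_sign_prod: "ext_sign S T = (\<Prod>i\<in>S. \<Prod>j\<in>T. if j < i then - 1 else 1)"
proof -
  have "(\<Prod>i\<in>S. \<Prod>j\<in>T. if j < i then - 1 else 1 :: 'a) =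
      (\<Prod>(i, j)\<in>S \<times> T. if j < i then - 1 else 1)"
    by (rule prod.cartesian_product)
  also have "\<dots> = (\<Prod>(i, j)\<in>{(i, j). i \<in> S \<and> j \<in> T \<and> j < i}. - 1)"
    by (rule prod.mono_neutral_cong_right) (auto split: if_splits)
  also have "\<dots> = ext_sign S T" by (simp add: ext_sign_def split_beta)
  finally show ?thesis by simp
qed

lemma card_3_ordered:
  assumes "card (T :: 6 set) = 3"
  obtains i j l where "i < j" "j < l" "T = {i, j, l}"
proof -
  define xs where "xs = sorted_list_of_set T"
  have xs: "sorted_wrt (<) xs" "set xs = T" "length xs = 3"
    by (simp_all add: xs_def assms)
  from xs(3) obtain i j l where "xs = [i, j, l]"
    by (auto simp: length_Suc_conv eval_nat_numeral)
  with xs that show ?thesis by auto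
qed

lemma triple_inject:
  assumes "(i :: 6) < j" "j < l" "i' < j'" "j' < l'" "{i, j, l} = {i', j', l'}"
  shows "i = i' \<and> j = j' \<and> l = l'"
  using strict_sorted_equal[of "[i, j, l]" "[i', j', l']"] assms by fastforce

section \<open>Products that land in the top degree\<close>

lemma wedge_UNIV:
  assumes "homog 3 w"
  shows "(w \<and>\<^sub>w z) $ UNIV = (\<Sum>(i, j, l)\<in>{(i, j, l). i < j \<and> j < l}.
    ext_sign {i, j, l} (- {i, j, l}) * w $ {i, j, l} * z $ (- {i, j, l}))"
proof -
  let ?S = "{(i, j, l). (i :: 6) < j \<and> j < l}" and ?g = "\<lambda>(i, j, l). {i, j, l :: 6}"
  have "(w \<and>\<^sub>w z) $ UNIV = (\<Sum>T\<in>?g ` ?S. ext_sign T (- T) * w $ T * z $ (- T))"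
    unfolding wedge_def vec_lambda_beta Compl_eq_Diff_UNIV
  proof (rule sum.mono_neutral_right)
    show "\<forall>T\<in>Pow UNIV - ?g ` ?S. ext_sign T (UNIV - T) * w $ T * z $ (UNIV - T) = 0"
    proof
      fix T assume T: "T \<in> Pow UNIV - ?g ` ?S"
      have "card T \<noteq> 3"
      proof
        assume "card T = 3"
        then obtain i j l where "i < j" "j < l" "T = {i, j, l}" by (rule card_3_ordered)
        then have "T \<in> ?g ` ?S" by (auto intro!: image_eqI[of _ _ "(i, j, l)"])
        then show False using T by simp
      qed
      then show "ext_sign T (UNIV - T) * w $ T * z $ (UNIV - T) = 0"
        using assms by (simp add: homog_def)
    qed
  qed auto
  also have "\<dots> = (\<Sum>(i, j, l)\<in>?S. ext_sign {i, j, l} (- {i, j, l}) * w $ {i, j, l} * z $ (- {i, j, l}))"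
    by (subst sum.reindex) (auto simp: inj_on_def split_beta dest: triple_inject)
  finally show ?thesis .
qed

lemma Compl_triple:
  "- {0, 1, 2::6} = {3, 4, 5}"
  "- {0, 1, 3::6} = {2, 4, 5}"
  "- {0, 1, 4::6} = {2, 3, 5}"
  "- {0, 1, 5::6} = {2, 3, 4}"
  "- {0, 2, 3::6} = {1, 4, 5}"
  "- {0, 2, 4::6} = {1, 3, 5}"
  "- {0, 2, 5::6} = {1, 3, 4}"
  "- {0, 3, 4::6} = {1, 2, 5}"
  "- {0, 3, 5::6} = {1, 2, 4}"
  "- {0, 4, 5::6} = {1, 2, 3}"
  "- {1, 2, 3::6} = {0, 4, 5}"
  "- {1, 2, 4::6} = {0, 3, 5}"
  "- {1, 2, 5::6} = {0, 3, 4}"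
  "- {1, 3, 4::6} = {0, 2, 5}"
  "- {1, 3, 5::6} = {0, 2, 4}"
  "- {1, 4, 5::6} = {0, 2, 3}"
  "- {2, 3, 4::6} = {0, 1, 5}"
  "- {2, 3, 5::6} = {0, 1, 4}"
  "- {2, 4, 5::6} = {0, 1, 3}"
  "- {3, 4, 5::6} = {0, 1, 2}"
  unfolding Compl_eq_Diff_UNIV UNIV_6 by (simp_all add: insert_Diff_if)

lemma wedge_UNIV_expand:
  assumes "homog 3 w"
  shows "(w \<and>\<^sub>w z) $ UNIV = w $ {0, 1, 2} * z $ {3, 4, 5} - w $ {0, 1, 3} * z $ {2, 4, 5} + w $ {0, 1, 4} * z $ {2, 3, 5} - w $ {0, 1, 5} * z $ {2, 3, 4} + w $ {0, 2, 3} * z $ {1, 4, 5} - w $ {0, 2, 4} * z $ {1, 3, 5} + w $ {0, 2, 5} * z $ {1, 3, 4} + w $ {0, 3, 4} * z $ {1, 2, 5} - w $ {0, 3, 5} * z $ {1, 2, 4} + w $ {0, 4, 5} * z $ {1, 2, 3} - w $ {1, 2, 3} * z $ {0, 4, 5} + w $ {1, 2, 4} * z $ {0, 3, 5} - w $ {1, 2, 5} * z $ {0, 3, 4} - w $ {1, 3, 4} * z $ {0, 2, 5} + w $ {1, 3, 5} * z $ {0, 2, 4} - w $ {1, 4, 5} * z $ {0, 2, 3} + w $ {2, 3, 4} * z $ {0, 1, 5} - w $ {2, 3, 5} * z $ {0, 1, 4} + w $ {2, 4, 5} * z $ {0, 1, 3} - w $ {3, 4, 5} * z $ {0, 1, 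2}"
  unfolding wedge_UNIV[OF assms] sum_triples_expand Compl_triple
  by (simp add: ext_sign_prod)

lemma wedge_ext1_right_triple:
  assumes "i < j" "j < l"
  shows "(p \<and>\<^sub>w ext1 v) $ {i, j, l} = p $ {i, j} * v $ l - p $ {i, l} * v $ j + p $ {j, l} * v $ i"
proof -
  have il: "i < l" using assms by simp
  have n: "i \<noteq> j" "j \<noteq> l" "i \<noteq> l" "\<not> j < i" "\<not> l < j" "\<not> l < i" using assms il by auto
  have d: "{i, j, l} - {i} = {j, l}" "{i, j, l} - {j} = {i, l}" "{i, j, l} - {l} = {i, j}"
    using n by auto
  have "(p \<and>\<^sub>w ext1 v) $ {i, j, l} = ext_sign ({i, j, l} - {i}) {i} * p $ ({i, j, l} - {i}) * v $ i +
    (ext_sign ({i, j, l} - {j}) {j} * p $ ({i, j, l} - {j}) * v $ j +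
     ext_sign ({i, j, l} - {l}) {l} * p $ ({i, j, l} - {l}) * v $ l)"
    unfolding wedge_ext1_right using n by simp
  then show ?thesis
    unfolding d by (simp add: ext_sign_prod assms il n)
qed

text \<open>Contraction with the dual vector at m: the sign is that of moving m to the front of the
  increasing triple it forms with a and b.\<close>

lemma pd_pair:
  fixes w :: "'a::comm_ring_1 ^ (6 set)"
  assumes "a < b"
  shows "pd m w $ {a, b} = (if m < a then w $ {m, a, b} else if m = a then 0 else
    if m < b then - w $ {a, m, b} else if m = b then 0 else w $ {a, b, m})"
proof -
  have delta: "(\<Sum>i\<in>UNIV. \<Sum>j\<in>UNIV. \<Sum>l\<in>UNIV. if i = x \<and> j = y \<and> l = z then c else 0) = c"
    for x y z :: 6 and c :: 'a
  proof -
    have "(\<Sum>l\<in>UNIV. if i = x \<and> j = y \<and> l = z then c else 0) = (if j = y then if i = x then c else 0 else 0)"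
      for i j by (cases "i = x \<and> j = y") auto
    then show ?thesis by simp
  qed
  \<comment> \<open>The three Kronecker terms of \<open>pd\<close> are sorted by the position of m
    in the triple, so that each of them selects a single triple.\<close>
  have summand: "(if i < j \<and> j < l then (w $ {i, j, l} *s (delta i m *s (ext1 (bv j) \<and>\<^sub>w ext1 (bv l))
            - delta j m *s (ext1 (bv i) \<and>\<^sub>w ext1 (bv l)) + delta l m *s (ext1 (bv i) \<and>\<^sub>w ext1 (bv j)))) $ {a, b} else 0)
     = (if i = m \<and> j = a \<and> l = b then if m < a then w $ {m, a, b} else 0 else 0)
     + (if i = a \<and> j = m \<and> l = b then if a < m \<and> m < b then - w $ {a, m, b} else 0 else 0)
     + (if i = a \<and> j = b \<and> l = m then if b < m then w $ {a, b, m} else 0 else 0)" for i j l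
  proof -
    have e: "(ext1 (bv x) \<and>\<^sub>w ext1 (bv y)) $ {a, b} = (if x = a \<and> y = b then 1 else 0 :: 'a)" if "x < y" for x y
      using that assms by (auto simp: wedge2_pair bv_def axis_def)
    show ?thesis
    proof (cases "i < j \<and> j < l")
      case True
      then have "i < l" using less_trans by blast
      note lt = True[THEN conjunct1] True[THEN conjunct2] this
      consider "i = m \<and> j = a \<and> l = b" | "i = a \<and> j = m \<and> l = b" | "i = a \<and> j = b \<and> l = m"
        | "\<not> (i = m \<and> j = a \<and> l = b)" "\<not> (i = a \<and> j = m \<and> l = b)" "\<not> (i = a \<and> j = b \<and> l = m)"
        by blast
      then show ?thesis
      proof cases
        case 4
        then have "(delta i m :: 'a) * (if j = a \<and> l = b then 1 else 0) = 0"
          "(delta j m :: 'a) * (if i = a \<and> l = b then 1 else 0) = 0"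
          "(delta l m :: 'a) * (if i = a \<and> j = b then 1 else 0) = 0"
          by (simp_all add: delta_def)
        note zero = this
        show ?thesis
          unfolding if_P[OF True] 4[THEN if_not_P] vector_smult_component vector_add_component
            vector_minus_component e[OF lt(1)] e[OF lt(2)] e[OF lt(3)] zero by simp
      qed (use lt lt[THEN less_imp_neq] lt[THEN less_imp_neq, THEN not_sym] in
          \<open>simp_all add: e delta_def\<close>)
    next
      case False
      have zero: "(if P then if R then c else 0 else 0) = 0" if "\<not> (P \<and> R)" for P R and c :: 'a
        using that by simp
      have n: "\<not> ((i = m \<and> j = a \<and> l = b) \<and> m < a)" "\<not> ((i = a \<and> j = m \<and> l = b) \<and> a < m \<and> m < b)"
        "\<not> ((i = a \<and> j = b \<and> l = m) \<and> b < m)" using False assms by blast+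
      show ?thesis unfolding if_not_P[OF False] n[THEN zero] by simp
    qed
  qed
  have "pd m w $ {a, b} = (\<Sum>i\<in>UNIV. \<Sum>j\<in>UNIV. \<Sum>l\<in>UNIV. if i < j \<and> j < l then
      (w $ {i, j, l} *s (delta i m *s (ext1 (bv j) \<and>\<^sub>w ext1 (bv l))
            - delta j m *s (ext1 (bv i) \<and>\<^sub>w ext1 (bv l)) + delta l m *s (ext1 (bv i) \<and>\<^sub>w ext1 (bv j)))) $ {a, b} else 0)"
    unfolding pd_def ext3_lin_def sum_triples sum_component by (intro sum.cong refl) simp
  also have "\<dots> = (if m < a then w $ {m, a, b} else 0) + (if a < m \<and> m < b then - w $ {a, m, b} else 0)
      + (if b < m then w $ {a, b, m} else 0)"
    unfolding summand sum.distrib delta ..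
  finally have eq: "pd m w $ {a, b} = (if m < a then w $ {m, a, b} else 0)
      + (if a < m \<and> m < b then - w $ {a, m, b} else 0) + (if b < m then w $ {a, b, m} else 0)" .
  consider "m < a" | "m = a" | "a < m" "m < b" | "m = b" | "b < m"
    by (metis linorder_neqE)
  then show ?thesis
  proof cases
    case 1
    then have "\<not> a < m" "\<not> b < m" using assms by (auto dest: less_trans)
    then show ?thesis using 1 by (simp add: eq)
  next
    case 5
    then have "\<not> m < a" "\<not> m < b" "m \<noteq> a" "m \<noteq> b" using assms by (auto dest: less_trans)
    then show ?thesis using 5 by (simp add: eq)
  next
    case 2
    show ?thesis unfolding eq using 2 assms less_not_sym[OF assms] by simp
  next
    case 3
    show ?thesis unfolding eq using 3 less_not_sym[OF 3(1)] less_not_sym[OF 3(2)] by auto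
  next
    case 4
    show ?thesis unfolding eq using 4 assms less_not_sym[OF assms] by auto
  qed
qed

lemma homog_pd: "homog 2 (pd m w)"
  unfolding pd_def ext3_lin_def split_beta
  by (intro homog_sum homog_linear homog_wedge2)

lemma homog_tau: "homog 6 tau"
proof -
  have "homog (1 + (1 + (1 + (1 + (1 + 1))))) (tau :: 'a ^ (6 set))"
    unfolding tau_def by (intro homog_wedge homog_ext1)
  then show ?thesis by (simp add: eval_nat_numeral)
qed

lemma wedge_bv_left:
  "(ext1 (bv i) \<and>\<^sub>w b) $ S = (if i \<in> S then ext_sign {i} (S - {i}) * b $ (S - {i}) else 0)"
proof -
  have "(ext1 (bv i) \<and>\<^sub>w b) $ S = (\<Sum>k\<in>S. if k = i then ext_sign {i} (S - {i}) * b $ (S - {i}) else 0)"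
    unfolding wedge_ext1_left by (rule sum.cong) (auto simp: bv_def axis_def)
  then show ?thesis by simp
qed

text \<open>The index 6 is 0, the least one; restoring the increasing order moves e_6 past five
  vectors.\<close>

lemma tau_UNIV: "tau $ UNIV = - 1"
proof -
  have "(ext1 (bv 4) \<and>\<^sub>w ext1 (bv 5) \<and>\<^sub>w ext1 (bv 6)) $ {0, 4, 5} = (1 :: 'a)"
    using wedge3_triple[of 0 4 5 "bv 4" "bv 5" "bv 6 :: 'a ^ 6"]
    by (simp add: wedge3_def det3_def bv_def axis_def)
  then show ?thesis
    unfolding tau_def wedge_bv_left UNIV_6
    by (simp add: ext_sign_prod insert_Diff_if)
qed

text \<open>The top degree is a line spanned by \<open>tau\<close>, whose only coordinate is -1.
  This makes the definite description in \<open>phi\<close> meaningful and accounts for the minus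
  sign in \<open>phi_nth\<close>.\<close>

lemma homog_6_eq_iff:
  fixes a :: "'a::comm_ring_1 ^ (6 set)"
  assumes "homog 6 a"
  shows "a = c *s tau \<longleftrightarrow> c = - (a $ UNIV)"
proof -
  have zero: "a $ S = 0" "tau $ S = (0 :: 'a)" if "S \<noteq> UNIV" for S
  proof -
    have "card S \<noteq> 6"
    proof
      assume "card S = 6"
      then have "S = UNIV" by (intro card_subset_eq) simp_all
      with that show False by simp
    qed
    then show "a $ S = 0" "tau $ S = (0 :: 'a)" using assms homog_tau[where ?'a = 'a] by (simp_all add: homog_def)
  qed
  show ?thesis
  proof
    assume "a = c *s tau"
    then show "c = - (a $ UNIV)" by (simp add: tau_UNIV)
  next
    assume c: "c = - (a $ UNIV)"
    have "a $ S = (c *s tau) $ S" for S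
      by (cases "S = UNIV") (simp_all add: zero c tau_UNIV)
    then show "a = c *s tau" by (simp only: vec_eq_iff) simp
  qed
qed

lemma phi_nth:
  assumes "homog 3 w"
  shows "phi w $ m $ j = - ((w \<and>\<^sub>w pd m w \<and>\<^sub>w ext1 (bv j)) $ UNIV)"
proof -
  have "homog (3 + (2 + 1)) (w \<and>\<^sub>w pd m w \<and>\<^sub>w ext1 (bv j))"
    by (intro homog_wedge assms homog_pd homog_ext1)
  then show ?thesis by (simp add: phi_def homog_6_eq_iff)
qed

text \<open>The table against which the identities of X are verified, after six coordinates have
  been eliminated by \<open>Xspace_relations\<close>.\<close>

lemma phi_entries:
  assumes "homog 3 w"
  shows "phi w $ 1 $ 1 = w $ {0, 1, 2} * w $ {3, 4, 5} - w $ {0, 1, 3} * w $ {2, 4, 5} + w $ {0, 1, 4} * w $ {2, 3, 5} - w $ {0, 1, 5} * w $ {2, 3, 4} - w $ {0, 2, 3} * w $ {1, 4, 5} + w $ {0, 2, 4} * w $ {1, 3, 5} - w $ {0, 2, 5} * w $ {1, 3, 4} - w $ {0, 3, 4} * w $ {1, 2, 5} + w $ {0, 3, 5} * w $ {1, 2, 4} - w $ {0, 4, 5} * w $ {1, 2, 3}"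
  "phi w $ 1 $ 2 = 2 * w $ {0, 1, 3} * w $ {1, 4, 5} - 2 * w $ {0, 1, 4} * w $ {1, 3, 5} + 2 * w $ {0, 1, 5} * w $ {1, 3, 4}"
  "phi w $ 1 $ 3 = - 2 * w $ {0, 1, 2} * w $ {1, 4, 5} + 2 * w $ {0, 1, 4} * w $ {1, 2, 5} - 2 * w $ {0, 1, 5} * w $ {1, 2, 4}"
  "phi w $ 1 $ 4 = 2 * w $ {0, 1, 2} * w $ {1, 3, 5} - 2 * w $ {0, 1, 3} * w $ {1, 2, 5} + 2 * w $ {0, 1, 5} * w $ {1, 2, 3}"
  "phi w $ 1 $ 5 = - 2 * w $ {0, 1, 2} * w $ {1, 3, 4} + 2 * w $ {0, 1, 3} * w $ {1, 2, 4} - 2 * w $ {0, 1, 4} * w $ {1, 2, 3}"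
  "phi w $ 1 $ 0 = 2 * w $ {1, 2, 3} * w $ {1, 4, 5} - 2 * w $ {1, 2, 4} * w $ {1, 3, 5} + 2 * w $ {1, 2, 5} * w $ {1, 3, 4}"
  "phi w $ 2 $ 1 = - 2 * w $ {0, 2, 3} * w $ {2, 4, 5} + 2 * w $ {0, 2, 4} * w $ {2, 3, 5} - 2 * w $ {0, 2, 5} * w $ {2, 3, 4}"
  "phi w $ 2 $ 2 = w $ {0, 1, 2} * w $ {3, 4, 5} + w $ {0, 1, 3} * w $ {2, 4, 5} - w $ {0, 1, 4} * w $ {2, 3, 5} + w $ {0, 1, 5} * w $ {2, 3, 4} + w $ {0, 2, 3} * w $ {1, 4, 5} - w $ {0, 2, 4} * w $ {1, 3, 5} + w $ {0, 2, 5} * w $ {1, 3, 4} - w $ {0, 3, 4} * w $ {1, 2, 5} + w $ {0, 3, 5} * w $ {1, 2, 4} - w $ {0, 4, 5} * w $ {1, 2, 3}"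
  "phi w $ 2 $ 3 = - 2 * w $ {0, 1, 2} * w $ {2, 4, 5} + 2 * w $ {0, 2, 4} * w $ {1, 2, 5} - 2 * w $ {0, 2, 5} * w $ {1, 2, 4}"
  "phi w $ 2 $ 4 = 2 * w $ {0, 1, 2} * w $ {2, 3, 5} - 2 * w $ {0, 2, 3} * w $ {1, 2, 5} + 2 * w $ {0, 2, 5} * w $ {1, 2, 3}"
  "phi w $ 2 $ 5 = - 2 * w $ {0, 1, 2} * w $ {2, 3, 4} + 2 * w $ {0, 2, 3} * w $ {1, 2, 4} - 2 * w $ {0, 2, 4} * w $ {1, 2, 3}"
  "phi w $ 2 $ 0 = 2 * w $ {1, 2, 3} * w $ {2, 4, 5} - 2 * w $ {1, 2, 4} * w $ {2, 3, 5} + 2 * w $ {1, 2, 5} * w $ {2, 3, 4}"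
  "phi w $ 3 $ 1 = - 2 * w $ {0, 2, 3} * w $ {3, 4, 5} + 2 * w $ {0, 3, 4} * w $ {2, 3, 5} - 2 * w $ {0, 3, 5} * w $ {2, 3, 4}"
  "phi w $ 3 $ 2 = 2 * w $ {0, 1, 3} * w $ {3, 4, 5} - 2 * w $ {0, 3, 4} * w $ {1, 3, 5} + 2 * w $ {0, 3, 5} * w $ {1, 3, 4}"
  "phi w $ 3 $ 3 = - w $ {0, 1, 2} * w $ {3, 4, 5} - w $ {0, 1, 3} * w $ {2, 4, 5} - w $ {0, 1, 4} * w $ {2, 3, 5} + w $ {0, 1, 5} * w $ {2, 3, 4} + w $ {0, 2, 3} * w $ {1, 4, 5} + w $ {0, 2, 4} * w $ {1, 3, 5} - w $ {0, 2, 5} * w $ {1, 3, 4} + w $ {0, 3, 4} * w $ {1, 2, 5} - w $ {0, 3, 5} * w $ {1, 2, 4} - w $ {0, 4, 5} * w $ {1, 2, 3}"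
  "phi w $ 3 $ 4 = 2 * w $ {0, 1, 3} * w $ {2, 3, 5} - 2 * w $ {0, 2, 3} * w $ {1, 3, 5} + 2 * w $ {0, 3, 5} * w $ {1, 2, 3}"
  "phi w $ 3 $ 5 = - 2 * w $ {0, 1, 3} * w $ {2, 3, 4} + 2 * w $ {0, 2, 3} * w $ {1, 3, 4} - 2 * w $ {0, 3, 4} * w $ {1, 2, 3}"
  "phi w $ 3 $ 0 = 2 * w $ {1, 2, 3} * w $ {3, 4, 5} - 2 * w $ {1, 3, 4} * w $ {2, 3, 5} + 2 * w $ {1, 3, 5} * w $ {2, 3, 4}"
  "phi w $ 4 $ 1 = - 2 * w $ {0, 2, 4} * w $ {3, 4, 5} + 2 * w $ {0, 3, 4} * w $ {2, 4, 5} - 2 * w $ {0, 4, 5} * w $ {2, 3, 4}"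
  "phi w $ 4 $ 2 = 2 * w $ {0, 1, 4} * w $ {3, 4, 5} - 2 * w $ {0, 3, 4} * w $ {1, 4, 5} + 2 * w $ {0, 4, 5} * w $ {1, 3, 4}"
  "phi w $ 4 $ 3 = - 2 * w $ {0, 1, 4} * w $ {2, 4, 5} + 2 * w $ {0, 2, 4} * w $ {1, 4, 5} - 2 * w $ {0, 4, 5} * w $ {1, 2, 4}"
  "phi w $ 4 $ 4 = - w $ {0, 1, 2} * w $ {3, 4, 5} + w $ {0, 1, 3} * w $ {2, 4, 5} + w $ {0, 1, 4} * w $ {2, 3, 5} + w $ {0, 1, 5} * w $ {2, 3, 4} - w $ {0, 2, 3} * w $ {1, 4, 5} - w $ {0, 2, 4} * w $ {1, 3, 5} - w $ {0, 2, 5} * w $ {1, 3, 4} + w $ {0, 3, 4} * w $ {1, 2, 5} + w $ {0, 3, 5} * w $ {1, 2, 4} + w $ {0, 4, 5} * w $ {1, 2, 3}"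
  "phi w $ 4 $ 5 = - 2 * w $ {0, 1, 4} * w $ {2, 3, 4} + 2 * w $ {0, 2, 4} * w $ {1, 3, 4} - 2 * w $ {0, 3, 4} * w $ {1, 2, 4}"
  "phi w $ 4 $ 0 = 2 * w $ {1, 2, 4} * w $ {3, 4, 5} - 2 * w $ {1, 3, 4} * w $ {2, 4, 5} + 2 * w $ {1, 4, 5} * w $ {2, 3, 4}"
  "phi w $ 5 $ 1 = - 2 * w $ {0, 2, 5} * w $ {3, 4, 5} + 2 * w $ {0, 3, 5} * w $ {2, 4, 5} - 2 * w $ {0, 4, 5} * w $ {2, 3, 5}"
  "phi w $ 5 $ 2 = 2 * w $ {0, 1, 5} * w $ {3, 4, 5} - 2 * w $ {0, 3, 5} * w $ {1, 4, 5} + 2 * w $ {0, 4, 5} * w $ {1, 3, 5}"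
  "phi w $ 5 $ 3 = - 2 * w $ {0, 1, 5} * w $ {2, 4, 5} + 2 * w $ {0, 2, 5} * w $ {1, 4, 5} - 2 * w $ {0, 4, 5} * w $ {1, 2, 5}"
  "phi w $ 5 $ 4 = 2 * w $ {0, 1, 5} * w $ {2, 3, 5} - 2 * w $ {0, 2, 5} * w $ {1, 3, 5} + 2 * w $ {0, 3, 5} * w $ {1, 2, 5}"
  "phi w $ 5 $ 5 = - w $ {0, 1, 2} * w $ {3, 4, 5} + w $ {0, 1, 3} * w $ {2, 4, 5} - w $ {0, 1, 4} * w $ {2, 3, 5} - w $ {0, 1, 5} * w $ {2, 3, 4} - w $ {0, 2, 3} * w $ {1, 4, 5} + w $ {0, 2, 4} * w $ {1, 3, 5} + w $ {0, 2, 5} * w $ {1, 3, 4} - w $ {0, 3, 4} * w $ {1, 2, 5} - w $ {0, 3, 5} * w $ {1, 2, 4} + w $ {0, 4, 5} * w $ {1, 2, 3}"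
  "phi w $ 5 $ 0 = 2 * w $ {1, 2, 5} * w $ {3, 4, 5} - 2 * w $ {1, 3, 5} * w $ {2, 4, 5} + 2 * w $ {1, 4, 5} * w $ {2, 3, 5}"
  "phi w $ 0 $ 1 = - 2 * w $ {0, 2, 3} * w $ {0, 4, 5} + 2 * w $ {0, 2, 4} * w $ {0, 3, 5} - 2 * w $ {0, 2, 5} * w $ {0, 3, 4}"
  "phi w $ 0 $ 2 = 2 * w $ {0, 1, 3} * w $ {0, 4, 5} - 2 * w $ {0, 1, 4} * w $ {0, 3, 5} + 2 * w $ {0, 1, 5} * w $ {0, 3, 4}"
  "phi w $ 0 $ 3 = - 2 * w $ {0, 1, 2} * w $ {0, 4, 5} + 2 * w $ {0, 1, 4} * w $ {0, 2, 5} - 2 * w $ {0, 1, 5} * w $ {0, 2, 4}"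
  "phi w $ 0 $ 4 = 2 * w $ {0, 1, 2} * w $ {0, 3, 5} - 2 * w $ {0, 1, 3} * w $ {0, 2, 5} + 2 * w $ {0, 1, 5} * w $ {0, 2, 3}"
  "phi w $ 0 $ 5 = - 2 * w $ {0, 1, 2} * w $ {0, 3, 4} + 2 * w $ {0, 1, 3} * w $ {0, 2, 4} - 2 * w $ {0, 1, 4} * w $ {0, 2, 3}"
  "phi w $ 0 $ 0 = w $ {0, 1, 2} * w $ {3, 4, 5} - w $ {0, 1, 3} * w $ {2, 4, 5} + w $ {0, 1, 4} * w $ {2, 3, 5} - w $ {0, 1, 5} * w $ {2, 3, 4} + w $ {0, 2, 3} * w $ {1, 4, 5} - w $ {0, 2, 4} * w $ {1, 3, 5} + w $ {0, 2, 5} * w $ {1, 3, 4} + w $ {0, 3, 4} * w $ {1, 2, 5} - w $ {0, 3, 5} * w $ {1, 2, 4} + w $ {0, 4, 5} * w $ {1, 2, 3}"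
  unfolding phi_nth[OF assms] wedge_UNIV_expand[OF assms]
  by (simp_all add: wedge_ext1_right_triple pd_pair bv_def axis_def algebra_simps)



text \<open>The trivector evaluated as an alternating form on three covectors, with covectors
  written as vectors by means of the dot product.\<close>

definition pair3 :: "'a::comm_ring_1 ^ (6 set) \<Rightarrow> 'a ^ 6 \<Rightarrow> 'a ^ 6 \<Rightarrow> 'a ^ 6 \<Rightarrow> 'a" where
  "pair3 x \<alpha> \<beta> \<gamma> = (\<Sum>(i, j, l)\<in>{(i, j, l). i < j \<and> j < l}. x $ {i, j, l} * det3 \<alpha> \<beta> \<gamma> i j l)"

text \<open>Three distinct indices have exactly one increasing arrangement, and triples with a
  repetition contribute nothing.\<close>

lemma sum_triples_symmetrize:
  fixes F :: "6 \<Rightarrow> 6 \<Rightarrow> 6 \<Rightarrow> 'b::comm_monoid_add"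
  assumes "\<And>i j. F i i j = 0" "\<And>i j. F i j i = 0" "\<And>i j. F j i i = 0"
  shows "(\<Sum>i\<in>UNIV. \<Sum>j\<in>UNIV. \<Sum>l\<in>UNIV. F i j l) =
    (\<Sum>(i, j, l)\<in>{(i, j, l). i < j \<and> j < l}. F i j l + F i l j + F j i l + F j l i + F l i j + F l j i)"
proof -
  define G where "G i j l = (\<lambda>c. if i < j \<and> j < l then c else (0 :: 'b))" for i j l :: 6
  have order: "\<not> y < x \<and> \<not> z < y \<and> \<not> z < x \<and> x < z" if "x < y" "y < z" for x y z :: 6
    using that(1,2)[THEN less_not_sym] less_trans[OF that] less_trans[OF that, THEN less_not_sym] by simp
  have split: "F i j l = G i j l (F i j l) + G i l j (F i j l) + G j i l (F i j l) + G j l i (F i j l)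
      + G l i j (F i j l) + G l j i (F i j l)" for i j l
  proof (cases "i = j \<or> j = l \<or> i = l")
    case True
    then have "F i j l = 0" using assms by auto
    then show ?thesis by (simp add: G_def)
  next
    case False
    then consider "i < j" "j < l" | "i < l" "l < j" | "j < i" "i < l" | "j < l" "l < i"
      | "l < i" "i < j" | "l < j" "j < i"
      by (metis linorder_neqE)
    then show ?thesis
      by cases (frule (1) order, simp add: G_def)+
  qed
  have swap23: "(\<Sum>i\<in>UNIV. \<Sum>j\<in>UNIV. \<Sum>l\<in>UNIV. H i j l) = (\<Sum>i\<in>UNIV. \<Sum>j\<in>UNIV. \<Sum>l\<in>UNIV. H i l j)"
    and swap12: "(\<Sum>i\<in>UNIV. \<Sum>j\<in>UNIV. \<Sum>l\<in>UNIV. H i j l) = (\<Sum>i\<in>UNIV. \<Sum>j\<in>UNIV. \<Sum>l\<in>UNIV. H j i l)"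
    for H :: "6 \<Rightarrow> 6 \<Rightarrow> 6 \<Rightarrow> 'b"
    by (auto intro: sum.swap sum.cong)
  let ?S = "\<lambda>H. \<Sum>i\<in>UNIV. \<Sum>j\<in>UNIV. \<Sum>l\<in>UNIV. H i j l"
  have "?S (\<lambda>i j l. G i l j (F i j l)) = ?S (\<lambda>i j l. G i j l (F i l j))"
    "?S (\<lambda>i j l. G j i l (F i j l)) = ?S (\<lambda>i j l. G i j l (F j i l))"
    by (rule swap23, rule swap12)
  moreover have "?S (\<lambda>i j l. G j l i (F i j l)) = ?S (\<lambda>i j l. G i j l (F l i j))"
    by (rule trans[OF swap12 swap23])
  moreover have "?S (\<lambda>i j l. G l i j (F i j l)) = ?S (\<lambda>i j l. G i j l (F j l i))"
    by (rule trans[OF swap23 swap12])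
  moreover have "?S (\<lambda>i j l. G l j i (F i j l)) = ?S (\<lambda>i j l. G i j l (F l j i))"
    by (rule trans[OF swap12 trans[OF swap23 swap12]])
  ultimately have "?S F = ?S (\<lambda>i j l. G i j l (F i j l) + G i j l (F i l j) + G i j l (F j i l) + G i j l (F l i j)
      + G i j l (F j l i) + G i j l (F l j i))"
    by (subst split) (simp only: sum.distrib)
  also have "\<dots> = ?S (\<lambda>i j l. if i < j \<and> j < l then F i j l + F i l j + F j i l + F j l i + F l i j + F l j i else 0)"
    by (intro sum.cong refl) (simp add: G_def ac_simps)
  finally show ?thesis by (simp only: sum_triples)
qed

text \<open>The six terms of the minor carry the signs that the antisymmetry of H absorbs. The gain
  is a sum over unrestricted indices, which factors.\<close>

lemma sum_det3:
  fixes H :: "6 \<Rightarrow> 6 \<Rightarrow> 6 \<Rightarrow> 'a::comm_ring_1"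
  assumes "\<And>i j. H i i j = 0" "\<And>i j l. H j i l = - H i j l" "\<And>i j l. H i l j = - H i j l"
  shows "(\<Sum>(i, j, l)\<in>{(i, j, l). i < j \<and> j < l}. det3 p q r i j l * H i j l) =
    (\<Sum>i\<in>UNIV. \<Sum>j\<in>UNIV. \<Sum>l\<in>UNIV. p $ i * q $ j * r $ l * H i j l)"
proof -
  have z1: "H i j i = 0" for i j
    by (simp only: assms(3)[where i = i and j = i and l = j] assms(1) minus_zero)
  have z2: "H i j j = 0" for i j
    using assms(2)[where i = j and j = i and l = j] z1[of j i] by simp
  have "det3 p q r i j l * H i j l = p $ i * q $ j * r $ l * H i j l + p $ i * q $ l * r $ j * H i l j
    + p $ j * q $ i * r $ l * H j i l + p $ j * q $ l * r $ i * H j l i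
    + p $ l * q $ i * r $ j * H l i j + p $ l * q $ j * r $ i * H l j i" for i j l
  proof -
    have "H i l j = - H i j l" "H j i l = - H i j l" "H j l i = H i j l" "H l i j = H i j l" "H l j i = - H i j l"
      using assms(3)[where i = i and j = j and l = l] assms(2)[where i = i and j = j and l = l]
        assms(3)[where i = j and j = i and l = l] assms(2)[where i = i and j = l and l = j]
        assms(2)[where i = j and j = l and l = i] by simp_all
    then show ?thesis by (simp add: det3_def algebra_simps)
  qed
  then show ?thesis
    by (subst sum_triples_symmetrize) (simp_all only: assms(1) z1 z2 mult_zero_right)
qed

lemma det3_alternating:
  "det3 p q r i i l = 0" "det3 p q r j i l = - det3 p q r i j l" "det3 p q r i l j = - det3 p q r i j l"
  by (simp_all add: det3_def algebra_simps)

lemma sum3_product: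
  "(\<Sum>i\<in>UNIV. \<Sum>j\<in>UNIV. \<Sum>l\<in>UNIV. a i * b j * c l) = sum a UNIV * sum b UNIV * (sum c UNIV :: 'a::comm_ring_1)"
  by (simp add: mult.assoc flip: sum_distrib_left sum_distrib_right)

text \<open>The Cauchy-Binet formula for two 3 x 6 matrices; the right-hand side is the determinant
  of the nine dot products.\<close>

lemma cauchy_binet3:
  fixes p :: "'a::comm_ring_1 ^ 6"
  shows "(\<Sum>(i, j, l)\<in>{(i, j, l). i < j \<and> j < l}. det3 p q r i j l * det3 \<alpha> \<beta> \<gamma> i j l) =
    dotp p \<alpha> * (dotp q \<beta> * dotp r \<gamma> - dotp q \<gamma> * dotp r \<beta>)
    - dotp p \<beta> * (dotp q \<alpha> * dotp r \<gamma> - dotp q \<gamma> * dotp r \<alpha>)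
    + dotp p \<gamma> * (dotp q \<alpha> * dotp r \<beta> - dotp q \<beta> * dotp r \<alpha>)"
proof -
  have s: "(\<Sum>i\<in>UNIV. \<Sum>j\<in>UNIV. \<Sum>l\<in>UNIV. (p $ i * \<alpha>' $ i) * (q $ j * \<beta>' $ j) * (r $ l * \<gamma>' $ l))
      = dotp p \<alpha>' * dotp q \<beta>' * dotp r \<gamma>'" for \<alpha>' \<beta>' \<gamma>'
    unfolding sum3_product dotp_def ..
  have "(\<Sum>(i, j, l)\<in>{(i, j, l). i < j \<and> j < l}. det3 p q r i j l * det3 \<alpha> \<beta> \<gamma> i j l) =
     (\<Sum>i\<in>UNIV. \<Sum>j\<in>UNIV. \<Sum>l\<in>UNIV. p $ i * q $ j * r $ l * det3 \<alpha> \<beta> \<gamma> i j l)"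
    by (rule sum_det3) (rule det3_alternating)+
  also have "\<dots> = (\<Sum>i\<in>UNIV. \<Sum>j\<in>UNIV. \<Sum>l\<in>UNIV.
      (p $ i * \<alpha> $ i) * (q $ j * \<beta> $ j) * (r $ l * \<gamma> $ l) - (p $ i * \<alpha> $ i) * (q $ j * \<gamma> $ j) * (r $ l * \<beta> $ l)
      - (p $ i * \<beta> $ i) * (q $ j * \<alpha> $ j) * (r $ l * \<gamma> $ l) + (p $ i * \<gamma> $ i) * (q $ j * \<alpha> $ j) * (r $ l * \<beta> $ l)
      + (p $ i * \<beta> $ i) * (q $ j * \<gamma> $ j) * (r $ l * \<alpha> $ l) - (p $ i * \<gamma> $ i) * (q $ j * \<beta> $ j) * (r $ l * \<alpha> $ l))"
    by (intro sum.cong refl) (simp add: det3_def algebra_simps)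
  also have "\<dots> = dotp p \<alpha> * dotp q \<beta> * dotp r \<gamma> - dotp p \<alpha> * dotp q \<gamma> * dotp r \<beta>
      - dotp p \<beta> * dotp q \<alpha> * dotp r \<gamma> + dotp p \<gamma> * dotp q \<alpha> * dotp r \<beta>
      + dotp p \<beta> * dotp q \<gamma> * dotp r \<alpha> - dotp p \<gamma> * dotp q \<beta> * dotp r \<alpha>"
    unfolding sum.distrib sum_subtractf s ..
  finally show ?thesis by (simp add: algebra_simps)
qed

lemma act3_nth:
  assumes "a < b" "b < c"
  shows "act3 g x $ {a, b, c} = (\<Sum>(i, j, l)\<in>{(i, j, l). i < j \<and> j < l}.
    x $ {i, j, l} * det3 (g *v bv i) (g *v bv j) (g *v bv l) a b c)"
  using assms unfolding act3_def ext3_lin_def sum_component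
  by (intro sum.cong) (auto simp: wedge3_triple)

lemma homog_act3: "homog 3 (act3 g x)"
  unfolding act3_def ext3_lin_def split_beta by (intro homog_sum homog_linear homog_wedge3)

lemma dotp_transpose: "dotp (g *v u) v = dotp u (transpose g *v v)"
proof -
  have "dotp (g *v u) v = (\<Sum>i\<in>UNIV. \<Sum>j\<in>UNIV. g $ i $ j * u $ j * v $ i)"
    by (simp add: dotp_def matrix_vector_mult_def sum_distrib_right)
  also have "\<dots> = (\<Sum>j\<in>UNIV. \<Sum>i\<in>UNIV. g $ i $ j * u $ j * v $ i)" by (rule sum.swap)
  also have "\<dots> = dotp u (transpose g *v v)"
    by (simp add: dotp_def matrix_vector_mult_def sum_distrib_left transpose_def algebra_simps)
  finally show ?thesis .
qed

lemma dotp_bv: "dotp (bv i) v = v $ i" "dotp v (bv i) = v $ i"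
  by (simp_all add: dotp_def bv_def axis_def if_distrib[of "\<lambda>c. c * _"] if_distrib[of "\<lambda>c. _ * c"] cong: if_cong)

text \<open>By Cauchy-Binet the matrix moves from the trivector to the covectors. The action laws
  and the invariance statements follow from this without any minors of g.\<close>

lemma pair3_act3:
  "pair3 (act3 g x) \<alpha> \<beta> \<gamma> = pair3 x (transpose g *v \<alpha>) (transpose g *v \<beta>) (transpose g *v \<gamma>)"
proof -
  let ?S = "{(i, j, l). (i :: 6) < j \<and> j < l}"
  have "pair3 (act3 g x) \<alpha> \<beta> \<gamma> = (\<Sum>(a, b, c)\<in>?S. \<Sum>(i, j, l)\<in>?S.
      x $ {i, j, l} * (det3 (g *v bv i) (g *v bv j) (g *v bv l) a b c * det3 \<alpha> \<beta> \<gamma> a b c))"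
    unfolding pair3_def
    by (intro sum.cong refl) (auto simp: act3_nth sum_distrib_right mult.assoc split_beta)
  also have "\<dots> = (\<Sum>(i, j, l)\<in>?S. x $ {i, j, l} * (\<Sum>(a, b, c)\<in>?S.
      det3 (g *v bv i) (g *v bv j) (g *v bv l) a b c * det3 \<alpha> \<beta> \<gamma> a b c))"
    unfolding split_beta sum_distrib_left by (rule sum.swap)
  also have "\<dots> = pair3 x (transpose g *v \<alpha>) (transpose g *v \<beta>) (transpose g *v \<gamma>)"
    unfolding pair3_def cauchy_binet3 dotp_transpose dotp_bv
    by (intro sum.cong refl) (auto simp: det3_def algebra_simps)
  finally show ?thesis .
qed

lemma pair3_bv:
  assumes "a < b" "b < c"
  shows "pair3 x (bv a) (bv b) (bv c) = x $ {a, b, c}"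
proof -
  have d: "det3 (bv a) (bv b) (bv c) i j l = (if (i, j, l) = (a, b, c) then 1 else 0 :: 'a)"
    if "i < j" "j < l" for i j l
    using assms that less_trans[OF assms] less_trans[OF that] by (auto simp: det3_def bv_def axis_def)
  have "pair3 x (bv a) (bv b) (bv c) = (\<Sum>p\<in>{(i, j, l). i < j \<and> j < l}. if p = (a, b, c) then x $ {a, b, c} else 0)"
    unfolding pair3_def by (intro sum.cong refl) (auto simp: d split: if_splits)
  then show ?thesis using assms by simp
qed

lemma Ext3_eqI:
  assumes "homog 3 x" "homog 3 y" "\<And>i j l. i < j \<Longrightarrow> j < l \<Longrightarrow> x $ {i, j, l} = y $ {i, j, l}"
  shows "x = y"
proof -
  have "x $ S = y $ S" for S
  proof (cases "card S = 3")
    case True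
    then show ?thesis by (rule card_3_ordered) (simp add: assms(3))
  qed (use assms(1,2) in \<open>simp add: homog_def\<close>)
  then show ?thesis by (simp add: vec_eq_iff)
qed

lemma pair3_inject:
  assumes "homog 3 x" "homog 3 y" "\<And>i j l. i < j \<Longrightarrow> j < l \<Longrightarrow> pair3 x (bv i) (bv j) (bv l) = pair3 y (bv i) (bv j) (bv l)"
  shows "x = y"
  using assms by (intro Ext3_eqI) (auto simp: pair3_bv)

lemma act3_mult: "act3 (g ** h) x = act3 g (act3 h x)"
  by (rule pair3_inject)
    (simp_all only: homog_act3 pair3_act3 matrix_transpose_mul flip: matrix_vector_mul_assoc)

lemma act3_1: "homog 3 x \<Longrightarrow> act3 (mat 1) x = x"
  by (rule pair3_inject) (simp_all add: homog_act3 pair3_act3 transpose_mat)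



section \<open>The symplectic form\<close>

lemma MJ_mult_nth:
  "(MJ *v u) $ 0 = - u $ 3" "(MJ *v u) $ 1 = u $ 4" "(MJ *v u) $ 2 = u $ 5"
  "(MJ *v u) $ 3 = u $ 0" "(MJ *v u) $ 4 = - u $ 1" "(MJ *v u) $ 5 = - u $ 2"
  by (simp_all add: matrix_vector_mult_def MJ_def sum_6)

lemma Jform_expand:
  "Jform u v = u $ 1 * v $ 4 + u $ 2 * v $ 5 + u $ 3 * v $ 0 - u $ 4 * v $ 1 - u $ 5 * v $ 2 - u $ 0 * v $ 3"
  by (simp add: Jform_def dotp_def sum_6 MJ_mult_nth)

lemma Jform_linear:
  "Jform (u + u') v = Jform u v + Jform u' v" "Jform u (v + v') = Jform u v + Jform u v'"
  "Jform (u - u') v = Jform u v - Jform u' v" "Jform u (v - v') = Jform u v - Jform u v'"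
  "Jform (c *s u) v = c * Jform u v" "Jform u (c *s v) = c * Jform u v"
  "Jform (- u) v = - Jform u v" "Jform u (- v) = - Jform u v"
  "Jform 0 v = 0" "Jform u 0 = 0"
  by (simp_all add: Jform_expand algebra_simps)

lemma Jform_self [simp]: "Jform u u = 0"
  by (simp add: Jform_expand)

lemma Jform_swap: "Jform v u = - Jform u v"
  by (simp add: Jform_expand)

lemma Jform_bv:
  "Jform u (bv 4) = u $ 1" "Jform u (bv 5) = u $ 2" "Jform u (bv 0) = u $ 3"
  "Jform u (bv 1) = - u $ 4" "Jform u (bv 2) = - u $ 5" "Jform u (bv 3) = - u $ 0"
  by (simp_all add: Jform_expand bv_def axis_def)

lemma vec_6_eqI:
  assumes "u $ 0 = v $ 0" "u $ 1 = v $ 1" "u $ 2 = v $ 2" "u $ 3 = v $ 3" "u $ 4 = v $ 4" "u $ 5 = v $ (5::6)"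
  shows "u = v"
proof -
  have "\<forall>i. u $ i = v $ i" unfolding all_6 using assms by blast
  then show ?thesis by (simp add: vec_eq_iff)
qed

lemma Jform_nondegenerate:
  assumes "\<And>w. Jform u w = Jform v w"
  shows "u = v"
  using assms[of "bv 0"] assms[of "bv 1"] assms[of "bv 2"] assms[of "bv 3"] assms[of "bv 4"] assms[of "bv 5"]
  by (intro vec_6_eqI) (simp_all add: Jform_bv)

lemma Jform_dual_vector:
  fixes u :: "'a::field ^ 6"
  assumes "u \<noteq> 0"
  obtains w where "Jform u w = 1"
proof -
  obtain w where w: "Jform u w \<noteq> 0"
    using Jform_nondegenerate[of u 0] assms by (auto simp: Jform_linear)
  have "Jform u ((1 / Jform u w) *s w) = 1" using w by (simp add: Jform_linear)
  with that show ?thesis by blast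
qed

lemma vec_6_expand:
  "v = v $ 0 *s bv 0 + v $ 1 *s bv 1 + v $ 2 *s bv 2 + v $ 3 *s bv 3 + v $ 4 *s bv 4 + v $ 5 *s bv (5::6)"
  by (rule vec_6_eqI) (simp_all add: bv_def axis_def)

lemma linear_6_eqI:
  fixes f g :: "'a::comm_ring_1 ^ 6 \<Rightarrow> 'a ^ 'n"
  assumes "\<And>u v. f (u + v) = f u + f v" "\<And>c u. f (c *s u) = c *s f u"
    and "\<And>u v. g (u + v) = g u + g v" "\<And>c u. g (c *s u) = c *s g u"
    and "\<forall>i. f (bv i) = g (bv i)"
  shows "f v = g v"
proof -
  have "f v = v $ 0 *s f (bv 0) + v $ 1 *s f (bv 1) + v $ 2 *s f (bv 2) + v $ 3 *s f (bv 3)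
      + v $ 4 *s f (bv 4) + v $ 5 *s f (bv 5)"
    by (subst vec_6_expand[of v]) (simp only: assms(1,2))
  also have "\<dots> = v $ 0 *s g (bv 0) + v $ 1 *s g (bv 1) + v $ 2 *s g (bv 2) + v $ 3 *s g (bv 3)
      + v $ 4 *s g (bv 4) + v $ 5 *s g (bv 5)"
    by (simp only: assms(5))
  also have "\<dots> = g v"
    by (subst (7) vec_6_expand[of v]) (simp only: assms(3,4))
  finally show ?thesis .
qed

text \<open>Below [u, v] stands for this product. It contracts x with the covectors
  \<open>MJ *v u\<close> and \<open>MJ *v v\<close>, so that J([u, v], w) is
  \<open>Tform x u v w\<close>, the alternating form on vectors that x becomes when J identifies V_6
  with its dual.\<close>

definition cross6 :: "'a::comm_ring_1 ^ (6 set) \<Rightarrow> 'a ^ 6 \<Rightarrow> 'a ^ 6 \<Rightarrow> 'a ^ 6" where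
  "cross6 x u v = (\<chi> i. pair3 x (MJ *v u) (MJ *v v) (bv i))"

definition Tform :: "'a::comm_ring_1 ^ (6 set) \<Rightarrow> 'a ^ 6 \<Rightarrow> 'a ^ 6 \<Rightarrow> 'a ^ 6 \<Rightarrow> 'a" where
  "Tform x u v w = pair3 x (MJ *v u) (MJ *v v) (MJ *v w)"

lemma cross6_nth:
  "cross6 x u v $ 1 = - u $ 0 * v $ 1 * x $ {1, 3, 4} - u $ 0 * v $ 2 * x $ {1, 3, 5} - u $ 0 * v $ 3 * x $ {0, 1, 3} - u $ 0 * v $ 5 * x $ {1, 2, 3} + u $ 1 * v $ 0 * x $ {1, 3, 4} + u $ 1 * v $ 2 * x $ {1, 4, 5} + u $ 1 * v $ 3 * x $ {0, 1, 4} + u $ 1 * v $ 5 * x $ {1, 2, 4} + u $ 2 * v $ 0 * x $ {1, 3, 5} - u $ 2 * v $ 1 * x $ {1, 4, 5} + u $ 2 * v $ 3 * x $ {0, 1, 5} + u $ 2 * v $ 5 * x $ {1, 2, 5} + u $ 3 * v $ 0 * x $ {0, 1, 3} - u $ 3 * v $ 1 * x $ {0, 1, 4} - u $ 3 * v $ 2 * x $ {0, 1, 5} + u $ 3 * v $ 5 * x $ {0, 1, 2} + u $ 5 * v $ 0 * x $ {1, 2, 3} - u $ 5 * v $ 1 * x $ {1, 2, 4} - u $ 5 * v $ 2 * x $ {1, 2, 5} - u $ 5 * v $ 3 * x $ {0, 1, 2}" "cross6 x u v $ 2 = - u $ 0 * v $ 1 * x $ {2, 3, 4} - u $ 0 *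 v $ 2 * x $ {2, 3, 5} - u $ 0 * v $ 3 * x $ {0, 2, 3} + u $ 0 * v $ 4 * x $ {1, 2, 3} + u $ 1 * v $ 0 * x $ {2, 3, 4} + u $ 1 * v $ 2 * x $ {2, 4, 5} + u $ 1 * v $ 3 * x $ {0, 2, 4} - u $ 1 * v $ 4 * x $ {1, 2, 4} + u $ 2 * v $ 0 * x $ {2, 3, 5} - u $ 2 * v $ 1 * x $ {2, 4, 5} + u $ 2 * v $ 3 * x $ {0, 2, 5} - u $ 2 * v $ 4 * x $ {1, 2, 5} + u $ 3 * v $ 0 * x $ {0, 2, 3} - u $ 3 * v $ 1 * x $ {0, 2, 4} - u $ 3 * v $ 2 * x $ {0, 2, 5} - u $ 3 * v $ 4 * x $ {0, 1, 2} - u $ 4 * v $ 0 * x $ {1, 2, 3} + u $ 4 * v $ 1 * x $ {1, 2, 4} + u $ 4 * v $ 2 * x $ {1, 2, 5} + u $ 4 * v $ 3 * x $ {0, 1, 2}" "cross6 x u v $ 3 = u $ 1 * v $ 2 * x $ {3, 4, 5} + u $ 1 * v $ 3 * x $ {0, 3, 4} - u $ 1 * v $ 4 * x $ {1, 3, 4} - u $ 1 * v $ 5 * x $ {2, 3, 4} - u $ 2 * v $ 1 * x $ {3, 4, 5} + u $ 2 * v $ 3 * x $ {0, 3, 5} - u $ 2 * v $ 4 * x $ {1, 3, 5} - u $ 2 * v $ 5 * x $ {2, 3, 5} - u $ 3 * v $ 1 * x $ {0, 3, 4} - u $ 3 * v $ 2 * x $ {0, 3, 5} - u $ 3 * v $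 4 * x $ {0, 1, 3} - u $ 3 * v $ 5 * x $ {0, 2, 3} + u $ 4 * v $ 1 * x $ {1, 3, 4} + u $ 4 * v $ 2 * x $ {1, 3, 5} + u $ 4 * v $ 3 * x $ {0, 1, 3} + u $ 4 * v $ 5 * x $ {1, 2, 3} + u $ 5 * v $ 1 * x $ {2, 3, 4} + u $ 5 * v $ 2 * x $ {2, 3, 5} + u $ 5 * v $ 3 * x $ {0, 2, 3} - u $ 5 * v $ 4 * x $ {1, 2, 3}" "cross6 x u v $ 4 = u $ 0 * v $ 2 * x $ {3, 4, 5} + u $ 0 * v $ 3 * x $ {0, 3, 4} - u $ 0 * v $ 4 * x $ {1, 3, 4} - u $ 0 * v $ 5 * x $ {2, 3, 4} - u $ 2 * v $ 0 * x $ {3, 4, 5} + u $ 2 * v $ 3 * x $ {0, 4, 5} - u $ 2 * v $ 4 * x $ {1, 4, 5} - u $ 2 * v $ 5 * x $ {2, 4, 5} - u $ 3 * v $ 0 * x $ {0, 3, 4} - u $ 3 * v $ 2 * x $ {0, 4, 5} - u $ 3 * v $ 4 * x $ {0, 1, 4} - u $ 3 * v $ 5 * x $ {0, 2, 4} + u $ 4 * v $ 0 * x $ {1, 3, 4} + u $ 4 * v $ 2 * x $ {1, 4, 5} + u $ 4 * v $ 3 * x $ {0, 1, 4} + u $ 4 * v $ 5 * x $ {1, 2, 4} + u $ 5 * v $ 0 * x $ {2, 3, 4} + u $ 5 * v $ 2 * x $ {2, 4, 5} + u $ 5 * v $ 3 * x $ {0, 2, 4} - u $ 5 * v $ 4 *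 x $ {1, 2, 4}" "cross6 x u v $ 5 = - u $ 0 * v $ 1 * x $ {3, 4, 5} + u $ 0 * v $ 3 * x $ {0, 3, 5} - u $ 0 * v $ 4 * x $ {1, 3, 5} - u $ 0 * v $ 5 * x $ {2, 3, 5} + u $ 1 * v $ 0 * x $ {3, 4, 5} - u $ 1 * v $ 3 * x $ {0, 4, 5} + u $ 1 * v $ 4 * x $ {1, 4, 5} + u $ 1 * v $ 5 * x $ {2, 4, 5} - u $ 3 * v $ 0 * x $ {0, 3, 5} + u $ 3 * v $ 1 * x $ {0, 4, 5} - u $ 3 * v $ 4 * x $ {0, 1, 5} - u $ 3 * v $ 5 * x $ {0, 2, 5} + u $ 4 * v $ 0 * x $ {1, 3, 5} - u $ 4 * v $ 1 * x $ {1, 4, 5} + u $ 4 * v $ 3 * x $ {0, 1, 5} + u $ 4 * v $ 5 * x $ {1, 2, 5} + u $ 5 * v $ 0 * x $ {2, 3, 5} - u $ 5 * v $ 1 * x $ {2, 4, 5} + u $ 5 * v $ 3 * x $ {0, 2, 5} - u $ 5 * v $ 4 * x $ {1, 2, 5}" "cross6 x u v $ 0 = - u $ 0 * v $ 1 * x $ {0, 3, 4} - u $ 0 * v $ 2 * x $ {0, 3, 5} - u $ 0 * v $ 4 * x $ {0, 1, 3} - u $ 0 * v $ 5 * x $ {0, 2, 3} + u $ 1 * v $ 0 * x $ {0, 3, 4} + u $ 1 * v $ 2 * x $ {0, 4, 5} + u $ 1 * v $ 4 * x $ {0, 1, 4} + u $ 1 * v $ 5 * x $ {0, 2, 4} +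 u $ 2 * v $ 0 * x $ {0, 3, 5} - u $ 2 * v $ 1 * x $ {0, 4, 5} + u $ 2 * v $ 4 * x $ {0, 1, 5} + u $ 2 * v $ 5 * x $ {0, 2, 5} + u $ 4 * v $ 0 * x $ {0, 1, 3} - u $ 4 * v $ 1 * x $ {0, 1, 4} - u $ 4 * v $ 2 * x $ {0, 1, 5} + u $ 4 * v $ 5 * x $ {0, 1, 2} + u $ 5 * v $ 0 * x $ {0, 2, 3} - u $ 5 * v $ 1 * x $ {0, 2, 4} - u $ 5 * v $ 2 * x $ {0, 2, 5} - u $ 5 * v $ 4 * x $ {0, 1, 2}"
  by (simp_all add: cross6_def pair3_def sum_triples_expand det3_def MJ_mult_nth bv_def axis_def algebra_simps)

lemma pair3_expand_third:
  "pair3 x \<alpha> \<beta> \<gamma> = dotp (\<chi> i. pair3 x \<alpha> \<beta> (bv i)) \<gamma>"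
  unfolding dotp_def sum_6 pair3_def sum_triples_expand det3_def
  by (simp add: bv_def axis_def algebra_simps)

lemma pair3_swap:
  "pair3 x \<beta> \<alpha> \<gamma> = - pair3 x \<alpha> \<beta> \<gamma>" "pair3 x \<alpha> \<gamma> \<beta> = - pair3 x \<alpha> \<beta> \<gamma>"
proof -
  have "det3 \<beta> \<alpha> \<gamma> i j l = - det3 \<alpha> \<beta> \<gamma> i j l" "det3 \<alpha> \<gamma> \<beta> i j l = - det3 \<alpha> \<beta> \<gamma> i j l" for i j l
    by (simp_all add: det3_def algebra_simps)
  then show "pair3 x \<beta> \<alpha> \<gamma> = - pair3 x \<alpha> \<beta> \<gamma>" "pair3 x \<alpha> \<gamma> \<beta> = - pair3 x \<alpha> \<beta> \<gamma>"
    by (simp_all add: pair3_def split_beta sum_negf)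
qed

lemma Tform_eq: "Tform x u v w = Jform (cross6 x u v) w"
  unfolding Tform_def Jform_def cross6_def by (rule pair3_expand_third)

lemma Tform_swap: "Tform x v u w = - Tform x u v w" "Tform x u w v = - Tform x u v w"
  unfolding Tform_def by (rule pair3_swap)+

lemma Tform_cyclic: "Tform x u v w = Tform x v w u"
  by (metis Tform_swap minus_minus)

lemma cross6_swap: "cross6 x v u = - cross6 x u v"
  by (rule Jform_nondegenerate) (simp only: Jform_linear Tform_swap(1)[of x v u] flip: Tform_eq)

lemma cross6_self [simp]: "cross6 x u u = 0"
  by (rule vec_6_eqI) (simp_all add: cross6_nth algebra_simps)

lemma Tform_self [simp]: "Tform x u u v = 0" "Tform x u v u = 0" "Tform x v u u = 0"
proof -
  show *: "Tform x u u v = 0" for u v by (simp add: Tform_eq Jform_linear)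
  show "Tform x u v u = 0" by (simp add: Tform_swap(2)[of x u v u] *)
  show "Tform x v u u = 0" by (simp add: Tform_cyclic[of x v u u] *)
qed

lemma cross6_linear:
  "cross6 x u (v + v') = cross6 x u v + cross6 x u v'" "cross6 x u (c *s v) = c *s cross6 x u v"
  "cross6 x (u + u') v = cross6 x u v + cross6 x u' v" "cross6 x (c *s u) v = c *s cross6 x u v"
  by (rule vec_6_eqI; simp add: cross6_nth algebra_simps)+

lemma cross6_minus:
  "cross6 x u (- v) = - cross6 x u v" "cross6 x (- u) v = - cross6 x u v"
  "cross6 x u 0 = 0" "cross6 x 0 v = 0"
  by (rule vec_6_eqI; simp add: cross6_nth algebra_simps)+

lemma Xspace_homog: "x \<in> Xspace \<Longrightarrow> homog 3 x"
  by (simp add: Xspace_def Ext3_iff)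

lemma psi_nth:
  "psi x $ 1 = x $ {1, 2, 5} + x $ {0, 1, 3}" "psi x $ 2 = x $ {0, 2, 3} - x $ {1, 2, 4}"
  "psi x $ 3 = - x $ {1, 3, 4} - x $ {2, 3, 5}" "psi x $ 4 = - x $ {2, 4, 5} - x $ {0, 3, 4}"
  "psi x $ 5 = x $ {1, 4, 5} - x $ {0, 3, 5}" "psi x $ 0 = x $ {0, 1, 4} + x $ {0, 2, 5}"
  by (simp_all add: psi_def ext3_lin_def sum_triples_expand Jform_expand bv_def axis_def)

text \<open>The six equations psi(x) = 0, each solved for one coordinate, so that as rewrite rules
  they leave fourteen free coordinates.\<close>

lemma Xspace_relations:
  assumes "x \<in> Xspace"
  shows "x $ {0, 1, 3} = - x $ {1, 2, 5}" "x $ {0, 2, 3} = x $ {1, 2, 4}"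
    "x $ {2, 3, 5} = - x $ {1, 3, 4}" "x $ {0, 3, 4} = - x $ {2, 4, 5}"
    "x $ {0, 3, 5} = x $ {1, 4, 5}" "x $ {0, 2, 5} = - x $ {0, 1, 4}"
proof -
  have "psi x = 0" using assms by (simp add: Xspace_def)
  then have "psi x $ k = 0" for k by simp
  from this[of 0] this[of 1] this[of 2] this[of 3] this[of 4] this[of 5]
  show "x $ {0, 1, 3} = - x $ {1, 2, 5}" "x $ {0, 2, 3} = x $ {1, 2, 4}"
    "x $ {2, 3, 5} = - x $ {1, 3, 4}" "x $ {0, 3, 4} = - x $ {2, 4, 5}"
    "x $ {0, 3, 5} = x $ {1, 4, 5}" "x $ {0, 2, 5} = - x $ {0, 1, 4}"
    unfolding psi_nth by (simp_all add: eq_neg_iff_add_eq_0 add.commute)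
qed

lemma matrix_vector_nth_6:
  "(A *v u) $ i = A $ i $ 0 * u $ 0 + A $ i $ 1 * u $ 1 + A $ i $ 2 * u $ 2 + A $ i $ 3 * u $ 3
    + A $ i $ 4 * u $ 4 + A $ i $ (5::6) * u $ 5"
  by (simp add: matrix_vector_mult_def sum_6)

lemma matrix_vector_mult_scale: "A *v (c *s u) = c *s (A *v u)" for A :: "'a::comm_ring_1 ^ 'n ^ 'm"
  by (simp add: vec_eq_iff matrix_vector_mult_def sum_distrib_left mult.left_commute)

text \<open>Equivalently J(phi u, v) + J(u, phi v) = 0, that is, phi(x) lies in the Lie algebra of
  Sp_6.\<close>

lemma Jform_phi_symmetric:
  assumes "x \<in> Xspace"
  shows "Jform u (phi x *v v) = Jform v (phi x *v u)"
proof -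
  note p = phi_entries[OF Xspace_homog[OF assms]] and r = Xspace_relations[OF assms]
  have "phi x $ 4 $ 4 = - phi x $ 1 $ 1" "phi x $ 5 $ 5 = - phi x $ 2 $ 2" "phi x $ 0 $ 0 = - phi x $ 3 $ 3"
    "phi x $ 4 $ 5 = - phi x $ 2 $ 1" "phi x $ 5 $ 4 = - phi x $ 1 $ 2" "phi x $ 4 $ 0 = - phi x $ 3 $ 1"
    "phi x $ 0 $ 4 = - phi x $ 1 $ 3" "phi x $ 5 $ 0 = - phi x $ 3 $ 2" "phi x $ 0 $ 5 = - phi x $ 2 $ 3"
    "phi x $ 1 $ 5 = phi x $ 2 $ 4" "phi x $ 1 $ 0 = phi x $ 3 $ 4" "phi x $ 2 $ 0 = phi x $ 3 $ 5"
    "phi x $ 4 $ 2 = phi x $ 5 $ 1" "phi x $ 4 $ 3 = phi x $ 0 $ 1" "phi x $ 5 $ 3 = phi x $ 0 $ 2"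
    unfolding p r by (simp_all add: algebra_simps)
  then show ?thesis
    unfolding Jform_expand matrix_vector_nth_6 by (simp add: algebra_simps)
qed



definition double_cross :: "'a::comm_ring_1 ^ (6 set) \<Rightarrow> 'a ^ 6 \<Rightarrow> 'a ^ 6 \<Rightarrow> 'a ^ 6" where
  "double_cross x u v = Jform u (phi x *v v) *s u + Jform u v *s (phi x *v u) - Jform u (phi x *v u) *s v"

text \<open>The identity is quadratic in u but linear in v, so only v is specialised to basis
  vectors; what remains are polynomial identities in the coordinates of u and x.\<close>

lemma cross6_cross6_bv0:
  assumes "x \<in> Xspace"
  shows "2 *s cross6 x u (cross6 x u (bv 0)) = double_cross x u (bv 0)"
  unfolding double_cross_def
  by (rule vec_6_eqI; simp add: cross6_nth Jform_expand matrix_vector_nth_6 bv_def axis_def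
        phi_entries[OF Xspace_homog[OF assms]] Xspace_relations[OF assms]; simp add: algebra_simps)

lemma cross6_cross6_bv1:
  assumes "x \<in> Xspace"
  shows "2 *s cross6 x u (cross6 x u (bv 1)) = double_cross x u (bv 1)"
  unfolding double_cross_def
  by (rule vec_6_eqI; simp add: cross6_nth Jform_expand matrix_vector_nth_6 bv_def axis_def
        phi_entries[OF Xspace_homog[OF assms]] Xspace_relations[OF assms]; simp add: algebra_simps)

lemma cross6_cross6_bv2:
  assumes "x \<in> Xspace"
  shows "2 *s cross6 x u (cross6 x u (bv 2)) = double_cross x u (bv 2)"
  unfolding double_cross_def
  by (rule vec_6_eqI; simp add: cross6_nth Jform_expand matrix_vector_nth_6 bv_def axis_def
        phi_entries[OF Xspace_homog[OF assms]] Xspace_relations[OF assms]; simp add: algebra_simps)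

lemma cross6_cross6_bv3:
  assumes "x \<in> Xspace"
  shows "2 *s cross6 x u (cross6 x u (bv 3)) = double_cross x u (bv 3)"
  unfolding double_cross_def
  by (rule vec_6_eqI; simp add: cross6_nth Jform_expand matrix_vector_nth_6 bv_def axis_def
        phi_entries[OF Xspace_homog[OF assms]] Xspace_relations[OF assms]; simp add: algebra_simps)

lemma cross6_cross6_bv4:
  assumes "x \<in> Xspace"
  shows "2 *s cross6 x u (cross6 x u (bv 4)) = double_cross x u (bv 4)"
  unfolding double_cross_def
  by (rule vec_6_eqI; simp add: cross6_nth Jform_expand matrix_vector_nth_6 bv_def axis_def
        phi_entries[OF Xspace_homog[OF assms]] Xspace_relations[OF assms]; simp add: algebra_simps)

lemma cross6_cross6_bv5:
  assumes "x \<in> Xspace"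
  shows "2 *s cross6 x u (cross6 x u (bv 5)) = double_cross x u (bv 5)"
  unfolding double_cross_def
  by (rule vec_6_eqI; simp add: cross6_nth Jform_expand matrix_vector_nth_6 bv_def axis_def
        phi_entries[OF Xspace_homog[OF assms]] Xspace_relations[OF assms]; simp add: algebra_simps)

text \<open>An analogue of a(ay) = -N(a) y for a pure octonion a: modulo the span of u and phi u,
  twice the square of [u, _] is multiplication by -J(u, phi u).\<close>

lemma cross6_cross6:
  assumes "x \<in> Xspace"
  shows "2 *s cross6 x u (cross6 x u v) =
    Jform u (phi x *v v) *s u + Jform u v *s (phi x *v u) - Jform u (phi x *v u) *s v"
proof -
  have "2 *s cross6 x u (cross6 x u v) = double_cross x u v"
  proof (rule linear_6_eqI[where f = "\<lambda>v. 2 *s cross6 x u (cross6 x u v)" and g = "double_cross x u"])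
    show "\<forall>i. 2 *s cross6 x u (cross6 x u (bv i)) = double_cross x u (bv i)"
      unfolding all_6 using assms
      by (simp only: cross6_cross6_bv0 cross6_cross6_bv1 cross6_cross6_bv2 cross6_cross6_bv3
          cross6_cross6_bv4 cross6_cross6_bv5 simp_thms)
  qed (simp_all add: cross6_linear double_cross_def matrix_vector_right_distrib matrix_vector_mult_scale
      Jform_linear vec_eq_iff algebra_simps)
  then show ?thesis by (simp only: double_cross_def)
qed



lemma cross6_diff: "cross6 x u (v - v') = cross6 x u v - cross6 x u v'"
  using cross6_linear(1)[of x u v "- v'"] by (simp add: cross6_minus)

text \<open>The cube of the operator [u, _] is computed in two ways: by the double product identity
  for [u, v], and by applying the operator to the identity for v. The difference is a relation
  between u and z = [u, phi u].\<close>

lemma cross6_phi_self: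
  fixes x :: "'a::field ^ (6 set)"
  assumes two: "(2::'a) \<noteq> 0" and x: "x \<in> Xspace"
  shows "cross6 x u (phi x *v u) = 0"
proof (cases "u = 0")
  case True
  then show ?thesis by (simp add: cross6_minus)
next
  case False
  let ?f = "\<lambda>u. phi x *v u" and ?A = "cross6 x u"
  let ?z = "?A (?f u)"
  obtain w where w: "Jform u w = 1" using False by (rule Jform_dual_vector)
  have eq: "(- Jform ?z v) *s u = Jform u v *s ?z" for v
  proof -
    have "Jform u (?A v) = 0"
      by (subst Jform_swap) (simp flip: Tform_eq)
    then have "2 *s ?A (?A (?A v)) = Jform u (?f (?A v)) *s u - Jform u (?f u) *s ?A v"
      using cross6_cross6[OF x, of u "?A v"] by simp
    moreover have "?A (2 *s ?A (?A v)) = Jform u v *s ?z - Jform u (?f u) *s ?A v"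
      unfolding cross6_cross6[OF x, of u v] by (simp add: cross6_linear cross6_diff)
    ultimately have "Jform u (?f (?A v)) *s u = Jform u v *s ?z"
      by (simp add: cross6_linear)
    moreover have "Jform u (?f (?A v)) = - Jform ?z v"
      using Jform_phi_symmetric[OF x, of u "?A v"] Tform_swap(2)[of x u "?f u" v] by (simp add: Tform_eq)
    ultimately show ?thesis by simp
  qed
  have z: "?z = (- Jform ?z w) *s u" using eq[of w] w by simp
  \<comment> \<open>Since z is -J(z, w) u and J(u, w) = 1, pairing with w returns J(z, w) with the
    opposite sign; here 2 must be invertible.\<close>
  have "Jform ?z w = Jform ((- Jform ?z w) *s u) w" by (subst z) (rule refl)
  also have "\<dots> = - Jform ?z w" by (simp only: Jform_linear w mult_1_right)
  finally have "2 * Jform ?z w = 0" by simp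
  then have "Jform ?z w = 0" using two by simp
  with z show ?thesis by simp
qed

text \<open>Polarisation of [u, phi u] = 0.\<close>

lemma cross6_phi:
  fixes x :: "'a::field ^ (6 set)"
  assumes "(2::'a) \<noteq> 0" "x \<in> Xspace"
  shows "cross6 x u (phi x *v v) = cross6 x (phi x *v u) v"
proof -
  note z = cross6_phi_self[OF assms]
  have "cross6 x u (phi x *v v) + cross6 x v (phi x *v u) = 0"
    using z[of "u + v"] by (simp add: matrix_vector_right_distrib cross6_linear z add.commute)
  then show ?thesis by (simp add: cross6_swap[of x v] eq_neg_iff_add_eq_0)
qed

text \<open>In the trilinear form phi moves freely between the arguments, while moving it across J
  changes the sign. Hence the product is conjugate bilinear for the multiplication by phi.\<close>

lemma phi_cross6:
  fixes x :: "'a::field ^ (6 set)"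
  assumes "(2::'a) \<noteq> 0" "x \<in> Xspace"
  shows "phi x *v cross6 x u v = - cross6 x (phi x *v u) v"
proof (rule Jform_nondegenerate)
  fix w
  have "Jform (phi x *v cross6 x u v) w = - Tform x u v (phi x *v w)"
    by (subst Jform_swap) (simp add: Jform_phi_symmetric[OF assms(2), of w] Tform_eq)
  also have "Tform x u v (phi x *v w) = Tform x (phi x *v w) u v"
    by (simp only: Tform_cyclic[of x "phi x *v w"])
  also have "\<dots> = Tform x w (phi x *v u) v"
    by (simp only: Tform_eq cross6_phi[OF assms])
  also have "\<dots> = Tform x (phi x *v u) v w"
    by (rule Tform_cyclic)
  finally show "Jform (phi x *v cross6 x u v) w = Jform (- cross6 x (phi x *v u) v) w"
    by (simp add: Tform_eq Jform_linear)
qed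

text \<open>With two sign changes phi passes through the double product: phi [u, [u, v]] = [u,
  [u, phi v]]. When both sides are expanded by the double product identity, only the two stated
  terms survive.\<close>

lemma phi_phi_parallel:
  fixes x :: "'a::field ^ (6 set)"
  assumes "(2::'a) \<noteq> 0" "x \<in> Xspace"
  shows "Jform u (phi x *v (phi x *v v)) *s u = Jform u v *s (phi x *v (phi x *v u))"
proof -
  let ?f = "\<lambda>u. phi x *v u"
  have "?f (cross6 x u (cross6 x u v)) = cross6 x u (cross6 x u (?f v))"
    by (simp add: phi_cross6[OF assms] cross6_phi[OF assms] cross6_minus flip: cross6_phi[OF assms, of u "cross6 x u v"])
  then have "?f (2 *s cross6 x u (cross6 x u v)) = 2 *s cross6 x u (cross6 x u (?f v))"
    by (simp add: matrix_vector_mult_scale)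
  then show ?thesis
    unfolding cross6_cross6[OF assms(2)]
    by (simp add: matrix_vector_right_distrib matrix_vector_mult_diff_distrib matrix_vector_mult_scale)
qed

lemma mat_mult_vector: "mat c *v u = c *s u" for c :: "'a::comm_ring_1"
  by (simp add: vec_eq_iff matrix_vector_mult_def mat_def if_distrib[of "\<lambda>c. c * _"] cong: if_cong)

lemma matrix_vector_axis: "(A *v axis j 1) $ i = A $ i $ j" for A :: "'a::comm_ring_1 ^ 'n ^ 'm"
  by (simp add: matrix_vector_mult_def axis_def if_distrib[of "\<lambda>c. _ * c"] cong: if_cong)

lemma scalar_matrixI:
  fixes A :: "'a::comm_ring_1 ^ 'n ^ 'n"
  assumes "\<And>u. \<exists>c. A *v u = c *s u"
  shows "\<exists>c. A = mat c"
proof -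
  have off: "A $ i $ j = 0" if "i \<noteq> j" for i j
  proof -
    obtain c where "A *v axis j 1 = c *s axis j 1" using assms by blast
    from arg_cong[OF this, of "\<lambda>v. v $ i"] that show ?thesis
      by (simp add: matrix_vector_axis) (simp add: axis_def)
  qed
  have diag: "A $ i $ i = A $ j $ j" if ij: "i \<noteq> j" for i j
  proof -
    obtain c where c: "A *v (axis i 1 + axis j 1) = c *s (axis i 1 + axis j 1)" using assms by blast
    have k: "A $ k $ i + A $ k $ j = c * (axis i 1 $ k + axis j 1 $ k)" for k
      using arg_cong[OF c, of "\<lambda>v. v $ k"] by (simp add: matrix_vector_right_distrib matrix_vector_axis distrib_left)
    have "A $ i $ i = c" using k[of i] ij off[OF ij] by (simp add: axis_def)
    moreover have "A $ j $ j = c" using k[of j] ij off[OF not_sym[OF ij]] by (simp add: axis_def)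
    ultimately show ?thesis by simp
  qed
  define i0 :: 'n where "i0 = undefined"
  obtain c where c: "c = A $ i0 $ i0" by simp
  have "A $ i $ i = c" for i
    using diag[of i i0] c by (cases "i = i0") simp_all
  then have "A $ i $ j = (if i = j then c else 0)" for i j
    using off[of i j] by (cases "i = j") simp_all
  then have "A = mat c" by (simp add: vec_eq_iff mat_def)
  then show ?thesis by blast
qed

text \<open>Choosing v with J(u, v) = 1 in \<open>phi_phi_parallel\<close> makes every u an
  eigenvector of phi^2. This also justifies the definite description in \<open>quartic\<close> on
  X.\<close>

lemma phi_square:
  fixes x :: "'a::field ^ (6 set)"
  assumes "(2::'a) \<noteq> 0" "x \<in> Xspace"
  shows "phi x ** phi x = mat (quartic x)"
proof -
  have "\<exists>c. (phi x ** phi x) *v u = c *s u" for u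
  proof (cases "u = 0")
    case False
    then obtain w where "Jform u w = 1" by (rule Jform_dual_vector)
    then have "phi x *v (phi x *v u) = Jform u (phi x *v (phi x *v w)) *s u"
      using phi_phi_parallel[OF assms, of u w] by simp
    then show ?thesis by (auto simp flip: matrix_vector_mul_assoc)
  qed auto
  then obtain c where c: "phi x ** phi x = mat c" using scalar_matrixI by blast
  have "d = c" if "phi x ** phi x = mat d" for d
    using that c by (auto simp: mat_def vec_eq_iff split: if_splits)
  then have "quartic x = c" unfolding quartic_def using c by (intro the_equality) auto
  with c show ?thesis by simp
qed

lemma phi_phi:
  fixes x :: "'a::field ^ (6 set)"
  assumes "(2::'a) \<noteq> 0" "x \<in> Xspace"
  shows "phi x *v (phi x *v u) = quartic x *s u"
  using phi_square[OF assms] by (simp add: matrix_vector_mul_assoc mat_mult_vector)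

section \<open>The symplectic group and its action\<close>

lemma MJ_transpose_mult:
  "MJ ** transpose MJ = (mat 1 :: 'a::comm_ring_1 ^ 6 ^ 6)"
  "transpose MJ ** MJ = (mat 1 :: 'a::comm_ring_1 ^ 6 ^ 6)"
proof -
  have t: "(transpose MJ *v u) = - (MJ *v u)" for u :: "'a ^ 6"
    by (rule vec_6_eqI) (simp_all add: matrix_vector_mult_def transpose_def MJ_def sum_6)
  have m: "MJ *v (- u) = - (MJ *v u)" for u :: "'a ^ 6"
    by (rule vec_6_eqI) (simp_all add: MJ_mult_nth)
  have s: "MJ *v (MJ *v u) = - u" for u :: "'a ^ 6"
    by (rule vec_6_eqI) (simp_all add: MJ_mult_nth)
  show "MJ ** transpose MJ = (mat 1 :: 'a ^ 6 ^ 6)" "transpose MJ ** MJ = (mat 1 :: 'a ^ 6 ^ 6)"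
    by (simp_all only: matrix_eq t m s mat_mult_vector minus_minus flip: matrix_vector_mul_assoc) simp_all
qed

text \<open>The definition of the group places the transpose on the right, whereas invariance of
  \<open>Jform\<close> has it on the left; the two agree because one-sided inverses of square
  matrices are two-sided.\<close>

lemma Sp6_transpose_mult:
  assumes "g \<in> Sp6"
  shows "transpose g ** MJ ** g = MJ"
proof -
  have "g ** (MJ ** transpose g ** transpose MJ) = (g ** MJ ** transpose g) ** transpose MJ"
    by (simp only: matrix_mul_assoc)
  also have "\<dots> = mat 1" using assms by (simp add: Sp6_def MJ_transpose_mult)
  finally have "(MJ ** transpose g ** transpose MJ) ** g = mat 1"
    by (simp add: matrix_left_right_inverse)
  then have "transpose MJ ** ((MJ ** transpose g ** transpose MJ) ** g) = transpose MJ" by simp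
  then have "(transpose MJ ** MJ) ** (transpose g ** transpose MJ ** g) = transpose MJ"
    by (simp only: matrix_mul_assoc)
  then have "transpose g ** transpose MJ ** g = transpose MJ" by (simp add: MJ_transpose_mult)
  from arg_cong[OF this, of transpose] show ?thesis
    by (simp add: matrix_transpose_mul matrix_mul_assoc)
qed

lemma Sp6I:
  assumes "transpose g ** MJ ** g = MJ"
  shows "g \<in> Sp6"
proof -
  have "(transpose MJ ** transpose g ** MJ) ** g = transpose MJ ** (transpose g ** MJ ** g)"
    by (simp only: matrix_mul_assoc)
  also have "\<dots> = mat 1" using assms by (simp add: MJ_transpose_mult)
  finally have 1: "(transpose MJ ** transpose g ** MJ) ** g = mat 1" .
  then have 2: "g ** (transpose MJ ** transpose g ** MJ) = mat 1" by (simp add: matrix_left_right_inverse)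
  then have "(g ** (transpose MJ ** transpose g ** MJ)) ** transpose MJ = transpose MJ" by simp
  then have "(g ** transpose MJ ** transpose g) ** (MJ ** transpose MJ) = transpose MJ"
    by (simp only: matrix_mul_assoc)
  then have "g ** transpose MJ ** transpose g = transpose MJ" by (simp add: MJ_transpose_mult)
  from arg_cong[OF this, of transpose] have "g ** MJ ** transpose g = MJ"
    by (simp add: matrix_transpose_mul matrix_mul_assoc)
  then show ?thesis using 1 2 by (auto simp: Sp6_def invertible_def)
qed

lemma Jform_mult: "Jform (g *v u) (h *v v) = dotp u ((transpose g ** MJ ** h) *v v)"
  by (simp add: Jform_def dotp_transpose matrix_vector_mul_assoc matrix_mul_assoc)

lemma Jform_Sp6: "g \<in> Sp6 \<Longrightarrow> Jform (g *v u) (g *v v) = Jform u v"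
  by (simp add: Jform_mult Sp6_transpose_mult) (simp add: Jform_def)

lemma Sp6_JformI:
  assumes "\<And>i j. Jform (g *v bv i) (g *v bv j) = Jform (bv i) (bv j)"
  shows "g \<in> Sp6"
proof (rule Sp6I)
  have "(transpose g ** MJ ** g) $ i $ j = MJ $ i $ j" for i j
    using assms[of i j] unfolding Jform_mult Jform_def[of "bv i"] dotp_bv by (simp add: bv_def matrix_vector_axis)
  then show "transpose g ** MJ ** g = MJ" by (simp add: vec_eq_iff)
qed

lemma Sp6_1: "mat 1 \<in> Sp6"
  by (rule Sp6I) simp

lemma Sp6_mult:
  assumes "g \<in> Sp6" "h \<in> Sp6"
  shows "g ** h \<in> Sp6"
  by (rule Sp6_JformI) (simp add: assms Jform_Sp6 flip: matrix_vector_mul_assoc)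

lemma Sp6_inverse:
  assumes "g \<in> Sp6"
  obtains h where "h \<in> Sp6" "g ** h = mat 1" "h ** g = mat 1"
proof -
  obtain h where h: "g ** h = mat 1" "h ** g = mat 1"
    using assms by (auto simp: Sp6_def invertible_def)
  have "Jform (h *v u) (h *v v) = Jform u v" for u v
    using Jform_Sp6[OF assms, of "h *v u" "h *v v"] by (simp add: matrix_vector_mul_assoc h)
  then have "h \<in> Sp6" by (intro Sp6_JformI) simp
  with h that show ?thesis by blast
qed

lemma Tform_act3: "g \<in> Sp6 \<Longrightarrow> Tform (act3 g x) (g *v u) (g *v v) (g *v w) = Tform x u v w"
  by (simp add: Tform_def pair3_act3 matrix_vector_mul_assoc Sp6_transpose_mult matrix_mul_assoc)

lemma cross6_act3:
  assumes "g \<in> Sp6"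
  shows "cross6 (act3 g x) (g *v u) (g *v v) = g *v cross6 x u v"
proof (rule Jform_nondegenerate)
  fix w
  obtain h where h: "h \<in> Sp6" "g ** h = mat 1" "h ** g = mat 1" using assms by (rule Sp6_inverse)
  have w: "w = g *v (h *v w)" by (simp add: matrix_vector_mul_assoc h)
  show "Jform (cross6 (act3 g x) (g *v u) (g *v v)) w = Jform (g *v cross6 x u v) w"
    by (subst (1 2) w) (simp only: Jform_Sp6[OF assms] Tform_act3[OF assms] flip: Tform_eq)
qed

lemma Jform_double_sum:
  "Jform q r = (\<Sum>b\<in>UNIV. \<Sum>c\<in>UNIV. q $ b * r $ c * Jform (bv b) (bv c))"
  by (simp add: sum_6 Jform_expand bv_def axis_def algebra_simps)

text \<open>The alternating tensor H represents psi; its value on a decomposable trivector involves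
  only J and the three vectors, so g can be pulled out.\<close>

lemma psi_act3: "psi (act3 g x) = g *v psi x" if "g \<in> Sp6"
proof -
  let ?S = "{(i, j, l). (i :: 6) < j \<and> j < l}"
  define H :: "6 \<Rightarrow> 6 \<Rightarrow> 6 \<Rightarrow> 6 \<Rightarrow> 'a" where
    "H k a b c = Jform (bv b) (bv c) * bv a $ k - Jform (bv a) (bv c) * bv b $ k + Jform (bv a) (bv b) * bv c $ k" for k a b c
  have alt: "H k a a c = 0" "H k b a c = - H k a b c" "H k a c b = - H k a b c" for k a b c
    unfolding H_def using Jform_swap[of "bv a" "bv b :: 'a ^ 6"] Jform_swap[of "bv b" "bv c :: 'a ^ 6"]
    by (simp_all add: algebra_simps)
  have psi: "psi y $ k = (\<Sum>(a, b, c)\<in>?S. y $ {a, b, c} * H k a b c)" for y k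
    unfolding psi_def ext3_lin_def sum_component H_def by (intro sum.cong) (auto simp: algebra_simps)
  have d: "(\<Sum>a\<in>UNIV. p $ a * bv a $ k) = p $ k" for p :: "'a ^ 6" and k
    by (simp add: bv_def axis_def if_distrib[of "\<lambda>c. _ * c"] cong: if_cong)
  have sum_H: "(\<Sum>(a, b, c)\<in>?S. det3 p q r a b c * H k a b c) = Jform q r * p $ k - Jform p r * q $ k + Jform p q * r $ k"
    for p q r k
  proof -
    have "(\<Sum>(a, b, c)\<in>?S. det3 p q r a b c * H k a b c) = (\<Sum>a\<in>UNIV. \<Sum>b\<in>UNIV. \<Sum>c\<in>UNIV. p $ a * q $ b * r $ c * H k a b c)"
      by (rule sum_det3) (rule alt)+
    also have "\<dots> = (\<Sum>a\<in>UNIV. \<Sum>b\<in>UNIV. \<Sum>c\<in>UNIV. (p $ a * bv a $ k) * (q $ b * r $ c * Jform (bv b) (bv c)))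
       - (\<Sum>a\<in>UNIV. \<Sum>b\<in>UNIV. \<Sum>c\<in>UNIV. (q $ b * bv b $ k) * (p $ a * r $ c * Jform (bv a) (bv c)))
       + (\<Sum>a\<in>UNIV. \<Sum>b\<in>UNIV. \<Sum>c\<in>UNIV. (p $ a * q $ b * Jform (bv a) (bv b)) * (r $ c * bv c $ k))"
      unfolding sum.distrib[symmetric] sum_subtractf[symmetric]
      by (intro sum.cong refl) (simp add: H_def algebra_simps)
    also have "(\<Sum>a\<in>UNIV. \<Sum>b\<in>UNIV. \<Sum>c\<in>UNIV. (q $ b * bv b $ k) * (p $ a * r $ c * Jform (bv a) (bv c)))
       = (\<Sum>b\<in>UNIV. \<Sum>a\<in>UNIV. \<Sum>c\<in>UNIV. (q $ b * bv b $ k) * (p $ a * r $ c * Jform (bv a) (bv c)))"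
      by (rule sum.swap)
    also have "\<dots> = q $ k * Jform p r"
      by (simp only: sum_distrib_left[symmetric] sum_distrib_right[symmetric] d Jform_double_sum[of p r])
    also have "(\<Sum>a\<in>UNIV. \<Sum>b\<in>UNIV. \<Sum>c\<in>UNIV. (p $ a * bv a $ k) * (q $ b * r $ c * Jform (bv b) (bv c)))
       = p $ k * Jform q r"
      by (simp only: sum_distrib_left[symmetric] sum_distrib_right[symmetric] d Jform_double_sum[of q r])
    also have "(\<Sum>a\<in>UNIV. \<Sum>b\<in>UNIV. \<Sum>c\<in>UNIV. (p $ a * q $ b * Jform (bv a) (bv b)) * (r $ c * bv c $ k))
       = Jform p q * r $ k"
      by (simp only: sum_distrib_left[symmetric] sum_distrib_right[symmetric] d Jform_double_sum[of p q])
    finally show ?thesis by (simp only: mult.commute)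
  qed
  have "psi (act3 g x) $ k = (g *v psi x) $ k" for k
  proof -
    have "psi (act3 g x) $ k = (\<Sum>(a, b, c)\<in>?S. \<Sum>(i, j, l)\<in>?S.
        x $ {i, j, l} * (det3 (g *v bv i) (g *v bv j) (g *v bv l) a b c * H k a b c))"
      unfolding psi by (intro sum.cong refl) (auto simp: act3_nth sum_distrib_right mult.assoc split_beta)
    also have "\<dots> = (\<Sum>(i, j, l)\<in>?S. x $ {i, j, l} * (\<Sum>(a, b, c)\<in>?S.
        det3 (g *v bv i) (g *v bv j) (g *v bv l) a b c * H k a b c))"
      unfolding split_beta sum_distrib_left by (rule sum.swap)
    also have "\<dots> = (\<Sum>(i, j, l)\<in>?S. x $ {i, j, l} * (\<Sum>m\<in>UNIV. g $ k $ m * H m i j l))"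
      unfolding sum_H Jform_Sp6[OF that]
      by (intro sum.cong refl)
        (auto simp: H_def matrix_vector_mult_def sum_distrib_left algebra_simps sum.distrib sum_subtractf)
    also have "\<dots> = (\<Sum>m\<in>UNIV. g $ k $ m * (\<Sum>(i, j, l)\<in>?S. x $ {i, j, l} * H m i j l))"
      unfolding split_beta sum_distrib_left by (subst sum.swap) (simp add: mult.left_commute)
    also have "\<dots> = (g *v psi x) $ k"
      unfolding psi[symmetric] by (simp add: matrix_vector_mult_def)
    finally show ?thesis .
  qed
  then show ?thesis by (simp add: vec_eq_iff)
qed

lemma Xspace_act3: "g \<in> Sp6 \<Longrightarrow> x \<in> Xspace \<Longrightarrow> act3 g x \<in> Xspace"
  by (simp add: Xspace_def Ext3_iff homog_act3 psi_act3)



text \<open>Both phi(x) and the conjugate of phi(gx) by g satisfy the double product identity for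
  the same product, so their difference D satisfies a relation without any product. That relation
  forces D = 0, and no entry of phi is expanded.\<close>

lemma phi_act3:
  fixes x :: "'a::field ^ (6 set)"
  assumes two: "(2::'a) \<noteq> 0" and x: "x \<in> Xspace" and g: "g \<in> Sp6"
  shows "phi (act3 g x) *v (g *v u) = g *v (phi x *v u)"
proof -
  obtain h where h: "h \<in> Sp6" "g ** h = mat 1" "h ** g = mat 1" using g by (rule Sp6_inverse)
  have hg: "h *v (g *v u) = u" "g *v (h *v u) = u" for u by (simp_all add: matrix_vector_mul_assoc h)
  have gx: "act3 g x \<in> Xspace" using g x by (rule Xspace_act3)
  define D where "D = h ** phi (act3 g x) ** g - phi x"
  have D: "D *v u = h *v (phi (act3 g x) *v (g *v u)) - phi x *v u" for u
    by (simp add: D_def matrix_vector_mult_diff_rdistrib matrix_vector_mul_assoc matrix_mul_assoc)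
  have JD: "Jform u (D *v v) = Jform (g *v u) (phi (act3 g x) *v (g *v v)) - Jform u (phi x *v v)" for u v
    using Jform_Sp6[OF g, of u "h *v (phi (act3 g x) *v (g *v v))"] by (simp add: D Jform_linear hg)
  have eq: "Jform u (D *v u) *s v = Jform u (D *v v) *s u + Jform u v *s (D *v u)" for u v
  proof -
    have "2 *s (g *v cross6 x u (cross6 x u v)) =
        Jform (g *v u) (phi (act3 g x) *v (g *v v)) *s (g *v u) + Jform u v *s (phi (act3 g x) *v (g *v u))
        - Jform (g *v u) (phi (act3 g x) *v (g *v u)) *s (g *v v)"
      using cross6_cross6[OF gx, of "g *v u" "g *v v"] by (simp add: cross6_act3[OF g] Jform_Sp6[OF g])
    from arg_cong[OF this, of "\<lambda>w. h *v w"]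
    have "2 *s cross6 x u (cross6 x u v) =
        Jform (g *v u) (phi (act3 g x) *v (g *v v)) *s u + Jform u v *s (h *v (phi (act3 g x) *v (g *v u)))
        - Jform (g *v u) (phi (act3 g x) *v (g *v u)) *s v"
      by (simp add: matrix_vector_right_distrib matrix_vector_mult_diff_distrib matrix_vector_mult_scale hg)
    then show ?thesis
      unfolding cross6_cross6[OF x] JD unfolding D by (simp add: vec_eq_iff algebra_simps)
  qed
  \<comment> \<open>The trace of \<open>eq\<close> over v: with q = J(u, Du) the left side
    contributes 6q and the right side q + q, and 4 is invertible.\<close>
  have quad: "Jform u (D *v u) = 0" for u
  proof -
    have "Jform u (D *v u) * bv m $ m = Jform u (D *v bv m) * u $ m + Jform u (bv m) * (D *v u) $ m" for m
      using arg_cong[OF eq[of u "bv m"], of "\<lambda>w. w $ m"] by simp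
    then have "(\<Sum>m\<in>UNIV. Jform u (D *v u) * bv m $ m) =
        (\<Sum>m\<in>UNIV. u $ m * Jform u (D *v bv m)) + (\<Sum>m\<in>UNIV. (D *v u) $ m * Jform u (bv m))"
      by (simp add: sum.distrib mult.commute)
    moreover have "(\<Sum>m\<in>UNIV. (D *v u) $ m * Jform u (bv m)) = Jform u (D *v u)"
      by (simp add: sum_6 Jform_bv) (simp add: Jform_expand algebra_simps)
    moreover have "(\<Sum>m\<in>UNIV. u $ m * Jform u (D *v bv m)) = Jform u (D *v u)"
    proof -
      have "D *v u = D *v (u $ 0 *s bv 0 + u $ 1 *s bv 1 + u $ 2 *s bv 2 + u $ 3 *s bv 3 + u $ 4 *s bv 4 + u $ 5 *s bv 5)"
        by (simp flip: vec_6_expand)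
      then show ?thesis
        by (simp add: sum_6 matrix_vector_right_distrib matrix_vector_mult_scale Jform_linear)
    qed
    moreover have "(\<Sum>m\<in>UNIV. Jform u (D *v u) * bv m $ m) = 6 * Jform u (D *v u)"
      by (simp add: bv_def)
    moreover have "6 * Jform u (D *v u) = Jform u (D *v u) + Jform u (D *v u) + 2 * (2 * Jform u (D *v u))" by simp
    ultimately have "2 * (2 * Jform u (D *v u)) = 0" by (simp only: add_cancel_left_right)
    then show ?thesis using two by (simp only: mult_eq_0_iff) simp
  qed
  have D0: "D *v u = 0"  for u
  proof (cases "u = 0")
    case False
    then obtain w where w: "Jform u w = 1" by (rule Jform_dual_vector)
    have Du: "D *v u = (- Jform u (D *v w)) *s u"
      using eq[of u w] w by (simp add: quad vec_eq_iff eq_neg_iff_add_eq_0 add.commute)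
    have "Jform u (D *v w) + Jform w (D *v u) = 0"
      using quad[of "u + w"] by (simp add: matrix_vector_right_distrib Jform_linear quad add.commute)
    moreover have "Jform w (D *v u) = Jform u (D *v w)"
      by (subst Du) (simp add: Jform_linear Jform_swap[of w u] w)
    ultimately have "2 * Jform u (D *v w) = 0" by simp
    then have "Jform u (D *v w) = 0" using two by simp
    then show ?thesis using Du by simp
  qed simp
  then have "h *v (phi (act3 g x) *v (g *v u)) = phi x *v u" using D[of u] by simp
  then show ?thesis using hg(2)[of "phi (act3 g x) *v (g *v u)"] by simp
qed

section \<open>Invariance of f_1 and f_2\<close>

lemma f2_eq: "f2 (x, v) = - (1 / 2) * Jform v (phi x *v v)"
  by (simp add: f2_def Jform_def)

lemma f2_act:
  fixes x :: "'a::field ^ (6 set)"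
  assumes "(2::'a) \<noteq> 0" "x \<in> Xspace" "g \<in> Sp6"
  shows "f2 (act3 g x, g *v v) = f2 (x, v)"
  by (simp add: f2_eq phi_act3[OF assms] Jform_Sp6[OF assms(3)])

lemma bv_nonzero: "bv i \<noteq> (0 :: 'a::comm_ring_1 ^ 6)"
  by (auto simp: bv_def axis_def vec_eq_iff)

lemma quartic_act3:
  fixes x :: "'a::field ^ (6 set)"
  assumes "(2::'a) \<noteq> 0" "x \<in> Xspace" "g \<in> Sp6"
  shows "quartic (act3 g x) = quartic x"
proof -
  let ?b = "bv 0 :: 'a ^ 6"
  have inj: "g *v ?b \<noteq> 0"
  proof
    assume "g *v ?b = 0"
    moreover obtain h where "h ** g = mat 1" using assms(3) by (rule Sp6_inverse)
    ultimately have "?b = 0" by (metis matrix_vector_mul_assoc matrix_vector_mul_lid matrix_vector_mult_0_right)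
    then show False using bv_nonzero by blast
  qed
  have "quartic (act3 g x) *s (g *v ?b) = phi (act3 g x) *v (phi (act3 g x) *v (g *v ?b))"
    by (rule phi_phi[OF assms(1) Xspace_act3[OF assms(3,2)], symmetric])
  also have "\<dots> = quartic x *s (g *v ?b)"
    by (simp only: phi_act3[OF assms] phi_phi[OF assms(1,2)] matrix_vector_mult_scale)
  finally have "quartic (act3 g x) *s (g *v ?b) = quartic x *s (g *v ?b)" .
  from vec.scale_right_imp_eq[OF inj this] show ?thesis .
qed

lemma f1_act3:
  fixes x :: "'a::field ^ (6 set)"
  assumes "(2::'a) \<noteq> 0" "x \<in> Xspace" "g \<in> Sp6"
  shows "f1 (act3 g x) = f1 x"
  by (simp add: f1_def quartic_act3[OF assms])

section \<open>Trivectors in normal form\<close>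

lemma normal_form_nth:
  "normal_form y0 y1 y2 y3 $ {1, 2, 3} = - 1"
   "normal_form y0 y1 y2 y3 $ {1, 2, 4} = 0"
   "normal_form y0 y1 y2 y3 $ {1, 2, 5} = 0"
   "normal_form y0 y1 y2 y3 $ {0, 1, 2} = 0"
   "normal_form y0 y1 y2 y3 $ {1, 3, 4} = 0"
   "normal_form y0 y1 y2 y3 $ {1, 3, 5} = 0"
   "normal_form y0 y1 y2 y3 $ {0, 1, 3} = 0"
   "normal_form y0 y1 y2 y3 $ {1, 4, 5} = 0"
   "normal_form y0 y1 y2 y3 $ {0, 1, 4} = 0"
   "normal_form y0 y1 y2 y3 $ {0, 1, 5} = y1"
   "normal_form y0 y1 y2 y3 $ {2, 3, 4} = 0"
   "normal_form y0 y1 y2 y3 $ {2, 3, 5} = 0"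
   "normal_form y0 y1 y2 y3 $ {0, 2, 3} = 0"
   "normal_form y0 y1 y2 y3 $ {2, 4, 5} = 0"
   "normal_form y0 y1 y2 y3 $ {0, 2, 4} = - y2"
   "normal_form y0 y1 y2 y3 $ {0, 2, 5} = 0"
   "normal_form y0 y1 y2 y3 $ {3, 4, 5} = y3"
   "normal_form y0 y1 y2 y3 $ {0, 3, 4} = 0"
   "normal_form y0 y1 y2 y3 $ {0, 3, 5} = 0"
   "normal_form y0 y1 y2 y3 $ {0, 4, 5} = - y0"
  by (simp_all add: normal_form_def wedge3_triple det3_def bv_def axis_def)

lemma homog_normal_form: "homog 3 (normal_form y0 y1 y2 y3)"
  unfolding normal_form_def by (intro homog_linear homog_wedge3)

lemma normal_form_Xspace: "normal_form y0 y1 y2 y3 \<in> Xspace"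
proof -
  have "psi (normal_form y0 y1 y2 y3) = 0"
    by (rule vec_6_eqI) (simp_all add: psi_nth normal_form_nth)
  then show ?thesis by (simp add: Xspace_def Ext3_iff homog_normal_form)
qed

lemma phi_normal_form:
  "phi (normal_form y0 y1 y2 y3) $ 1 $ 1 = - y0"
   "phi (normal_form y0 y1 y2 y3) $ 1 $ 2 = 0"
   "phi (normal_form y0 y1 y2 y3) $ 1 $ 3 = 0"
   "phi (normal_form y0 y1 y2 y3) $ 1 $ 4 = - 2 * y1"
   "phi (normal_form y0 y1 y2 y3) $ 1 $ 5 = 0"
   "phi (normal_form y0 y1 y2 y3) $ 1 $ 0 = 0"
   "phi (normal_form y0 y1 y2 y3) $ 2 $ 1 = 0"
   "phi (normal_form y0 y1 y2 y3) $ 2 $ 2 = - y0"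
   "phi (normal_form y0 y1 y2 y3) $ 2 $ 3 = 0"
   "phi (normal_form y0 y1 y2 y3) $ 2 $ 4 = 0"
   "phi (normal_form y0 y1 y2 y3) $ 2 $ 5 = - 2 * y2"
   "phi (normal_form y0 y1 y2 y3) $ 2 $ 0 = 0"
   "phi (normal_form y0 y1 y2 y3) $ 3 $ 1 = 0"
   "phi (normal_form y0 y1 y2 y3) $ 3 $ 2 = 0"
   "phi (normal_form y0 y1 y2 y3) $ 3 $ 3 = - y0"
   "phi (normal_form y0 y1 y2 y3) $ 3 $ 4 = 0"
   "phi (normal_form y0 y1 y2 y3) $ 3 $ 5 = 0"
   "phi (normal_form y0 y1 y2 y3) $ 3 $ 0 = - 2 * y3"
   "phi (normal_form y0 y1 y2 y3) $ 4 $ 1 = 2 * y2 * y3"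
   "phi (normal_form y0 y1 y2 y3) $ 4 $ 2 = 0"
   "phi (normal_form y0 y1 y2 y3) $ 4 $ 3 = 0"
   "phi (normal_form y0 y1 y2 y3) $ 4 $ 4 = y0"
   "phi (normal_form y0 y1 y2 y3) $ 4 $ 5 = 0"
   "phi (normal_form y0 y1 y2 y3) $ 4 $ 0 = 0"
   "phi (normal_form y0 y1 y2 y3) $ 5 $ 1 = 0"
   "phi (normal_form y0 y1 y2 y3) $ 5 $ 2 = 2 * y1 * y3"
   "phi (normal_form y0 y1 y2 y3) $ 5 $ 3 = 0"
   "phi (normal_form y0 y1 y2 y3) $ 5 $ 4 = 0"
   "phi (normal_form y0 y1 y2 y3) $ 5 $ 5 = y0"
   "phi (normal_form y0 y1 y2 y3) $ 5 $ 0 = 0"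
   "phi (normal_form y0 y1 y2 y3) $ 0 $ 1 = 0"
   "phi (normal_form y0 y1 y2 y3) $ 0 $ 2 = 0"
   "phi (normal_form y0 y1 y2 y3) $ 0 $ 3 = 2 * y1 * y2"
   "phi (normal_form y0 y1 y2 y3) $ 0 $ 4 = 0"
   "phi (normal_form y0 y1 y2 y3) $ 0 $ 5 = 0"
   "phi (normal_form y0 y1 y2 y3) $ 0 $ 0 = y0"
  by (simp_all add: phi_entries[OF homog_normal_form] normal_form_nth)

lemma f1_normal_form:
  fixes y0 :: "'a::field"
  assumes "(2::'a) \<noteq> 0"
  shows "f1 (normal_form y0 y1 y2 y3) = y1 * y2 * y3 - 1 / 4 * y0\<^sup>2"
proof -
  have "quartic (normal_form y0 y1 y2 y3) = (phi (normal_form y0 y1 y2 y3) ** phi (normal_form y0 y1 y2 y3)) $ 1 $ 1"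
    by (simp add: phi_square[OF assms normal_form_Xspace] mat_def)
  also have "\<dots> = y0\<^sup>2 - 4 * (y1 * y2 * y3)"
    by (simp add: matrix_matrix_mult_def sum_6 phi_normal_form power2_eq_square)
  finally have q: "quartic (normal_form y0 y1 y2 y3) = y0\<^sup>2 - 4 * (y1 * y2 * y3)" .
  have "(4::'a) \<noteq> 0" using assms by (metis mult_2 mult_eq_0_iff numeral_Bit0)
  then show ?thesis unfolding f1_def q by (simp add: field_simps)
qed

lemma f2_normal_form:
  fixes y0 :: "'a::field"
  assumes "(2::'a) \<noteq> 0"
  shows "f2 (normal_form y0 y1 y2 y3, u) =
    - (y1 * (u $ 4)\<^sup>2 + y0 * u $ 1 * u $ 4 + y2 * y3 * (u $ 1)\<^sup>2
     + y2 * (u $ 5)\<^sup>2 + y0 * u $ 2 * u $ 5 + y1 * y3 * (u $ 2)\<^sup>2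
     + y3 * (u $ 0)\<^sup>2 + y0 * u $ 3 * u $ 0 + y1 * y2 * (u $ 3)\<^sup>2)"
proof -
  have eq: "Jform u (phi (normal_form y0 y1 y2 y3) *v u) =
    2 * (y1 * (u $ 4)\<^sup>2 + y0 * u $ 1 * u $ 4 + y2 * y3 * (u $ 1)\<^sup>2
     + y2 * (u $ 5)\<^sup>2 + y0 * u $ 2 * u $ 5 + y1 * y3 * (u $ 2)\<^sup>2
     + y3 * (u $ 0)\<^sup>2 + y0 * u $ 3 * u $ 0 + y1 * y2 * (u $ 3)\<^sup>2)"
    by (simp add: Jform_expand matrix_vector_nth_6 phi_normal_form power2_eq_square algebra_simps)
  have half: "- (1 / 2) * (2 * s) = - s" for s :: 'a using assms by simp
  show ?thesis unfolding f2_eq eq by (rule half)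
qed

text \<open>The complement of the plane of v and phi v is stable under phi. If J(w, phi w) vanished
  on it, then so would its polarisation, and since phi^2 is a nonzero scalar J itself would vanish
  there; the complement would be zero and V_6 would be spanned by two vectors.\<close>

lemma exists_orthogonal_anisotropic:
  fixes x :: "'a::field ^ (6 set)"
  assumes two: "(2::'a) \<noteq> 0" and x: "x \<in> Xspace" and q: "quartic x \<noteq> 0"
    and v: "Jform v (phi x *v v) \<noteq> 0"
  obtains w where "Jform v w = 0" "Jform (phi x *v v) w = 0" "Jform w (phi x *v w) \<noteq> 0"
proof -
  let ?f = "\<lambda>u. phi x *v u" and ?c = "Jform v (phi x *v v)"
  \<comment> \<open>The projection onto the J-orthogonal complement of v and phi v.\<close>
  define pr where "pr u = u + (Jform (?f v) u / ?c) *s v - (Jform v u / ?c) *s ?f v" for u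
  have fv: "Jform (?f v) v = - ?c" by (rule Jform_swap)
  have pr: "Jform v (pr u) = 0" "Jform (?f v) (pr u) = 0" for u
    using v by (simp_all add: pr_def Jform_linear fv)
  have sym: "Jform u (?f w) = Jform w (?f u)" for u w by (rule Jform_phi_symmetric[OF x])
  have fstab: "Jform v (?f u) = 0 \<and> Jform (?f v) (?f u) = 0" if "Jform v u = 0" "Jform (?f v) u = 0" for u
  proof
    show "Jform v (?f u) = 0" using sym[of v u] Jform_swap[of u "?f v"] that by simp
    have "Jform (?f v) (?f u) = - (quartic x * Jform v u)"
      using sym[of "?f v" u] Jform_swap[of u v] by (simp add: phi_phi[OF two x] Jform_linear)
    then show "Jform (?f v) (?f u) = 0" using that by simp
  qed
  have "\<exists>w. Jform v w = 0 \<and> Jform (?f v) w = 0 \<and> Jform w (?f w) \<noteq> 0"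
  proof (rule ccontr)
    assume "\<not> ?thesis"
    then have iso: "Jform w (?f w) = 0" if "Jform v w = 0" "Jform (?f v) w = 0" for w using that by blast
    have iso2: "Jform w (?f w') = 0"
      if "Jform v w = 0" "Jform (?f v) w = 0" "Jform v w' = 0" "Jform (?f v) w' = 0" for w w'
    proof -
      have "Jform (w + w') (?f (w + w')) = 0" using that by (intro iso) (simp_all add: Jform_linear)
      then have "2 * Jform w (?f w') = 0"
        using iso[of w] iso[of w'] that sym[of w' w]
        by (simp add: matrix_vector_right_distrib Jform_linear)
      then show ?thesis using two by simp
    qed
    have zero: "pr u = 0" for u
    proof (rule Jform_nondegenerate)
      fix w
      have "Jform (pr u) (?f (?f (pr w))) = 0"
        by (rule iso2[OF pr fstab[OF pr, THEN conjunct1] fstab[OF pr, THEN conjunct2]])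
      then have "Jform (pr u) (pr w) = 0" using q by (simp add: phi_phi[OF two x] Jform_linear)
      then have "Jform (pr u) w + (Jform (?f v) w / ?c) * Jform (pr u) v - (Jform v w / ?c) * Jform (pr u) (?f v) = 0"
        unfolding pr_def[of w] by (simp add: Jform_linear)
      then show "Jform (pr u) w = Jform 0 w"
        using pr[of u] Jform_swap[of "pr u" v] Jform_swap[of "pr u" "?f v"] by (simp add: Jform_linear)
    qed
    have "u \<in> vec.span {v, ?f v}" for u
    proof -
      have "u = (- (Jform (?f v) u / ?c)) *s v + (Jform v u / ?c) *s ?f v"
        using zero[of u] by (simp add: pr_def vec_eq_iff algebra_simps)
      also have "\<dots> \<in> vec.span {v, ?f v}"
        by (intro vec.span_add vec.span_scale vec.span_base) auto
      finally show ?thesis .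
    qed
    then have "UNIV \<subseteq> vec.span {v, ?f v}" by blast
    then have "vec.dim (UNIV :: ('a ^ 6) set) \<le> card {v, ?f v}" by (rule vec.dim_le_card) simp
    then have "6 \<le> card {v, ?f v}" by (simp only: vec_dim_card) simp
    then show False by (simp add: card_insert_if split: if_splits)
  qed
  with that show ?thesis by blast
qed

lemma matrix_vector_mult_minus: "A *v (- u) = - (A *v u)" for A :: "'a::comm_ring_1 ^ 'n ^ 'm"
  by (simp add: vec_eq_iff matrix_vector_mult_def sum_negf)

lemma Jform_bv_bv: "Jform (bv i) (bv j) = MJ $ i $ j"
  unfolding Jform_def dotp_bv by (simp add: bv_def matrix_vector_axis)

text \<open>The product determines the trilinear form, and as \<open>MJ\<close> is invertible the
  trilinear form determines x.\<close>

lemma cross6_inject: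
  assumes "homog 3 x" "homog 3 y" "\<forall>i j. cross6 x (bv i) (bv j) = cross6 y (bv i) (bv j)"
  shows "x = y"
proof -
  have 1: "cross6 x (bv i) v = cross6 y (bv i) v" for i v
    using assms(3) by (intro linear_6_eqI[where f = "cross6 x (bv i)" and g = "cross6 y (bv i)" and v = v])
      (simp_all add: cross6_linear)
  have eq: "cross6 x u v = cross6 y u v" for u v
    by (intro linear_6_eqI[where f = "\<lambda>u. cross6 x u v" and g = "\<lambda>u. cross6 y u v" and v = u])
      (simp_all add: cross6_linear 1)
  have p: "pair3 z \<alpha> \<beta> \<gamma> = Tform z (transpose MJ *v \<alpha>) (transpose MJ *v \<beta>) (transpose MJ *v \<gamma>)" for z \<alpha> \<beta> \<gamma>
    unfolding Tform_def matrix_vector_mul_assoc MJ_transpose_mult by simp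
  show ?thesis
    by (rule pair3_inject) (use assms(1,2) in \<open>simp_all only: p Tform_eq eq\<close>)
qed

lemma matrix_columns_6:
  fixes E :: "6 \<Rightarrow> 'a::comm_ring_1 ^ 6"
  shows "(\<chi> i j. E j $ i) *v bv k = E k"
    and "(\<chi> i j. E j $ i) *v z = z $ 0 *s E 0 + z $ 1 *s E 1 + z $ 2 *s E 2 + z $ 3 *s E 3 + z $ 4 *s E 4 + z $ 5 *s E 5"
  by (simp add: vec_eq_iff bv_def matrix_vector_axis) (simp add: vec_eq_iff matrix_vector_nth_6 mult.commute)

lemma cross6_normal_form:
  "cross6 (normal_form 0 y1 y2 y3) (bv 4) (bv 5) = (- 1) *s bv 3"
  "cross6 (normal_form 0 y1 y2 y3) (bv 4) (bv 2) = (- y1) *s bv 0"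
  "cross6 (normal_form 0 y1 y2 y3) (bv 1) (bv 5) = (- y2) *s bv 0"
  "cross6 (normal_form 0 y1 y2 y3) (bv 1) (bv 2) = (y3) *s bv 3"
  "cross6 (normal_form 0 y1 y2 y3) (bv 4) (bv 0) = (1) *s bv 2"
  "cross6 (normal_form 0 y1 y2 y3) (bv 4) (bv 3) = (y1) *s bv 5"
  "cross6 (normal_form 0 y1 y2 y3) (bv 5) (bv 0) = (- 1) *s bv 1"
  "cross6 (normal_form 0 y1 y2 y3) (bv 5) (bv 3) = (- y2) *s bv 4"
  "cross6 (normal_form 0 y1 y2 y3) (bv 1) (bv 0) = (y3) *s bv 5"
  "cross6 (normal_form 0 y1 y2 y3) (bv 1) (bv 3) = (- y2) *s bv 2"
  "cross6 (normal_form 0 y1 y2 y3) (bv 2) (bv 0) = (- y3) *s bv 4"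
  "cross6 (normal_form 0 y1 y2 y3) (bv 2) (bv 3) = (y1) *s bv 1"
  "cross6 (normal_form 0 y1 y2 y3) (bv 1) (bv 4) = 0"
  "cross6 (normal_form 0 y1 y2 y3) (bv 2) (bv 5) = 0"
  "cross6 (normal_form 0 y1 y2 y3) (bv 3) (bv 0) = 0"
  by (rule vec_6_eqI; simp add: cross6_nth normal_form_nth bv_def axis_def)+

text \<open>Once v, which becomes e_4, and an orthogonal anisotropic v2, which becomes e_5, are
  chosen, the product and phi produce the other four basis vectors. It remains to compare the
  pairings and the products with those of the normal form.\<close>

theorem normal_form_exists:
  fixes x :: "'a::field ^ (6 set)"
  assumes two: "(2::'a) \<noteq> 0" and x: "x \<in> Xspace" and "f1 x \<noteq> 0" and "f2 (x, v) \<noteq> 0"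
  obtains g y1 y2 y3 where "g \<in> Sp6" "act3 g x = normal_form 0 y1 y2 y3" "g *v v = bv 4"
    "y1 \<noteq> 0" "y2 \<noteq> 0" "y3 \<noteq> 0"
proof -
  let ?f = "\<lambda>u. phi x *v u" and ?X = "cross6 x"
  define c where "c = quartic x"
  have c: "c \<noteq> 0" using assms(3) by (auto simp: f1_def c_def)
  have four: "(4::'a) \<noteq> 0" using two by (metis mult_2 mult_eq_0_iff numeral_Bit0)
  have ff: "?f (?f u) = c *s u" for u unfolding c_def by (rule phi_phi[OF two x])
  have sym: "Jform u (?f w) = Jform w (?f u)" for u w by (rule Jform_phi_symmetric[OF x])
  have mv: "?X u (?f w) = ?X (?f u) w" for u w by (rule cross6_phi[OF two x])
  have Jv: "Jform v (?f v) \<noteq> 0" using assms(4) by (auto simp: f2_eq)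
  obtain v2 where v2: "Jform v v2 = 0" "Jform (?f v) v2 = 0" "Jform v2 (?f v2) \<noteq> 0"
    using exists_orthogonal_anisotropic[OF two x _ Jv] c unfolding c_def by blast
  define y1 y2 where "y1 = Jform v (?f v) / 2" and "y2 = Jform v2 (?f v2) / 2"
  have Jy: "Jform v (?f v) = 2 * y1" "Jform v2 (?f v2) = 2 * y2" using two by (simp_all add: y1_def y2_def)
  have y: "y1 \<noteq> 0" "y2 \<noteq> 0" using Jv v2(3) Jy by auto
  \<comment> \<open>Forced by phi^2 = -4 y1 y2 y3 for the normal form with y0 = 0.\<close>
  define y3 where "y3 = - c / (4 * y1 * y2)"
  have y3: "y3 \<noteq> 0" using c y four by (simp add: y3_def)
  define d where "d = ?X v v2"
  have Jo: "Jform v2 v = 0" "Jform v (?f v2) = 0" "Jform v2 (?f v) = 0"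
    using v2 Jform_swap[of v2 v] Jform_swap[of v2 "?f v"] sym[of v v2] by simp_all
  have half: "a = b" if "2 *s a = 2 *s b" for a b :: "'a ^ 6" using that two by simp
  have fd: "?f d = - ?X v (?f v2)" "?f d = ?X v2 (?f v)"
    unfolding d_def phi_cross6[OF two x] by (simp only: mv) (simp only: cross6_swap[of x v2 "?f v"])
  have t1: "?X v d = - y1 *s v2"
  proof (rule half)
    show "2 *s ?X v d = 2 *s (- y1 *s v2)"
      unfolding d_def cross6_cross6[OF x] by (simp add: Jo v2 Jy)
  qed
  have t2: "?X v2 d = y2 *s v"
  proof (rule half)
    have "?X v2 d = - ?X v2 (?X v2 v)" unfolding d_def by (simp add: cross6_swap[of x v v2] cross6_minus)
    then have "2 *s ?X v2 d = - (2 *s ?X v2 (?X v2 v))" by simp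
    then show "2 *s ?X v2 d = 2 *s (y2 *s v)"
      unfolding cross6_cross6[OF x] by (simp add: Jo v2 Jy)
  qed
  have t3: "?X v (?f d) = y1 *s ?f v2"
  proof (rule half)
    have "?X v (?f d) = - ?X v (?X v (?f v2))" unfolding fd(1) by (simp add: cross6_minus)
    then have "2 *s ?X v (?f d) = - (2 *s ?X v (?X v (?f v2)))" by simp
    then show "2 *s ?X v (?f d) = 2 *s (y1 *s ?f v2)"
      unfolding cross6_cross6[OF x] by (simp add: Jo v2 Jy ff Jform_linear)
  qed
  have t4: "?X v2 (?f d) = - y2 *s ?f v"
  proof (rule half)
    show "2 *s ?X v2 (?f d) = 2 *s (- y2 *s ?f v)"
      unfolding fd(2) cross6_cross6[OF x] by (simp add: Jo v2 Jy ff Jform_linear)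
  qed
  have Jd: "Jform d v = 0" "Jform d v2 = 0" "Jform d (?f v) = 0" "Jform d (?f v2) = 0"
  proof -
    have "cross6 x v (?f v) = 0" "cross6 x v2 (?f v2) = 0" by (rule cross6_phi_self[OF two x])+
    then have "Tform x v (?f v) v2 = 0" "Tform x v2 (?f v2) v = 0" by (simp_all add: Tform_eq Jform_linear)
    then show "Jform d (?f v) = 0" "Jform d (?f v2) = 0"
      using Tform_swap(2)[of x v "?f v" v2] Tform_cyclic[of x v v2 "?f v2"] by (simp_all add: d_def Tform_eq)
    show "Jform d v = 0" "Jform d v2 = 0" unfolding d_def by (simp_all flip: Tform_eq)
  qed
  have Jdd: "Jform d (?f d) = 2 * y1 * y2"
  proof -
    have "Jform d (?f d) = Tform x v v2 (?f d)" by (simp add: Tform_eq d_def)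
    also have "\<dots> = Tform x v2 (?f d) v" by (rule Tform_cyclic)
    also have "\<dots> = - y2 * Jform (?f v) v" by (simp add: Tform_eq t4 Jform_linear)
    also have "Jform (?f v) v = - (2 * y1)" using Jform_swap[of "?f v" v] Jy by simp
    finally show ?thesis by simp
  qed
  have Jf: "Jform (?f u) w = - Jform u (?f w)" for u w
    using Jform_swap[of "?f u" w] sym[of w u] by simp
  define t where "t = - 1 / (2 * y1 * y2)"
  have tc: "t * c = 2 * y3" and ty: "t * y1 = - 1 / (2 * y2)" "t * y2 = - 1 / (2 * y1)"
    using y two four by (simp_all add: t_def y3_def field_simps)
  \<comment> \<open>The factors are read off the normal form, where e_4 times e_5 is -e_3, phi e_4 =
    -2 y1 e_1, phi e_5 = -2 y2 e_2 and phi e_3 = 2 y1 y2 e_6; the index 0 is that of e_6.\<close>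
  define E :: "6 \<Rightarrow> 'a ^ 6" where "E i = (if i = 0 then t *s ?f d else if i = 1 then (- 1 / (2 * y1)) *s ?f v
    else if i = 2 then (- 1 / (2 * y2)) *s ?f v2 else if i = 3 then - d else if i = 4 then v else v2)" for i
  have E: "E 0 = t *s ?f d" "E 1 = (- 1 / (2 * y1)) *s ?f v" "E 2 = (- 1 / (2 * y2)) *s ?f v2"
    "E 3 = - d" "E 4 = v" "E 5 = v2" by (simp_all add: E_def)
  define e :: "'a ^ 6 ^ 6" where "e = (\<chi> i j. E j $ i)"
  have e: "e *v bv k = E k" for k unfolding e_def by (rule matrix_columns_6)
  have JE: "\<forall>i j. Jform (E i) (E j) = Jform (bv i) (bv j)"
    unfolding all_6 E
    using y two Jform_swap[of v d] Jform_swap[of v2 d]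
    by (simp add: Jform_linear Jf ff Jo v2 Jd Jdd Jy sym[of v d] sym[of v2 d] Jform_bv_bv MJ_def t_def)
  have "e \<in> Sp6" by (rule Sp6_JformI) (simp add: e JE)
  then obtain g where g: "g \<in> Sp6" "e ** g = mat 1" "g ** e = mat 1" by (rule Sp6_inverse)
  have gE: "g *v E k = bv k" for k
    using arg_cong[OF e[of k], of "\<lambda>u. g *v u"] by (simp add: matrix_vector_mul_assoc g)
  have X0: "?X v (?f v) = 0" "?X v2 (?f v2) = 0" "?X d (?f d) = 0" by (rule cross6_phi_self[OF two x])+
  have sc: "a *s u = b *s u" if "a = b" for a b :: 'a and u :: "'a ^ 6" using that by simp
  \<comment> \<open>One equation for each of the fifteen pairs of basis vectors, in the order of
    \<open>cross6_normal_form\<close>.\<close>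
  have T: "?X (E 4) (E 5) = - E 3" "?X (E 4) (E 2) = - y1 *s E 0" "?X (E 1) (E 5) = - y2 *s E 0"
    "?X (E 1) (E 2) = y3 *s E 3" "?X (E 4) (E 0) = E 2" "?X (E 4) (E 3) = y1 *s E 5"
    "?X (E 5) (E 0) = - E 1" "?X (E 5) (E 3) = - y2 *s E 4" "?X (E 1) (E 0) = y3 *s E 5"
    "?X (E 1) (E 3) = - y2 *s E 2" "?X (E 2) (E 0) = - y3 *s E 4" "?X (E 2) (E 3) = y1 *s E 1"
    "?X (E 1) (E 4) = 0" "?X (E 2) (E 5) = 0" "?X (E 3) (E 0) = 0"
  proof -
    have m: "?X (?f v) v2 = - ?f d" "?X v (?f v2) = - ?f d"
      using fd(1) by (simp_all flip: mv)
    have m3: "?X (?f v) d = y1 *s ?f v2" "?X (?f v2) d = - y2 *s ?f v" "?X (?f v) v = 0" "?X (?f v2) v2 = 0"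
      by (simp_all only: t3 t4 X0 flip: mv)
    have m1: "?X v v2 = d" by (simp only: d_def)
    have m2: "?X (?f v) (?f v2) = c *s d" "?X (?f v) (?f d) = c *s (- y1 *s v2)" "?X (?f v2) (?f d) = c *s (y2 *s v)"
      by (simp_all add: ff cross6_linear t1 t2 m m1 flip: mv[of _ "?f _"])
    have cc: "c = - (4 * y1 * y2 * y3)" using y four by (simp add: y3_def)
    show "?X (E 4) (E 5) = - E 3" "?X (E 4) (E 2) = - y1 *s E 0" "?X (E 1) (E 5) = - y2 *s E 0"
      "?X (E 1) (E 2) = y3 *s E 3" "?X (E 4) (E 0) = E 2" "?X (E 4) (E 3) = y1 *s E 5"
      "?X (E 5) (E 0) = - E 1" "?X (E 5) (E 3) = - y2 *s E 4" "?X (E 1) (E 0) = y3 *s E 5"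
      "?X (E 1) (E 3) = - y2 *s E 2" "?X (E 2) (E 0) = - y3 *s E 4" "?X (E 2) (E 3) = y1 *s E 1"
      "?X (E 1) (E 4) = 0" "?X (E 2) (E 5) = 0" "?X (E 3) (E 0) = 0"
      unfolding E using y two four
      by (simp_all add: cross6_linear cross6_minus m m1 m2 m3 t1 t2 t3 t4 X0 vec_eq_iff t_def cc field_simps)
  qed
  have "act3 g x = normal_form 0 y1 y2 y3"
  proof (rule cross6_inject)
    let ?n = "normal_form 0 y1 y2 y3"
    define P where "P i j \<longleftrightarrow> ?X (E i) (E j) = e *v cross6 ?n (bv i) (bv j)" for i j
    have swap: "P i j \<Longrightarrow> P j i" for i j
      unfolding P_def cross6_swap[of _ "E j"] cross6_swap[of _ "bv j"] by (simp add: matrix_vector_mult_minus)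
    have self: "P i i" for i unfolding P_def by simp
    have P: "P 4 5" "P 4 2" "P 1 5" "P 1 2" "P 4 0" "P 4 3" "P 5 0" "P 5 3" "P 1 0" "P 1 3" "P 2 0" "P 2 3" "P 1 4" "P 2 5" "P 3 0"
      unfolding P_def cross6_normal_form matrix_vector_mult_scale e T by simp_all
    have "\<forall>i j. P i j"
      unfolding all_6 using P P[THEN swap] self by simp
    then have "g *v ?X (E i) (E j) = cross6 ?n (bv i) (bv j)" for i j
      by (simp add: P_def matrix_vector_mul_assoc g)
    then show "\<forall>i j. cross6 (act3 g x) (bv i) (bv j) = cross6 ?n (bv i) (bv j)"
      by (simp add: cross6_act3[OF g(1)] flip: gE)
  qed (simp_all add: homog_act3 homog_normal_form)
  moreover have "g *v v = bv 4" using gE[of 4] by (simp add: E)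
  ultimately show ?thesis using that g(1) y y3 by blast
qed



section \<open>Composition algebras\<close>

text \<open>The zero algebra satisfies \<open>composition_algebra\<close>; the condition on the unit
  excludes it.\<close>

locale comp_alg =
  fixes C :: "('a::field, 'c::ab_group_add) calg"
  assumes comp: "composition_algebra C" and two: "(2::'a) \<noteq> 0" and unt_nonzero: "unt C \<noteq> 0"
begin

sublocale vector_space "scl C" using comp by (simp add: composition_algebra_def)

abbreviation "N \<equiv> nrm C"
abbreviation "B \<equiv> polar C"
abbreviation "e \<equiv> unt C"
abbreviation pr (infixl "\<cdot>" 70) where "x \<cdot> y \<equiv> mul C x y"
abbreviation sc (infixr "\<star>" 75) where "r \<star> x \<equiv> scl C r x"

lemma mul_right: "x \<cdot> (y + z) = x \<cdot> y + x \<cdot> z" "x \<cdot> (r \<star> y) = r \<star> (x \<cdot> y)"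
  and mul_left: "(y + z) \<cdot> x = y \<cdot> x + z \<cdot> x" "(r \<star> y) \<cdot> x = r \<star> (y \<cdot> x)"
  and B_right: "B x (y + z) = B x y + B x z" "B x (r \<star> y) = r * B x y"
proof -
  have "Vector_Spaces.linear (scl C) (scl C) (\<lambda>y. mul C x y)" "Vector_Spaces.linear (scl C) (scl C) (\<lambda>y. mul C y x)"
    "Vector_Spaces.linear (scl C) (*) (\<lambda>y. polar C x y)"
    using comp by (simp_all add: composition_algebra_def)
  note l = this[unfolded Vector_Spaces.linear_iff]
  show "x \<cdot> (y + z) = x \<cdot> y + x \<cdot> z" "x \<cdot> (r \<star> y) = r \<star> (x \<cdot> y)"
    "(y + z) \<cdot> x = y \<cdot> x + z \<cdot> x" "(r \<star> y) \<cdot> x = r \<star> (y \<cdot> x)"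
    "B x (y + z) = B x y + B x z" "B x (r \<star> y) = r * B x y"
    using l by blast+
qed

lemma unit [simp]: "e \<cdot> x = x" "x \<cdot> e = x"
  and N_scale: "N (r \<star> x) = r\<^sup>2 * N x"
  and nondegenerate: "nondegenerate_on C UNIV"
  and N_mul: "N (x \<cdot> y) = N x * N y"
  using comp unfolding composition_algebra_def by simp_all

lemma B_sym: "B x y = B y x" by (simp add: polar_def add.commute)

lemma B_left: "B (x + y) z = B x z + B y z" "B (r \<star> x) z = r * B x z"
  using B_right[of z] by (simp_all add: B_sym[of _ z])

lemma neg_scale: "- x = (- 1) \<star> x" by simp

lemma mul_minus [simp]: "x \<cdot> (- y) = - (x \<cdot> y)" "(- y) \<cdot> x = - (y \<cdot> x)"
  by (subst neg_scale, simp only: mul_right mul_left, simp)+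

lemma mul_diff: "x \<cdot> (y - z) = x \<cdot> y - x \<cdot> z" "(y - z) \<cdot> x = y \<cdot> x - z \<cdot> x"
  using mul_right(1)[of x y "- z"] mul_left(1)[of y "- z" x] by simp_all

lemma B_minus [simp]: "B x (- y) = - B x y" "B (- y) x = - B y x"
  by (subst neg_scale, simp only: B_right B_left, simp)+

lemma B_diff: "B x (y - z) = B x y - B x z" "B (y - z) x = B y x - B z x"
  using B_right(1)[of x y "- z"] B_left(1)[of y "- z" x] by simp_all

lemma mul_zero [simp]: "x \<cdot> 0 = 0" "0 \<cdot> x = 0"
  using mul_diff[of x x x] mul_diff(2)[of x x x] by simp_all

lemma B_zero [simp]: "B x 0 = 0" "B 0 x = 0"
  using B_diff[of x x x] B_diff(2)[of x x x] by simp_all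

lemma N_add: "N (x + y) = N x + N y + B x y" by (simp add: polar_def)

lemma N_minus [simp]: "N (- x) = N x"
  using N_scale[of "- 1" x] by simp

lemma N_zero [simp]: "N 0 = 0" using N_scale[of 0 0] by simp

lemma B_self: "B x x = 2 * N x"
proof -
  have "x + x = 2 \<star> x" by (metis scale_left_distrib scale_one one_add_one)
  then have "B x x = 2\<^sup>2 * N x - N x - N x" by (simp add: polar_def N_scale)
  then show ?thesis by (simp add: power2_eq_square algebra_simps)
qed

lemma B_eqI: "(\<And>z. B x z = B y z) \<Longrightarrow> x = y"
  using nondegenerate unfolding nondegenerate_on_def by (metis B_diff(2) UNIV_I eq_iff_diff_eq_0)

lemma N_unit [simp]: "N e = 1"
proof (rule ccontr)
  assume "N e \<noteq> 1"
  then have "N x = 0" for x using N_mul[of e x] by auto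
  then have "B e z = B 0 z" for z by (simp add: polar_def)
  then have "e = 0" by (rule B_eqI)
  then show False using unt_nonzero by simp
qed

lemma B_mul_common: "B (x \<cdot> z) (y \<cdot> z) = B x y * N z" "B (x \<cdot> y) (x \<cdot> z) = N x * B y z"
  unfolding polar_def mul_left[symmetric] mul_right[symmetric] N_mul by (simp_all add: algebra_simps)

text \<open>The full polarisation of the multiplicativity of the norm. The adjointness rules for
  left and right multiplication are its instances with the unit as one argument.\<close>

lemma B_four: "B (x \<cdot> z) (y \<cdot> w) + B (x \<cdot> w) (y \<cdot> z) = B x y * B z w"
  using B_mul_common(1)[of x "z + w" y]
  by (simp add: mul_right B_left B_right B_mul_common N_add B_sym[of w z] algebra_simps)

section \<open>Conjugation, adjoints and the alternative laws\<close>

definition conj :: "'c \<Rightarrow> 'c" where "conj x = B x e \<star> e - x"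

lemma conj_linear: "conj (x + y) = conj x + conj y" "conj (r \<star> x) = r \<star> conj x"
  by (simp_all add: conj_def B_left scale_left_distrib scale_right_diff_distrib)

lemma conj_unit [simp]: "conj e = e"
  using scale_left_distrib[of 1 1 e] by (simp add: conj_def B_self)

lemma conj_conj [simp]: "conj (conj x) = x"
  by (simp add: conj_def B_diff B_left B_self scale_left_diff_distrib)

lemma N_conj [simp]: "N (conj x) = N x"
proof -
  have "N (B x e \<star> e + - x) = N x"
    by (simp only: N_add N_scale B_left B_minus N_minus N_unit B_sym[of e]) (simp add: power2_eq_square)
  then show ?thesis by (simp add: conj_def)
qed

lemma B_conj: "B (conj x) y = B x (conj y)"
  by (simp add: conj_def B_diff B_left B_right B_sym[of e])

lemma B_mul_left: "B (x \<cdot> y) z = B y (conj x \<cdot> z)"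
  using B_four[of x y e z] by (simp add: conj_def mul_diff mul_left B_diff B_right B_sym[of "x \<cdot> z"] algebra_simps)

lemma B_mul_right: "B (x \<cdot> y) z = B x (z \<cdot> conj y)"
  using B_four[of x y z e] by (simp add: conj_def mul_diff mul_right B_diff B_right algebra_simps)

lemma conj_cancel_left: "x \<cdot> (conj x \<cdot> y) = N x \<star> y" "conj x \<cdot> (x \<cdot> y) = N x \<star> y"
proof -
  show *: "x \<cdot> (conj x \<cdot> y) = N x \<star> y" for x
    by (rule B_eqI) (simp add: B_mul_left[of x] B_mul_common B_left)
  show "conj x \<cdot> (x \<cdot> y) = N x \<star> y" using *[of "conj x"] by simp
qed

lemma conj_cancel_right: "(y \<cdot> conj x) \<cdot> x = N x \<star> y" "(y \<cdot> x) \<cdot> conj x = N x \<star> y"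
proof -
  show *: "(y \<cdot> conj x) \<cdot> x = N x \<star> y" for x
    by (rule B_eqI) (simp add: B_mul_right[of _ x] B_mul_common B_left mult.commute)
  show "(y \<cdot> x) \<cdot> conj x = N x \<star> y" using *[of "conj x"] by simp
qed

lemma conj_mul: "conj (x \<cdot> y) = conj y \<cdot> conj x"
proof (rule B_eqI)
  fix z
  have "B (conj (x \<cdot> y)) z = B (z \<cdot> x) (conj y)"
    by (simp add: B_conj B_mul_right[of x] B_mul_left[of z] B_mul_right[of z] B_sym[of x])
  also have "\<dots> = B (conj y \<cdot> conj x) z"
    by (simp only: B_mul_right[of z x] B_sym[of z])
  finally show "B (conj (x \<cdot> y)) z = B (conj y \<cdot> conj x) z" .
qed

lemma conj_orthogonal: "B x e = 0 \<Longrightarrow> conj x = - x"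
  by (simp add: conj_def)

lemma polar_left: "x \<cdot> (conj y \<cdot> z) + y \<cdot> (conj x \<cdot> z) = B x y \<star> z"
  using conj_cancel_left(1)[of "x + y" z]
  by (simp add: conj_linear mul_left mul_right conj_cancel_left N_add scale_left_distrib algebra_simps)

lemma polar_right: "(z \<cdot> conj x) \<cdot> y + (z \<cdot> conj y) \<cdot> x = B x y \<star> z"
  using conj_cancel_right(1)[of z "x + y"]
  by (simp add: conj_linear mul_left mul_right conj_cancel_right N_add scale_left_distrib algebra_simps)

text \<open>The middle Moufang identity. Paired with z, either side is carried by the adjoints and
  \<open>B_four\<close> to the same sum of products of polar forms.\<close>

lemma moufang: "(a \<cdot> x) \<cdot> (y \<cdot> a) = a \<cdot> ((x \<cdot> y) \<cdot> a)"
proof (rule B_eqI)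
  fix z
  have "B ((a \<cdot> x) \<cdot> (y \<cdot> a)) z = B (y \<cdot> a) ((conj x \<cdot> conj a) \<cdot> z)"
    by (simp add: B_mul_left[of "a \<cdot> x"] conj_mul)
  also have "\<dots> = B y (conj x \<cdot> conj a) * B a z - B (y \<cdot> z) ((conj x \<cdot> conj a) \<cdot> a)"
    using B_four[of y a "conj x \<cdot> conj a" z] by (simp add: algebra_simps)
  also have "\<dots> = B (x \<cdot> y) (conj a) * B a z - N a * B (conj (x \<cdot> y)) z"
    by (simp add: conj_cancel_right B_right B_mul_left[of x] conj_mul) (simp add: B_mul_left[of y] B_sym[of z])
  also have "B (conj (x \<cdot> y)) z = B ((x \<cdot> y) \<cdot> z) e"
    by (simp add: B_mul_left[of "x \<cdot> y"] B_sym[of "conj (x \<cdot> y)"])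
  also have "B (x \<cdot> y) (conj a) * B a z - N a * B ((x \<cdot> y) \<cdot> z) e = B ((x \<cdot> y) \<cdot> a) (conj a \<cdot> z)"
    using B_four[of "x \<cdot> y" a "conj a" z] conj_cancel_left(2)[of a e] by (simp add: B_right algebra_simps)
  also have "\<dots> = B (a \<cdot> ((x \<cdot> y) \<cdot> a)) z" by (simp add: B_mul_left[of a])
  finally show "B ((a \<cdot> x) \<cdot> (y \<cdot> a)) z = B (a \<cdot> ((x \<cdot> y) \<cdot> a)) z" .
qed

section \<open>The Cayley-Dickson rules for a vector c orthogonal to a subalgebra\<close>

lemma doubling_comm:
  assumes "B c e = 0" "B x c = 0"
  shows "x \<cdot> c = c \<cdot> conj x"
proof -
  have c: "conj c = - c" using assms(1) by (rule conj_orthogonal)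
  have "B (x \<cdot> c) e = 0" by (simp add: B_mul_right[of x] c assms)
  then have "conj (x \<cdot> c) = - (x \<cdot> c)" by (rule conj_orthogonal)
  then show ?thesis by (simp add: conj_mul c)
qed

text \<open>The hypotheses ask for orthogonality of c to the products that occur instead of a whole
  subalgebra, so the same rules serve when passing from K to Q and from Q to C.\<close>

lemma doubling_1:
  assumes "B c e = 0" "B x c = 0" "B y c = 0" "B (y \<cdot> x) c = 0"
  shows "x \<cdot> (y \<cdot> c) = (y \<cdot> x) \<cdot> c"
proof -
  have c: "conj c = - c" using assms(1) by (rule conj_orthogonal)
  have "x \<cdot> (c \<cdot> conj y) = c \<cdot> (conj x \<cdot> conj y)"
    using polar_left[of x c "conj y"] by (simp add: c assms(2))
  then show ?thesis
    by (simp add: doubling_comm[OF assms(1,3)] doubling_comm[OF assms(1,4)] conj_mul)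
qed

lemma doubling_2:
  assumes "B c e = 0" "B y c = 0"
  shows "(x \<cdot> c) \<cdot> y = (x \<cdot> conj y) \<cdot> c"
  using polar_right[of x c y] assms by (simp add: conj_orthogonal B_sym)

lemma doubling_3:
  assumes "B c e = 0" "B x c = 0" "B (conj x \<cdot> y) c = 0"
  shows "(x \<cdot> c) \<cdot> (y \<cdot> c) = - (N c \<star> (conj y \<cdot> x))"
proof -
  have c: "conj c = - c" using assms(1) by (rule conj_orthogonal)
  have "(x \<cdot> c) \<cdot> (y \<cdot> c) = c \<cdot> (c \<cdot> conj (conj x \<cdot> y))"
    by (simp add: doubling_comm[OF assms(1,2)] moufang doubling_comm[OF assms(1,3)])
  also have "- (c \<cdot> (c \<cdot> conj (conj x \<cdot> y))) = N c \<star> conj (conj x \<cdot> y)"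
    using conj_cancel_left(2)[of c "conj (conj x \<cdot> y)"] by (simp add: c)
  then have "c \<cdot> (c \<cdot> conj (conj x \<cdot> y)) = - (N c \<star> (conj y \<cdot> x))"
    by (metis minus_minus conj_mul conj_conj)
  finally show ?thesis .
qed

definition quat :: "'c \<Rightarrow> 'c \<Rightarrow> 'a \<times> 'a \<times> 'a \<times> 'a \<Rightarrow> 'c" where
  "quat a b = (\<lambda>(s0, s1, s2, s3). s0 \<star> e + s1 \<star> a + s2 \<star> b + s3 \<star> (a \<cdot> b))"

end

text \<open>Coordinates with respect to 1, a, b, ab with a^2 = -\<alpha> and b^2 = -\<beta>, so that
  the norm form is diagonal with entries 1, \<alpha>, \<beta>, \<alpha>\<beta>.\<close>

definition qmul :: "'a::field \<Rightarrow> 'a \<Rightarrow> 'a \<times> 'a \<times> 'a \<times> 'a \<Rightarrow> 'a \<times> 'a \<times> 'a \<times> 'a \<Rightarrow> 'a \<times> 'a \<times> 'a \<times> 'a" where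
  "qmul \<alpha> \<beta> = (\<lambda>(s0, s1, s2, s3) (t0, t1, t2, t3).
    (s0 * t0 - \<alpha> * s1 * t1 - \<beta> * s2 * t2 - \<alpha> * \<beta> * s3 * t3,
     s0 * t1 + s1 * t0 + \<beta> * (s2 * t3 - s3 * t2),
     s0 * t2 + s2 * t0 + \<alpha> * (s3 * t1 - s1 * t3),
     s0 * t3 + s3 * t0 + s1 * t2 - s2 * t1))"

definition qconj :: "'a::field \<times> 'a \<times> 'a \<times> 'a \<Rightarrow> 'a \<times> 'a \<times> 'a \<times> 'a" where
  "qconj = (\<lambda>(s0, s1, s2, s3). (s0, - s1, - s2, - s3))"

definition qnrm :: "'a::field \<Rightarrow> 'a \<Rightarrow> 'a \<times> 'a \<times> 'a \<times> 'a \<Rightarrow> 'a" where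
  "qnrm \<alpha> \<beta> = (\<lambda>(s0, s1, s2, s3). s0\<^sup>2 + \<alpha> * s1\<^sup>2 + \<beta> * s2\<^sup>2 + \<alpha> * \<beta> * s3\<^sup>2)"

definition qscl :: "'a::field \<Rightarrow> 'a \<times> 'a \<times> 'a \<times> 'a \<Rightarrow> 'a \<times> 'a \<times> 'a \<times> 'a" where
  "qscl r = (\<lambda>(s0, s1, s2, s3). (r * s0, r * s1, r * s2, r * s3))"

context comp_alg begin

lemma quat_linear: "quat a b (s + t) = quat a b s + quat a b t" "quat a b (qscl r s) = r \<star> quat a b s"
  by (cases s; cases t; simp add: quat_def qscl_def scale_left_distrib scale_right_distrib)+

lemma quat_diff: "quat a b (s - t) = quat a b s - quat a b t"
  by (cases s; cases t; simp add: quat_def scale_left_diff_distrib)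

lemma square_orthogonal: "B a e = 0 \<Longrightarrow> a \<cdot> (a \<cdot> x) = - (N a \<star> x)" "B a e = 0 \<Longrightarrow> a \<cdot> a = - (N a \<star> e)"
  using conj_cancel_left(2)[of a x] conj_cancel_left(2)[of a e] by (simp_all add: conj_orthogonal eq_neg_iff_add_eq_0 neg_eq_iff_add_eq_0)

lemma quat_mul:
  assumes a: "B a e = 0" "N a = \<alpha>" and b: "B b e = 0" "B b a = 0" "N b = \<beta>"
  shows "quat a b s \<cdot> quat a b t = quat a b (qmul \<alpha> \<beta> s t)"
proof -
  have ab: "B a b = 0" using b(2) by (simp add: B_sym)
  have ca: "conj a = - a" and cb: "conj b = - b" using a b by (simp_all add: conj_orthogonal)
  have eb: "B e b = 0" using b(1) by (simp add: B_sym)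
  have aa: "a \<cdot> a = - (\<alpha> \<star> e)" and aab: "a \<cdot> (a \<cdot> b) = - (\<alpha> \<star> b)" and bb: "b \<cdot> b = - (\<beta> \<star> e)"
    using square_orthogonal[of a] square_orthogonal[of b] a b by simp_all
  have ba: "b \<cdot> a = - (a \<cdot> b)" using doubling_comm[OF b(1) ab] by (simp add: ca)
  have aba: "(a \<cdot> b) \<cdot> a = \<alpha> \<star> b" using doubling_2[OF b(1) ab, of a] by (simp add: ca aa mul_left)
  have abab: "(a \<cdot> b) \<cdot> (a \<cdot> b) = - (\<alpha> * \<beta>) \<star> e"
    using doubling_3[OF b(1) ab, of a] by (simp add: ca aa b B_left eb mult.commute)
  have bab: "b \<cdot> (a \<cdot> b) = \<beta> \<star> a"
    using doubling_3[OF b(1) eb, of a] ab by (simp add: ca b)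
  have abb: "(a \<cdot> b) \<cdot> b = - (\<beta> \<star> a)"
    using conj_cancel_right(2)[of a b] by (simp add: cb b eq_neg_iff_add_eq_0 neg_eq_iff_add_eq_0)
  obtain s0 s1 s2 s3 t0 t1 t2 t3 where st: "s = (s0, s1, s2, s3)" "t = (t0, t1, t2, t3)"
    by (metis prod.exhaust)
  show ?thesis
    unfolding st quat_def qmul_def
    by (simp add: mul_left mul_right aa aab bb ba aba abab bab abb scale_left_distrib scale_right_distrib
        scale_left_diff_distrib scale_right_diff_distrib mult_ac)
      (simp add: algebra_simps)
qed

lemma quat_conj:
  assumes a: "B a e = 0" and b: "B b e = 0" "B b a = 0"
  shows "conj (quat a b s) = quat a b (qconj s)"
proof -
  have "B (a \<cdot> b) e = 0"
    using B_mul_right[of a b e] b by (simp add: conj_orthogonal B_sym[of a])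
  then show ?thesis using a b
    by (cases s) (simp add: quat_def qconj_def conj_linear conj_orthogonal)
qed

end


definition qpol :: "'a::field \<Rightarrow> 'a \<Rightarrow> 'a \<times> 'a \<times> 'a \<times> 'a \<Rightarrow> 'a \<times> 'a \<times> 'a \<times> 'a \<Rightarrow> 'a" where
  "qpol \<alpha> \<beta> = (\<lambda>(s0, s1, s2, s3) (t0, t1, t2, t3).
     2 * (s0 * t0 + \<alpha> * s1 * t1 + \<beta> * s2 * t2 + \<alpha> * \<beta> * s3 * t3))"

text \<open>The pair (u, v) stands for u + v c with c^2 = -\<gamma>.\<close>

definition omul :: "'a::field \<Rightarrow> 'a \<Rightarrow> 'a \<Rightarrow> ('a \<times> 'a \<times> 'a \<times> 'a) \<times> ('a \<times> 'a \<times> 'a \<times> 'a)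
    \<Rightarrow> ('a \<times> 'a \<times> 'a \<times> 'a) \<times> ('a \<times> 'a \<times> 'a \<times> 'a) \<Rightarrow> ('a \<times> 'a \<times> 'a \<times> 'a) \<times> ('a \<times> 'a \<times> 'a \<times> 'a)" where
  "omul \<alpha> \<beta> \<gamma> = (\<lambda>(u, v) (u', v').
     (qmul \<alpha> \<beta> u u' - qscl \<gamma> (qmul \<alpha> \<beta> (qconj v') v), qmul \<alpha> \<beta> v' u + qmul \<alpha> \<beta> v (qconj u')))"

definition onrm :: "'a::field \<Rightarrow> 'a \<Rightarrow> 'a \<Rightarrow> ('a \<times> 'a \<times> 'a \<times> 'a) \<times> ('a \<times> 'a \<times> 'a \<times> 'a) \<Rightarrow> 'a" where
  "onrm \<alpha> \<beta> \<gamma> = (\<lambda>(u, v). qnrm \<alpha> \<beta> u + \<gamma> * qnrm \<alpha> \<beta> v)"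

definition oscl :: "'a::field \<Rightarrow> ('a \<times> 'a \<times> 'a \<times> 'a) \<times> ('a \<times> 'a \<times> 'a \<times> 'a)
    \<Rightarrow> ('a \<times> 'a \<times> 'a \<times> 'a) \<times> ('a \<times> 'a \<times> 'a \<times> 'a)" where
  "oscl r = (\<lambda>(u, v). (qscl r u, qscl r v))"

text \<open>Only orthogonality and norms are prescribed; by the doubling rules they determine all
  products of a, b, c. That the norms are nonzero is assumed where it matters.\<close>

definition cd_triple :: "('a::field, 'c::ab_group_add) calg \<Rightarrow> 'c \<Rightarrow> 'c \<Rightarrow> 'c \<Rightarrow> 'a \<Rightarrow> 'a \<Rightarrow> 'a \<Rightarrow> bool" where
  "cd_triple C a b c \<alpha> \<beta> \<gamma> \<longleftrightarrow> nrm C a = \<alpha> \<and> nrm C b = \<beta> \<and> nrm C c = \<gamma> \<and>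
     polar C a (unt C) = 0 \<and> polar C b (unt C) = 0 \<and> polar C b a = 0 \<and>
     polar C c (unt C) = 0 \<and> polar C c a = 0 \<and> polar C c b = 0 \<and> polar C c (mul C a b) = 0"

text \<open>Anisotropy of the members makes them independent and makes projections and reflections
  available.\<close>

definition orth_family :: "('a::field, 'c::ab_group_add) calg \<Rightarrow> (nat \<Rightarrow> 'c) \<Rightarrow> nat \<Rightarrow> bool" where
  "orth_family C z n \<longleftrightarrow> (\<forall>i<n. \<forall>j<n. i \<noteq> j \<longrightarrow> polar C (z i) (z j) = 0) \<and> (\<forall>i<n. nrm C (z i) \<noteq> 0)"

context comp_alg begin

section \<open>Orthogonal families and Witt cancellation\<close>

lemma B_sum: "B (\<Sum>i\<in>A. c i \<star> z i) y = (\<Sum>i\<in>A. c i * B (z i) y)"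
  by (induction A rule: infinite_finite_induct) (simp_all add: B_left)

lemma orth_family_B_sum:
  assumes "orth_family C z n" "j < n"
  shows "B (\<Sum>i<n. c i \<star> z i) (z j) = 2 * c j * N (z j)"
proof -
  have "B (\<Sum>i<n. c i \<star> z i) (z j) = (\<Sum>i<n. if i = j then 2 * c j * N (z j) else 0)"
    unfolding B_sum using assms by (intro sum.cong) (auto simp: orth_family_def B_self)
  then show ?thesis using assms(2) by simp
qed

lemma orth_family_inj:
  assumes "orth_family C z n"
  shows "inj_on z {..<n}"
proof (rule inj_onI)
  fix i j assume ij: "i \<in> {..<n}" "j \<in> {..<n}" "z i = z j"
  show "i = j"
  proof (rule ccontr)
    assume "i \<noteq> j"
    then have "B (z i) (z j) = 0" using assms ij(1,2) unfolding orth_family_def by blast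
    then have "2 * N (z i) = 0" using ij by (simp add: B_self)
    then show False using assms ij two by (simp add: orth_family_def)
  qed
qed

lemma orth_family_independent:
  assumes "orth_family C z n"
  shows "independent (z ` {..<n})"
proof
  assume "dependent (z ` {..<n})"
  then obtain u v where v: "v \<in> z ` {..<n}" "u v \<noteq> 0" and s: "(\<Sum>v\<in>z ` {..<n}. u v \<star> v) = 0"
    by (auto simp: dependent_finite)
  obtain j where j: "j < n" "v = z j" using v by auto
  have "(\<Sum>i<n. u (z i) \<star> z i) = 0"
    using s by (simp add: sum.reindex[OF orth_family_inj[OF assms]])
  then have "2 * u (z j) * N (z j) = 0"
    using orth_family_B_sum[OF assms j(1), of "\<lambda>i. u (z i)"] by simp
  then show False using v j assms two by (simp add: orth_family_def)
qed

lemma orth_family_card: "orth_family C z n \<Longrightarrow> card (z ` {..<n}) = n"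
  by (simp add: card_image orth_family_inj)

lemma orth_family_dim: "orth_family C z n \<Longrightarrow> dim (span (z ` {..<n})) = n"
  by (simp only: dim_span_eq_card_independent[OF orth_family_independent] orth_family_card)

lemma orth_family_span:
  assumes z: "orth_family C z n" "\<And>i. i < n \<Longrightarrow> z i \<in> S" and S: "subspace S" "dim S = n" "0 < n"
  shows "S = span (z ` {..<n})"
proof
  show "span (z ` {..<n}) \<subseteq> S" using z(2) S(1) by (intro span_minimal) auto
  obtain T where T: "T \<subseteq> S" "independent T" "S \<subseteq> span T" "card T = dim S" by (rule basis_exists)
  have cT: "card T = n" using T(4) S(2) by simp
  have fT: "finite T" by (rule card_ge_0_finite) (simp only: cT S(3))
  show "S \<subseteq> span (z ` {..<n})"
  proof
    fix y assume y: "y \<in> S"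
    show "y \<in> span (z ` {..<n})"
    proof (rule ccontr)
      assume ny: "y \<notin> span (z ` {..<n})"
      then have "independent (insert y (z ` {..<n}))"
        by (rule independent_insertI) (rule orth_family_independent[OF z(1)])
      moreover have "insert y (z ` {..<n}) \<subseteq> S" using y z(2) by auto
      with T(3) have "insert y (z ` {..<n}) \<subseteq> span T" by (rule order_trans[rotated])
      ultimately have "card (insert y (z ` {..<n})) \<le> card T"
        using independent_span_bound[OF fT] by blast
      moreover have "y \<notin> z ` {..<n}" using ny span_base[of y "z ` {..<n}"] by blast
      then have "card (insert y (z ` {..<n})) = Suc n" by (simp add: orth_family_card[OF z(1)])
      ultimately show False using cT by simp
    qed
  qed
qed

lemma span_family:
  fixes n :: nat
  assumes "inj_on z {..<n}"
  shows "span (z ` {..<n}) = {\<Sum>i<n. c i \<star> z i | c. True}"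
proof -
  have "span (z ` {..<n}) = range (\<lambda>u. \<Sum>v\<in>z ` {..<n}. u v \<star> v)" by (rule span_finite) (rule finite_imageI, rule finite_lessThan)
  also have "\<dots> = {\<Sum>i<n. u (z i) \<star> z i | u. True}"
    by (auto simp: sum.reindex[OF assms])
  also have "\<dots> = {\<Sum>i<n. c i \<star> z i | c. True}"
  proof safe
    fix c
    have "(\<Sum>i<n. c i \<star> z i) = (\<Sum>i<n. c (the_inv_into {..<n} z (z i)) \<star> z i)"
      by (intro sum.cong refl) (simp add: the_inv_into_f_f[OF assms])
    then show "\<exists>u. (\<Sum>i<n. c i \<star> z i) = (\<Sum>i<n. u (z i) \<star> z i) \<and> True"
      by (intro exI[of _ "\<lambda>v. c (the_inv_into {..<n} z v)"]) simp
  qed auto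
  finally show ?thesis .
qed

text \<open>If the norm vanished on the complement of the family in S, the complement would be
  orthogonal to S and hence zero, and S would be spanned by n vectors.\<close>

lemma orth_family_extend:
  assumes z: "orth_family C z n" "\<And>i. i < n \<Longrightarrow> z i \<in> S" and S: "subspace S" "nondegenerate_on C S" "n < dim S"
  obtains w where "w \<in> S" "N w \<noteq> 0" "\<And>i. i < n \<Longrightarrow> B w (z i) = 0"
proof -
  \<comment> \<open>The projection onto the span of the family; the 2 comes from B(z, z) = 2
    N(z).\<close>
  define p where "p y = (\<Sum>i<n. (B y (z i) / (2 * N (z i))) \<star> z i)" for y
  have pS: "p y \<in> S" for y unfolding p_def using z(2) S(1) by (intro subspace_sum subspace_scale) auto
  have pz: "B (p y) (z i) = B y (z i)" if "i < n" for y i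
    unfolding p_def orth_family_B_sum[OF z(1) that] using z(1) that two by (simp add: orth_family_def)
  have "\<exists>w\<in>S. N w \<noteq> 0 \<and> (\<forall>i<n. B w (z i) = 0)"
  proof (rule ccontr)
    assume "\<not> ?thesis"
    then have iso: "N w = 0" if "w \<in> S" "\<forall>i<n. B w (z i) = 0" for w using that by blast
    have zero: "w = 0" if w: "w \<in> S" "\<forall>i<n. B w (z i) = 0" for w
    proof -
      have "B w y = 0" if y: "y \<in> S" for y
      proof -
        have q: "y - p y \<in> S" "\<forall>i<n. B (y - p y) (z i) = 0"
          using y pS S(1) by (simp_all add: subspace_diff B_diff pz)
        have "N (w + (y - p y)) = 0"
          using w q S(1) by (intro iso) (simp_all add: subspace_add B_left)
        then have "B w (y - p y) = 0" using iso[OF w] iso[OF q] by (simp add: N_add)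
        moreover have "B w (p y) = 0" unfolding B_sym[of w] p_def B_sum
          using w(2) by (intro sum.neutral) (simp add: B_sym[of w])
        ultimately show ?thesis by (simp add: B_diff)
      qed
      then show ?thesis using S(2) w(1) by (simp add: nondegenerate_on_def)
    qed
    have "S \<subseteq> span (z ` {..<n})"
    proof
      fix y assume y: "y \<in> S"
      have "y - p y = 0" using y pS S(1) by (intro zero) (simp_all add: subspace_diff B_diff pz)
      then have "y = p y" by simp
      moreover have "p y \<in> span (z ` {..<n})"
        unfolding p_def by (intro span_sum span_scale span_base) auto
      ultimately show "y \<in> span (z ` {..<n})" by simp
    qed
    then have "dim S \<le> card (z ` {..<n})" by (rule dim_le_card) simp
    then show False using S(3) orth_family_card[OF z(1)] by simp
  qed
  with that show ?thesis by blast
qed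

text \<open>The usual reflection along d: no factor 2 appears because B(d, d) = 2 N(d).\<close>

definition reflect :: "'c \<Rightarrow> 'c \<Rightarrow> 'c" where "reflect d y = y - (B y d / N d) \<star> d"

lemma reflect_B:
  assumes "N d \<noteq> 0"
  shows "B (reflect d x) (reflect d y) = B x y"
  using assms two unfolding reflect_def by (simp add: B_diff B_left B_right B_self B_sym[of d] field_simps)

lemma reflect_N: "N d \<noteq> 0 \<Longrightarrow> N (reflect d x) = N x"
  using reflect_B[of d x x] two by (simp add: B_self)

text \<open>Witt cancellation in the form in which it is used: reflections inside S turn the first n
  vectors of one family into those of another, and the remaining vectors keep their norms and
  orthogonality.\<close>

lemma orth_family_witt:
  assumes w: "orth_family C w m" "\<And>i. i < m \<Longrightarrow> w i \<in> S" and S: "subspace S"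
    and z: "orth_family C z n" "\<And>i. i < n \<Longrightarrow> z i \<in> S" "n \<le> m" "\<And>i. i < n \<Longrightarrow> N (z i) = N (w i)"
  shows "\<exists>w'. orth_family C w' m \<and> (\<forall>i<m. w' i \<in> S \<and> N (w' i) = N (w i)) \<and> (\<forall>i<n. w' i = z i)"
  using z
proof (induction n)
  case 0
  then show ?case using w by (intro exI[of _ w]) auto
next
  case (Suc n)
  have "orth_family C z n" using Suc.prems(1) by (simp add: orth_family_def)
  then obtain w' where w': "orth_family C w' m" "\<And>i. i < m \<Longrightarrow> w' i \<in> S" "\<And>i. i < m \<Longrightarrow> N (w' i) = N (w i)"
    "\<And>i. i < n \<Longrightarrow> w' i = z i"
    using Suc by (metis Suc_leD less_SucI)
  have nm: "n < m" using Suc.prems(3) by simp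
  define u t where "u = w' n" and "t = z n"
  have uS: "u \<in> S" "t \<in> S" using w'(2)[OF nm] Suc.prems(2)[of n] by (simp_all add: u_def t_def)
  have Nu: "N u = N t"
    using w'(3)[OF nm] Suc.prems(4)[of n] by (simp add: u_def t_def)
  have Nt: "N t \<noteq> 0" using Suc.prems(1) unfolding orth_family_def t_def by blast
  have perp: "B (w' i) u = 0" "B (w' i) t = 0" if "i < n" for i
  proof -
    show "B (w' i) u = 0" using w'(1) that nm by (simp add: orth_family_def u_def)
    show "B (w' i) t = 0" unfolding w'(4)[OF that] t_def using Suc.prems(1) that by (simp add: orth_family_def)
  qed
  \<comment> \<open>N(u - t) + N(u + t) = 4 N(t) is nonzero, so one of the two differences is
    anisotropic. The reflection along it takes u to t or to -t, and it fixes the vectors already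
    placed, as both u and t are orthogonal to them.\<close>
  obtain \<epsilon> d :: 'a and v where \<epsilon>: "\<epsilon> = 1 \<or> \<epsilon> = - 1" "v = u - \<epsilon> \<star> t" "N v \<noteq> 0"
  proof -
    have "N (u - t) + N (u - (- t)) = 4 * N t"
      using N_add[of u "- t"] N_add[of u t] Nu by simp
    moreover have "(4::'a) \<noteq> 0" using two by (metis mult_2 mult_eq_0_iff numeral_Bit0)
    ultimately have "N (u - t) \<noteq> 0 \<or> N (u - (- t)) \<noteq> 0" using Nt by auto
    then show ?thesis using that[of 1 "u - t"] that[of "- 1" "u - (- t)"] by auto
  qed
  have NE: "N (\<epsilon> \<star> t) = N t" using \<epsilon>(1) by (auto simp: N_scale)
  have Buv: "B u v = N v"
  proof -
    have "N v = N u + N t - B u (\<epsilon> \<star> t)"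
      using N_add[of u "- (\<epsilon> \<star> t)"] NE \<epsilon>(2) by simp
    then show ?thesis using \<epsilon>(2) Nu by (simp add: B_diff B_self)
  qed
  have ru: "reflect v u = \<epsilon> \<star> t" using \<epsilon>(2,3) Buv by (simp add: reflect_def)
  have \<epsilon>\<epsilon>: "\<epsilon> * \<epsilon> = 1" using \<epsilon>(1) by auto
  have rw: "reflect v (w' i) = w' i" if "i < n" for i
    using perp[OF that] \<epsilon>(2) by (simp add: reflect_def B_diff B_right)
  \<comment> \<open>The factor \<epsilon> at place n corrects the sign left by the
    reflection.\<close>
  define w'' where "w'' i = (if i = n then \<epsilon> \<star> reflect v (w' i) else reflect v (w' i))" for i
  have vS: "v \<in> S" using uS S \<epsilon>(2) by (simp add: subspace_diff subspace_scale)
  have "orth_family C w'' m"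
    using w'(1) \<epsilon>(1,3) unfolding orth_family_def w''_def
    by (auto simp: B_left B_right reflect_B N_scale reflect_N)
  moreover have "w'' i \<in> S \<and> N (w'' i) = N (w i)" if "i < m" for i
    using w'(2)[OF that] w'(3)[OF that] vS S \<epsilon>(1,3) unfolding w''_def
    by (auto simp: N_scale reflect_N) (auto simp: reflect_def subspace_diff subspace_scale subspace_neg)
  moreover have "w'' i = z i" if "i < Suc n" for i
  proof (cases "i = n")
    case True
    then show ?thesis using ru \<epsilon>\<epsilon> by (simp add: w''_def u_def t_def)
  next
    case False
    then show ?thesis using that rw w'(4) by (simp add: w''_def)
  qed
  ultimately show ?case by blast
qed

section \<open>Octonions in Cayley-Dickson coordinates\<close>

definition octo where "octo a b c = (\<lambda>(u, v). quat a b u + quat a b v \<cdot> c)"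

context
  fixes a b c \<alpha> \<beta> \<gamma>
  assumes triple: "cd_triple C a b c \<alpha> \<beta> \<gamma>"
begin

lemma triple_simps [simp]:
  "N a = \<alpha>" "N b = \<beta>" "N c = \<gamma>" "B a e = 0" "B b e = 0" "B b a = 0" "B c e = 0" "B c a = 0" "B c b = 0"
  "B c (a \<cdot> b) = 0" "B e a = 0" "B e b = 0" "B a b = 0" "B e c = 0" "B a c = 0" "B b c = 0" "B (a \<cdot> b) c = 0"
  using triple B_sym unfolding cd_triple_def by metis+

lemma B_ab [simp]: "B e (a \<cdot> b) = 0" "B a (a \<cdot> b) = 0" "B b (a \<cdot> b) = 0" "N (a \<cdot> b) = \<alpha> * \<beta>"
  "B (a \<cdot> b) e = 0" "B (a \<cdot> b) a = 0" "B (a \<cdot> b) b = 0"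
proof -
  show *: "B (a \<cdot> b) e = 0" "B (a \<cdot> b) a = 0" "B (a \<cdot> b) b = 0"
    using B_mul_right[of a b e] B_mul_common(2)[of a b e] B_mul_common(1)[of a b e]
    by (simp_all add: conj_orthogonal)
  then show "B e (a \<cdot> b) = 0" "B a (a \<cdot> b) = 0" "B b (a \<cdot> b) = 0" by (simp_all add: B_sym[of _ "a \<cdot> b"])
  show "N (a \<cdot> b) = \<alpha> * \<beta>" by (simp add: N_mul)
qed

lemma quat_mul_triple: "quat a b s \<cdot> quat a b t = quat a b (qmul \<alpha> \<beta> s t)"
  by (rule quat_mul) simp_all

lemma quat_conj_triple: "conj (quat a b s) = quat a b (qconj s)"
  by (rule quat_conj) simp_all

lemma N_quat: "N (quat a b s) = qnrm \<alpha> \<beta> s"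
  by (cases s) (simp add: quat_def qnrm_def N_add N_scale B_left B_right algebra_simps)

lemma B_quat: "B (quat a b s) (quat a b t) = qpol \<alpha> \<beta> s t"
  by (cases s; cases t) (simp add: quat_def qpol_def B_left B_right B_self algebra_simps)

lemma B_quat_c: "B (quat a b s) c = 0"
  by (cases s) (simp add: quat_def B_left)

lemma B_quat_quat_c: "B (quat a b s) (quat a b t \<cdot> c) = 0"
  by (simp add: B_sym[of "quat a b s"] B_mul_left quat_conj_triple quat_mul_triple B_quat_c B_sym[of c])

lemma N_octo: "N (octo a b c p) = onrm \<alpha> \<beta> \<gamma> p"
  by (cases p) (simp add: octo_def onrm_def N_add B_quat_quat_c N_mul N_quat mult.commute)

lemma octo_add: "octo a b c (p + q) = octo a b c p + octo a b c q"
  by (simp add: octo_def split_beta quat_linear mul_left algebra_simps)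

lemma octo_scale: "octo a b c (oscl r p) = r \<star> octo a b c p"
  by (cases p) (simp add: octo_def oscl_def quat_linear mul_left scale_right_distrib)

lemma octo_mul: "octo a b c p \<cdot> octo a b c q = octo a b c (omul \<alpha> \<beta> \<gamma> p q)"
proof -
  obtain u v u' v' where p: "p = (u, v)" and q: "q = (u', v')" by (cases p; cases q) auto
  let ?q = "quat a b"
  have 1: "?q u \<cdot> (?q v' \<cdot> c) = (?q v' \<cdot> ?q u) \<cdot> c"
    by (rule doubling_1) (simp_all add: quat_mul_triple B_quat_c)
  have 2: "(?q v \<cdot> c) \<cdot> ?q u' = (?q v \<cdot> conj (?q u')) \<cdot> c"
    by (rule doubling_2) (simp_all add: B_quat_c)
  have 3: "(?q v \<cdot> c) \<cdot> (?q v' \<cdot> c) = - (N c \<star> (conj (?q v') \<cdot> ?q v))"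
    by (rule doubling_3) (simp_all add: quat_conj_triple quat_mul_triple B_quat_c)
  show ?thesis
    unfolding p q by (simp add: octo_def omul_def mul_left mul_right 1 2 3 quat_conj_triple quat_mul_triple
        quat_linear quat_diff)
qed

lemma quat_basis: "quat a b (1, 0, 0, 0) = e" "quat a b (0, 1, 0, 0) = a" "quat a b (0, 0, 1, 0) = b"
  "quat a b (0, 0, 0, 1) = a \<cdot> b"
  by (simp_all add: quat_def)

lemma octo_inj:
  assumes "\<alpha> \<noteq> 0" "\<beta> \<noteq> 0" "\<gamma> \<noteq> 0"
  shows "inj (octo a b c)"
proof (rule injI)
  fix p q assume eq: "octo a b c p = octo a b c q"
  have q0: "s = 0" if "quat a b s = 0" for s
  proof -
    have "qpol \<alpha> \<beta> s t = 0" for t using B_quat[of s t] that by simp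
    from this[of "(1, 0, 0, 0)"] this[of "(0, 1, 0, 0)"] this[of "(0, 0, 1, 0)"] this[of "(0, 0, 0, 1)"]
    show ?thesis using assms two by (cases s) (simp add: qpol_def zero_prod_def)
  qed
  obtain u v where uv: "p - q = (u, v)" by (cases "p - q")
  have "octo a b c (p - q) = 0" using octo_add[of "p - q" q] eq by simp
  then have z: "quat a b u + quat a b v \<cdot> c = 0" by (simp add: octo_def uv)
  have "B (quat a b u) (quat a b t) = 0" for t
    using arg_cong[OF z, of "\<lambda>x. B x (quat a b t)"] B_quat_quat_c[of t v] by (simp add: B_left B_right B_sym[of _ "quat a b t"])
  then have "qpol \<alpha> \<beta> u t = 0" for t by (simp add: B_quat)
  from this[of "(1, 0, 0, 0)"] this[of "(0, 1, 0, 0)"] this[of "(0, 0, 1, 0)"] this[of "(0, 0, 0, 1)"]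
  have u: "u = 0" using assms two by (cases u) (simp add: qpol_def zero_prod_def)
  then have "quat a b v \<cdot> c = 0" using z by (simp add: quat_def zero_prod_def)
  then have "\<gamma> \<star> quat a b v = 0" using conj_cancel_right(2)[of "quat a b v" c] by simp
  then have "v = 0" using assms(3) q0 by simp
  then have "p - q = 0" using uv u by (simp add: zero_prod_def)
  then show "p = q" by simp
qed

text \<open>The eight products are the images of unit vectors under \<open>octo\<close>, and
  \<open>onrm\<close> is a diagonal form.\<close>

lemma triple_orth_family:
  assumes "\<alpha> \<noteq> 0" "\<beta> \<noteq> 0" "\<gamma> \<noteq> 0"
  shows "orth_family C (\<lambda>i. [e, a, b, a \<cdot> b, c, a \<cdot> c, b \<cdot> c, (a \<cdot> b) \<cdot> c] ! i) 8"
proof -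
  define d where "d i k = (if i = k then 1 else 0 :: 'a)" for i k :: nat
  define z where "z i = octo a b c ((d i 0, d i 1, d i 2, d i 3), (d i 4, d i 5, d i 6, d i 7))" for i
  have lt: "i < 8 \<Longrightarrow> i = 0 \<or> i = 1 \<or> i = 2 \<or> i = 3 \<or> i = 4 \<or> i = 5 \<or> i = 6 \<or> i = (7::nat)" for i by arith
  have z: "[e, a, b, a \<cdot> b, c, a \<cdot> c, b \<cdot> c, (a \<cdot> b) \<cdot> c] ! i = z i" if "i < 8" for i
    using lt[OF that] by (elim disjE) (simp_all add: z_def d_def octo_def quat_def)
  have "N (z i + z j) = N (z i) + N (z j)" if "i \<noteq> j" for i j
    using that unfolding z_def octo_add[symmetric] N_octo
    by (simp add: onrm_def qnrm_def d_def algebra_simps)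
  then have "B (z i) (z j) = 0" if "i \<noteq> j" for i j using that by (simp add: polar_def)
  moreover have "N (z i) \<noteq> 0" if "i < 8" for i
    using lt[OF that] assms by (elim disjE) (simp_all add: z_def N_octo onrm_def qnrm_def d_def)
  ultimately show ?thesis using z by (simp add: orth_family_def)
qed

end

end

section \<open>Parameters of maximal flags\<close>

text \<open>K and Q are given as ranges of the coordinate maps, so an isomorphism of flags with
  equal parameters can be written down by coordinates.\<close>

definition flag_params :: "('a::field, 'c::ab_group_add) calg \<Rightarrow> 'c set \<Rightarrow> 'c set \<Rightarrow> 'a \<Rightarrow> 'a \<Rightarrow> 'a \<Rightarrow> bool" where
  "flag_params C K Q \<alpha> \<beta> \<gamma> \<longleftrightarrow> (\<exists>a b c. cd_triple C a b c \<alpha> \<beta> \<gamma> \<and>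
     K = {comp_alg.quat C a b (s, t, 0, 0) | s t. True} \<and> Q = range (comp_alg.quat C a b) \<and>
     surj (comp_alg.octo C a b c))"

lemma orth_family_mono: "orth_family C z n \<Longrightarrow> m \<le> n \<Longrightarrow> orth_family C z m"
  by (simp add: orth_family_def)

lemma comp_alg_flag:
  assumes "(2::'a::field) \<noteq> 0" "two_flag (C :: ('a, 'c::ab_group_add) calg) K"
  shows "comp_alg C"
proof
  show C: "composition_algebra C" using assms(2) by (simp add: two_flag_def)
  then interpret vector_space "scl C" by (simp add: composition_algebra_def)
  show "unt C \<noteq> 0"
  proof
    assume u: "unt C = 0"
    have "Vector_Spaces.linear (scl C) (scl C) (\<lambda>y. mul C y x)" for x using C by (simp add: composition_algebra_def)
    then have z: "mul C 0 x = 0" for x by (metis Vector_Spaces.linear_iff scale_zero_left)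
    have m: "mul C (unt C) x = x" for x using C by (simp add: composition_algebra_def)
    have "x = 0" for x :: 'c using m[of x] z[of x] u by simp
    then have "UNIV \<subseteq> span {}" by auto
    then have "dim UNIV \<le> card ({} :: 'c set)" by (rule dim_le_card) simp
    then show False using assms(2) by (simp add: two_flag_def dim_on_def)
  qed
qed (rule assms(1))

context comp_alg begin

lemma polar_square: "x \<cdot> x = B x e \<star> x - N x \<star> e"
  using conj_cancel_left(1)[of x e] by (simp add: conj_def mul_diff mul_right algebra_simps)

context
  fixes a b c \<alpha> \<beta> \<gamma>
  assumes triple: "cd_triple C a b c \<alpha> \<beta> \<gamma>" and nz: "\<alpha> \<noteq> 0" "\<beta> \<noteq> 0" "\<gamma> \<noteq> 0"
begin

text \<open>The initial segments of lengths 2, 4 and 8 are bases of K, Q and C.\<close>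

abbreviation "zz \<equiv> \<lambda>i. [e, a, b, a \<cdot> b, c, a \<cdot> c, b \<cdot> c, (a \<cdot> b) \<cdot> c] ! i"

lemma zz: "orth_family C zz 8" "orth_family C zz 4" "orth_family C zz 2"
  using triple_orth_family[OF triple nz] by (auto intro: orth_family_mono)

lemma span_zz2: "span (zz ` {..<2}) = {quat a b (s, t, 0, 0) | s t. True}"
  unfolding span_family[OF orth_family_inj[OF zz(3)]]
proof safe
  fix f
  show "\<exists>s t. (\<Sum>i<2. f i \<star> zz i) = quat a b (s, t, 0, 0) \<and> True"
    by (intro exI[of _ "f 0"] exI[of _ "f 1"]) (simp add: quat_def eval_nat_numeral)
next
  fix s t
  show "\<exists>f. quat a b (s, t, 0, 0) = (\<Sum>i<2. f i \<star> zz i) \<and> True"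
    by (intro exI[of _ "\<lambda>i. [s, t] ! i"]) (simp add: quat_def eval_nat_numeral)
qed

lemma span_zz4: "span (zz ` {..<4}) = range (quat a b)"
  unfolding span_family[OF orth_family_inj[OF zz(2)]]
proof safe
  fix f
  show "(\<Sum>i<4. f i \<star> zz i) \<in> range (quat a b)"
    by (rule image_eqI[of _ _ "(f 0, f 1, f 2, f 3)"]) (simp_all add: quat_def eval_nat_numeral)
next
  fix s0 s1 s2 s3
  show "\<exists>f. quat a b (s0, s1, s2, s3) = (\<Sum>i<4. f i \<star> zz i) \<and> True"
    by (intro exI[of _ "\<lambda>i. [s0, s1, s2, s3] ! i"]) (simp add: quat_def eval_nat_numeral)
qed

lemma span_zz8: "span (zz ` {..<8}) = range (octo a b c)"
  unfolding span_family[OF orth_family_inj[OF zz(1)]]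
proof safe
  fix f
  show "(\<Sum>i<8. f i \<star> zz i) \<in> range (octo a b c)"
    by (rule image_eqI[of _ _ "((f 0, f 1, f 2, f 3), (f 4, f 5, f 6, f 7))"])
      (simp_all add: octo_def quat_def eval_nat_numeral mul_left algebra_simps)
next
  fix s0 s1 s2 s3 s4 s5 s6 s7
  show "\<exists>f. octo a b c ((s0, s1, s2, s3), (s4, s5, s6, s7)) = (\<Sum>i<8. f i \<star> zz i) \<and> True"
    by (intro exI[of _ "\<lambda>i. [s0, s1, s2, s3, s4, s5, s6, s7] ! i"])
      (simp add: octo_def quat_def eval_nat_numeral mul_left algebra_simps)
qed

text \<open>By dimension, the two, four and eight orthogonal vectors already span K, Q and C once a
  lies in K and b in Q.\<close>

lemma flag_paramsI:
  assumes "maximal_flag C K Q" "a \<in> K" "b \<in> Q"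
  shows "flag_params C K Q \<alpha> \<beta> \<gamma>"
proof -
  have K: "subspace K" "e \<in> K" "dim K = 2" and Q: "subspace Q" "dim Q = 4" "K \<subseteq> Q" "\<And>x y. x \<in> Q \<Longrightarrow> y \<in> Q \<Longrightarrow> x \<cdot> y \<in> Q"
    and U: "dim UNIV = 8"
    using assms(1) by (auto simp: maximal_flag_def two_flag_def composition_subalgebra_def dim_on_def)
  have "zz i \<in> K" if "i < 2" for i using that K assms(2) by (auto simp: less_2_cases_iff)
  from orth_family_span[OF zz(3) this K(1,3)] have 1: "K = {quat a b (s, t, 0, 0) | s t. True}" by (simp add: span_zz2)
  have "i < 4 \<Longrightarrow> i = 0 \<or> i = 1 \<or> i = 2 \<or> i = (3::nat)" for i by arith
  then have "zz i \<in> Q" if "i < 4" for i using that K Q assms(2,3) by fastforce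
  from orth_family_span[OF zz(2) this Q(1,2)] have 2: "Q = range (quat a b)" by (simp add: span_zz4)
  have 3: "surj (octo a b c)" using orth_family_span[OF zz(1) _ subspace_UNIV U] by (simp add: span_zz8)
  show ?thesis unfolding flag_params_def
    by (rule exI[of _ a], rule exI[of _ b], rule exI[of _ c]) (intro conjI triple 1 2 3)
qed

lemma maximal_flag_triple:
  assumes "surj (octo a b c)"
  shows "maximal_flag C {quat a b (s, t, 0, 0) | s t. True} (range (quat a b))"
proof -
  let ?K = "{quat a b (s, t, 0, 0) | s t. True}"
  have K: "subspace ?K" "dim ?K = 2"
    unfolding span_zz2[symmetric] using orth_family_dim[OF zz(3)] by (simp_all add: subspace_span)
  have Q: "subspace (range (quat a b))" "dim (range (quat a b)) = 4"
    unfolding span_zz4[symmetric] using orth_family_dim[OF zz(2)] by (simp_all add: subspace_span)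
  have U: "dim UNIV = 8"
    using orth_family_dim[OF zz(1)] unfolding span_zz8 assms .
  have q: "quat a b s = 0" if "\<forall>t \<in> {(1, 0, 0, 0), (0, 1, 0, 0), (0, 0, 1, 0), (0, 0, 0, 1)}. qpol \<alpha> \<beta> s t = 0" for s
    using that nz two by (cases s) (simp add: qpol_def quat_def)
  have "nondegenerate_on C (range (quat a b))"
    unfolding nondegenerate_on_def
  proof (intro ballI impI)
    fix x assume "x \<in> range (quat a b)" and x: "\<forall>y\<in>range (quat a b). B x y = 0"
    then obtain s where s: "x = quat a b s" by blast
    have "B x (quat a b t) = 0" for t using x by blast
    then have "qpol \<alpha> \<beta> s t = 0" for t using B_quat[OF triple, of s t] unfolding s by metis
    then show "x = 0" unfolding s by (intro q) simp
  qed
  moreover have "nondegenerate_on C ?K"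
    unfolding nondegenerate_on_def
  proof (intro ballI impI)
    fix x assume "x \<in> ?K" and x: "\<forall>y\<in>?K. B x y = 0"
    then obtain s t where s: "x = quat a b (s, t, 0, 0)" by blast
    have "B x (quat a b (1, 0, 0, 0)) = 0" "B x (quat a b (0, 1, 0, 0)) = 0" using x by blast+
    then show "x = 0" unfolding s B_quat[OF triple] using nz two by (simp add: qpol_def quat_def)
  qed
  moreover have "e \<in> ?K" using quat_basis(1)[OF triple] by (intro CollectI exI[of _ 1] exI[of _ 0]) simp
  moreover have "e \<in> range (quat a b)" using quat_basis(1)[OF triple] by (metis rangeI)
  moreover have "x \<cdot> y \<in> ?K" if xy: "x \<in> ?K" "y \<in> ?K" for x y
  proof -
    obtain s t s' t' where "x = quat a b (s, t, 0, 0)" "y = quat a b (s', t', 0, 0)" using xy by blast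
    then have "x \<cdot> y = quat a b (s * s' - \<alpha> * t * t', s * t' + t * s', 0, 0)"
      by (simp add: quat_mul_triple[OF triple] qmul_def)
    then show ?thesis by blast
  qed
  moreover have "x \<cdot> y \<in> range (quat a b)" if "x \<in> range (quat a b)" "y \<in> range (quat a b)" for x y
    using that quat_mul_triple[OF triple] by auto
  ultimately show ?thesis using K Q U comp
    by (auto simp: maximal_flag_def two_flag_def composition_subalgebra_def dim_on_def)
qed

end

lemma flag_params_maximal:
  assumes "flag_params C K Q \<alpha> \<beta> \<gamma>" "\<alpha> \<noteq> 0" "\<beta> \<noteq> 0" "\<gamma> \<noteq> 0"
  shows "maximal_flag C K Q"
  using assms maximal_flag_triple unfolding flag_params_def by blast

section \<open>Finding and changing the parameters of a flag\<close>

lemma orth_family_4: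
  assumes a: "B a e = 0" and b: "B b e = 0" "B b a = 0" and nz: "N a \<noteq> 0" "N b \<noteq> 0"
  shows "orth_family C (\<lambda>i. [e, a, b, a \<cdot> b] ! i) 4"
proof -
  have ba: "B a b = 0" using b(2) by (simp only: B_sym[of a b])
  have 1: "B (a \<cdot> b) e = 0" by (subst B_mul_right) (simp add: conj_orthogonal[OF b(1)] ba)
  have 2: "B (a \<cdot> b) a = 0" using B_mul_common(2)[of a b e] b(1) by simp
  have 3: "B (a \<cdot> b) b = 0" using B_mul_common(1)[of a b e] a by simp
  have 4: "B e a = 0" "B e b = 0" "B e (a \<cdot> b) = 0" "B a (a \<cdot> b) = 0" "B b (a \<cdot> b) = 0"
    using B_sym[of e a] B_sym[of e b] B_sym[of e "a \<cdot> b"] B_sym[of a "a \<cdot> b"] B_sym[of b "a \<cdot> b"] a b 1 2 3 by simp_all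
  have lt: "i < 4 \<Longrightarrow> i = 0 \<or> i = 1 \<or> i = 2 \<or> i = (3::nat)" for i by arith
  have "B ([e, a, b, a \<cdot> b] ! i) ([e, a, b, a \<cdot> b] ! j) = 0" if "i < 4" "j < 4" "i \<noteq> j" for i j
    using lt[OF that(1)] lt[OF that(2)] that(3) by (elim disjE) (simp_all add: 1 2 3 4 a b ba)
  moreover have "N ([e, a, b, a \<cdot> b] ! i) \<noteq> 0" if "i < 4" for i
    using lt[OF that] nz by (elim disjE) (simp_all add: N_mul)
  ultimately show ?thesis unfolding orth_family_def by blast
qed

lemma orth_family_2:
  assumes "B a e = 0" "N a \<noteq> 0"
  shows "orth_family C (\<lambda>i. [e, a] ! i) 2"
  using assms B_sym[of e a] by (auto simp: orth_family_def less_2_cases_iff)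

lemma exists_pure_in_quadratic:
  assumes "two_flag C K"
  obtains a where "a \<in> K" "B a e = 0" "N a \<noteq> 0"
proof -
  have "orth_family C (\<lambda>i. e) 1" by (simp add: orth_family_def)
  moreover have K: "subspace K" "e \<in> K" "1 < dim K" "nondegenerate_on C K"
    using assms by (auto simp: two_flag_def composition_subalgebra_def dim_on_def)
  ultimately show ?thesis using orth_family_extend[of "\<lambda>i. e" 1 K] that by auto
qed

text \<open>The orthogonal family 1, a extends inside Q because 2 < 4, and 1, a, b, ab extends
  inside C because 4 < 8. The vector a is prescribed so that it can be matched with f_1
  later.\<close>

lemma maximal_flag_params:
  assumes flag: "maximal_flag C K Q" and a: "a \<in> K" "B a e = 0" "N a \<noteq> 0"
  obtains b c where "b \<in> Q" "N b \<noteq> 0" "N c \<noteq> 0" "cd_triple C a b c (N a) (N b) (N c)"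
proof -
  have Qd: "dim Q = 4" and U: "dim UNIV = 8" and Qs: "composition_subalgebra C Q" and KQ: "K \<subseteq> Q"
    using flag unfolding maximal_flag_def two_flag_def dim_on_def by blast+
  have Q: "subspace Q" "e \<in> Q" "nondegenerate_on C Q"
    using Qs unfolding composition_subalgebra_def by blast+
  have Qd2: "2 < dim Q" by (simp add: Qd)
  have aQ: "a \<in> Q" using KQ a(1) by blast
  define z where "z = (\<lambda>i. [e, a] ! i)"
  have z: "z 0 = e" "z 1 = a" by (simp_all add: z_def)
  have zo: "orth_family C z 2" unfolding z_def by (rule orth_family_2[OF a(2,3)])
  have zQ: "z i \<in> Q" if "i < 2" for i
  proof -
    have "i = 0 \<or> i = 1" using that by arith
    then show ?thesis using Q(2) aQ z by (elim disjE) simp_all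
  qed
  obtain b where b: "b \<in> Q" "N b \<noteq> 0" "\<And>i. i < 2 \<Longrightarrow> B b (z i) = 0"
    by (rule orth_family_extend[OF zo zQ Q(1,3) Qd2]) (assumption, rule that)
  have be: "B b e = 0" "B b a = 0" using b(3)[of 0] b(3)[of 1] unfolding z by simp_all
  define y where "y = (\<lambda>i. [e, a, b, a \<cdot> b] ! i)"
  have y: "y 0 = e" "y 1 = a" "y 2 = b" "y 3 = a \<cdot> b" by (simp_all add: y_def)
  have yo: "orth_family C y 4" unfolding y_def by (rule orth_family_4[OF a(2) be a(3) b(2)])
  have U4: "4 < dim UNIV" by (simp add: U)
  obtain c where c: "N c \<noteq> 0" "\<And>i. i < 4 \<Longrightarrow> B c (y i) = 0"
    by (rule orth_family_extend[OF yo UNIV_I subspace_UNIV nondegenerate U4]) (rule that)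
  have "B c e = 0" "B c a = 0" "B c b = 0" "B c (a \<cdot> b) = 0"
    using c(2)[of 0] c(2)[of 1] c(2)[of 2] c(2)[of 3] unfolding y by simp_all
  then have "cd_triple C a b c (N a) (N b) (N c)"
    unfolding cd_triple_def using a(2) be by iprover
  then show ?thesis by (rule that[OF b(1,2) c(1)])
qed

text \<open>Witt cancellation is applied twice. In Q the prefix 1, a is forced on w and leaves an
  element b of norm \<beta>; in C the prefix 1, a, b, ab is forced on v and leaves an element of
  norm \<gamma>. So the parameters depend only on K and on the norms of Q and C.\<close>

lemma flag_params_change:
  assumes flag: "maximal_flag C K Q" and a: "a \<in> K" "B a e = 0" "N a = \<alpha>"
    and nz: "\<alpha> \<noteq> 0" "\<beta> \<noteq> 0" "\<gamma> \<noteq> 0"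
    and w: "orth_family C w 3" "\<And>i. i < 3 \<Longrightarrow> w i \<in> Q" "N (w 0) = 1" "N (w 1) = \<alpha>" "N (w 2) = \<beta>"
    and v: "orth_family C v 5" "N (v 0) = 1" "N (v 1) = \<alpha>" "N (v 2) = \<beta>" "N (v 3) = \<alpha> * \<beta>" "N (v 4) = \<gamma>"
  shows "flag_params C K Q \<alpha> \<beta> \<gamma>"
proof -
  have Q: "subspace Q" "e \<in> Q" "K \<subseteq> Q"
    using flag unfolding maximal_flag_def composition_subalgebra_def by blast+
  have Na: "N a \<noteq> 0" using a nz by simp
  have aQ: "a \<in> Q" using Q(3) a(1) by blast
  define z where "z = (\<lambda>i. [e, a] ! i)"
  have z: "z 0 = e" "z 1 = a" by (simp_all add: z_def)
  have zo: "orth_family C z 2" unfolding z_def by (rule orth_family_2[OF a(2) Na])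
  have zQ: "z i \<in> Q" "N (z i) = N (w i)" if "i < 2" for i
  proof -
    have i: "i = 0 \<or> i = 1" using that by arith
    show "z i \<in> Q" using i Q(2) aQ z by (elim disjE) simp_all
    show "N (z i) = N (w i)" using i z w(3,4) a(3) by (elim disjE) simp_all
  qed
  have "2 \<le> (3::nat)" by simp
  from orth_family_witt[OF w(1,2) Q(1) zo zQ(1) this zQ(2)] obtain w'
    where w': "orth_family C w' 3" "\<forall>i<3. w' i \<in> Q \<and> N (w' i) = N (w i)" "\<forall>i<2. w' i = z i"
    by iprover
  define b where "b = w' 2"
  have b: "b \<in> Q" "N b = \<beta>" using w'(2)[rule_format, of 2] w(5) by (simp_all add: b_def)
  have w'z: "w' 0 = e" "w' 1 = a" using w'(3)[rule_format, of 0] w'(3)[rule_format, of 1] unfolding z by simp_all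
  have "B (w' 2) (w' 0) = 0" "B (w' 2) (w' 1) = 0" using w'(1) unfolding orth_family_def by simp_all
  then have be: "B b e = 0" "B b a = 0" unfolding w'z b_def .
  have Nb: "N b \<noteq> 0" using b nz by simp
  define y where "y = (\<lambda>i. [e, a, b, a \<cdot> b] ! i)"
  have y: "y 0 = e" "y 1 = a" "y 2 = b" "y 3 = a \<cdot> b" by (simp_all add: y_def)
  have yo: "orth_family C y 4" unfolding y_def by (rule orth_family_4[OF a(2) be Na Nb])
  have yN: "N (y i) = N (v i)" if "i < 4" for i
  proof -
    have i: "i = 0 \<or> i = 1 \<or> i = 2 \<or> i = 3" using that by arith
    show ?thesis using i y v a(3) b(2) by (elim disjE) (simp_all add: N_mul)
  qed
  have "4 \<le> (5::nat)" by simp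
  from orth_family_witt[OF v(1) UNIV_I subspace_UNIV yo UNIV_I this yN] obtain v'
    where v': "orth_family C v' 5" "\<forall>i<5. v' i \<in> UNIV \<and> N (v' i) = N (v i)" "\<forall>i<4. v' i = y i"
    by iprover
  have v'y: "v' 0 = e" "v' 1 = a" "v' 2 = b" "v' 3 = a \<cdot> b"
    using v'(3)[rule_format, of 0] v'(3)[rule_format, of 1] v'(3)[rule_format, of 2] v'(3)[rule_format, of 3]
    unfolding y by simp_all
  have v'4: "N (v' 4) = \<gamma>" using v'(2)[rule_format, of 4] v(6) by simp
  have v'0: "B (v' 4) (v' i) = 0" if "i < 4" for i
  proof -
    have "i < 5" "(4::nat) < 5" "4 \<noteq> i" using that by simp_all
    then show ?thesis using v'(1) unfolding orth_family_def by iprover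
  qed
  have "B (v' 4) e = 0" "B (v' 4) a = 0" "B (v' 4) b = 0" "B (v' 4) (a \<cdot> b) = 0"
    using v'0[of 0] v'0[of 1] v'0[of 2] v'0[of 3] unfolding v'y by simp_all
  then have "cd_triple C a b (v' 4) \<alpha> \<beta> \<gamma>"
    unfolding cd_triple_def using v'4 a(2,3) b(2) be by iprover
  from flag_paramsI[OF this nz flag a(1) b(1)] show ?thesis .
qed

end

text \<open>The norm does not occur in \<open>alg_iso\<close>. It is recovered from x^2 = B(x, 1) x
  - N(x) 1, which determines the trace and the norm of every x outside the line of the unit.\<close>

lemma alg_iso_preserves:
  assumes "comp_alg C" "comp_alg C'" and iso: "alg_iso C UNIV C' UNIV \<theta>"
  shows "nrm C' (\<theta> x) = nrm C x" "polar C' (\<theta> x) (\<theta> y) = polar C x y"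
proof -
  interpret A: comp_alg C by fact
  interpret A': comp_alg C' by fact
  have \<theta>: "\<theta> (x + y) = \<theta> x + \<theta> y" "\<theta> (mul C x y) = mul C' (\<theta> x) (\<theta> y)" "\<theta> (scl C s x) = scl C' s (\<theta> x)"
    "\<theta> (unt C) = unt C'" "inj \<theta>" for x y s
    using iso by (auto simp: alg_iso_def bij_betw_def)
  have nrm: "nrm C' (\<theta> x) = nrm C x" for x
  proof (cases "\<exists>r. x = scl C r (unt C)")
    case True
    then show ?thesis using \<theta> by (auto simp: A.N_scale A'.N_scale)
  next
    case False
    define p n where "p = polar C x (unt C) - polar C' (\<theta> x) (unt C')" and "n = nrm C x - nrm C' (\<theta> x)"
    have "\<theta> (mul C x x) + scl C' (nrm C x) (unt C') = scl C' (polar C x (unt C)) (\<theta> x)"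
    proof -
      have "mul C x x + scl C (nrm C x) (unt C) = scl C (polar C x (unt C)) x" by (simp add: A.polar_square)
      from arg_cong[OF this, of \<theta>] show ?thesis by (simp only: \<theta>)
    qed
    moreover have "\<theta> (mul C x x) + scl C' (nrm C' (\<theta> x)) (unt C') = scl C' (polar C' (\<theta> x) (unt C')) (\<theta> x)"
      using A'.polar_square[of "\<theta> x"] by (simp add: \<theta>)
    ultimately have pn: "scl C' p (\<theta> x) = scl C' n (unt C')"
      unfolding p_def n_def A'.scale_left_diff_distrib by (metis add_diff_cancel_left)
    have "p = 0"
    proof (rule ccontr)
      assume "p \<noteq> 0"
      then have "\<theta> x = scl C' (n / p) (unt C')"
        using arg_cong[OF pn, of "scl C' (1 / p)"] by simp
      then have "\<theta> x = \<theta> (scl C (n / p) (unt C))" by (simp add: \<theta>)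
      then show False using False \<theta>(5) by (auto dest: injD)
    qed
    then have "n = 0" using pn A'.unt_nonzero by simp
    then show ?thesis by (simp add: n_def)
  qed
  show "nrm C' (\<theta> x) = nrm C x" by (rule nrm)
  show "polar C' (\<theta> x) (\<theta> y) = polar C x y" unfolding polar_def nrm \<theta>(1)[symmetric] ..
qed

text \<open>In the coordinates of \<open>octo\<close> the operations depend on the three parameters
  only.\<close>

lemma flag_params_iso:
  assumes "comp_alg C" "comp_alg C'" "flag_params C K Q \<alpha> \<beta> \<gamma>" "flag_params C' K' Q' \<alpha> \<beta> \<gamma>"
    and nz: "\<alpha> \<noteq> 0" "\<beta> \<noteq> 0" "\<gamma> \<noteq> 0"
  shows "flag_iso C K Q C' K' Q'"
proof -
  interpret A: comp_alg C by fact
  interpret A': comp_alg C' by fact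
  obtain a b c where t: "cd_triple C a b c \<alpha> \<beta> \<gamma>" and K: "K = {A.quat a b (s, t, 0, 0) | s t. True}"
    and Q: "Q = range (A.quat a b)" and s: "surj (A.octo a b c)" using assms(3) unfolding flag_params_def by blast
  obtain a' b' c' where t': "cd_triple C' a' b' c' \<alpha> \<beta> \<gamma>" and K': "K' = {A'.quat a' b' (s, t, 0, 0) | s t. True}"
    and Q': "Q' = range (A'.quat a' b')" and s': "surj (A'.octo a' b' c')" using assms(4) unfolding flag_params_def by blast
  let ?f = "A.octo a b c" and ?f' = "A'.octo a' b' c'"
  have inj: "inj ?f" "inj ?f'" using A.octo_inj[OF t nz] A'.octo_inj[OF t' nz] .
  define \<theta> where "\<theta> = ?f' \<circ> inv_into UNIV ?f"
  have \<theta>: "\<theta> (?f p) = ?f' p" for p by (simp add: \<theta>_def inj)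
  have ex: "\<exists>p. x = ?f p" for x using s by (metis surjD)
  have q: "A.quat a b u = ?f (u, 0)" "A'.quat a' b' u = ?f' (u, 0)" for u
    by (simp_all add: A.octo_def A'.octo_def A.quat_def A'.quat_def zero_prod_def)
  have "bij \<theta>" using inj s s' unfolding \<theta>_def by (intro bij_comp bij_imp_bij_inv) (simp_all add: bij_def)
  moreover have "\<theta> (x + y) = \<theta> x + \<theta> y \<and> \<theta> (mul C x y) = mul C' (\<theta> x) (\<theta> y)" for x y
  proof -
    obtain p r where "x = ?f p" "y = ?f r" using ex by metis
    then show ?thesis
      by (simp add: \<theta> A.octo_mul[OF t] A'.octo_mul[OF t'] flip: A.octo_add[OF t] A'.octo_add[OF t'])
  qed
  moreover have "\<theta> (scl C r x) = scl C' r (\<theta> x)" for r x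
  proof -
    obtain p where "x = ?f p" using ex by metis
    then show ?thesis by (simp add: \<theta> flip: A.octo_scale[OF t] A'.octo_scale[OF t'])
  qed
  moreover have "\<theta> (unt C) = unt C'"
    using \<theta>[of "((1, 0, 0, 0), 0)"] by (simp flip: q add: A.quat_basis[OF t] A'.quat_basis[OF t'])
  ultimately have "alg_iso C UNIV C' UNIV \<theta>" by (auto simp: alg_iso_def)
  moreover have "\<theta> ` Q = Q'" unfolding Q Q' q by (simp add: image_image \<theta>)
  moreover have "K = range (\<lambda>(s, t). ?f ((s, t, 0, 0), 0))" "K' = range (\<lambda>(s, t). ?f' ((s, t, 0, 0), 0))"
    unfolding K K' q by auto
  then have "\<theta> ` K = K'" by (simp add: image_image split_beta \<theta>)
  ultimately show ?thesis unfolding flag_iso_def by blast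
qed

lemma flag_iso_params:
  assumes "comp_alg C" "comp_alg C'" "flag_iso C K Q C' K' Q'" "flag_params C K Q \<alpha> \<beta> \<gamma>"
    "maximal_flag C' K' Q'" and nz: "\<alpha> \<noteq> 0" "\<beta> \<noteq> 0" "\<gamma> \<noteq> 0"
  shows "flag_params C' K' Q' \<alpha> \<beta> \<gamma>"
proof -
  interpret A: comp_alg C by fact
  interpret A': comp_alg C' by fact
  obtain a b c where t: "cd_triple C a b c \<alpha> \<beta> \<gamma>" and K: "K = {A.quat a b (s, t, 0, 0) | s t. True}"
    and Q: "Q = range (A.quat a b)" using assms(4) unfolding flag_params_def by blast
  obtain \<theta> where iso: "alg_iso C UNIV C' UNIV \<theta>" and im: "\<theta> ` Q = Q'" "\<theta> ` K = K'"
    using assms(3) unfolding flag_iso_def by blast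
  note p = alg_iso_preserves[OF assms(1,2) iso]
  have m: "\<theta> (unt C) = unt C'" "\<theta> (mul C a b) = mul C' (\<theta> a) (\<theta> b)" using iso by (auto simp: alg_iso_def)
  have "cd_triple C' (\<theta> a) (\<theta> b) (\<theta> c) \<alpha> \<beta> \<gamma>"
    using t unfolding cd_triple_def m[symmetric] p .
  moreover have "\<theta> a \<in> K'" unfolding im(2)[symmetric] K using A.quat_basis(2)[OF t] by (intro imageI) (metis (mono_tags, lifting) mem_Collect_eq)
  moreover have "\<theta> b \<in> Q'" unfolding im(1)[symmetric] Q using A.quat_basis(3)[OF t] by (metis imageI rangeI)
  ultimately show ?thesis using A'.flag_paramsI nz assms(5) by blast
qed



section \<open>Standard models of flags\<close>

lemma UNIV_8: "(UNIV :: 8 set) = {0, 1, 2, 3, 4, 5, 6, 7}"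
  by (rule sym, rule card_subset_eq) simp_all

definition of8 :: "'b ^ 8 \<Rightarrow> ('b \<times> 'b \<times> 'b \<times> 'b) \<times> ('b \<times> 'b \<times> 'b \<times> 'b)" where
  "of8 v = ((v $ 0, v $ 1, v $ 2, v $ 3), (v $ 4, v $ 5, v $ 6, v $ 7))"

definition to8 :: "('b \<times> 'b \<times> 'b \<times> 'b) \<times> ('b \<times> 'b \<times> 'b \<times> 'b) \<Rightarrow> 'b ^ 8" where
  "to8 = (\<lambda>((p0, p1, p2, p3), (p4, p5, p6, p7)). \<chi> i. if i = 0 then p0 else if i = 1 then p1 else if i = 2 then p2
     else if i = 3 then p3 else if i = 4 then p4 else if i = 5 then p5 else if i = 6 then p6 else p7)"

lemma of8_to8 [simp]: "of8 (to8 p) = p"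
  by (simp add: of8_def to8_def split_beta)

lemma to8_of8 [simp]: "to8 (of8 v) = v"
proof -
  have "\<forall>i\<in>UNIV. to8 (of8 v) $ i = v $ i" unfolding UNIV_8 by (simp add: of8_def to8_def)
  then show ?thesis by (simp add: vec_eq_iff)
qed

lemma of8_linear: "of8 (u + v) = of8 u + of8 v" "of8 (r *s v) = oscl r (of8 v)"
  by (simp_all add: of8_def oscl_def qscl_def)

lemma to8_linear: "to8 (p + q) = to8 p + to8 q" "to8 (oscl r p) = r *s to8 p"
  by (metis of8_linear(1) of8_to8 to8_of8) (metis of8_linear(2) of8_to8 to8_of8)

definition cd_alg :: "'a::field \<Rightarrow> 'a \<Rightarrow> 'a \<Rightarrow> ('a, 'a ^ 8) calg" where
  "cd_alg \<alpha> \<beta> \<gamma> = \<lparr>scl = (*s), mul = (\<lambda>u v. to8 (omul \<alpha> \<beta> \<gamma> (of8 u) (of8 v))),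
     unt = to8 ((1, 0, 0, 0), (0, 0, 0, 0)), nrm = (\<lambda>v. onrm \<alpha> \<beta> \<gamma> (of8 v))\<rparr>"

lemma qnrm_qmul: "qnrm \<alpha> \<beta> (qmul \<alpha> \<beta> s t) = qnrm \<alpha> \<beta> s * qnrm \<alpha> \<beta> t"
  by (cases s; cases t) (simp add: qnrm_def qmul_def power2_eq_square algebra_simps)

lemma qnrm_add: "qnrm \<alpha> \<beta> (s + t) = qnrm \<alpha> \<beta> s + qnrm \<alpha> \<beta> t + qpol \<alpha> \<beta> s t"
  by (cases s; cases t) (simp add: qnrm_def qpol_def power2_eq_square algebra_simps)

lemma qnrm_diff_scl: "qnrm \<alpha> \<beta> (s - qscl r t) = qnrm \<alpha> \<beta> s + r\<^sup>2 * qnrm \<alpha> \<beta> t - r * qpol \<alpha> \<beta> s t"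
  by (cases s; cases t) (simp add: qnrm_def qpol_def qscl_def power2_eq_square algebra_simps)

lemma qnrm_qconj: "qnrm \<alpha> \<beta> (qconj s) = qnrm \<alpha> \<beta> s"
  by (cases s) (simp add: qnrm_def qconj_def)

text \<open>The cross terms in the norm of a Cayley-Dickson product are these two values with
  opposite signs, so this identity is what makes the doubled norm multiplicative.\<close>

lemma qpol_qmul_exchange:
  "qpol \<alpha> \<beta> (qmul \<alpha> \<beta> s u) (qmul \<alpha> \<beta> (qconj w) v) = qpol \<alpha> \<beta> (qmul \<alpha> \<beta> w s) (qmul \<alpha> \<beta> v (qconj u))"
  by (cases s; cases u; cases w; cases v) (simp add: qpol_def qmul_def qconj_def algebra_simps)

lemma onrm_omul: "onrm \<alpha> \<beta> \<gamma> (omul \<alpha> \<beta> \<gamma> p q) = onrm \<alpha> \<beta> \<gamma> p * onrm \<alpha> \<beta> \<gamma> q"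
proof -
  obtain u v u' v' where "p = (u, v)" "q = (u', v')" by (cases p; cases q)
  then show ?thesis
    by (simp add: omul_def onrm_def qnrm_add qnrm_diff_scl qnrm_qmul qnrm_qconj qpol_qmul_exchange[of _ _ u u' v' v]
        power2_eq_square algebra_simps)
qed

lemma vector_space_field: "vector_space ((*) :: 'a::field \<Rightarrow> 'a \<Rightarrow> 'a)"
  by unfold_locales (simp_all add: algebra_simps)

lemma polar_cd_alg: "polar (cd_alg \<alpha> \<beta> \<gamma>) u v =
  qpol \<alpha> \<beta> (fst (of8 u)) (fst (of8 v)) + \<gamma> * qpol \<alpha> \<beta> (snd (of8 u)) (snd (of8 v))"
  by (simp add: polar_def cd_alg_def of8_linear onrm_def split_beta qnrm_add algebra_simps)

lemma composition_algebra_cd: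
  fixes \<alpha> :: "'a::field"
  assumes two: "(2::'a) \<noteq> 0" and nz: "\<alpha> \<noteq> 0" "\<beta> \<noteq> 0" "\<gamma> \<noteq> 0"
  shows "composition_algebra (cd_alg \<alpha> \<beta> \<gamma>)"
proof -
  have vs: "vector_space ((*s) :: 'a \<Rightarrow> 'a ^ 8 \<Rightarrow> 'a ^ 8)" by unfold_locales (simp_all add: vec_eq_iff algebra_simps)
  have q: "qmul \<alpha> \<beta> (s + t) u = qmul \<alpha> \<beta> s u + qmul \<alpha> \<beta> t u" "qmul \<alpha> \<beta> u (s + t) = qmul \<alpha> \<beta> u s + qmul \<alpha> \<beta> u t"
    "qmul \<alpha> \<beta> (qscl r s) u = qscl r (qmul \<alpha> \<beta> s u)" "qmul \<alpha> \<beta> u (qscl r s) = qscl r (qmul \<alpha> \<beta> u s)"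
    "qconj (s + t) = qconj s + qconj t" "qconj (qscl r s) = qscl r (qconj s)"
    "qscl r (s + t) = qscl r s + qscl r t" "qscl r (s - t) = qscl r s - qscl r t" "qscl r (qscl k s) = qscl k (qscl r s)" for s t u r k
    by (cases s; cases t; cases u; simp add: qmul_def qconj_def qscl_def algebra_simps)+
  have o: "omul \<alpha> \<beta> \<gamma> (x + y) z = omul \<alpha> \<beta> \<gamma> x z + omul \<alpha> \<beta> \<gamma> y z"
    "omul \<alpha> \<beta> \<gamma> z (x + y) = omul \<alpha> \<beta> \<gamma> z x + omul \<alpha> \<beta> \<gamma> z y"
    "omul \<alpha> \<beta> \<gamma> (oscl r x) z = oscl r (omul \<alpha> \<beta> \<gamma> x z)" "omul \<alpha> \<beta> \<gamma> z (oscl r x) = oscl r (omul \<alpha> \<beta> \<gamma> z x)" for x y z r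
    unfolding omul_def oscl_def split_beta fst_add snd_add fst_conv snd_conv q by (simp_all add: algebra_simps)
  have p: "qpol \<alpha> \<beta> s (t + u) = qpol \<alpha> \<beta> s t + qpol \<alpha> \<beta> s u" "qpol \<alpha> \<beta> s (qscl r u) = r * qpol \<alpha> \<beta> s u" for s t u r
    by (cases s; cases t; cases u; simp add: qpol_def qscl_def algebra_simps)+
  have one: "omul \<alpha> \<beta> \<gamma> ((1, 0, 0, 0), (0, 0, 0, 0)) x = x" "omul \<alpha> \<beta> \<gamma> x ((1, 0, 0, 0), (0, 0, 0, 0)) = x" for x
    by (cases x; simp add: omul_def qmul_def qconj_def qscl_def split_beta)+
  have nd: "nondegenerate_on (cd_alg \<alpha> \<beta> \<gamma>) UNIV"
    unfolding nondegenerate_on_def polar_cd_alg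
  proof (intro ballI impI)
    fix x :: "'a ^ 8"
    assume "\<forall>y\<in>UNIV. qpol \<alpha> \<beta> (fst (of8 x)) (fst (of8 y)) + \<gamma> * qpol \<alpha> \<beta> (snd (of8 x)) (snd (of8 y)) = 0"
    then have h: "qpol \<alpha> \<beta> (fst (of8 x)) s + \<gamma> * qpol \<alpha> \<beta> (snd (of8 x)) t = 0" for s t
      using of8_to8[of "(s, t)"] by (metis UNIV_I fst_conv snd_conv)
    obtain x0 x1 x2 x3 x4 x5 x6 x7 where x: "of8 x = ((x0, x1, x2, x3), (x4, x5, x6, x7))" by (metis prod.exhaust)
    have "of8 x = ((0, 0, 0, 0), (0, 0, 0, 0))"
      using h[of "(1, 0, 0, 0)" "(0, 0, 0, 0)"] h[of "(0, 1, 0, 0)" "(0, 0, 0, 0)"] h[of "(0, 0, 1, 0)" "(0, 0, 0, 0)"]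
        h[of "(0, 0, 0, 1)" "(0, 0, 0, 0)"] h[of "(0, 0, 0, 0)" "(1, 0, 0, 0)"] h[of "(0, 0, 0, 0)" "(0, 1, 0, 0)"]
        h[of "(0, 0, 0, 0)" "(0, 0, 1, 0)"] h[of "(0, 0, 0, 0)" "(0, 0, 0, 1)"] two nz
      unfolding x by (simp add: qpol_def)
    then have "x = to8 ((0, 0, 0, 0), (0, 0, 0, 0))" by (metis to8_of8)
    then show "x = 0" by (simp add: to8_def vec_eq_iff)
  qed
  have sc: "onrm \<alpha> \<beta> \<gamma> (oscl r x) = r\<^sup>2 * onrm \<alpha> \<beta> \<gamma> x" for r x
    by (cases x) (simp add: onrm_def oscl_def qnrm_def qscl_def split_beta power_mult_distrib algebra_simps)
  have "polar (cd_alg \<alpha> \<beta> \<gamma>) x (y + z) = polar (cd_alg \<alpha> \<beta> \<gamma>) x y + polar (cd_alg \<alpha> \<beta> \<gamma>) x z"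
    "polar (cd_alg \<alpha> \<beta> \<gamma>) x (r *s y) = r * polar (cd_alg \<alpha> \<beta> \<gamma>) x y" for x y z r
    unfolding polar_cd_alg of8_linear oscl_def split_beta fst_add snd_add fst_conv snd_conv p by (simp_all add: algebra_simps)
  with nd vs vector_space_field show ?thesis
    by (simp add: composition_algebra_def Vector_Spaces.linear_iff)
      (simp add: cd_alg_def of8_linear to8_linear o one onrm_omul sc)
qed

section \<open>Zorn's algebra as a Cayley-Dickson algebra\<close>

lemma Zorn_simps:
  "scl Zorn s (a, u, v, b) = (s * a, s *s u, s *s v, s * b)"
  "mul Zorn (a, u, v, b) (a', u', v', b') = (a * a' + dotp u v', a *s u' + b' *s u - cross v v',
               a' *s v + b *s v' + cross u u', b * b' + dotp v u')"
  "unt Zorn = (1, 0, 0, 1)" "nrm Zorn (a, u, v, b) = a * b - dotp u v"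
  by (simp_all add: Zorn_def)

lemma dotp_3: "dotp u v = u $ 1 * v $ 1 + u $ 2 * v $ 2 + u $ 3 * v $ (3::3)"
  by (simp add: dotp_def sum_3)

lemma cross_nth [simp]: "cross u v $ 1 = u $ 2 * v $ 3 - u $ 3 * v $ 2" "cross u v $ 2 = u $ 3 * v $ 1 - u $ 1 * v $ 3"
  "cross u v $ 3 = u $ 1 * v $ 2 - u $ 2 * v $ 1"
  by (simp_all add: cross_def)

lemma polar_Zorn: "polar Zorn (a, u, v, b) (a', u', v', b') = a * b' + a' * b - dotp u v' - dotp u' v"
  by (simp add: polar_def Zorn_simps dotp_3 algebra_simps)

lemma composition_algebra_Zorn: "composition_algebra (Zorn :: ('a::field, _) calg)"
proof -
  let ?Z = "Zorn :: ('a, 'a \<times> ('a ^ 3) \<times> ('a ^ 3) \<times> 'a) calg"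
  have vs: "vector_space (scl ?Z)"
    by unfold_locales (auto simp: Zorn_simps vec_eq_iff algebra_simps)
  have nd: "x = 0" if "\<forall>y. polar ?Z x y = 0" for x
  proof -
    obtain a u v b where x: "x = (a, u, v, b)" by (metis prod.exhaust)
    have h: "a * b' + a' * b - dotp u v' - dotp u' v = 0" for a' u' v' b'
      using that unfolding x by (metis polar_Zorn)
    have ax: "dotp w (axis k 1) = w $ k" "dotp (axis k 1) w = w $ k" "dotp w 0 = 0" "dotp 0 w = 0" for w :: "'a ^ 3" and k
      by (simp_all add: dotp_def axis_def if_distrib[of "\<lambda>c. c * _"] if_distrib[of "\<lambda>c. _ * c"] cong: if_cong)
    have "a = 0" "b = 0" using h[where a' = 1 and u' = 0 and v' = 0 and b' = 0] h[where a' = 0 and u' = 0 and v' = 0 and b' = 1] by (simp_all add: ax)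
    moreover have "u $ k = 0" "v $ k = 0" for k
      using h[where a' = 0 and u' = 0 and v' = "axis k 1" and b' = 0]
        h[where a' = 0 and u' = "axis k 1" and v' = 0 and b' = 0] by (simp_all add: ax)
    ultimately show ?thesis by (simp add: x zero_prod_def vec_eq_iff)
  qed
  show ?thesis
    unfolding composition_algebra_def Vector_Spaces.linear_iff nondegenerate_on_def
    using nd by (auto simp: vs vector_space_field Zorn_simps polar_Zorn vec_eq_iff forall_3 dotp_3 power2_eq_square algebra_simps)
qed

lemma comp_alg_cd:
  fixes \<alpha> :: "'a::field"
  assumes "(2::'a) \<noteq> 0" "\<alpha> \<noteq> 0" "\<beta> \<noteq> 0" "\<gamma> \<noteq> 0"
  shows "comp_alg (cd_alg \<alpha> \<beta> \<gamma>)"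
proof
  show "composition_algebra (cd_alg \<alpha> \<beta> \<gamma>)" using assms by (rule composition_algebra_cd)
  have "to8 ((1, 0, 0, 0), (0, 0, 0, 0)) $ 0 = (1 :: 'a)" by (simp add: to8_def)
  then show "unt (cd_alg \<alpha> \<beta> \<gamma>) \<noteq> 0" by (auto simp: cd_alg_def simp del: of8_to8)
qed (rule assms(1))

lemma cd_alg_simps:
  "scl (cd_alg \<alpha> \<beta> \<gamma>) r (to8 p) = to8 (oscl r p)" "mul (cd_alg \<alpha> \<beta> \<gamma>) (to8 p) (to8 q) = to8 (omul \<alpha> \<beta> \<gamma> p q)"
  "unt (cd_alg \<alpha> \<beta> \<gamma>) = to8 ((1, 0, 0, 0), (0, 0, 0, 0))" "nrm (cd_alg \<alpha> \<beta> \<gamma>) (to8 p) = onrm \<alpha> \<beta> \<gamma> p"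
  by (simp_all add: cd_alg_def to8_linear)

lemma cd_alg_triple:
  fixes \<alpha> :: "'a::field"
  assumes nz: "(2::'a) \<noteq> 0" "\<alpha> \<noteq> 0" "\<beta> \<noteq> 0" "\<gamma> \<noteq> 0"
  obtains a b c where "cd_triple (cd_alg \<alpha> \<beta> \<gamma>) a b c \<alpha> \<beta> \<gamma>" "surj (comp_alg.octo (cd_alg \<alpha> \<beta> \<gamma>) a b c)"
proof -
  let ?C = "cd_alg \<alpha> \<beta> \<gamma>"
  interpret comp_alg ?C using nz by (rule comp_alg_cd)
  let ?a = "to8 ((0, 1, 0, 0), (0, 0, 0, 0)) :: 'a ^ 8" and ?b = "to8 ((0, 0, 1, 0), (0, 0, 0, 0)) :: 'a ^ 8"
    and ?c = "to8 ((0, 0, 0, 0), (1, 0, 0, 0)) :: 'a ^ 8"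
  have "cd_triple ?C ?a ?b ?c \<alpha> \<beta> \<gamma>"
    unfolding cd_triple_def cd_alg_simps polar_cd_alg of8_to8
    by (simp add: onrm_def qnrm_def qpol_def omul_def qmul_def qconj_def qscl_def)
  moreover have "octo ?a ?b ?c p = to8 p" for p
  proof -
    obtain p0 p1 p2 p3 p4 p5 p6 p7 where p: "p = ((p0, p1, p2, p3), (p4, p5, p6, p7))" by (metis prod.exhaust)
    show ?thesis
      unfolding p octo_def quat_def split_conv cd_alg_simps to8_linear(1)[symmetric]
      by (simp add: omul_def oscl_def qmul_def qconj_def qscl_def)
  qed
  then have "surj (octo ?a ?b ?c)" by (metis surjI to8_of8)
  ultimately show ?thesis by (rule that)
qed

lemma comp_alg_Zorn: "(2::'a::field) \<noteq> 0 \<Longrightarrow> comp_alg (Zorn :: ('a, _) calg)"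
  by unfold_locales (simp_all add: composition_algebra_Zorn Zorn_simps zero_prod_def)

text \<open>The split flag admits every parameter triple whose first entry is -r^2: the diagonal
  element with entries r and -r spans K with the unit, and antidiagonal elements take every
  norm.\<close>

lemma Zorn_triple:
  fixes r :: "'a::field"
  assumes nz: "(2::'a) \<noteq> 0" "r \<noteq> 0" "\<beta> \<noteq> 0" "\<gamma> \<noteq> 0"
  obtains a b c where "cd_triple Zorn a b c (- r\<^sup>2) \<beta> \<gamma>" "surj (comp_alg.octo Zorn a b c)"
    "{comp_alg.quat Zorn a b (s, t, 0, 0) | s t. True} = Zorn_diag"
proof -
  interpret comp_alg "Zorn :: ('a, _) calg" using nz(1) by (rule comp_alg_Zorn)
  have four: "(4::'a) \<noteq> 0" using nz(1) by (metis mult_2 mult_eq_0_iff numeral_Bit0)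
  let ?a = "(r, 0, 0, - r) :: 'a \<times> ('a ^ 3) \<times> ('a ^ 3) \<times> 'a" and ?b = "(0, axis 1 1, axis 1 (- \<beta>), 0) :: 'a \<times> ('a ^ 3) \<times> ('a ^ 3) \<times> 'a"
    and ?c = "(0, axis 2 1, axis 2 (- \<gamma>), 0) :: 'a \<times> ('a ^ 3) \<times> ('a ^ 3) \<times> 'a"
  have ab: "mul Zorn ?a ?b = (0, axis 1 r, axis 1 (r * \<beta>), 0)"
    by (simp add: Zorn_simps vec_eq_iff forall_3 dotp_3 axis_def)
  have "cd_triple Zorn ?a ?b ?c (- r\<^sup>2) \<beta> \<gamma>"
    unfolding cd_triple_def ab by (simp add: Zorn_simps polar_Zorn dotp_3 axis_def power2_eq_square)
  moreover have quat: "quat ?a ?b (s0, s1, s2, s3) = (s0 + r * s1, axis 1 (s2 + r * s3), axis 1 (\<beta> * (r * s3 - s2)), s0 - r * s1)" for s0 s1 s2 s3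
    unfolding quat_def split_conv ab by (simp add: Zorn_simps vec_eq_iff forall_3 axis_def algebra_simps)
  have octo: "octo ?a ?b ?c ((s0, s1, s2, s3), (s4, s5, s6, s7)) =
    (s0 + r * s1, vector [s2 + r * s3, s4 + r * s5, \<beta> * \<gamma> * (r * s7 - s6)],
     vector [\<beta> * (r * s3 - s2), \<gamma> * (r * s5 - s4), s6 + r * s7], s0 - r * s1)" for s0 s1 s2 s3 s4 s5 s6 s7
    unfolding octo_def split_conv quat by (simp add: Zorn_simps vec_eq_iff forall_3 dotp_3 axis_def algebra_simps)
  have "\<exists>p. x = octo ?a ?b ?c p" for x
  proof -
    obtain a u v b where x: "x = (a, u, v, b)" by (metis prod.exhaust)
    \<comment> \<open>The formula for \<open>octo\<close> splits into four two-by-two systems, one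
      for the diagonal and one for each coordinate of the two vectors; this is their
      solution.\<close>
    have "x = octo ?a ?b ?c (((a + b) / 2, (a - b) / (2 * r), (u $ 1 - v $ 1 / \<beta>) / 2, (u $ 1 + v $ 1 / \<beta>) / (2 * r)),
      ((u $ 2 - v $ 2 / \<gamma>) / 2, (u $ 2 + v $ 2 / \<gamma>) / (2 * r), (v $ 3 - u $ 3 / (\<beta> * \<gamma>)) / 2, (v $ 3 + u $ 3 / (\<beta> * \<gamma>)) / (2 * r)))"
      unfolding x octo using nz four by (simp add: vec_eq_iff forall_3 field_simps)
    then show ?thesis by blast
  qed
  then have "surj (octo ?a ?b ?c)" unfolding surj_def by blast
  moreover have "{quat ?a ?b (s, t, 0, 0) | s t. True} = Zorn_diag"
  proof -
    have z: "axis 1 0 = (0 :: 'a ^ 3)" by (simp add: vec_eq_iff axis_def)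
    have *: "(a, 0, 0, b) = quat ?a ?b ((a + b) / 2, (a - b) / (2 * r), 0, 0)" for a b
      unfolding quat using nz four by (simp add: z field_simps)
    show ?thesis
    proof (intro subset_antisym subsetI)
      fix x assume "x \<in> {quat ?a ?b (s, t, 0, 0) | s t. True}"
      then show "x \<in> Zorn_diag" unfolding quat Zorn_diag_def by (auto simp: z)
    next
      fix x :: "'a \<times> ('a ^ 3) \<times> ('a ^ 3) \<times> 'a" assume "x \<in> Zorn_diag"
      then obtain a b where "x = (a, 0, 0, b)" unfolding Zorn_diag_def by blast
      then show "x \<in> {quat ?a ?b (s, t, 0, 0) | s t. True}" using *[of a b] by blast
    qed
  qed
  ultimately show ?thesis by (rule that)
qed



section \<open>Isomorphisms of norm-one groups\<close>

text \<open>On a finite field the product of all X - a, plus 1, has no root. Infinitude lets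
  polynomial identities be inferred from values.\<close>

lemma infinite_alg_closed: "infinite (UNIV :: 'a::alg_closed_field set)"
proof
  assume fin: "finite (UNIV :: 'a set)"
  define p :: "'a poly" where "p = (\<Prod>a\<in>UNIV. [:- a, 1:]) + 1"
  have d: "degree (\<Prod>a\<in>UNIV. [:- a, 1:] :: 'a poly) = card (UNIV :: 'a set)"
    by (subst degree_prod_eq_sum_degree) (simp_all add: fin)
  have "card (UNIV :: 'a set) > 0" using fin by (simp add: card_gt_0_iff)
  then have "degree p > 0" unfolding p_def using d by (subst degree_add_eq_left) simp_all
  then obtain z where "poly p z = 0" using alg_closed_imp_poly_has_root by blast
  moreover have "poly p z = 1"
    unfolding p_def by (simp add: poly_prod) (rule prod_zero[OF fin], rule bexI[of _ z], simp_all)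
  ultimately show False by simp
qed

text \<open>The formal Taylor expansion at 0 of a function that is rational off the zeros of a polynomial.\<close>

definition expands :: "('f::alg_closed_field \<Rightarrow> 'f) \<Rightarrow> 'f fps \<Rightarrow> bool" where
  "expands f G \<longleftrightarrow> (\<exists>P D. poly D 0 \<noteq> 0 \<and> G * fps_of_poly D = fps_of_poly P \<and>
     (\<forall>t. poly D t \<noteq> 0 \<longrightarrow> f t * poly D t = poly P t))"

lemma expands_const: "expands (\<lambda>t. c) (fps_const c)"
  unfolding expands_def by (intro exI[of _ "[:c:]"] exI[of _ 1]) (simp add: fps_of_poly_const)

lemma expands_add:
  assumes "expands f G" "expands g H"
  shows "expands (\<lambda>t. f t + g t) (G + H)"
proof -
  obtain P D where 1: "poly D 0 \<noteq> 0" "G * fps_of_poly D = fps_of_poly P" "\<And>t. poly D t \<noteq> 0 \<Longrightarrow> f t * poly D t = poly P t"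
    using assms(1) unfolding expands_def by blast
  obtain Q E where 2: "poly E 0 \<noteq> 0" "H * fps_of_poly E = fps_of_poly Q" "\<And>t. poly E t \<noteq> 0 \<Longrightarrow> g t * poly E t = poly Q t"
    using assms(2) unfolding expands_def by blast
  have "(G + H) * fps_of_poly (D * E) = fps_of_poly (P * E + Q * D)"
    by (simp add: fps_of_poly_mult fps_of_poly_add flip: 1(2) 2(2)) (simp add: algebra_simps)
  moreover have "(f t + g t) * poly (D * E) t = poly (P * E + Q * D) t" if "poly (D * E) t \<noteq> 0" for t
    using that by (simp flip: 1(3) 2(3)) (simp add: algebra_simps)
  moreover have "poly (D * E) 0 \<noteq> 0" using 1(1) 2(1) by simp
  ultimately show ?thesis unfolding expands_def by blast
qed

lemma expands_mult:
  assumes "expands f G" "expands g H"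
  shows "expands (\<lambda>t. f t * g t) (G * H)"
proof -
  obtain P D where 1: "poly D 0 \<noteq> 0" "G * fps_of_poly D = fps_of_poly P" "\<And>t. poly D t \<noteq> 0 \<Longrightarrow> f t * poly D t = poly P t"
    using assms(1) unfolding expands_def by blast
  obtain Q E where 2: "poly E 0 \<noteq> 0" "H * fps_of_poly E = fps_of_poly Q" "\<And>t. poly E t \<noteq> 0 \<Longrightarrow> g t * poly E t = poly Q t"
    using assms(2) unfolding expands_def by blast
  have "(G * H) * fps_of_poly (D * E) = fps_of_poly (P * Q)"
    by (simp add: fps_of_poly_mult flip: 1(2) 2(2))
  moreover have "(f t * g t) * poly (D * E) t = poly (P * Q) t" if "poly (D * E) t \<noteq> 0" for t
    using that by (simp flip: 1(3) 2(3))
  moreover have "poly (D * E) 0 \<noteq> 0" using 1(1) 2(1) by simp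
  ultimately show ?thesis unfolding expands_def by blast
qed

text \<open>Two functions with the same values off the zeros of E have quotients P/D and Q/F that
  agree as rational functions, because a nonzero polynomial cannot vanish on an infinite
  field.\<close>

lemma expands_unique:
  assumes "expands f G" "expands g H" and E: "poly E 0 \<noteq> 0" "\<And>t. poly E t \<noteq> 0 \<Longrightarrow> f t = g t"
  shows "G = H"
proof -
  obtain P D where 1: "poly D 0 \<noteq> 0" "G * fps_of_poly D = fps_of_poly P" "\<And>t. poly D t \<noteq> 0 \<Longrightarrow> f t * poly D t = poly P t"
    using assms(1) unfolding expands_def by blast
  obtain Q F where 2: "poly F 0 \<noteq> 0" "H * fps_of_poly F = fps_of_poly Q" "\<And>t. poly F t \<noteq> 0 \<Longrightarrow> g t * poly F t = poly Q t"
    using assms(2) unfolding expands_def by blast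
  have "poly ((P * F - Q * D) * (E * (D * F))) t = 0" for t
    using 1(3)[of t] 2(3)[of t] E(2)[of t] by (cases "poly E t = 0 \<or> poly D t = 0 \<or> poly F t = 0") (auto simp: algebra_simps simp flip: 1(3) 2(3))
  then have "(P * F - Q * D) * (E * (D * F)) = 0"
    using poly_roots_finite[of "(P * F - Q * D) * (E * (D * F))"] infinite_alg_closed[where ?'a = 'a] by auto
  moreover have "E \<noteq> 0" "D \<noteq> 0" "F \<noteq> 0" using E 1(1) 2(1) by auto
  ultimately have "P * F = Q * D" by auto
  then have "fps_of_poly (P * F) = fps_of_poly (Q * D)" by simp
  then have "D = 0 \<or> F = 0 \<or> G = H"
    by (auto simp: fps_of_poly_mult simp flip: 1(2) 2(2))
  then show ?thesis using \<open>D \<noteq> 0\<close> \<open>F \<noteq> 0\<close> by auto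
qed

text \<open>The chain rule, by induction on the generation of polynomial functions. The gradient d
  is the same for all curves through u, and it lies in k because both the coefficients and the point
  u are rational over k.\<close>

lemma poly_funs_gradient:
  fixes p :: "'a::field alg_closure ^ 4 \<Rightarrow> 'a alg_closure"
  assumes "p \<in> poly_funs vec_coords" and e: "\<And>i. u $ i \<in> range to_ac"
  shows "\<exists>d0 d. p u = to_ac d0 \<and> (\<forall>c C. (\<forall>i. expands (\<lambda>t. c t $ i) (C i) \<and> fps_nth (C i) 0 = u $ i) \<longrightarrow>
    (\<exists>G. expands (\<lambda>t. p (c t)) G \<and> fps_nth G 0 = to_ac d0 \<and> fps_nth G 1 = (\<Sum>i\<in>UNIV. to_ac (d i) * fps_nth (C i) 1)))"
  using assms(1)
proof induction
  case (coord c)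
  then obtain j where c: "c = (\<lambda>s. s $ j)" by (auto simp: vec_coords_def)
  obtain d0 where d0: "u $ j = to_ac d0" using e[of j] by auto
  have s: "(\<Sum>i\<in>UNIV. to_ac (if i = j then 1 else 0 :: 'a) * f i) = f j" for f :: "4 \<Rightarrow> 'a alg_closure"
    by (simp add: if_distrib[of to_ac] if_distrib[of "\<lambda>c. c * _"] cong: if_cong)
  show ?case
    by (rule exI[of _ d0], rule exI[of _ "\<lambda>i. if i = j then 1 else 0"]) (use d0 in \<open>auto simp: c s\<close>)
next
  case (const a)
  show ?case
    by (rule exI[of _ a], rule exI[of _ "\<lambda>i. 0"]) (auto intro!: exI[of _ "fps_const (to_ac a)"] expands_const)
next
  case (add p q)
  obtain p0 p1 where p: "p u = to_ac p0" "\<And>c C. \<forall>i. expands (\<lambda>t. c t $ i) (C i) \<and> fps_nth (C i) 0 = u $ i \<Longrightarrow>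
    (\<exists>G. expands (\<lambda>t. p (c t)) G \<and> fps_nth G 0 = to_ac p0 \<and> fps_nth G 1 = (\<Sum>i\<in>UNIV. to_ac (p1 i) * fps_nth (C i) 1))"
    using add.IH(1) by blast
  obtain q0 q1 where q: "q u = to_ac q0" "\<And>c C. \<forall>i. expands (\<lambda>t. c t $ i) (C i) \<and> fps_nth (C i) 0 = u $ i \<Longrightarrow>
    (\<exists>G. expands (\<lambda>t. q (c t)) G \<and> fps_nth G 0 = to_ac q0 \<and> fps_nth G 1 = (\<Sum>i\<in>UNIV. to_ac (q1 i) * fps_nth (C i) 1))"
    using add.IH(2) by blast
  show ?case
  proof (rule exI[of _ "p0 + q0"], rule exI[of _ "\<lambda>i. p1 i + q1 i"], intro conjI allI impI)
    show "p u + q u = to_ac (p0 + q0)" by (simp add: p q)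
    fix c :: "'a alg_closure \<Rightarrow> 'a alg_closure ^ 4" and C
    assume C: "\<forall>i. expands (\<lambda>t. c t $ i) (C i) \<and> fps_nth (C i) 0 = u $ i"
    obtain G where "expands (\<lambda>t. p (c t)) G" "fps_nth G 0 = to_ac p0" "fps_nth G 1 = (\<Sum>i\<in>UNIV. to_ac (p1 i) * fps_nth (C i) 1)"
      using p(2)[OF C] by blast
    moreover obtain H where "expands (\<lambda>t. q (c t)) H" "fps_nth H 0 = to_ac q0" "fps_nth H 1 = (\<Sum>i\<in>UNIV. to_ac (q1 i) * fps_nth (C i) 1)"
      using q(2)[OF C] by blast
    ultimately show "\<exists>G. expands (\<lambda>t. p (c t) + q (c t)) G \<and> fps_nth G 0 = to_ac (p0 + q0) \<and>
        fps_nth G 1 = (\<Sum>i\<in>UNIV. to_ac (p1 i + q1 i) * fps_nth (C i) 1)"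
      by (intro exI[of _ "G + H"]) (simp add: expands_add distrib_right sum.distrib)
  qed
next
  case (mult p q)
  obtain p0 p1 where p: "p u = to_ac p0" "\<And>c C. \<forall>i. expands (\<lambda>t. c t $ i) (C i) \<and> fps_nth (C i) 0 = u $ i \<Longrightarrow>
    (\<exists>G. expands (\<lambda>t. p (c t)) G \<and> fps_nth G 0 = to_ac p0 \<and> fps_nth G 1 = (\<Sum>i\<in>UNIV. to_ac (p1 i) * fps_nth (C i) 1))"
    using mult.IH(1) by blast
  obtain q0 q1 where q: "q u = to_ac q0" "\<And>c C. \<forall>i. expands (\<lambda>t. c t $ i) (C i) \<and> fps_nth (C i) 0 = u $ i \<Longrightarrow>
    (\<exists>G. expands (\<lambda>t. q (c t)) G \<and> fps_nth G 0 = to_ac q0 \<and> fps_nth G 1 = (\<Sum>i\<in>UNIV. to_ac (q1 i) * fps_nth (C i) 1))"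
    using mult.IH(2) by blast
  show ?case
  proof (rule exI[of _ "p0 * q0"], rule exI[of _ "\<lambda>i. p0 * q1 i + q0 * p1 i"], intro conjI allI impI)
    show "p u * q u = to_ac (p0 * q0)" by (simp add: p q)
    fix c :: "'a alg_closure \<Rightarrow> 'a alg_closure ^ 4" and C
    assume C: "\<forall>i. expands (\<lambda>t. c t $ i) (C i) \<and> fps_nth (C i) 0 = u $ i"
    obtain G where G: "expands (\<lambda>t. p (c t)) G" "fps_nth G 0 = to_ac p0" "fps_nth G 1 = (\<Sum>i\<in>UNIV. to_ac (p1 i) * fps_nth (C i) 1)"
      using p(2)[OF C] by blast
    obtain H where H: "expands (\<lambda>t. q (c t)) H" "fps_nth H 0 = to_ac q0" "fps_nth H 1 = (\<Sum>i\<in>UNIV. to_ac (q1 i) * fps_nth (C i) 1)"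
      using q(2)[OF C] by blast
    have "fps_nth (G * H) 1 = fps_nth G 0 * fps_nth H 1 + fps_nth G 1 * fps_nth H 0"
      by (simp add: fps_mult_nth)
    also have "\<dots> = (\<Sum>i\<in>UNIV. to_ac (p0 * q1 i + q0 * p1 i) * fps_nth (C i) 1)"
      unfolding G(2,3) H(2,3) sum_distrib_left sum_distrib_right sum.distrib[symmetric]
      by (intro sum.cong refl) (simp add: algebra_simps)
    finally show "\<exists>G. expands (\<lambda>t. p (c t) * q (c t)) G \<and> fps_nth G 0 = to_ac (p0 * q0) \<and>
        fps_nth G 1 = (\<Sum>i\<in>UNIV. to_ac (p0 * q1 i + q0 * p1 i) * fps_nth (C i) 1)"
      using G H by (intro exI[of _ "G * H"]) (simp add: expands_mult)
  qed
qed

section \<open>Quaternions as vectors, conjugation and the Cayley curves\<close>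

lemma UNIV_4: "(UNIV :: 4 set) = {0, 1, 2, 3}"
  by (rule sym, rule card_subset_eq) simp_all

lemma sum_UNIV_4: "(\<Sum>i\<in>UNIV. f i) = f 0 + f 1 + f 2 + f (3::4)"
  unfolding UNIV_4 by (simp add: add.assoc)

lemma all_UNIV_4: "(\<forall>i::4. P i) \<longleftrightarrow> P 0 \<and> P 1 \<and> P 2 \<and> P 3"
proof -
  have "(\<forall>i. P i) \<longleftrightarrow> (\<forall>i\<in>UNIV. P i)" by simp
  then show ?thesis unfolding UNIV_4 by simp
qed

lemma vec_4_eqI:
  assumes "u $ 0 = v $ 0" "u $ 1 = v $ 1" "u $ 2 = v $ 2" "u $ 3 = v $ (3::4)"
  shows "u = v"
proof -
  have "\<forall>i. u $ i = v $ i" unfolding all_UNIV_4 using assms by blast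
  then show ?thesis by (simp add: vec_eq_iff)
qed

definition vec4 :: "'b \<Rightarrow> 'b \<Rightarrow> 'b \<Rightarrow> 'b \<Rightarrow> 'b ^ 4" where
  "vec4 a b c d = (\<chi> i. if i = 0 then a else if i = 1 then b else if i = 2 then c else d)"

lemma vec4_nth [simp]: "vec4 a b c d $ 0 = a" "vec4 a b c d $ 1 = b" "vec4 a b c d $ 2 = c" "vec4 a b c d $ 3 = d"
  by (simp_all add: vec4_def)

text \<open>The product \<open>qmul\<close>, now on vectors of length 4, the shape in which norm-one
  groups are given over the closure.\<close>

definition qm :: "'b::field \<Rightarrow> 'b \<Rightarrow> 'b ^ 4 \<Rightarrow> 'b ^ 4 \<Rightarrow> 'b ^ 4" where
  "qm \<alpha> \<beta> s t = vec4
    (s $ 0 * t $ 0 - \<alpha> * s $ 1 * t $ 1 - \<beta> * s $ 2 * t $ 2 - \<alpha> * \<beta> * s $ 3 * t $ 3)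
    (s $ 0 * t $ 1 + s $ 1 * t $ 0 + \<beta> * (s $ 2 * t $ 3 - s $ 3 * t $ 2))
    (s $ 0 * t $ 2 + s $ 2 * t $ 0 + \<alpha> * (s $ 3 * t $ 1 - s $ 1 * t $ 3))
    (s $ 0 * t $ 3 + s $ 3 * t $ 0 + s $ 1 * t $ 2 - s $ 2 * t $ 1)"

definition qc :: "'b::field ^ 4 \<Rightarrow> 'b ^ 4" where
  "qc s = vec4 (s $ 0) (- s $ 1) (- s $ 2) (- s $ 3)"

definition qn :: "'b::field \<Rightarrow> 'b \<Rightarrow> 'b ^ 4 \<Rightarrow> 'b" where
  "qn \<alpha> \<beta> s = (s $ 0)\<^sup>2 + \<alpha> * (s $ 1)\<^sup>2 + \<beta> * (s $ 2)\<^sup>2 + \<alpha> * \<beta> * (s $ 3)\<^sup>2"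

abbreviation q1 :: "'b::field ^ 4" where "q1 \<equiv> vec4 1 0 0 0"

lemma qm_assoc: "qm \<alpha> \<beta> (qm \<alpha> \<beta> s t) u = qm \<alpha> \<beta> s (qm \<alpha> \<beta> t u)"
  by (rule vec_4_eqI) (simp_all add: qm_def algebra_simps)

lemma qm_q1 [simp]: "qm \<alpha> \<beta> q1 s = s" "qm \<alpha> \<beta> s q1 = s"
  by (rule vec_4_eqI; simp add: qm_def)+

lemma qm_qc: "qm \<alpha> \<beta> s (qc s) = qn \<alpha> \<beta> s *s q1" "qm \<alpha> \<beta> (qc s) s = qn \<alpha> \<beta> s *s q1"
  by (rule vec_4_eqI; simp add: qm_def qc_def qn_def power2_eq_square algebra_simps)+

lemma qn_qm: "qn \<alpha> \<beta> (qm \<alpha> \<beta> s t) = qn \<alpha> \<beta> s * qn \<alpha> \<beta> t"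
  by (simp add: qm_def qn_def power2_eq_square algebra_simps)

lemma qn_qc [simp]: "qn \<alpha> \<beta> (qc s) = qn \<alpha> \<beta> s"
  by (simp add: qc_def qn_def)

lemma qm_linear:
  "qm \<alpha> \<beta> s (t + u) = qm \<alpha> \<beta> s t + qm \<alpha> \<beta> s u" "qm \<alpha> \<beta> s (r *s t) = r *s qm \<alpha> \<beta> s t"
  "qm \<alpha> \<beta> (t + u) s = qm \<alpha> \<beta> t s + qm \<alpha> \<beta> u s" "qm \<alpha> \<beta> (r *s t) s = r *s qm \<alpha> \<beta> t s"
  by (rule vec_4_eqI; simp add: qm_def algebra_simps)+

text \<open>Conjugation by g, as a matrix on the whole four-dimensional algebra, for g of norm
  one.\<close>

definition qad :: "'b::field \<Rightarrow> 'b \<Rightarrow> 'b ^ 4 \<Rightarrow> 'b ^ 4 ^ 4" where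
  "qad \<alpha> \<beta> g = (\<chi> i j. qm \<alpha> \<beta> g (qm \<alpha> \<beta> (axis j 1) (qc g)) $ i)"

lemma qad_mult: "qad \<alpha> \<beta> g *v x = qm \<alpha> \<beta> g (qm \<alpha> \<beta> x (qc g))"
  by (rule vec_4_eqI) (simp_all add: qad_def matrix_vector_mult_def sum_UNIV_4 qm_def axis_def algebra_simps)

text \<open>The map x -> g x h has trace tr(g) tr(h), and both g and its conjugate have trace 2
  g_0.\<close>

lemma trace_qad: "trace (qad \<alpha> \<beta> g) = 4 * (g $ 0)\<^sup>2"
  by (simp add: trace_def sum_UNIV_4 qad_def qm_def qc_def axis_def power2_eq_square algebra_simps)

lemma qad_q1: "qn \<alpha> \<beta> g = 1 \<Longrightarrow> qad \<alpha> \<beta> g *v q1 = q1"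
  by (simp add: qad_mult qm_qc)

lemma qad_pure: "x $ 0 = 0 \<Longrightarrow> (qad \<alpha> \<beta> g *v x) $ 0 = 0"
  by (simp add: qad_mult qm_def qc_def algebra_simps)

lemma qn_qad: "qn \<alpha> \<beta> g = 1 \<Longrightarrow> qn \<alpha> \<beta> (qad \<alpha> \<beta> g *v x) = qn \<alpha> \<beta> x"
  by (simp add: qad_mult qn_qm)

text \<open>The denominator is 1 up to terms of order two, so division does not affect the
  coefficients of order at most one.\<close>

lemma expands_ratio:
  assumes "poly D 0 = 1" "coeff D 1 = 0"
  shows "\<exists>G. expands (\<lambda>t. poly P t / poly D t) G \<and> fps_nth G 0 = coeff P 0 \<and> fps_nth G 1 = coeff P 1"
proof -
  define G where "G = fps_of_poly P * inverse (fps_of_poly D)"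
  have D0: "coeff D 0 = 1" using assms(1) by (simp add: poly_0_coeff_0)
  have GD: "G * fps_of_poly D = fps_of_poly P"
    unfolding G_def using inverse_mult_eq_1[of "fps_of_poly D"] D0 by (simp add: mult.assoc)
  have "expands (\<lambda>t. poly P t / poly D t) G"
    unfolding expands_def using GD assms(1) by (intro exI[of _ P] exI[of _ D]) simp
  moreover have 0: "fps_nth G 0 = coeff P 0"
    using arg_cong[OF GD, of "\<lambda>F. fps_nth F 0"] D0 by simp
  moreover have "fps_nth G 1 = coeff P 1"
    using arg_cong[OF GD, of "\<lambda>F. fps_nth F 1"] D0 assms(2) by (simp add: fps_mult_nth)
  ultimately show ?thesis by blast
qed

text \<open>The Cayley curve \<open>(1 + t x) / (1 - t x)\<close> through 1 in the norm-one group, for a pure quaternion \<open>x\<close>.\<close>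

definition cayley :: "'b::field \<Rightarrow> 'b \<Rightarrow> 'b ^ 4 \<Rightarrow> 'b \<Rightarrow> 'b ^ 4" where
  "cayley \<alpha> \<beta> x t = ((1 - qn \<alpha> \<beta> x * t\<^sup>2) / (1 + qn \<alpha> \<beta> x * t\<^sup>2)) *s q1 + (2 * t / (1 + qn \<alpha> \<beta> x * t\<^sup>2)) *s x"

lemma qn_cayley:
  assumes "x $ 0 = 0" "1 + qn \<alpha> \<beta> x * t\<^sup>2 \<noteq> 0"
  shows "qn \<alpha> \<beta> (cayley \<alpha> \<beta> x t) = 1"
proof -
  define n where "n = qn \<alpha> \<beta> x"
  define d where "d = 1 + n * t\<^sup>2"
  have n: "n = \<alpha> * (x $ 1)\<^sup>2 + \<beta> * (x $ 2)\<^sup>2 + \<alpha> * \<beta> * (x $ 3)\<^sup>2" using assms(1) by (simp add: n_def qn_def)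
  have "qn \<alpha> \<beta> (r *s q1 + m *s x) = r\<^sup>2 + m\<^sup>2 * (\<alpha> * (x $ 1)\<^sup>2 + \<beta> * (x $ 2)\<^sup>2 + \<alpha> * \<beta> * (x $ 3)\<^sup>2)" for r m
    using assms(1) by (simp add: qn_def power_mult_distrib algebra_simps)
  then have "qn \<alpha> \<beta> (cayley \<alpha> \<beta> x t) = ((1 - n * t\<^sup>2) / d)\<^sup>2 + (2 * t / d)\<^sup>2 * (\<alpha> * (x $ 1)\<^sup>2 + \<beta> * (x $ 2)\<^sup>2 + \<alpha> * \<beta> * (x $ 3)\<^sup>2)"
    unfolding cayley_def d_def n_def .
  also have "\<dots> = ((1 - n * t\<^sup>2)\<^sup>2 + 4 * t\<^sup>2 * n) / d\<^sup>2"
    unfolding n[symmetric] by (simp add: power_divide add_divide_distrib power_mult_distrib)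
  also have "(1 - n * t\<^sup>2)\<^sup>2 + 4 * t\<^sup>2 * n = d\<^sup>2"
    by (simp add: d_def n_def power2_eq_square algebra_simps)
  finally show ?thesis using assms(2) by (simp add: d_def n_def)
qed

lemma qad_cayley:
  assumes "qn \<alpha> \<beta> g = 1"
  shows "cayley \<alpha> \<beta> (qad \<alpha> \<beta> g *v x) t = qad \<alpha> \<beta> g *v cayley \<alpha> \<beta> x t"
  unfolding cayley_def qn_qad[OF assms]
  by (simp add: matrix_vector_right_distrib matrix_vector_mult_scale qad_q1[OF assms])

lemma expands_cayley:
  assumes "x $ 0 = 0"
  shows "\<exists>C. \<forall>i. expands (\<lambda>t. cayley \<alpha> \<beta> x t $ i) (C i) \<and> fps_nth (C i) 0 = q1 $ i \<and> fps_nth (C i) 1 = 2 * x $ i"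
proof -
  define n where "n = qn \<alpha> \<beta> x"
  let ?D = "[:1, 0, n:]"
  have "\<forall>i. \<exists>G. expands (\<lambda>t. cayley \<alpha> \<beta> x t $ i) G \<and> fps_nth G 0 = q1 $ i \<and> fps_nth G 1 = 2 * x $ i"
  proof
    fix i
    let ?P = "smult (q1 $ i) [:1, 0, - n:] + [:0, 2 * x $ i:]"
    have "cayley \<alpha> \<beta> x t $ i = poly ?P t / poly ?D t" for t
      by (simp add: cayley_def power2_eq_square algebra_simps add_divide_distrib diff_divide_distrib flip: n_def)
    moreover have "\<exists>G. expands (\<lambda>t. poly ?P t / poly ?D t) G \<and> fps_nth G 0 = coeff ?P 0 \<and> fps_nth G 1 = coeff ?P 1"
      by (rule expands_ratio) simp_all
    ultimately show "\<exists>G. expands (\<lambda>t. cayley \<alpha> \<beta> x t $ i) G \<and> fps_nth G 0 = q1 $ i \<and> fps_nth G 1 = 2 * x $ i"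
      by simp
  qed
  then show ?thesis by metis
qed

lemma expands_linear:
  fixes f :: "4 \<Rightarrow> 'f::alg_closed_field \<Rightarrow> 'f"
  assumes "\<And>j. expands (f j) (G j)"
  shows "expands (\<lambda>t. \<Sum>j\<in>UNIV. m j * f j t) (\<Sum>j\<in>UNIV. fps_const (m j) * G j)"
  unfolding sum_UNIV_4 by (intro expands_add expands_mult expands_const assms)

lemma expands_qn:
  assumes "\<And>j. expands (\<lambda>t. s t $ j) (G j)"
  shows "expands (\<lambda>t. qn \<alpha> \<beta> (s t)) (G 0 * G 0 + fps_const \<alpha> * (G 1 * G 1) + fps_const \<beta> * (G 2 * G 2)
    + fps_const (\<alpha> * \<beta>) * (G 3 * G 3))"
  unfolding qn_def power2_eq_square by (intro expands_add expands_mult expands_const assms)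

lemma four_nonzero: "(2::'b::field) \<noteq> 0 \<Longrightarrow> (4::'b) \<noteq> 0"
  by (metis mult_2 mult_eq_0_iff numeral_Bit0)

lemma fps_const_mult_square_nth_2:
  "fps_nth F 0 = 0 \<Longrightarrow> fps_nth (fps_const k * (F * F)) 2 = k * (fps_nth F 1)\<^sup>2" for F :: "'b::field fps"
  by (simp add: fps_mult_nth numeral_2_eq_2 power2_eq_square)

lemma norm_form_eq:
  fixes a :: "'b::field"
  assumes "c0\<^sup>2 + a * c1\<^sup>2 + b * c2\<^sup>2 + a * b * c3\<^sup>2 = 1" "h0\<^sup>2 + a' * h1\<^sup>2 + b' * h2\<^sup>2 + a' * b' * h3\<^sup>2 = 1" "c0\<^sup>2 = h0\<^sup>2"
  shows "a' * (h1 * h1) + b' * (h2 * h2) + (a' * b') * (h3 * h3) = a * (c1 * c1) + b * (c2 * c2) + (a * b) * (c3 * c3)"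
proof -
  have "a' * h1\<^sup>2 + b' * h2\<^sup>2 + a' * b' * h3\<^sup>2 = 1 - h0\<^sup>2" using assms(2) by (simp add: eq_diff_eq add_ac)
  also have "\<dots> = a * c1\<^sup>2 + b * c2\<^sup>2 + a * b * c3\<^sup>2" unfolding assms(3)[symmetric] using assms(1) by (simp add: diff_eq_eq add_ac)
  finally show ?thesis by (simp only: power2_eq_square)
qed

lemma cancel_doubled_form:
  fixes a :: "'b::field"
  assumes two: "(2::'b) \<noteq> 0" and eq: "a' * (2 * h1)\<^sup>2 + b' * (2 * h2)\<^sup>2 + c' * (2 * h3)\<^sup>2 = a * (2 * x1)\<^sup>2 + b * (2 * x2)\<^sup>2 + c * (2 * x3)\<^sup>2"
  shows "a' * h1\<^sup>2 + b' * h2\<^sup>2 + c' * h3\<^sup>2 = a * x1\<^sup>2 + b * x2\<^sup>2 + c * x3\<^sup>2"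
proof -
  have "4 * (a' * h1\<^sup>2 + b' * h2\<^sup>2 + c' * h3\<^sup>2) = 4 * (a * x1\<^sup>2 + b * x2\<^sup>2 + c * x3\<^sup>2)"
    using eq by (simp add: power_mult_distrib distrib_left mult.left_commute)
  then show ?thesis using mult_left_cancel[OF four_nonzero[OF two]] by blast
qed

text \<open>J is the Jacobian matrix of H at 1, and its columns 1 and 2 are the images of the two
  standard generators. The first two equations give the norms of these images; subtracting them from
  the third gives orthogonality.\<close>

theorem quaternion_isometry:
  fixes \<alpha> \<beta> \<alpha>' \<beta>' :: "'a::field"
    and H H' :: "'a alg_closure ^ 4 \<Rightarrow> 'a alg_closure ^ 4"
  defines "S \<equiv> {s. qn (to_ac \<alpha>) (to_ac \<beta>) s = 1}" and "S' \<equiv> {s. qn (to_ac \<alpha>') (to_ac \<beta>') s = 1}"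
  assumes two: "(2::'a) \<noteq> 0"
    and poly: "\<And>i. (\<lambda>s. H s $ i) \<in> poly_funs vec_coords" "\<And>i. (\<lambda>s. H' s $ i) \<in> poly_funs vec_coords"
    and maps: "\<And>s. s \<in> S \<Longrightarrow> H s \<in> S'" "\<And>s. s \<in> S \<Longrightarrow> H' (H s) = s"
    and hom: "\<And>s t. s \<in> S \<Longrightarrow> t \<in> S \<Longrightarrow> H (qm (to_ac \<alpha>) (to_ac \<beta>) s t) = qm (to_ac \<alpha>') (to_ac \<beta>') (H s) (H t)"
  shows "\<exists>J. \<alpha>' * (J 1 1)\<^sup>2 + \<beta>' * (J 2 1)\<^sup>2 + \<alpha>' * \<beta>' * (J 3 1)\<^sup>2 = \<alpha> \<and>
    \<alpha>' * (J 1 2)\<^sup>2 + \<beta>' * (J 2 2)\<^sup>2 + \<alpha>' * \<beta>' * (J 3 2)\<^sup>2 = \<beta> \<and>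
    \<alpha>' * (J 1 1 + J 1 2)\<^sup>2 + \<beta>' * (J 2 1 + J 2 2)\<^sup>2 + \<alpha>' * \<beta>' * (J (3::4) (1::4) + J 3 2)\<^sup>2 = \<alpha> + \<beta>"
proof -
  let ?a = "to_ac \<alpha>" and ?b = "to_ac \<beta>" and ?a' = "to_ac \<alpha>'" and ?b' = "to_ac \<beta>'"
  let ?m = "qm ?a ?b" and ?m' = "qm ?a' ?b'" and ?c = "cayley ?a ?b" and ?n = "qn ?a ?b"
  have two': "(2::'a alg_closure) \<noteq> 0" using two by (metis to_ac_eq_0_iff to_ac_numeral)
  have q1S: "q1 \<in> S" by (simp add: S_def qn_def)
  have S: "s \<in> S \<Longrightarrow> qc s \<in> S" "s \<in> S \<Longrightarrow> t \<in> S \<Longrightarrow> ?m s t \<in> S" for s t by (simp_all add: S_def qn_qm)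
  have nS: "s \<in> S' \<Longrightarrow> qn ?a' ?b' s = 1" for s by (simp add: S'_def)
  have H1: "H q1 = q1"
  proof -
    have "?m' (H q1) (H q1) = H q1" using hom[OF q1S q1S] by simp
    then have "?m' (qc (H q1)) (?m' (H q1) (H q1)) = ?m' (qc (H q1)) (H q1)" by simp
    then show ?thesis by (simp add: qm_qc nS[OF maps(1)[OF q1S]] flip: qm_assoc)
  qed
  have Hc: "H (qc s) = qc (H s)" if s: "s \<in> S" for s
  proof -
    have "?m' (H s) (H (qc s)) = q1" using hom[OF s S(1)[OF s]] s H1 by (simp add: qm_qc S_def)
    then have "?m' (qc (H s)) (?m' (H s) (H (qc s))) = qc (H s)" by simp
    then show ?thesis by (simp add: qm_qc nS[OF maps(1)[OF s]] flip: qm_assoc)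
  qed
  have k: "q1 $ i \<in> range (to_ac :: 'a \<Rightarrow> _)" for i :: 4
  proof -
    have "\<forall>i. q1 $ i \<in> range (to_ac :: 'a \<Rightarrow> _)" using rangeI[of "to_ac :: 'a \<Rightarrow> _" 0] rangeI[of "to_ac :: 'a \<Rightarrow> _" 1] unfolding all_UNIV_4 by simp
    then show ?thesis by blast
  qed
  \<comment> \<open>The rows of the differential of H at 1, with entries in k; the value at 1 is the
    unit by \<open>H1\<close>.\<close>
  have "\<forall>i. \<exists>d. \<forall>c C. (\<forall>j. expands (\<lambda>t. c t $ j) (C j) \<and> fps_nth (C j) 0 = q1 $ j) \<longrightarrow>
      (\<exists>G. expands (\<lambda>t. H (c t) $ i) G \<and> fps_nth G 0 = q1 $ i \<and> fps_nth G 1 = (\<Sum>j\<in>UNIV. to_ac (d j) * fps_nth (C j) 1))"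
  proof
    fix i
    obtain d0 d where d: "H q1 $ i = to_ac d0" "\<forall>c C. (\<forall>j. expands (\<lambda>t. c t $ j) (C j) \<and> fps_nth (C j) 0 = q1 $ j) \<longrightarrow>
      (\<exists>G. expands (\<lambda>t. H (c t) $ i) G \<and> fps_nth G 0 = to_ac d0 \<and> fps_nth G 1 = (\<Sum>j\<in>UNIV. to_ac (d j) * fps_nth (C j) 1))"
      using poly_funs_gradient[OF poly(1)[of i] k] by (elim exE conjE) (rule that)
    have d0: "to_ac d0 = q1 $ i" using d(1) H1 by simp
    show "\<exists>d. \<forall>c C. (\<forall>j. expands (\<lambda>t. c t $ j) (C j) \<and> fps_nth (C j) 0 = q1 $ j) \<longrightarrow>
      (\<exists>G. expands (\<lambda>t. H (c t) $ i) G \<and> fps_nth G 0 = q1 $ i \<and> fps_nth G 1 = (\<Sum>j\<in>UNIV. to_ac (d j) * fps_nth (C j) 1))"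
      by (rule exI[of _ d]) (rule d(2)[unfolded d0])
  qed
  from choice[OF this] obtain J where J0: "\<forall>i c C. (\<forall>j. expands (\<lambda>t. c t $ j) (C j) \<and> fps_nth (C j) 0 = q1 $ j) \<longrightarrow>
      (\<exists>G. expands (\<lambda>t. H (c t) $ i) G \<and> fps_nth G 0 = q1 $ i \<and> fps_nth G 1 = (\<Sum>j\<in>UNIV. to_ac (J i j) * fps_nth (C j) 1))"
    by (elim exE) (rule that)
  note J = J0[THEN spec, THEN spec, THEN spec, THEN mp]
  have H'1: "H' q1 = q1" using maps(2)[OF q1S] H1 by simp
  have "\<forall>i. \<exists>d. \<forall>c C. (\<forall>j. expands (\<lambda>t. c t $ j) (C j) \<and> fps_nth (C j) 0 = q1 $ j) \<longrightarrow>
      (\<exists>G. expands (\<lambda>t. H' (c t) $ i) G \<and> fps_nth G 0 = q1 $ i \<and> fps_nth G 1 = (\<Sum>j\<in>UNIV. to_ac (d j) * fps_nth (C j) 1))"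
  proof
    fix i
    obtain d0 d where d: "H' q1 $ i = to_ac d0" "\<forall>c C. (\<forall>j. expands (\<lambda>t. c t $ j) (C j) \<and> fps_nth (C j) 0 = q1 $ j) \<longrightarrow>
      (\<exists>G. expands (\<lambda>t. H' (c t) $ i) G \<and> fps_nth G 0 = to_ac d0 \<and> fps_nth G 1 = (\<Sum>j\<in>UNIV. to_ac (d j) * fps_nth (C j) 1))"
      using poly_funs_gradient[OF poly(2)[of i] k] by (elim exE conjE) (rule that)
    have d0: "to_ac d0 = q1 $ i" using d(1) H'1 by simp
    show "\<exists>d. \<forall>c C. (\<forall>j. expands (\<lambda>t. c t $ j) (C j) \<and> fps_nth (C j) 0 = q1 $ j) \<longrightarrow>
      (\<exists>G. expands (\<lambda>t. H' (c t) $ i) G \<and> fps_nth G 0 = q1 $ i \<and> fps_nth G 1 = (\<Sum>j\<in>UNIV. to_ac (d j) * fps_nth (C j) 1))"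
      by (rule exI[of _ d]) (rule d(2)[unfolded d0])
  qed
  from choice[OF this] obtain J' where J'0: "\<forall>i c C. (\<forall>j. expands (\<lambda>t. c t $ j) (C j) \<and> fps_nth (C j) 0 = q1 $ j) \<longrightarrow>
      (\<exists>G. expands (\<lambda>t. H' (c t) $ i) G \<and> fps_nth G 0 = q1 $ i \<and> fps_nth G 1 = (\<Sum>j\<in>UNIV. to_ac (J' i j) * fps_nth (C j) 1))"
    by (elim exE) (rule that)
  note J' = J'0[THEN spec, THEN spec, THEN spec, THEN mp]
  define L L' where "L = (\<chi> i j. to_ac (J i j))" and "L' = (\<chi> i j. to_ac (J' i j))"
  have cS: "?c x t \<in> S" if "x $ 0 = 0" "poly [:1, 0, ?n x:] t \<noteq> 0" for x t
    using qn_cayley[of x ?a ?b t] that by (simp add: S_def power2_eq_square algebra_simps)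
  \<comment> \<open>The Cayley curve of x leaves 1 with velocity 2x, so its image leaves 1 with
    velocity 2Lx.\<close>
  have V: "\<exists>G. \<forall>i. expands (\<lambda>t. H (?c x t) $ i) (G i) \<and> fps_nth (G i) 0 = q1 $ i \<and> fps_nth (G i) 1 = 2 * (L *v x) $ i"
    if x: "x $ 0 = 0" for x
  proof -
    obtain C where C: "\<forall>i. expands (\<lambda>t. ?c x t $ i) (C i) \<and> fps_nth (C i) 0 = q1 $ i \<and> fps_nth (C i) 1 = 2 * x $ i"
      using expands_cayley[OF x] by blast
    then have "\<forall>j. expands (\<lambda>t. ?c x t $ j) (C j) \<and> fps_nth (C j) 0 = q1 $ j" by blast
    from J[OF this] have "\<forall>i. \<exists>G. expands (\<lambda>t. H (?c x t) $ i) G \<and> fps_nth G 0 = q1 $ i \<and> fps_nth G 1 = 2 * (L *v x) $ i"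
      using C by (simp add: L_def matrix_vector_mult_def sum_distrib_left mult.left_commute)
    then show ?thesis by (rule choice)
  qed
  have D0: "poly [:1, 0, n:] 0 \<noteq> 0" for n :: "'a alg_closure" by simp
  \<comment> \<open>The linear coefficient of the norm equation along the image curve is 2 times the
    scalar part of 2Lx.\<close>
  have L0: "(L *v x) $ 0 = 0" if x: "x $ 0 = 0" for x
  proof -
    obtain G where G: "\<And>i. expands (\<lambda>t. H (?c x t) $ i) (G i)" "\<And>i. fps_nth (G i) 0 = q1 $ i"
      "\<And>i. fps_nth (G i) 1 = 2 * (L *v x) $ i" using V[OF x] by blast
    have "G 0 * G 0 + fps_const ?a' * (G 1 * G 1) + fps_const ?b' * (G 2 * G 2) + fps_const (?a' * ?b') * (G 3 * G 3)
      = fps_const 1"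
      by (rule expands_unique[OF expands_qn[OF G(1)] expands_const D0[of "?n x"]]) (rule nS[OF maps(1)[OF cS[OF x]]])
    from arg_cong[OF this, of "\<lambda>F. fps_nth F 1"] have "2 * (L *v x) $ 0 + 2 * (L *v x) $ 0 = 0"
      using G(2,3)[unfolded One_nat_def] by (simp add: fps_mult_nth)
    then have "2 * (2 * (L *v x) $ 0) = 0" by (simp only: mult_2)
    then show ?thesis using two' by (simp only: mult_eq_0_iff simp_thms)
  qed
  \<comment> \<open>Conjugation carries the Cayley curve of x to that of the conjugate of x, and H
    respects conjugation; the linear coefficients are compared.\<close>
  have equi: "L *v (qad ?a ?b g *v x) = qad ?a' ?b' (H g) *v (L *v x)" if g: "g \<in> S" and x: "x $ 0 = 0" for g x
  proof -
    have g1: "?n g = 1" using g by (simp add: S_def)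
    let ?x = "qad ?a ?b g *v x" and ?A = "qad ?a' ?b' (H g)"
    obtain G where G: "\<And>i. expands (\<lambda>t. H (?c ?x t) $ i) (G i)" "\<And>i. fps_nth (G i) 1 = 2 * (L *v ?x) $ i"
      using V[OF qad_pure[OF x]] by blast
    obtain F where F: "\<And>i. expands (\<lambda>t. H (?c x t) $ i) (F i)" "\<And>i. fps_nth (F i) 1 = 2 * (L *v x) $ i"
      using V[OF x] by blast
    have "G i = (\<Sum>j\<in>UNIV. fps_const (?A $ i $ j) * F j)" for i
    proof (rule expands_unique[OF G(1) expands_linear[OF F(1)] D0[of "?n x"]])
      fix t assume t: "poly [:1, 0, ?n x:] t \<noteq> 0"
      have e: "?c ?x t = ?m g (?m (?c x t) (qc g))" unfolding qad_cayley[OF g1] by (rule qad_mult)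
      have "H (?c ?x t) = H (?m g (?m (?c x t) (qc g)))" by (simp only: e)
      also have "\<dots> = ?m' (H g) (?m' (H (?c x t)) (qc (H g)))" using cS[OF x t] g by (simp add: hom S Hc)
      also have "\<dots> = ?A *v H (?c x t)" by (rule qad_mult[symmetric])
      finally have "H (?c ?x t) = ?A *v H (?c x t)" .
      then show "H (?c ?x t) $ i = (\<Sum>j\<in>UNIV. ?A $ i $ j * H (?c x t) $ j)" by (simp add: matrix_vector_mult_def)
    qed
    then have "2 * (L *v ?x) $ i = 2 * (?A *v (L *v x)) $ i" for i
      using G(2)[of i] F(2) by (simp add: fps_sum_nth matrix_vector_mult_def[of ?A] sum_distrib_left mult.left_commute)
    then show ?thesis using two' by (simp add: vec_eq_iff)
  qed
  \<comment> \<open>The chain rule for H' after H, along the Cayley curve.\<close>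
  have inv: "L' *v (L *v x) = x" if x: "x $ 0 = 0" for x
  proof -
    obtain G where G: "\<And>i. expands (\<lambda>t. H (?c x t) $ i) (G i)" "\<And>i. fps_nth (G i) 0 = q1 $ i"
      "\<And>i. fps_nth (G i) 1 = 2 * (L *v x) $ i" using V[OF x] by blast
    obtain C where C: "\<And>i. expands (\<lambda>t. ?c x t $ i) (C i)" "\<And>i. fps_nth (C i) 1 = 2 * x $ i"
      using expands_cayley[OF x] by blast
    have "2 * (L' *v (L *v x)) $ i = 2 * x $ i" for i
    proof -
      have "\<forall>j. expands (\<lambda>t. H (?c x t) $ j) (G j) \<and> fps_nth (G j) 0 = q1 $ j" using G by blast
      from J'[OF this, of i] obtain F where F: "expands (\<lambda>t. H' (H (?c x t)) $ i) F"
        "fps_nth F 1 = (\<Sum>j\<in>UNIV. to_ac (J' i j) * fps_nth (G j) 1)" by blast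
      have "F = C i"
      proof (rule expands_unique[OF F(1) C(1) D0[of "?n x"]])
        fix t assume "poly [:1, 0, ?n x:] t \<noteq> 0"
        from maps(2)[OF cS[OF x this]] show "H' (H (?c x t)) $ i = ?c x t $ i" by simp
      qed
      then show ?thesis
        using F(2)[unfolded G(3)] C(2)[of i]
        by (simp add: L'_def matrix_vector_mult_def[of "\<chi> i j. to_ac (J' i j)"] sum_distrib_left mult.left_commute)
    qed
    then show ?thesis using two' by (simp add: vec_eq_iff)
  qed
  \<comment> \<open>L is under control only on pure quaternions, so its column 0 is replaced by the
    unit. The result is an invertible intertwiner of the two four-dimensional conjugation
    representations.\<close>
  define M where "M = (\<chi> i j. if j = 0 then q1 $ i else L $ i $ j)"
  define M' where "M' = (\<chi> i j. if j = 0 then q1 $ i else L' $ i $ j)"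
  have Mx: "M *v y = y $ 0 *s q1 + L *v (y - y $ 0 *s q1)" "M' *v y = y $ 0 *s q1 + L' *v (y - y $ 0 *s q1)" for y
    by (rule vec_4_eqI; simp add: M_def M'_def matrix_vector_mult_def sum_UNIV_4)+
  have "M' *v (M *v y) = y" for y
  proof -
    have p: "(y - y $ 0 *s q1) $ 0 = 0" by simp
    have "(M *v y) $ 0 = y $ 0" by (simp add: Mx(1) L0[OF p])
    then have "M' *v (M *v y) = y $ 0 *s q1 + L' *v (L *v (y - y $ 0 *s q1))" by (simp add: Mx)
    then show ?thesis by (simp add: inv[OF p])
  qed
  then have M'M: "M' ** M = mat 1" by (simp add: matrix_eq matrix_vector_mul_assoc)
  then have MM': "M ** M' = mat 1" by (simp add: matrix_left_right_inverse)
  \<comment> \<open>Conjugation by g and conjugation by H g are similar matrices, and their traces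
    are 4 times the squares of the scalar parts.\<close>
  have sq: "(H g $ 0)\<^sup>2 = (g $ 0)\<^sup>2" if g: "g \<in> S" for g
  proof -
    let ?A = "qad ?a ?b g" and ?B = "qad ?a' ?b' (H g)"
    have "M *v (?A *v y) = ?B *v (M *v y)" for y
    proof -
      define p where "p = y - y $ 0 *s q1"
      have p: "p $ 0 = 0" and y: "y = y $ 0 *s q1 + p" by (simp_all add: p_def)
      have g1: "?n g = 1" "qn ?a' ?b' (H g) = 1" using g nS[OF maps(1)[OF g]] by (simp_all add: S_def)
      have Mq: "M *v q1 = q1" by (rule vec_4_eqI) (simp_all add: M_def matrix_vector_mult_def sum_UNIV_4)
      have Mz: "M *v z = L *v z" if "z $ 0 = 0" for z using that by (simp add: Mx)
      show ?thesis
        by (subst (1 2) y) (simp add: matrix_vector_right_distrib matrix_vector_mult_scale qad_q1[OF g1(1)] Mq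
            Mz[OF p] Mz[OF qad_pure[OF p]] qad_q1[OF g1(2)] equi[OF g p])
    qed
    then have eq: "M ** ?A = ?B ** M" by (simp add: matrix_eq flip: matrix_vector_mul_assoc)
    have "?A = M' ** (?B ** M)" using arg_cong[OF eq, of "(**) M'"] M'M by (simp add: matrix_mul_assoc)
    then have "trace ?A = trace (M' ** (?B ** M))" by (rule arg_cong)
    also have "\<dots> = trace ((?B ** M) ** M')" by (rule trace_mul_sym)
    also have "(?B ** M) ** M' = ?B" by (simp add: MM' flip: matrix_mul_assoc)
    finally have "4 * (g $ 0)\<^sup>2 = 4 * (H g $ 0)\<^sup>2" unfolding trace_qad .
    then show ?thesis using four_nonzero[OF two'] by simp
  qed
  \<comment> \<open>On both sides the norm of the pure part is 1 minus the square of the scalar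
    part, so H preserves it along the curve. The coefficient of t^2 is four times the claim.\<close>
  have isom: "?a' * ((L *v x) $ 1)\<^sup>2 + ?b' * ((L *v x) $ 2)\<^sup>2 + ?a' * ?b' * ((L *v x) $ 3)\<^sup>2 =
    ?a * (x $ 1)\<^sup>2 + ?b * (x $ 2)\<^sup>2 + ?a * ?b * (x $ 3)\<^sup>2" if x: "x $ 0 = 0" for x
  proof -
    obtain G where G: "\<And>i. expands (\<lambda>t. H (?c x t) $ i) (G i)" "\<And>i. fps_nth (G i) 0 = q1 $ i"
      "\<And>i. fps_nth (G i) 1 = 2 * (L *v x) $ i" using V[OF x] by blast
    obtain C where C: "\<And>i. expands (\<lambda>t. ?c x t $ i) (C i)" "\<And>i. fps_nth (C i) 0 = q1 $ i" "\<And>i. fps_nth (C i) 1 = 2 * x $ i"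
      using expands_cayley[OF x] by blast
    have "fps_const ?a' * (G 1 * G 1) + fps_const ?b' * (G 2 * G 2) + fps_const (?a' * ?b') * (G 3 * G 3)
      = fps_const ?a * (C 1 * C 1) + fps_const ?b * (C 2 * C 2) + fps_const (?a * ?b) * (C 3 * C 3)"
    proof (rule expands_unique[where E = "[:1, 0, ?n x:]"])
      show "expands (\<lambda>t. ?a' * (H (?c x t) $ 1 * H (?c x t) $ 1) + ?b' * (H (?c x t) $ 2 * H (?c x t) $ 2)
          + (?a' * ?b') * (H (?c x t) $ 3 * H (?c x t) $ 3))
        (fps_const ?a' * (G 1 * G 1) + fps_const ?b' * (G 2 * G 2) + fps_const (?a' * ?b') * (G 3 * G 3))"
        by (intro expands_add expands_mult expands_const G)
      show "expands (\<lambda>t. ?a * (?c x t $ 1 * ?c x t $ 1) + ?b * (?c x t $ 2 * ?c x t $ 2) + (?a * ?b) * (?c x t $ 3 * ?c x t $ 3))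
        (fps_const ?a * (C 1 * C 1) + fps_const ?b * (C 2 * C 2) + fps_const (?a * ?b) * (C 3 * C 3))"
        by (intro expands_add expands_mult expands_const C)
      fix t assume t: "poly [:1, 0, ?n x:] t \<noteq> 0"
      have "?n (?c x t) = 1" "qn ?a' ?b' (H (?c x t)) = 1" "(H (?c x t) $ 0)\<^sup>2 = (?c x t $ 0)\<^sup>2"
        using cS[OF x t] nS[OF maps(1)] sq by (simp_all add: S_def)
      then show "?a' * (H (?c x t) $ 1 * H (?c x t) $ 1) + ?b' * (H (?c x t) $ 2 * H (?c x t) $ 2)
          + (?a' * ?b') * (H (?c x t) $ 3 * H (?c x t) $ 3) =
        ?a * (?c x t $ 1 * ?c x t $ 1) + ?b * (?c x t $ 2 * ?c x t $ 2) + (?a * ?b) * (?c x t $ 3 * ?c x t $ 3)"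
        by (intro norm_form_eq[OF _ _ sym]) (simp_all add: qn_def)
    qed (rule D0)
    from arg_cong[OF this, of "\<lambda>F. fps_nth F 2"]
    have "?a' * (2 * (L *v x) $ 1)\<^sup>2 + ?b' * (2 * (L *v x) $ 2)\<^sup>2 + ?a' * ?b' * (2 * (L *v x) $ 3)\<^sup>2 =
      ?a * (2 * x $ 1)\<^sup>2 + ?b * (2 * x $ 2)\<^sup>2 + ?a * ?b * (2 * x $ 3)\<^sup>2"
      by (simp only: fps_add_nth fps_const_mult_square_nth_2 G(2,3) C(2,3) vec4_nth)
    then show ?thesis by (rule cancel_doubled_form[OF two'])
  qed
  have Lx: "(L *v vec4 0 r s 0) $ i = to_ac (J i 1) * r + to_ac (J i 2) * s" for i r s
    by (simp add: L_def matrix_vector_mult_def sum_UNIV_4)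
  have t: "to_ac x + to_ac y = to_ac (x + y)" "to_ac x * to_ac y = to_ac (x * y)" "(to_ac x)\<^sup>2 = to_ac (x\<^sup>2)" for x y :: 'a
    by simp_all
  show ?thesis
    using isom[of "vec4 0 1 0 0"] isom[of "vec4 0 0 1 0"] isom[of "vec4 0 1 1 0"]
    unfolding Lx vec4_nth by (intro exI[of _ J]) (simp add: t del: to_ac_add to_ac_mult to_ac_power)
qed


section \<open>The stabilizer of a normal form\<close>

text \<open>With respect to the multiplication of \<open>V\<^sub>6\<close> by \<open>k(\<surd>-i)\<close> given by \<open>phi\<close>, these are the matrices
  of the special unitary group of the orthogonal complement of \<open>e\<^sub>4\<close>.\<close>

definition smat :: "'b::field \<Rightarrow> 'b \<Rightarrow> 'b \<Rightarrow> 'b ^ 4 \<Rightarrow> 'b ^ 6 ^ 6" where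
  "smat y1 y2 y3 s = (\<chi> i j. (if j = 1 then bv 1 else if j = 4 then bv 4
    else if j = 5 then s $ 0 *s bv 5 + (y2 * s $ 1) *s bv 2 + s $ 2 *s bv 3 + (y1 * y2 * s $ 3) *s bv 0
    else if j = 2 then s $ 0 *s bv 2 + (y1 * y3 * s $ 3) *s bv 3 - (y1 * y3 * s $ 1) *s bv 5 - (y1 * s $ 2) *s bv 0
    else if j = 3 then (y1 * y2 * s $ 1) *s bv 0 - (y1 * s $ 2) *s bv 5 + s $ 0 *s bv 3 - (y1 * y2 * s $ 3) *s bv 2
    else s $ 0 *s bv 0 - (y1 * y3 * s $ 3) *s bv 5 - (y3 * s $ 1) *s bv 3 + s $ 2 *s bv 2) $ i)"

text \<open>Read off from the image of e_5, which determines the element of the stabilizer.\<close>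

definition sco :: "'b::field \<Rightarrow> 'b \<Rightarrow> 'b ^ 6 ^ 6 \<Rightarrow> 'b ^ 4" where
  "sco y1 y2 g = vec4 (g $ 5 $ 5) (g $ 2 $ 5 / y2) (g $ 3 $ 5) (g $ 0 $ 5 / (y1 * y2))"

lemma smat_bv:
  "smat y1 y2 y3 s *v bv 1 = bv 1" "smat y1 y2 y3 s *v bv 4 = bv 4"
  "smat y1 y2 y3 s *v bv 5 = s $ 0 *s bv 5 + (y2 * s $ 1) *s bv 2 + s $ 2 *s bv 3 + (y1 * y2 * s $ 3) *s bv 0"
  "smat y1 y2 y3 s *v bv 2 = s $ 0 *s bv 2 + (y1 * y3 * s $ 3) *s bv 3 - (y1 * y3 * s $ 1) *s bv 5 - (y1 * s $ 2) *s bv 0"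
  "smat y1 y2 y3 s *v bv 3 = (y1 * y2 * s $ 1) *s bv 0 - (y1 * s $ 2) *s bv 5 + s $ 0 *s bv 3 - (y1 * y2 * s $ 3) *s bv 2"
  "smat y1 y2 y3 s *v bv 0 = s $ 0 *s bv 0 - (y1 * y3 * s $ 3) *s bv 5 - (y3 * s $ 1) *s bv 3 + s $ 2 *s bv 2"
  unfolding smat_def matrix_columns_6(1) by simp_all

lemma sco_smat:
  assumes "y1 \<noteq> 0" "y2 \<noteq> 0"
  shows "sco y1 y2 (smat y1 y2 y3 s) = s"
  by (rule vec_4_eqI) (use assms in \<open>simp_all add: sco_def smat_def bv_def axis_def\<close>)

lemma smat_Sp6:
  assumes "qn (y1 * y2 * y3) y1 s = 1"
  shows "smat y1 y2 y3 s \<in> Sp6"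
proof -
  define s0 s1 s2 s3 where "s0 = s $ 0" and "s1 = s $ 1" and "s2 = s $ 2" and "s3 = s $ 3"
  have N: "s0 * s0 = 1 - y1 * y2 * y3 * s1 * s1 - y1 * s2 * s2 - y1 * y2 * y3 * y1 * s3 * s3"
    using assms by (simp add: qn_def s0_def s1_def s2_def s3_def power2_eq_square algebra_simps)
  have "\<forall>i j. Jform (smat y1 y2 y3 s *v bv i) (smat y1 y2 y3 s *v bv j) = Jform (bv i) (bv j)"
    unfolding all_6 smat_bv s0_def[symmetric] s1_def[symmetric] s2_def[symmetric] s3_def[symmetric]
    by (simp add: Jform_linear Jform_bv_bv MJ_def N algebra_simps)
  then show ?thesis by (intro Sp6_JformI) blast
qed

text \<open>Invariance of the trivector is tested on its product: the fifteen basis pairs, with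
  s_0^2 eliminated by the norm equation, give equivariance of the product, and
  \<open>cross6_inject\<close> concludes.\<close>

lemma smat_act3:
  assumes q: "qn (y1 * y2 * y3) y1 s = 1"
  shows "act3 (smat y1 y2 y3 s) (normal_form 0 y1 y2 y3) = normal_form 0 y1 y2 y3"
proof -
  let ?n = "normal_form 0 y1 y2 y3" and ?g = "smat y1 y2 y3 s"
  note g = smat_Sp6[OF q]
  define s0 s1 s2 s3 where "s0 = s $ 0" and "s1 = s $ 1" and "s2 = s $ 2" and "s3 = s $ 3"
  have N: "s0 * s0 = 1 - y1 * y2 * y3 * s1 * s1 - y1 * s2 * s2 - y1 * y2 * y3 * y1 * s3 * s3"
    using q by (simp add: qn_def s0_def s1_def s2_def s3_def power2_eq_square algebra_simps)
  define P where "P i j \<longleftrightarrow> cross6 ?n (?g *v bv i) (?g *v bv j) = ?g *v cross6 ?n (bv i) (bv j)" for i j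
  have swap: "P i j \<Longrightarrow> P j i" for i j
    unfolding P_def cross6_swap[of _ "?g *v bv j"] cross6_swap[of _ "bv j"] by (simp add: matrix_vector_mult_minus)
  have self: "P i i" for i unfolding P_def by simp
  have P: "P 4 5" "P 4 2" "P 1 5" "P 1 2" "P 4 0" "P 4 3" "P 5 0" "P 5 3" "P 1 0" "P 1 3" "P 2 0" "P 2 3" "P 1 4" "P 2 5" "P 3 0"
    unfolding P_def cross6_normal_form matrix_vector_mult_scale smat_bv matrix_vector_mult_0_right
      s0_def[symmetric] s1_def[symmetric] s2_def[symmetric] s3_def[symmetric]
    by (rule vec_6_eqI; simp add: cross6_nth normal_form_nth bv_def axis_def; simp add: N algebra_simps)+
  have all: "\<forall>i j. P i j" unfolding all_6 using P P[THEN swap] self by simp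
  have b: "cross6 ?n (?g *v bv i) (?g *v v) = ?g *v cross6 ?n (bv i) v" for i v
    by (rule linear_6_eqI[where f = "\<lambda>v. cross6 ?n (?g *v bv i) (?g *v v)" and g = "\<lambda>v. ?g *v cross6 ?n (bv i) v" and v = v])
      (use all in \<open>simp_all add: P_def cross6_linear matrix_vector_right_distrib matrix_vector_mult_scale\<close>)
  have gen: "cross6 ?n (?g *v u) (?g *v v) = ?g *v cross6 ?n u v" for u v
    by (rule linear_6_eqI[where f = "\<lambda>u. cross6 ?n (?g *v u) (?g *v v)" and g = "\<lambda>u. ?g *v cross6 ?n u v" and v = u])
      (simp_all add: b cross6_linear matrix_vector_right_distrib matrix_vector_mult_scale)
  obtain h where h: "?g ** h = mat 1" using g by (rule Sp6_inverse)
  have gh: "?g *v (h *v u) = u" for u by (simp add: matrix_vector_mul_assoc h)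
  show ?thesis
  proof (rule cross6_inject)
    have "cross6 (act3 ?g ?n) (?g *v u) (?g *v v) = cross6 ?n (?g *v u) (?g *v v)" for u v
      by (simp add: cross6_act3[OF g] gen)
    from this[of "h *v bv _" "h *v bv _"] show "\<forall>i j. cross6 (act3 ?g ?n) (bv i) (bv j) = cross6 ?n (bv i) (bv j)"
      by (simp add: gh)
  qed (simp_all add: homog_act3 homog_normal_form)
qed

text \<open>Such a g commutes with phi and respects the product. It fixes e_4 and therefore e_1, a
  multiple of phi e_4; and the image of e_5 fixes those of e_2 (by phi), of e_3 (by the product with
  e_4) and of e_6 (by the product of e_4 and e_2).\<close>

lemma stabilizer_normal_form:
  fixes y1 :: "'b::field"
  assumes two: "(2::'b) \<noteq> 0" and y: "y1 \<noteq> 0" "y2 \<noteq> 0" "y3 \<noteq> 0"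
    and g: "g \<in> Sp6" "act3 g (normal_form 0 y1 y2 y3) = normal_form 0 y1 y2 y3" "g *v bv 4 = bv 4"
  shows "smat y1 y2 y3 (sco y1 y2 g) = g" "qn (y1 * y2 * y3) y1 (sco y1 y2 g) = 1"
proof -
  let ?n = "normal_form 0 y1 y2 y3"
  have ph: "phi ?n *v bv 4 = (- 2 * y1) *s bv 1" "phi ?n *v bv 5 = (- 2 * y2) *s bv 2"
    by (rule vec_6_eqI; simp add: matrix_vector_nth_6 phi_normal_form bv_def axis_def)+
  have eq: "g *v (phi ?n *v u) = phi ?n *v (g *v u)" for u
    using phi_act3[OF two normal_form_Xspace g(1), of 0 y1 y2 y3 u] g(2) by simp
  have cr: "g *v cross6 ?n u v = cross6 ?n (g *v u) (g *v v)" for u v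
    using cross6_act3[OF g(1), of ?n u v] g(2) by simp
  have canc: "u = v" if "c *s u = c *s v" "c \<noteq> 0" for u v :: "'b ^ 6" and c using that by simp
  have g1: "g *v bv 1 = bv 1"
  proof (rule canc)
    show "(- 2 * y1) *s (g *v bv 1) = (- 2 * y1) *s bv 1"
      using eq[of "bv 4"] by (simp only: ph g(3) matrix_vector_mult_scale)
    show "- 2 * y1 \<noteq> 0" using two y by simp
  qed
  define w where "w = g *v bv 5"
  have wn: "w $ i = g $ i $ 5" for i by (simp add: w_def bv_def matrix_vector_axis)
  \<comment> \<open>The image of e_5 stays orthogonal to the fixed vectors e_1 and e_4, which leaves
    four coordinates.\<close>
  have "w $ 1 = 0" "w $ 4 = 0"
    using Jform_Sp6[OF g(1), of "bv 5" "bv 4"] Jform_Sp6[OF g(1), of "bv 5" "bv 1"]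
    by (simp_all add: g(3) g1 Jform_bv_bv MJ_def flip: w_def) (simp_all add: Jform_bv)
  then have w: "w = w $ 5 *s bv 5 + w $ 2 *s bv 2 + w $ 3 *s bv 3 + w $ 0 *s bv 0"
    by (intro vec_6_eqI) (simp_all add: bv_def axis_def)
  define s where "s = sco y1 y2 g"
  have s: "w $ 5 = s $ 0" "w $ 2 = y2 * s $ 1" "w $ 3 = s $ 2" "w $ 0 = y1 * y2 * s $ 3"
    using y by (simp_all add: s_def sco_def wn)
  have w5: "g *v bv 5 = smat y1 y2 y3 s *v bv 5" unfolding smat_bv s[symmetric] w_def[symmetric] by (rule w)
  have g2: "g *v bv 2 = smat y1 y2 y3 s *v bv 2"
  proof (rule canc)
    have "(- 2 * y2) *s (g *v bv 2) = phi ?n *v (smat y1 y2 y3 s *v bv 5)"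
      using eq[of "bv 5"] by (simp only: ph w5 matrix_vector_mult_scale)
    also have "\<dots> = (- 2 * y2) *s (smat y1 y2 y3 s *v bv 2)"
      unfolding smat_bv using y by (intro vec_6_eqI) (simp_all add: matrix_vector_nth_6 phi_normal_form bv_def axis_def)
    finally show "(- 2 * y2) *s (g *v bv 2) = (- 2 * y2) *s (smat y1 y2 y3 s *v bv 2)" .
    show "- 2 * y2 \<noteq> 0" using two y by simp
  qed
  have g3: "g *v bv 3 = smat y1 y2 y3 s *v bv 3"
  proof (rule canc)
    have "(- 1) *s (g *v bv 3) = cross6 ?n (bv 4) (smat y1 y2 y3 s *v bv 5)"
      using cr[of "bv 4" "bv 5"] by (simp only: cross6_normal_form g(3) w5 matrix_vector_mult_scale)
    also have "\<dots> = (- 1) *s (smat y1 y2 y3 s *v bv 3)"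
      unfolding smat_bv by (intro vec_6_eqI) (simp_all add: cross6_nth normal_form_nth bv_def axis_def)
    finally show "(- 1) *s (g *v bv 3) = (- 1) *s (smat y1 y2 y3 s *v bv 3)" .
  qed simp
  have g0: "g *v bv 0 = smat y1 y2 y3 s *v bv 0"
  proof (rule canc)
    have "(- y1) *s (g *v bv 0) = cross6 ?n (bv 4) (smat y1 y2 y3 s *v bv 2)"
      using cr[of "bv 4" "bv 2"] by (simp only: cross6_normal_form g(3) g2 matrix_vector_mult_scale)
    also have "\<dots> = (- y1) *s (smat y1 y2 y3 s *v bv 0)"
      unfolding smat_bv by (intro vec_6_eqI) (simp_all add: cross6_nth normal_form_nth bv_def axis_def)
    finally show "(- y1) *s (g *v bv 0) = (- y1) *s (smat y1 y2 y3 s *v bv 0)" .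
  qed (use y in simp)
  have "\<forall>i. g *v bv i = smat y1 y2 y3 s *v bv i"
    unfolding all_6 using g0 g1 g2 g3 g(3) w5 by (simp only: smat_bv simp_thms)
  then have "g $ i $ j = smat y1 y2 y3 s $ i $ j" for i j
    by (metis bv_def matrix_vector_axis)
  then show "smat y1 y2 y3 (sco y1 y2 g) = g" by (simp add: vec_eq_iff s_def)
  \<comment> \<open>The norm equation is the invariance of the quadratic form J(w, phi w), evaluated
    at the image of e_5.\<close>
  have "Jform w (phi ?n *v w) = Jform (bv 5) (phi ?n *v bv 5)"
    unfolding w_def eq[symmetric] by (rule Jform_Sp6[OF g(1)])
  then have "2 * (y2 * qn (y1 * y2 * y3) y1 s) = 2 * y2"
    unfolding ph by (subst (asm) (1 2) w)
      (simp add: s matrix_vector_nth_6 phi_normal_form Jform_expand bv_def axis_def qn_def power2_eq_square algebra_simps)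
  then show "qn (y1 * y2 * y3) y1 (sco y1 y2 g) = 1" using two y by (simp add: s_def)
qed

lemma sco_mult:
  assumes "y1 \<noteq> 0" "y2 \<noteq> 0"
  shows "sco y1 y2 (smat y1 y2 y3 s ** smat y1 y2 y3 t) = qm (y1 * y2 * y3) y1 s t"
proof -
  have c: "(A ** B) $ i $ 5 = (A *v (B *v bv 5)) $ i" for A B :: "'a ^ 6 ^ 6" and i
    by (simp add: matrix_vector_mul_assoc bv_def matrix_vector_axis)
  show ?thesis
    unfolding sco_def c smat_bv matrix_vector_right_distrib matrix_vector_mult_scale
    by (rule vec_4_eqI) (use assms in \<open>simp_all add: qm_def bv_def axis_def field_simps\<close>)
qed

section \<open>Base change to the algebraic closure\<close>

definition mapv :: "'a::field ^ 'n \<Rightarrow> 'a alg_closure ^ 'n" where "mapv v = (\<chi> i. to_ac (v $ i))"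

definition mapm :: "'a::field ^ 'n ^ 'm \<Rightarrow> 'a alg_closure ^ 'n ^ 'm" where "mapm A = (\<chi> i j. to_ac (A $ i $ j))"

lemma mapv_nth [simp]: "mapv v $ i = to_ac (v $ i)" by (simp add: mapv_def)

lemma mapm_nth [simp]: "mapm A $ i $ j = to_ac (A $ i $ j)" by (simp add: mapm_def)

lemma to_ac_sum: "to_ac (\<Sum>i\<in>I. f i) = (\<Sum>i\<in>I. to_ac (f i))"
  by (induction I rule: infinite_finite_induct) simp_all

lemma mapv_linear:
  "mapv (u + v) = mapv u + mapv v" "mapv (u - v) = mapv u - mapv v" "mapv (- u) = - mapv u"
  "mapv (c *s u) = to_ac c *s mapv u" "mapv (\<Sum>i\<in>I. f i) = (\<Sum>i\<in>I. mapv (f i))"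
  by (simp_all add: vec_eq_iff to_ac_sum)

lemma mapm_mult: "mapm (A ** B) = mapm A ** mapm B"
  by (simp add: matrix_matrix_mult_def vec_eq_iff to_ac_sum)

lemma mapv_mult: "mapv (A *v v) = mapm A *v mapv v"
  by (simp add: matrix_vector_mult_def vec_eq_iff to_ac_sum)

lemma mapm_1: "mapm (mat 1) = mat 1" by (simp add: mat_def vec_eq_iff)

lemma mapm_transpose: "mapm (transpose A) = transpose (mapm A)" by (simp add: transpose_def vec_eq_iff)

lemma mapm_MJ: "mapm MJ = MJ" by (simp add: MJ_def vec_eq_iff)

lemma mapv_bv: "mapv (bv i) = bv i" by (simp add: bv_def axis_def vec_eq_iff)

lemma mapm_Sp6:
  assumes "g \<in> Sp6"
  shows "mapm g \<in> Sp6"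
proof -
  obtain h where h: "g ** h = mat 1" "h ** g = mat 1" using Sp6_inverse[OF assms] .
  have "mapm g ** mapm h = mat 1" "mapm h ** mapm g = mat 1" using h by (simp_all add: mapm_1 flip: mapm_mult)
  moreover have "mapm (g ** MJ ** transpose g) = mapm MJ" using assms by (simp add: Sp6_def)
  ultimately show ?thesis by (auto simp: Sp6_def invertible_def mapm_mult mapm_MJ mapm_transpose)
qed

lemma mapv_wedge: "mapv (a \<and>\<^sub>w b) = mapv a \<and>\<^sub>w mapv b"
  by (simp add: wedge_def vec_eq_iff to_ac_sum ext_sign_def)

lemma mapv_ext1: "mapv (ext1 v) = ext1 (mapv v)"
  by (simp add: ext1_def vec_eq_iff to_ac_sum if_distrib[of to_ac] cong: if_cong)

lemma mapv_wedge3: "mapv (wedge3 u v w) = wedge3 (mapv u) (mapv v) (mapv w)"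
  by (simp add: wedge3_def mapv_wedge mapv_ext1)

lemma mapv_act3: "mapv (act3 g x) = act3 (mapm g) (mapv x)"
  by (simp add: act3_def ext3_lin_def split_beta mapv_linear mapv_wedge3 mapv_mult mapv_bv)

lemma mapv_normal_form: "mapv (normal_form y0 y1 y2 y3) = normal_form (to_ac y0) (to_ac y1) (to_ac y2) (to_ac y3)"
  by (simp add: normal_form_def mapv_linear mapv_wedge3 mapv_bv)

section \<open>Polynomial functions with coefficients in k\<close>

lemma poly_funs_sum:
  assumes "\<And>i. i \<in> I \<Longrightarrow> p i \<in> poly_funs cs"
  shows "(\<lambda>x. \<Sum>i\<in>I. p i x) \<in> poly_funs cs"
  using assms
proof (induction I rule: infinite_finite_induct)
  case (insert i I)
  then have "(\<lambda>x. p i x + (\<Sum>i\<in>I. p i x)) \<in> poly_funs cs" by (intro poly_funs.add) simp_all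
  with insert(1,2) show ?case by simp
qed (use poly_funs.const[of 0] in simp_all)

lemma poly_funs_compose:
  assumes "p \<in> poly_funs cs" "\<And>c. c \<in> cs \<Longrightarrow> (\<lambda>x. c (F x)) \<in> poly_funs ds"
  shows "(\<lambda>x. p (F x)) \<in> poly_funs ds"
  using assms(1) by induction (simp_all add: assms(2) poly_funs.const poly_funs.add poly_funs.mult)

lemma poly_funs_compose_vec:
  assumes "p \<in> poly_funs vec_coords" "\<And>i. (\<lambda>x. F x $ i) \<in> poly_funs ds"
  shows "(\<lambda>x. p (F x)) \<in> poly_funs ds"
  using assms(1) by (rule poly_funs_compose) (auto simp: vec_coords_def assms(2))

lemma poly_funs_compose_mat:
  assumes "p \<in> poly_funs mat_coords" "\<And>i j. (\<lambda>x. F x $ i $ j) \<in> poly_funs ds"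
  shows "(\<lambda>x. p (F x)) \<in> poly_funs ds"
  using assms(1) by (rule poly_funs_compose) (auto simp: mat_coords_def assms(2))

lemma poly_funs_coords: "(\<lambda>s. s $ i) \<in> poly_funs vec_coords" "(\<lambda>g. g $ j $ l) \<in> poly_funs mat_coords"
  by (rule poly_funs.coord; auto simp: vec_coords_def mat_coords_def)+

lemma poly_funs_mapm: "(\<lambda>x. mapm A $ i $ j) \<in> poly_funs cs"
  by (simp add: poly_funs.const)

lemma poly_funs_matrix:
  assumes "\<And>i j. (\<lambda>x. A x $ i $ j) \<in> poly_funs cs" "\<And>i j. (\<lambda>x. B x $ i $ j) \<in> poly_funs cs"
  shows "(\<lambda>x. (A x ** B x) $ i $ j) \<in> poly_funs cs"
  by (simp add: matrix_matrix_mult_def) (intro poly_funs_sum poly_funs.mult assms)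

lemma poly_funs_vector:
  assumes "\<And>i. (\<lambda>x. v x $ i) \<in> poly_funs cs"
  shows "(\<lambda>x. (mapm A *v v x) $ i) \<in> poly_funs cs"
  by (simp add: matrix_vector_mult_def) (intro poly_funs_sum poly_funs.mult poly_funs.const assms)

lemma poly_funs_minus: "p \<in> poly_funs cs \<Longrightarrow> q \<in> poly_funs cs \<Longrightarrow> (\<lambda>x. p x - q x) \<in> poly_funs cs"
  using poly_funs.add[OF _ poly_funs.mult[OF poly_funs.const[of "- 1"]], of p cs q] by simp

lemma poly_funs_divide: "p \<in> poly_funs cs \<Longrightarrow> (\<lambda>x. p x / to_ac c) \<in> poly_funs cs"
  using poly_funs.mult[OF _ poly_funs.const[of "inverse c"], of p cs] by (simp add: field_simps)

lemma poly_funs_if: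
  "(P \<Longrightarrow> p \<in> poly_funs cs) \<Longrightarrow> (\<not> P \<Longrightarrow> q \<in> poly_funs cs) \<Longrightarrow> (\<lambda>x. if P then p x else q x) \<in> poly_funs cs"
  by (cases P) simp_all

lemma poly_funs_bv: "(\<lambda>x. bv k $ i) \<in> poly_funs cs"
  using poly_funs.const[of "bv k $ i" cs] by (simp flip: mapv_nth add: mapv_bv)

lemma poly_funs_sco: "(\<lambda>g. sco (to_ac y1) (to_ac y2) g $ i) \<in> poly_funs mat_coords"
proof -
  have "\<forall>i. (\<lambda>g. sco (to_ac y1) (to_ac y2) g $ i) \<in> poly_funs mat_coords"
    unfolding all_UNIV_4 sco_def vec4_nth to_ac_mult[symmetric] by (intro conjI poly_funs_divide poly_funs_coords)
  then show ?thesis by blast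
qed

lemma poly_funs_smat: "(\<lambda>s. smat (to_ac y1) (to_ac y2) (to_ac y3) s $ i $ j) \<in> poly_funs vec_coords"
  unfolding smat_def vec_lambda_beta if_distrib[of "\<lambda>v. v $ i"] vector_add_component vector_minus_component
    vector_smult_component
  by (intro poly_funs_if poly_funs.add poly_funs_minus poly_funs.mult poly_funs_coords poly_funs.const poly_funs_bv)

text \<open>An isomorphism over k with the norm-one group in the coordinates of 1, a, b, ab. Closure
  of S under products is recorded in the same clause as multiplicativity.\<close>

definition stabilizer_chart :: "('a::field alg_closure ^ 6 ^ 6) set \<Rightarrow> 'a alg_closure \<Rightarrow> 'a alg_closure \<Rightarrow>
    ('a alg_closure ^ 6 ^ 6 \<Rightarrow> 'a alg_closure ^ 4) \<Rightarrow> ('a alg_closure ^ 4 \<Rightarrow> 'a alg_closure ^ 6 ^ 6) \<Rightarrow> bool" where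
  "stabilizer_chart S \<alpha> \<beta> \<Phi> \<Psi> \<longleftrightarrow>
     (\<forall>i. (\<lambda>k. \<Phi> k $ i) \<in> poly_funs mat_coords) \<and> (\<forall>i j. (\<lambda>s. \<Psi> s $ i $ j) \<in> poly_funs vec_coords) \<and>
     (\<forall>k\<in>S. qn \<alpha> \<beta> (\<Phi> k) = 1 \<and> \<Psi> (\<Phi> k) = k) \<and> (\<forall>s. qn \<alpha> \<beta> s = 1 \<longrightarrow> \<Psi> s \<in> S \<and> \<Phi> (\<Psi> s) = s) \<and>
     (\<forall>k\<in>S. \<forall>l\<in>S. \<Phi> (k ** l) = qm \<alpha> \<beta> (\<Phi> k) (\<Phi> l) \<and> k ** l \<in> S)"

lemma stabilizer_chartD:
  assumes "stabilizer_chart S \<alpha> \<beta> \<Phi> \<Psi>"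
  shows "(\<lambda>k. \<Phi> k $ i) \<in> poly_funs mat_coords" "(\<lambda>s. \<Psi> s $ i' $ j) \<in> poly_funs vec_coords"
    "k \<in> S \<Longrightarrow> qn \<alpha> \<beta> (\<Phi> k) = 1" "k \<in> S \<Longrightarrow> \<Psi> (\<Phi> k) = k" "qn \<alpha> \<beta> s = 1 \<Longrightarrow> \<Psi> s \<in> S"
    "qn \<alpha> \<beta> s = 1 \<Longrightarrow> \<Phi> (\<Psi> s) = s"
    "k \<in> S \<Longrightarrow> l \<in> S \<Longrightarrow> \<Phi> (k ** l) = qm \<alpha> \<beta> (\<Phi> k) (\<Phi> l) \<and> k ** l \<in> S"
  using assms by (simp_all add: stabilizer_chart_def)

text \<open>Conjugation by the k-rational matrix g reduces to the stabilizer of the normal form, and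
  it is a polynomial map with coefficients in k.\<close>

lemma stabilizer_coordinates:
  fixes x :: "'a::field ^ (6 set)"
  assumes two: "(2::'a) \<noteq> 0" and x: "x \<in> Xspace"
    and g: "g \<in> Sp6" "act3 g x = normal_form 0 y1 y2 y3" "g *v v = bv 4" and y: "y1 \<noteq> 0" "y2 \<noteq> 0" "y3 \<noteq> 0"
  shows "\<exists>\<Phi> \<Psi>. stabilizer_chart (stabilizer (x, v)) (to_ac (y1 * y2 * y3)) (to_ac y1) \<Phi> \<Psi>"
proof -
  obtain h where h: "h \<in> Sp6" "g ** h = mat 1" "h ** g = mat 1" using Sp6_inverse[OF g(1)] .
  let ?g = "mapm g" and ?h = "mapm h" and ?y1 = "to_ac y1" and ?y2 = "to_ac y2" and ?y3 = "to_ac y3"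
  let ?n = "normal_form 0 ?y1 ?y2 ?y3"
  define \<Phi> where "\<Phi> k = sco ?y1 ?y2 (?g ** k ** ?h)" for k
  define \<Psi> where "\<Psi> s = ?h ** smat ?y1 ?y2 ?y3 s ** ?g" for s
  have two': "(2::'a alg_closure) \<noteq> 0" using two by (metis to_ac_eq_0_iff to_ac_numeral)
  have y': "?y1 \<noteq> 0" "?y2 \<noteq> 0" "?y3 \<noteq> 0" using y by simp_all
  have t: "to_ac (y1 * y2 * y3) = ?y1 * ?y2 * ?y3" by simp
  have gh: "?g ** ?h = mat 1" "?h ** ?g = mat 1" using h by (simp_all add: mapm_1 flip: mapm_mult)
  have S: "?g \<in> Sp6" "?h \<in> Sp6" using g(1) h(1) by (simp_all add: mapm_Sp6)
  have hom: "homog 3 (mapv x)" using Xspace_homog[OF x] by (simp add: homog_def)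
  have nx: "act3 ?g (mapv x) = ?n" "?g *v mapv v = bv 4"
    using arg_cong[OF g(2), of mapv] arg_cong[OF g(3), of mapv]
    by (simp_all add: mapv_act3 mapv_normal_form mapv_mult mapv_bv)
  have "act3 ?h ?n = act3 (?h ** ?g) (mapv x)" unfolding nx(1)[symmetric] act3_mult ..
  then have xn1: "act3 ?h ?n = mapv x" by (simp add: gh act3_1 hom)
  have "?h *v bv 4 = (?h ** ?g) *v mapv v" unfolding nx(2)[symmetric] matrix_vector_mul_assoc ..
  then have xn2: "?h *v bv 4 = mapv v" by (simp add: gh)
  note xn = xn1 xn2
  have st: "k \<in> stabilizer (x, v) \<longleftrightarrow> k \<in> Sp6 \<and> act3 k (mapv x) = mapv x \<and> k *v mapv v = mapv v" for k
    by (simp add: stabilizer_def act_def mapv_def)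
  have conj: "?g ** k ** ?h \<in> Sp6" "act3 (?g ** k ** ?h) ?n = ?n" "(?g ** k ** ?h) *v bv 4 = bv 4"
    if "k \<in> stabilizer (x, v)" for k
    using that unfolding st by (simp_all add: Sp6_mult S act3_mult xn nx flip: matrix_vector_mul_assoc)
  have cancel: "?h ** (?g ** k ** ?h) ** ?g = k" "?g ** (?h ** k ** ?g) ** ?h = k" for k
  proof -
    have "?h ** (?g ** k ** ?h) ** ?g = (?h ** ?g) ** k ** (?h ** ?g)" "?g ** (?h ** k ** ?g) ** ?h = (?g ** ?h) ** k ** (?g ** ?h)"
      by (simp_all only: matrix_mul_assoc)
    then show "?h ** (?g ** k ** ?h) ** ?g = k" "?g ** (?h ** k ** ?g) ** ?h = k" by (simp_all add: gh)
  qed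
  have sm: "smat ?y1 ?y2 ?y3 (\<Phi> k) = ?g ** k ** ?h" "qn (?y1 * ?y2 * ?y3) ?y1 (\<Phi> k) = 1"
    if "k \<in> stabilizer (x, v)" for k
    unfolding \<Phi>_def by (rule stabilizer_normal_form[OF two' y' conj[OF that]])+
  have \<Psi>: "\<Psi> s \<in> stabilizer (x, v)" if q: "qn (?y1 * ?y2 * ?y3) ?y1 s = 1" for s
    unfolding st \<Psi>_def
    by (simp add: Sp6_mult S smat_Sp6[OF q] act3_mult nx smat_act3[OF q] xn smat_bv(2) flip: matrix_vector_mul_assoc)
  have \<Phi>_poly: "(\<lambda>k. \<Phi> k $ i) \<in> poly_funs mat_coords" for i
      unfolding \<Phi>_def by (rule poly_funs_compose_mat[OF poly_funs_sco]) (intro poly_funs_matrix poly_funs_mapm poly_funs_coords)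
  have \<Psi>_poly: "(\<lambda>s. \<Psi> s $ i $ j) \<in> poly_funs vec_coords" for i j
      unfolding \<Psi>_def by (intro poly_funs_matrix poly_funs_mapm poly_funs_smat)
  have \<Psi>\<Phi>: "\<Psi> (\<Phi> k) = k" if "k \<in> stabilizer (x, v)" for k
      by (simp add: \<Psi>_def sm(1)[OF that] cancel)
  have \<Phi>\<Psi>: "\<Phi> (\<Psi> s) = s" for s
      by (simp add: \<Psi>_def \<Phi>_def cancel sco_smat[OF y'(1,2)])
  have mult: "\<Phi> (k ** l) = qm (?y1 * ?y2 * ?y3) ?y1 (\<Phi> k) (\<Phi> l) \<and> k ** l \<in> stabilizer (x, v)"
    if kl: "k \<in> stabilizer (x, v)" "l \<in> stabilizer (x, v)" for k l
  proof -
    have "(?g ** k ** ?h) ** (?g ** l ** ?h) = ?g ** k ** (?h ** ?g) ** l ** ?h" by (simp only: matrix_mul_assoc)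
    also have "\<dots> = ?g ** (k ** l) ** ?h" unfolding gh matrix_mul_rid by (simp only: matrix_mul_assoc)
    finally have "\<Phi> (k ** l) = sco ?y1 ?y2 (smat ?y1 ?y2 ?y3 (\<Phi> k) ** smat ?y1 ?y2 ?y3 (\<Phi> l))"
      by (simp add: \<Phi>_def[of "k ** l"] sm(1)[OF kl(1)] sm(1)[OF kl(2)])
    moreover have "k ** l \<in> stabilizer (x, v)"
      using kl unfolding st by (simp add: Sp6_mult act3_mult flip: matrix_vector_mul_assoc)
    ultimately show ?thesis by (simp add: sco_mult[OF y'(1,2)])
  qed
  have "stabilizer_chart (stabilizer (x, v)) (?y1 * ?y2 * ?y3) ?y1 \<Phi> \<Psi>"
    unfolding stabilizer_chart_def
    by (intro conjI allI ballI impI; (rule \<Phi>_poly \<Psi>_poly \<Phi>\<Psi> | (rule sm(2) \<Psi>\<Phi> \<Psi> mult[THEN conjunct1] mult[THEN conjunct2]; assumption)))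
  then show ?thesis unfolding t by blast
qed

section \<open>Norm-one groups in coordinates\<close>

lemma less_4 [simp]: "(0::4) < 1" "(0::4) < 2" "(0::4) < 3" "(1::4) < 2" "(1::4) < 3" "(2::4) < 3"
  "\<not> (1::4) < 0" "\<not> (2::4) < 0" "\<not> (3::4) < 0" "\<not> (2::4) < 1" "\<not> (3::4) < 1" "\<not> (3::4) < 2"
  by (simp_all add: less_bit0_def bit0.Rep_numeral bit0.Rep_0 bit0.Rep_1)

lemma sum_pairs_4: "(\<Sum>(i, j)\<in>{(i :: 4, j). i < j}. f i j) = f 0 1 + f 0 2 + f 0 3 + f 1 2 + f 1 3 + f 2 3"
  for f :: "4 \<Rightarrow> 4 \<Rightarrow> 'b::comm_ring_1"
proof -
  have "(\<Sum>(i, j)\<in>{(i :: 4, j). i < j}. f i j) = (\<Sum>(i, j)\<in>UNIV \<times> UNIV. if i < j then f i j else 0)"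
    by (rule sum.mono_neutral_cong_left) (auto split: if_splits)
  also have "\<dots> = (\<Sum>i\<in>UNIV. \<Sum>j\<in>UNIV. if i < j then f i j else 0)" by (rule sum.cartesian_product[symmetric])
  also have "\<dots> = f 0 1 + f 0 2 + f 0 3 + f 1 2 + f 1 3 + f 2 3" by (simp add: sum_UNIV_4 add.assoc)
  finally show ?thesis .
qed

lemma qm_0: "qm \<alpha> \<beta> 0 t = 0" "qm \<alpha> \<beta> t 0 = 0"
  using qm_linear(4)[of \<alpha> \<beta> 0 0 t] qm_linear(2)[of \<alpha> \<beta> t 0 0] by simp_all

lemma qm_sum: "qm \<alpha> \<beta> (\<Sum>i\<in>I. f i) t = (\<Sum>i\<in>I. qm \<alpha> \<beta> (f i) t)" "qm \<alpha> \<beta> t (\<Sum>i\<in>I. f i) = (\<Sum>i\<in>I. qm \<alpha> \<beta> t (f i))"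
  by (induction I rule: infinite_finite_induct; simp add: qm_0 qm_linear)+

lemma matrix_vector_mult_sum: "A *v (\<Sum>i\<in>I. f i) = (\<Sum>i\<in>I. A *v f i)" for A :: "'b::comm_ring_1 ^ 'n ^ 'm"
  by (induction I rule: infinite_finite_induct) (simp_all add: matrix_vector_right_distrib)

definition qp :: "'b::field \<Rightarrow> 'b \<Rightarrow> 'b ^ 4 \<Rightarrow> 'b ^ 4 \<Rightarrow> 'b" where
  "qp \<alpha> \<beta> s t = 2 * (s $ 0 * t $ 0 + \<alpha> * s $ 1 * t $ 1 + \<beta> * s $ 2 * t $ 2 + \<alpha> * \<beta> * s $ 3 * t $ 3)"

lemma qn_combination:
  "qn \<alpha> \<beta> (s0 *s m0 + s1 *s m1 + s2 *s m2 + s3 *s m3) = s0\<^sup>2 * qn \<alpha> \<beta> m0 + s1\<^sup>2 * qn \<alpha> \<beta> m1 + s2\<^sup>2 * qn \<alpha> \<beta> m2 + s3\<^sup>2 * qn \<alpha> \<beta> m3 +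
    (s0 * s1 * qp \<alpha> \<beta> m0 m1 + s0 * s2 * qp \<alpha> \<beta> m0 m2 + s0 * s3 * qp \<alpha> \<beta> m0 m3 + s1 * s2 * qp \<alpha> \<beta> m1 m2 +
     s1 * s3 * qp \<alpha> \<beta> m1 m3 + s2 * s3 * qp \<alpha> \<beta> m2 m3)"
  by (simp add: qn_def qp_def power2_eq_square algebra_simps)

lemma to_ac_qn: "to_ac (qn \<alpha> \<beta> m) = qn (to_ac \<alpha>) (to_ac \<beta>) (mapv m)"
  "to_ac (qp \<alpha> \<beta> m n) = qp (to_ac \<alpha>) (to_ac \<beta>) (mapv m) (mapv n)"
  by (simp_all add: qn_def qp_def)

lemma mapv_qm: "mapv (qm \<alpha> \<beta> s t) = qm (to_ac \<alpha>) (to_ac \<beta>) (mapv s) (mapv t)"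
  by (rule vec_4_eqI) (simp_all add: qm_def)

context comp_alg begin

definition q4 :: "'c \<Rightarrow> 'c \<Rightarrow> 'a ^ 4 \<Rightarrow> 'c" where
  "q4 a b s = quat a b (s $ 0, s $ 1, s $ 2, s $ 3)"

lemma range_q4: "range (q4 a b) = range (quat a b)"
proof (intro subset_antisym subsetI)
  fix x assume "x \<in> range (quat a b)"
  then obtain s0 s1 s2 s3 where "x = quat a b (s0, s1, s2, s3)" by auto
  then have "x = q4 a b (vec4 s0 s1 s2 s3)" by (simp add: q4_def)
  then show "x \<in> range (q4 a b)" by blast
qed (auto simp: q4_def)

lemma q4_linear: "q4 a b (s + t) = q4 a b s + q4 a b t" "q4 a b (r *s s) = r \<star> q4 a b s"
  by (simp_all add: q4_def quat_def scale_left_distrib scale_right_distrib add_ac)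

lemma q4_sum: "q4 a b (\<Sum>i\<in>I. f i) = (\<Sum>i\<in>I. q4 a b (f i))"
proof (induction I rule: infinite_finite_induct)
  have "q4 a b 0 = 0" using q4_linear(2)[of a b 0 0] by simp
  then show "q4 a b (\<Sum>i\<in>{}. f i) = (\<Sum>i\<in>{}. q4 a b (f i))"
    and "infinite I \<Longrightarrow> q4 a b (\<Sum>i\<in>I. f i) = (\<Sum>i\<in>I. q4 a b (f i))" for I by simp_all
qed (simp add: q4_linear)

context
  fixes a b c \<alpha> \<beta> \<gamma>
  assumes triple: "cd_triple C a b c \<alpha> \<beta> \<gamma>" and nz: "\<alpha> \<noteq> 0" "\<beta> \<noteq> 0" "\<gamma> \<noteq> 0"
begin

lemma q4_inj: "q4 a b s = q4 a b t \<Longrightarrow> s = t"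
proof -
  assume "q4 a b s = q4 a b t"
  then have "octo a b c ((s $ 0, s $ 1, s $ 2, s $ 3), 0) = octo a b c ((t $ 0, t $ 1, t $ 2, t $ 3), 0)"
    by (simp add: octo_def q4_def)
  then show ?thesis using octo_inj[OF triple nz] by (auto dest!: injD intro: vec_4_eqI)
qed

lemma q4_forms: "N (q4 a b s) = qn \<alpha> \<beta> s" "B (q4 a b s) (q4 a b t) = qp \<alpha> \<beta> s t" "q4 a b s \<cdot> q4 a b t = q4 a b (qm \<alpha> \<beta> s t)"
  by (simp_all add: q4_def N_quat[OF triple] qnrm_def qn_def B_quat[OF triple] qpol_def qp_def
      quat_mul_triple[OF triple] qmul_def qm_def)

lemma exists_basis: "\<exists>z :: 4 \<Rightarrow> 'c. basis_of C (range (quat a b)) z"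
proof -
  define z where "z i = q4 a b (axis i 1)" for i :: 4
  have i: "inj z" by (rule injI) (auto simp: z_def axis_eq_axis dest: q4_inj)
  have z4: "z 0 = e" "z 1 = a" "z 2 = b" "z 3 = a \<cdot> b" by (simp_all add: z_def q4_def axis_def quat_def)
  have "range z = {e, a, b, a \<cdot> b}" unfolding UNIV_4 using z4 by simp
  moreover have "{..<4::nat} = {0, 1, 2, 3}" by auto
  ultimately have r: "range z = (\<lambda>i. [e, a, b, a \<cdot> b, c, a \<cdot> c, b \<cdot> c, (a \<cdot> b) \<cdot> c] ! i) ` {..<4}"
    by (simp add: numeral_3_eq_3 numeral_2_eq_2)
  have "basis_of C (range (quat a b)) z"
    unfolding basis_of_def using i orth_family_independent[OF zz(2)[OF triple nz]] span_zz4[OF triple nz] by (simp add: r)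
  then show ?thesis by blast
qed

text \<open>\<open>stabilizer_iso_SL1\<close> allows any basis of Q. The matrix M over k passes from
  its coordinates to those of 1, a, b, ab, in which the norm and the product are \<open>qn\<close>
  and \<open>qm\<close>.\<close>

lemma basis_coordinates:
  assumes z: "basis_of C (range (quat a b)) (z :: 4 \<Rightarrow> 'c)"
  obtains M M' where "M ** M' = mat 1" "M' ** M = mat 1"
    "\<And>s. ext_nrm C z s = qn (to_ac \<alpha>) (to_ac \<beta>) (mapm M *v s)"
    "\<And>s t. mapm M *v ext_mul C z s t = qm (to_ac \<alpha>) (to_ac \<beta>) (mapm M *v s) (mapm M *v t)"
proof -
  have z1: "inj z" "independent (range z)" "span (range z) = range (q4 a b)" using z by (simp_all add: basis_of_def range_q4)
  have "\<forall>i. \<exists>s. z i = q4 a b s"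
  proof
    fix i
    have "z i \<in> span (range z)" by (rule span_base) simp
    then show "\<exists>s. z i = q4 a b s" unfolding z1(3) by blast
  qed
  from choice[OF this] obtain m where m: "\<And>i. z i = q4 a b (m i)" by blast
  have "\<forall>l. \<exists>d. q4 a b (axis l 1) = (\<Sum>i\<in>UNIV. d i \<star> z i)"
  proof
    fix l
    have "q4 a b (axis l 1) \<in> span (range z)" unfolding z1(3) by blast
    then obtain u where "q4 a b (axis l 1) = (\<Sum>v\<in>range z. u v \<star> v)"
      using span_finite[of "range z"] by auto
    then have "q4 a b (axis l 1) = (\<Sum>i\<in>UNIV. u (z i) \<star> z i)" by (simp add: sum.reindex[OF z1(1)])
    then show "\<exists>d. q4 a b (axis l 1) = (\<Sum>i\<in>UNIV. d i \<star> z i)" by (intro exI[of _ "\<lambda>i. u (z i)"])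
  qed
  from choice[OF this] obtain n where n: "\<And>l. q4 a b (axis l 1) = (\<Sum>i\<in>UNIV. n l i \<star> z i)" by blast
  define M where "M = (\<chi> l i. m i $ l)"
  define M' where "M' = (\<chi> i l. n l i)"
  have Ms: "M *v s = (\<Sum>i\<in>UNIV. s $ i *s m i)" for s
    by (simp add: M_def matrix_vector_mult_def vec_eq_iff mult.commute)
  have q4M: "q4 a b (M *v s) = (\<Sum>i\<in>UNIV. s $ i \<star> z i)" for s
    by (simp add: Ms q4_sum q4_linear m)
  have Mn: "M *v (\<chi> i. n l i) = axis l 1" for l
    by (rule q4_inj) (simp add: q4M n)
  have "(M ** M') $ i $ l = mat 1 $ i $ l" for i l
  proof -
    have "(M ** M') $ i $ l = (M *v (\<chi> i. n l i)) $ i"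
      by (simp add: matrix_matrix_mult_def matrix_vector_mult_def M'_def)
    then show ?thesis by (simp add: Mn mat_def axis_def)
  qed
  then have MM': "M ** M' = mat 1" by (simp add: vec_eq_iff)
  then have M'M: "M' ** M = mat 1" by (simp add: matrix_left_right_inverse)
  have rep: "representation (range z) (q4 a b (M *v s)) (z l) = s $ l" for s l
  proof -
    have "representation (range z) (\<Sum>i\<in>UNIV. s $ i \<star> z i) (z l) = (\<Sum>i\<in>UNIV. s $ i * (if z l = z i then 1 else 0))"
      by (simp add: representation_sum representation_scale representation_basis z1(2) span_base span_scale)
    also have "\<dots> = s $ l" by (simp add: inj_eq[OF z1(1)] if_distrib cong: if_cong)
    finally show ?thesis by (simp add: q4M)
  qed
  have repm: "representation (range z) (z i \<cdot> z j) (z l) = (M' *v qm \<alpha> \<beta> (m i) (m j)) $ l" for i j l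
  proof -
    have "z i \<cdot> z j = q4 a b (M *v (M' *v qm \<alpha> \<beta> (m i) (m j)))"
      by (simp add: m q4_forms matrix_vector_mul_assoc MM')
    then show ?thesis by (simp only: rep)
  qed
  have Ms': "mapm M *v s = (\<Sum>i\<in>UNIV. s $ i *s mapv (m i))" for s
    by (simp add: M_def matrix_vector_mult_def vec_eq_iff mult.commute)
  have "mapm M *v ext_mul C z s t = qm (to_ac \<alpha>) (to_ac \<beta>) (mapm M *v s) (mapm M *v t)" for s t
  proof -
    have "ext_mul C z s t = (\<Sum>i\<in>UNIV. \<Sum>j\<in>UNIV. (s $ i * t $ j) *s mapv (M' *v qm \<alpha> \<beta> (m i) (m j)))"
      by (simp add: ext_mul_def repm vec_eq_iff)
    then have "mapm M *v ext_mul C z s t = (\<Sum>i\<in>UNIV. \<Sum>j\<in>UNIV. (s $ i * t $ j) *s mapv (M *v (M' *v qm \<alpha> \<beta> (m i) (m j))))"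
      by (simp add: matrix_vector_mult_sum matrix_vector_mult_scale mapv_mult)
    also have "\<dots> = (\<Sum>i\<in>UNIV. \<Sum>j\<in>UNIV. (s $ i * t $ j) *s qm (to_ac \<alpha>) (to_ac \<beta>) (mapv (m i)) (mapv (m j)))"
      by (simp add: matrix_vector_mul_assoc MM' mapv_qm)
    also have "\<dots> = qm (to_ac \<alpha>) (to_ac \<beta>) (mapm M *v s) (mapm M *v t)"
      unfolding Ms' unfolding qm_sum(1) unfolding qm_sum(2)
      by (simp add: qm_linear(2,4) vector_smult_assoc mult.commute)
    finally show ?thesis .
  qed
  moreover have "ext_nrm C z s = qn (to_ac \<alpha>) (to_ac \<beta>) (mapm M *v s)" for s
    unfolding ext_nrm_def sum_UNIV_4 sum_pairs_4 Ms' qn_combination m q4_forms to_ac_qn ..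
  ultimately show ?thesis using that MM' M'M by blast
qed

end

end


section \<open>Flags with parameters read off a normal form\<close>

context comp_alg begin

context
  fixes a b c :: 'c and y1 y2 y3 :: 'a and x :: "'a ^ (6 set)" and v :: "'a ^ 6" and g :: "'a ^ 6 ^ 6"
  assumes triple: "cd_triple C a b c (y1 * y2 * y3) y1 y2" and y: "y1 \<noteq> 0" "y2 \<noteq> 0" "y3 \<noteq> 0"
    and x: "x \<in> Xspace" and g: "g \<in> Sp6" "act3 g x = normal_form 0 y1 y2 y3" "g *v v = bv 4"
    and surj: "surj (octo a b c)"
begin

lemma f1_point: "f1 x = y1 * y2 * y3"
  using f1_act3[OF two x g(1)] f1_normal_form[OF two, of 0 y1 y2 y3] by (simp add: g(2))

lemma y_prod: "y1 * y2 * y3 \<noteq> 0" using y by simp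

lemma flag_point: "flag_params C {quat a b (s, t, 0, 0) | s t. True} (range (quat a b)) (y1 * y2 * y3) y1 y2"
  unfolding flag_params_def using triple surj by blast

lemma stabilizer_iso_point: "stabilizer_iso_SL1 (x, v) C (range (quat a b))"
proof -
  let ?i = "to_ac (y1 * y2 * y3)" and ?y = "to_ac y1" and ?S = "stabilizer (x, v)"
  obtain \<Phi> \<Psi> where "stabilizer_chart ?S ?i ?y \<Phi> \<Psi>"
    using stabilizer_coordinates[OF two x g y] by blast
  note P = stabilizer_chartD[OF this]
  obtain z :: "4 \<Rightarrow> 'c" where z: "basis_of C (range (quat a b)) z"
    using exists_basis[OF triple y_prod y(1,2)] by blast
  obtain M M' where M: "M ** M' = mat 1" "M' ** M = mat 1"
    "\<And>s. ext_nrm C z s = qn ?i ?y (mapm M *v s)"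
    "\<And>s t. mapm M *v ext_mul C z s t = qm ?i ?y (mapm M *v s) (mapm M *v t)"
    using basis_coordinates[OF triple y_prod y(1,2) z] by blast
  have MM: "mapm M *v (mapm M' *v s) = s" "mapm M' *v (mapm M *v s) = s" for s
    by (simp_all add: matrix_vector_mul_assoc M mapm_1 flip: mapm_mult)
  define F where "F k = mapm M' *v \<Phi> k" for k
  define G where "G s = \<Psi> (mapm M *v s)" for s
  have "(\<lambda>k. F k $ i) \<in> poly_funs mat_coords" for i
    unfolding F_def by (intro poly_funs_vector P)
  moreover have "(\<lambda>s. G s $ i $ j) \<in> poly_funs vec_coords" for i j
    unfolding G_def by (rule poly_funs_compose_vec[OF P(2)]) (intro poly_funs_vector poly_funs_coords)
  moreover have "F k \<in> SL1 C z \<and> G (F k) = k" if "k \<in> ?S" for k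
    using that P(3,4) by (simp add: SL1_def M(3) F_def G_def MM)
  moreover have "G s \<in> ?S \<and> F (G s) = s" if "s \<in> SL1 C z" for s
    using that P(5,6) by (simp add: SL1_def M(3) F_def G_def MM)
  moreover have "F (k ** l) = ext_mul C z (F k) (F l)" if kl: "k \<in> ?S" "l \<in> ?S" for k l
  proof -
    have "mapm M *v F (k ** l) = qm ?i ?y (\<Phi> k) (\<Phi> l)" using P(7)[OF kl] by (simp add: F_def MM)
    also have "\<dots> = mapm M *v ext_mul C z (F k) (F l)" by (simp add: M(4) F_def MM)
    finally show ?thesis by (metis MM(2))
  qed
  ultimately show ?thesis unfolding stabilizer_iso_SL1_def using z by (intro exI[of _ z] exI[of _ F] exI[of _ G] conjI ballI allI) simp_all
qed

text \<open>Zorn's algebra has a triple with the same three parameters whose quadratic subalgebra is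
  the diagonal.\<close>

lemma attached_split:
  assumes r: "r\<^sup>2 = - f1 x"
  shows "\<exists>\<theta>. alg_iso C UNIV Zorn UNIV \<theta> \<and> \<theta> ` {quat a b (s, t, 0, 0) | s t. True} = Zorn_diag"
proof -
  have i: "- r\<^sup>2 = y1 * y2 * y3" using r f1_point by simp
  then have "r \<noteq> 0" using y by auto
  from Zorn_triple[OF two this y(1,2)] obtain a' b' c' where
    "cd_triple Zorn a' b' c' (- r\<^sup>2) y1 y2" "surj (comp_alg.octo Zorn a' b' c')"
    "{comp_alg.quat Zorn a' b' (s, t, 0, 0) | s t. True} = Zorn_diag" .
  then have "flag_params Zorn Zorn_diag (range (comp_alg.quat Zorn a' b')) (y1 * y2 * y3) y1 y2"
    unfolding flag_params_def i by blast
  from flag_params_iso[OF comp_alg_axioms comp_alg_Zorn[OF two] flag_point this y_prod y(1,2)]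
  show ?thesis unfolding flag_iso_def by blast
qed

lemma attached_nonsplit:
  shows "\<exists>\<theta>. alg_iso C {quat a b (s, t, 0, 0) | s t. True} (quad_alg (f1 x)) UNIV \<theta>"
    and "norm_decomposes C {quat a b (s, t, 0, 0) | s t. True} y1 y2 y3"
proof -
  let ?K = "{quat a b (s, t, 0, 0) | s t. True}"
  define q where "q = (\<lambda>(s, t). quat a b (s, t, 0, 0))"
  define \<theta> where "\<theta> = inv_into UNIV q"
  have q_inj: "inj q"
  proof (rule injI)
    fix p p' assume "q p = q p'"
    then have "q4 a b (vec4 (fst p) (snd p) 0 0) = q4 a b (vec4 (fst p') (snd p') 0 0)"
      by (simp add: q_def q4_def split_beta)
    then have "vec4 (fst p) (snd p) 0 0 = vec4 (fst p') (snd p') 0 (0 :: 'a)" by (rule q4_inj[OF triple y_prod y(1,2)])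
    then have "vec4 (fst p) (snd p) 0 0 $ 0 = vec4 (fst p') (snd p') 0 (0 :: 'a) $ 0"
      "vec4 (fst p) (snd p) 0 0 $ 1 = vec4 (fst p') (snd p') 0 (0 :: 'a) $ 1" by simp_all
    then show "p = p'" by (simp add: prod_eq_iff)
  qed
  have \<theta>q [simp]: "\<theta> (q p) = p" for p unfolding \<theta>_def using q_inj by simp
  have K: "?K = range q" by (auto simp: q_def)
  have q_add: "q p + q p' = q (p + p')" for p p'
    by (cases p; cases p') (simp add: q_def flip: quat_linear)
  have q_scale: "r \<star> q (s, t) = q (r * s, r * t)" for r s t
    by (simp add: q_def qscl_def flip: quat_linear)
  have q_mul: "q p \<cdot> q p' = q (mul (quad_alg (f1 x)) p p')" for p p'
    by (cases p; cases p') (simp add: q_def quat_mul_triple[OF triple] qmul_def quad_alg_def f1_point)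
  have q_unit: "e = q (1, 0)" by (simp add: q_def quat_def)
  have "bij_betw \<theta> ?K UNIV" unfolding K by (rule bij_betwI[of _ _ _ q]) auto
  then have "alg_iso C ?K (quad_alg (f1 x)) UNIV \<theta>"
    unfolding alg_iso_def K
    by (auto simp: q_add q_mul q_unit q_scale quad_alg_def[of "f1 x"] simp del: split_paired_All)
  then show "\<exists>\<theta>. alg_iso C ?K (quad_alg (f1 x)) UNIV \<theta>" by blast
  \<comment> \<open>The last quarter of the norm of \<open>octo\<close> is y1 y2 N_K. As y1 y2 y3 is
    the norm of a, it is isometric to y3 N_K; the isometry exchanges the two coordinates and scales
    them by y3 and 1/(y1 y2).\<close>
  define T where "T = (\<lambda>(p0, p1, p2, p3). octo a b c ((fst (\<theta> p0), snd (\<theta> p0), fst (\<theta> p1), snd (\<theta> p1)),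
     (fst (\<theta> p2), snd (\<theta> p2), y3 * snd (\<theta> p3), fst (\<theta> p3) / (y1 * y2))))"
  have T: "T (q (s0, t0), q (s1, t1), q (s2, t2), q (s3, t3)) = octo a b c ((s0, t0, s1, t1), (s2, t2, y3 * t3, s3 / (y1 * y2)))"
    for s0 t0 s1 t1 s2 t2 s3 t3 by (simp add: T_def)
  have K4: "\<exists>s0 t0 s1 t1 s2 t2 s3 t3. p = (q (s0, t0), q (s1, t1), q (s2, t2), q (s3, t3))"
    if "p \<in> range q \<times> range q \<times> range q \<times> range q" for p
  proof -
    define r0 r1 r2 r3 where "r0 = \<theta> (fst p)" and "r1 = \<theta> (fst (snd p))" and "r2 = \<theta> (fst (snd (snd p)))"
      and "r3 = \<theta> (snd (snd (snd p)))"
    have "p = (q r0, q r1, q r2, q r3)" using that unfolding r0_def r1_def r2_def r3_def by auto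
    then have "p = (q (fst r0, snd r0), q (fst r1, snd r1), q (fst r2, snd r2), q (fst r3, snd r3))" by simp
    then show ?thesis by blast
  qed
  have "bij_betw T (range q \<times> range q \<times> range q \<times> range q) UNIV"
  proof (rule bij_betwI')
    fix p p' assume pp: "p \<in> range q \<times> range q \<times> range q \<times> range q" "p' \<in> range q \<times> range q \<times> range q \<times> range q"
    then obtain s0 t0 s1 t1 s2 t2 s3 t3 s0' t0' s1' t1' s2' t2' s3' t3'
      where p: "p = (q (s0, t0), q (s1, t1), q (s2, t2), q (s3, t3))" "p' = (q (s0', t0'), q (s1', t1'), q (s2', t2'), q (s3', t3'))"
      using K4[OF pp(1)] K4[OF pp(2)] by (elim exE) (rule that)
    show "(T p = T p') = (p = p')"
      unfolding p T inj_eq[OF octo_inj[OF triple y_prod y(1,2)]] prod.inject inj_eq[OF q_inj] using y by auto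
  next
    fix w
    obtain r where r: "w = octo a b c r" using surjD[OF surj, of w] by blast
    obtain r1 r2 where "r = (r1, r2)" by (cases r)
    moreover obtain s0 t0 s1 t1 where "r1 = (s0, t0, s1, t1)" by (metis prod.exhaust)
    moreover obtain s2 t2 s3 t3 where "r2 = (s2, t2, s3, t3)" by (metis prod.exhaust)
    ultimately have "w = octo a b c ((s0, t0, s1, t1), (s2, t2, s3, t3))" using r by simp
    then have "w = T (q (s0, t0), q (s1, t1), q (s2, t2), q (y1 * y2 * t3, s3 / y3))" using y by (simp add: T)
    then show "\<exists>p\<in>range q \<times> range q \<times> range q \<times> range q. w = T p" by blast
  qed simp
  moreover have "T (p + p') = T p + T p'"
    if pp: "p \<in> range q \<times> range q \<times> range q \<times> range q" "p' \<in> range q \<times> range q \<times> range q \<times> range q" for p p'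
  proof -
    obtain s0 t0 s1 t1 s2 t2 s3 t3 s0' t0' s1' t1' s2' t2' s3' t3'
      where p: "p = (q (s0, t0), q (s1, t1), q (s2, t2), q (s3, t3))" "p' = (q (s0', t0'), q (s1', t1'), q (s2', t2'), q (s3', t3'))"
      using K4[OF pp(1)] K4[OF pp(2)] by (elim exE) (rule that)
    show ?thesis unfolding p by (simp add: q_add T distrib_left add_divide_distrib flip: octo_add[OF triple])
  qed
  moreover have "T (r \<star> p0, r \<star> p1, r \<star> p2, r \<star> p3) = r \<star> T (p0, p1, p2, p3)"
    if pp: "p0 \<in> range q" "p1 \<in> range q" "p2 \<in> range q" "p3 \<in> range q" for r p0 p1 p2 p3
  proof -
    obtain s0 t0 s1 t1 s2 t2 s3 t3 where "(p0, p1, p2, p3) = (q (s0, t0), q (s1, t1), q (s2, t2), q (s3, t3))"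
      using K4[OF SigmaI[OF pp(1) SigmaI[OF pp(2) SigmaI[OF pp(3,4)]]]] by (elim exE) (rule that)
    then show ?thesis
      by (simp add: q_scale T oscl_def qscl_def mult.left_commute flip: octo_scale[OF triple])
  qed
  moreover have "N (T (p0, p1, p2, p3)) = N p0 + y1 * N p1 + y2 * N p2 + y3 * N p3"
    if pp: "p0 \<in> range q" "p1 \<in> range q" "p2 \<in> range q" "p3 \<in> range q" for p0 p1 p2 p3
  proof -
    obtain s0 t0 s1 t1 s2 t2 s3 t3 where p: "(p0, p1, p2, p3) = (q (s0, t0), q (s1, t1), q (s2, t2), q (s3, t3))"
      using K4[OF SigmaI[OF pp(1) SigmaI[OF pp(2) SigmaI[OF pp(3,4)]]]] by (elim exE) (rule that)
    have Nq: "N (q (s, t)) = s\<^sup>2 + y1 * y2 * y3 * t\<^sup>2" for s t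
      by (simp add: q_def N_quat[OF triple] qnrm_def)
    have p': "p0 = q (s0, t0)" "p1 = q (s1, t1)" "p2 = q (s2, t2)" "p3 = q (s3, t3)" using p by simp_all
    define u where "u = s3 / (y1 * y2)"
    have s3: "s3 = u * (y1 * y2)" using y by (simp add: u_def)
    have "N (T (p0, p1, p2, p3)) = onrm (y1 * y2 * y3) y1 y2 ((s0, t0, s1, t1), (s2, t2, y3 * t3, u))"
      unfolding p' T N_octo[OF triple] u_def ..
    then show ?thesis unfolding p' Nq s3 by (simp add: onrm_def qnrm_def power2_eq_square algebra_simps)
  qed
  ultimately show "norm_decomposes C ?K y1 y2 y3"
    unfolding norm_decomposes_def K by (intro exI[of _ T] conjI ballI allI)
qed

lemma represents_point: "represents (x, v) C {quat a b (s, t, 0, 0) | s t. True} (range (quat a b))"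
proof -
  let ?K = "{quat a b (s, t, 0, 0) | s t. True}"
  have "maximal_flag C ?K (range (quat a b))" by (rule flag_params_maximal[OF flag_point y_prod y(1,2)])
  then have tf: "two_flag C ?K" by (simp add: maximal_flag_def)
  have "y1 * y2 * y3 - 1 / 4 * 0\<^sup>2 = f1 x" by (simp add: f1_point)
  then have "\<exists>y0 y1 y2 y3. y1 \<noteq> 0 \<and> y2 \<noteq> 0 \<and> y3 \<noteq> 0 \<and> y1 * y2 * y3 - 1 / 4 * y0\<^sup>2 = f1 x \<and>
      (\<exists>g\<in>Sp6. act3 g x = normal_form y0 y1 y2 y3) \<and> norm_decomposes C ?K y1 y2 y3"
    using y g(1,2) attached_nonsplit(2) by blast
  then have "attached x C ?K"
    unfolding attached_def using tf attached_split attached_nonsplit(1) by auto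
  then show ?thesis unfolding represents_def using stabilizer_iso_point by simp
qed

end

lemma represents_params:
  assumes "flag_params C K Q (y1 * y2 * y3) y1 y2" "y1 \<noteq> 0" "y2 \<noteq> 0" "y3 \<noteq> 0"
    and "x \<in> Xspace" "g \<in> Sp6" "act3 g x = normal_form 0 y1 y2 y3" "g *v v = bv 4"
  shows "represents (x, v) C K Q"
  using assms(1) represents_point[OF _ assms(2-)] unfolding flag_params_def by blast

end

section \<open>Recovering the parameters\<close>

lemma all_less_3: "(\<forall>i<3::nat. P i) \<longleftrightarrow> P 0 \<and> P 1 \<and> P 2"
  by (auto simp: numeral_eq_Suc less_Suc_eq)

lemma all_less_5: "(\<forall>i<5::nat. P i) \<longleftrightarrow> P 0 \<and> P 1 \<and> P 2 \<and> P 3 \<and> P 4"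
  by (auto simp: numeral_eq_Suc less_Suc_eq)

text \<open>Completing the square. For z = z1 and m = z2 z3 the factor z m - z0^2/4 is f_1 of the
  normal form, so that each of the three planes of -f_2 carries a multiple of N_K.\<close>

lemma norm_block:
  fixes z :: "'a::field"
  assumes "z \<noteq> 0" "(2::'a) \<noteq> 0"
  shows "z * ((p + z0 * q / (2 * z))\<^sup>2 + (z * m - 1 / 4 * z0\<^sup>2) * (q / z)\<^sup>2) = z * p\<^sup>2 + z0 * q * p + m * q\<^sup>2"
proof -
  define u h where "u = q / z" and "h = z0 / 2"
  have q: "q = z * u" and z0: "z0 = 2 * h" using assms by (simp_all add: u_def h_def)
  have "z0 * q / (2 * z) = h * u" unfolding q z0 using assms by (simp add: field_simps)
  moreover have "q / z = u" by (simp add: u_def)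
  moreover have "1 / 4 * z0\<^sup>2 = h\<^sup>2" unfolding z0 using four_nonzero[OF assms(2)] by (simp add: power_mult_distrib)
  ultimately show ?thesis by (simp only:) (simp add: q z0 power2_eq_square algebra_simps)
qed

context comp_alg begin

text \<open>The preimage a of t satisfies a^2 = -i and is not a scalar, so its quadratic equation
  gives trace 0 and norm i.\<close>

lemma quad_alg_generator:
  assumes K: "composition_subalgebra C K" and iso: "alg_iso C K (quad_alg i) UNIV \<theta>"
  obtains a where "a \<in> K" "B a e = 0" "N a = i"
proof -
  have eK: "e \<in> K" and mK: "\<And>x y. x \<in> K \<Longrightarrow> y \<in> K \<Longrightarrow> x \<cdot> y \<in> K" and sK: "subspace K"
    using K by (auto simp: composition_subalgebra_def)
  have bij: "bij_betw \<theta> K UNIV" and \<theta>: "\<And>x y. x \<in> K \<Longrightarrow> y \<in> K \<Longrightarrow> \<theta> (x \<cdot> y) = mul (quad_alg i) (\<theta> x) (\<theta> y)"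
    "\<And>s x. x \<in> K \<Longrightarrow> \<theta> (s \<star> x) = scl (quad_alg i) s (\<theta> x)" "\<theta> e = (1, 0)"
    using iso by (auto simp: alg_iso_def quad_alg_def)
  have scl: "scl (quad_alg i) s (p, q) = (s * p, s * q)" and mul: "mul (quad_alg i) (0, 1) (0, 1) = (- i, 0)" for s p q
    by (simp_all add: quad_alg_def)
  obtain a where a: "a \<in> K" "\<theta> a = (0, 1)" using bij by (metis UNIV_I bij_betw_imp_surj_on imageE)
  have "\<theta> (a \<cdot> a) = \<theta> ((- i) \<star> e)" using a eK by (simp only: \<theta> scl mul) simp
  moreover have "a \<cdot> a \<in> K" "(- i) \<star> e \<in> K" using mK a(1) subspace_scale[OF sK eK] by blast+
  ultimately have "a \<cdot> a = (- i) \<star> e" using bij by (metis bij_betw_imp_inj_on inj_onD)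
  then have eq: "B a e \<star> a = (N a - i) \<star> e"
    using polar_square[of a] by (simp add: scale_left_diff_distrib algebra_simps)
  have B0: "B a e = 0"
  proof (rule ccontr)
    assume nz: "B a e \<noteq> 0"
    have "a = inverse (B a e) \<star> (B a e \<star> a)" using nz by simp
    also have "\<dots> = (inverse (B a e) * (N a - i)) \<star> e" by (simp only: eq scale_scale)
    finally have "\<theta> a = \<theta> ((inverse (B a e) * (N a - i)) \<star> e)" by (rule arg_cong)
    then show False unfolding a(2) \<theta>(2)[OF eK] \<theta>(3) scl by simp
  qed
  then have "N a = i" using eq unt_nonzero by simp
  with a(1) B0 show ?thesis by (rule that)
qed

text \<open>The normal form in \<open>attached\<close> may differ from the one with y0 = 0, and the
  z's from the y's. Both belong to x, and f_2 is invariant, so in either case the norm of C is the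
  form with entries 1, i plus -f_2; it can be evaluated at the basis of the preferred normal
  form.\<close>

lemma norm_family:
  assumes a: "a \<in> K" "B a e = 0" "N a = f1 x" and K: "composition_subalgebra C K"
    and nd: "norm_decomposes C K z1 z2 z3" and z: "z1 \<noteq> 0" "z2 \<noteq> 0" "z3 \<noteq> 0" "z1 * z2 * z3 - 1 / 4 * z0\<^sup>2 = f1 x"
    and g': "g' \<in> Sp6" "act3 g' x = normal_form z0 z1 z2 z3" and x: "x \<in> Xspace"
    and g: "g \<in> Sp6" "act3 g x = normal_form 0 y1 y2 y3" and y: "y1 \<noteq> 0" "y2 \<noteq> 0" "y3 \<noteq> 0"
  obtains w where "orth_family C w 5" "N (w 0) = 1" "N (w 1) = y1 * y2 * y3" "N (w 2) = y1"
    "N (w 3) = y1 * y2 * y3 * y1" "N (w 4) = y2"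
proof -
  have i: "f1 x = y1 * y2 * y3"
    using f1_act3[OF two x g(1)] f1_normal_form[OF two, of 0 y1 y2 y3] by (simp add: g(2))
  have sK: "subspace K" and eK: "e \<in> K" using K by (auto simp: composition_subalgebra_def)
  define k where "k s t = s \<star> e + t \<star> a" for s t
  have kK: "k s t \<in> K" for s t
    unfolding k_def by (intro subspace_add subspace_scale sK eK a(1))
  have k_add: "k s t + k s' t' = k (s + s') (t + t')" for s t s' t'
    by (simp add: k_def scale_left_distrib add_ac)
  have Nk: "N (k s t) = s\<^sup>2 + f1 x * t\<^sup>2" for s t
    by (simp add: k_def N_add N_scale B_left B_right a B_sym[of e a] mult.commute)
  from nd[unfolded norm_decomposes_def] obtain T where T0:
    "\<forall>p\<in>K \<times> K \<times> K \<times> K. \<forall>q\<in>K \<times> K \<times> K \<times> K. T (p + q) = T p + T q"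
    "\<forall>a\<in>K. \<forall>b\<in>K. \<forall>c\<in>K. \<forall>d\<in>K. N (T (a, b, c, d)) = N a + z1 * N b + z2 * N c + z3 * N d"
    by (elim exE conjE) (rule that, assumption+)
  have T: "\<And>p q. p \<in> K \<times> K \<times> K \<times> K \<Longrightarrow> q \<in> K \<times> K \<times> K \<times> K \<Longrightarrow> T (p + q) = T p + T q"
    "\<And>p0 p1 p2 p3. p0 \<in> K \<Longrightarrow> p1 \<in> K \<Longrightarrow> p2 \<in> K \<Longrightarrow> p3 \<in> K \<Longrightarrow> N (T (p0, p1, p2, p3)) = N p0 + z1 * N p1 + z2 * N p2 + z3 * N p3"
    using T0 by blast+
  obtain h where h: "h \<in> Sp6" "g ** h = mat 1" "h ** g = mat 1" using Sp6_inverse[OF g(1)] .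
  define A where "A = g' ** h"
  have "act3 h (normal_form 0 y1 y2 y3) = x"
    unfolding g(2)[symmetric] by (simp add: h(3) act3_1 Xspace_homog[OF x] flip: act3_mult)
  then have An: "act3 A (normal_form 0 y1 y2 y3) = normal_form z0 z1 z2 z3" by (simp add: A_def act3_mult g'(2))
  have AS: "A \<in> Sp6" unfolding A_def by (intro Sp6_mult g'(1) h(1))
  \<comment> \<open>The substitution of \<open>norm_block\<close> in the planes (e_4, e_1), (e_5,
    e_2), (e_6, e_3); it makes the norm equal to s^2 + f_1 t^2 - f_2.\<close>
  define R0 where "R0 s t u = T (k s t, k (u $ 4 + z0 * u $ 1 / (2 * z1)) (u $ 1 / z1),
    k (u $ 5 + z0 * u $ 2 / (2 * z2)) (u $ 2 / z2), k (u $ 0 + z0 * u $ 3 / (2 * z3)) (u $ 3 / z3))" for s t and u :: "'a ^ 6"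
  define R where "R s t w = R0 s t (A *v w)" for s t w
  have R0_add: "R0 s t u + R0 s' t' u' = R0 (s + s') (t + t') (u + u')" for s t u s' t' u'
    unfolding R0_def by (subst T(1)[symmetric]) (simp_all add: kK k_add distrib_left add_divide_distrib add_ac)
  have R_add: "R s t w + R s' t' w' = R (s + s') (t + t') (w + w')" for s t w s' t' w'
    by (simp add: R_def R0_add matrix_vector_right_distrib)
  have b: "z1 * ((u $ 4 + z0 * u $ 1 / (2 * z1))\<^sup>2 + f1 x * (u $ 1 / z1)\<^sup>2) = z1 * (u $ 4)\<^sup>2 + z0 * u $ 1 * u $ 4 + z2 * z3 * (u $ 1)\<^sup>2"
    "z2 * ((u $ 5 + z0 * u $ 2 / (2 * z2))\<^sup>2 + f1 x * (u $ 2 / z2)\<^sup>2) = z2 * (u $ 5)\<^sup>2 + z0 * u $ 2 * u $ 5 + z1 * z3 * (u $ 2)\<^sup>2"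
    "z3 * ((u $ 0 + z0 * u $ 3 / (2 * z3))\<^sup>2 + f1 x * (u $ 3 / z3)\<^sup>2) = z3 * (u $ 0)\<^sup>2 + z0 * u $ 3 * u $ 0 + z1 * z2 * (u $ 3)\<^sup>2"
    for u :: "'a ^ 6"
    using norm_block[OF z(1) two, of "u $ 4" z0 "u $ 1" "z2 * z3"] norm_block[OF z(2) two, of "u $ 5" z0 "u $ 2" "z1 * z3"]
      norm_block[OF z(3) two, of "u $ 0" z0 "u $ 3" "z1 * z2"] z(4)[symmetric] by (simp_all only: mult_ac)
  have "N (R0 s t u) = s\<^sup>2 + f1 x * t\<^sup>2 - f2 (normal_form z0 z1 z2 z3, u)" for s t u
    unfolding R0_def T(2)[OF kK kK kK kK] Nk b f2_normal_form[OF two] by (simp add: add_ac)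
  then have NR: "N (R s t w) = s\<^sup>2 + y1 * y2 * y3 * t\<^sup>2 - f2 (normal_form 0 y1 y2 y3, w)" for s t w
    using f2_act[OF two normal_form_Xspace[of 0 y1 y2 y3] AS, of w] by (simp add: R_def An i)
  \<comment> \<open>On the normal form with y0 = 0, -f_2 takes the values y1 at e_4, y2 at e_5 and
    y2 y3 at e_1; the factor y1 turns the last one into i y1.\<close>
  define w where "w k = [R 1 0 0, R 0 1 0, R 0 0 (bv 4), R 0 0 (y1 *s bv 1), R 0 0 (bv 5)] ! k" for k
  have w: "w 0 = R 1 0 0" "w 1 = R 0 1 0" "w 2 = R 0 0 (bv 4)" "w 3 = R 0 0 (y1 *s bv 1)" "w 4 = R 0 0 (bv 5)"
    by (simp_all add: w_def)
  have BR: "B (R s t u) (R s' t' u') = N (R (s + s') (t + t') (u + u')) - N (R s t u) - N (R s' t' u')" for s t u s' t' u'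
    by (simp add: polar_def R_add)
  have nw: "N (w 0) = 1" "N (w 1) = y1 * y2 * y3" "N (w 2) = y1" "N (w 3) = y1 * y2 * y3 * y1" "N (w 4) = y2"
    unfolding w NR f2_normal_form[OF two] by (simp_all add: bv_def axis_def power2_eq_square)
  moreover have "orth_family C w 5"
    unfolding orth_family_def all_less_5 nw unfolding w BR NR f2_normal_form[OF two]
    using y by (simp add: bv_def axis_def)
  ultimately show ?thesis using that by blast
qed

text \<open>The given isomorphism with the norm-one group of Q, composed with the chart of the
  stabilizer, is an isomorphism between two norm-one groups of quaternion algebras, to which
  \<open>quaternion_isometry\<close> applies.\<close>

lemma stabilizer_family:
  assumes triple: "cd_triple C a b c \<alpha> \<beta>' \<gamma>" and nz: "\<alpha> \<noteq> 0" "\<beta>' \<noteq> 0" "\<gamma> \<noteq> 0" and \<alpha>: "\<alpha> = y1 * y2 * y3"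
    and x: "x \<in> Xspace" and g: "g \<in> Sp6" "act3 g x = normal_form 0 y1 y2 y3" "g *v v = bv 4"
    and y: "y1 \<noteq> 0" "y2 \<noteq> 0" "y3 \<noteq> 0" and iso: "stabilizer_iso_SL1 (x, v) C (range (quat a b))"
  obtains w where "orth_family C w 3" "\<And>i. i < 3 \<Longrightarrow> w i \<in> range (quat a b)" "N (w 0) = 1" "N (w 1) = \<alpha>" "N (w 2) = y1"
proof -
  let ?i = "to_ac (y1 * y2 * y3)" and ?y = "to_ac y1" and ?S = "stabilizer (x, v)" and ?b = "to_ac \<beta>'"
  obtain \<Phi> \<Psi> where "stabilizer_chart ?S ?i ?y \<Phi> \<Psi>"
    using stabilizer_coordinates[OF two x g y] by blast
  note P = stabilizer_chartD[OF this]
  obtain z F G where z: "basis_of C (range (quat a b)) z" and F0: "\<forall>i. (\<lambda>k. F k $ i) \<in> poly_funs mat_coords"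
    and G0: "\<forall>i j. (\<lambda>s. G s $ i $ j) \<in> poly_funs vec_coords" and FG0: "\<forall>g\<in>?S. F g \<in> SL1 C z \<and> G (F g) = g"
    and hom0: "\<forall>g\<in>?S. \<forall>h\<in>?S. F (g ** h) = ext_mul C z (F g) (F h)"
    using iso[unfolded stabilizer_iso_SL1_def] by (elim exE conjE) (rule that, assumption+)
  note F = F0[THEN spec] and G = G0[THEN spec, THEN spec]
  have FG: "\<And>k. k \<in> ?S \<Longrightarrow> F k \<in> SL1 C z" "\<And>k. k \<in> ?S \<Longrightarrow> G (F k) = k" using FG0 by blast+
  note hom = hom0[THEN bspec, THEN bspec]
  obtain M M' where M: "M ** M' = mat 1" "M' ** M = mat 1"
    "\<And>s. ext_nrm C z s = qn (to_ac \<alpha>) ?b (mapm M *v s)"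
    "\<And>s t. mapm M *v ext_mul C z s t = qm (to_ac \<alpha>) ?b (mapm M *v s) (mapm M *v t)"
    using basis_coordinates[OF triple nz z] by blast
  have MM: "mapm M *v (mapm M' *v s) = s" "mapm M' *v (mapm M *v s) = s" for s
    by (simp_all add: matrix_vector_mul_assoc M mapm_1 flip: mapm_mult)
  \<comment> \<open>From the parameters (i, y1) through the stabilizer to the parameters (\<alpha>,
    \<beta>') of Q.\<close>
  define H where "H s = mapm M *v F (\<Psi> s)" for s
  define H' where "H' t = \<Phi> (G (mapm M' *v t))" for t
  have H: "(\<lambda>s. H s $ i) \<in> poly_funs vec_coords" for i
    unfolding H_def by (rule poly_funs_vector, rule poly_funs_compose_mat[OF F P(2)])
  have H': "(\<lambda>s. H' s $ i) \<in> poly_funs vec_coords" for i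
    unfolding H'_def by (rule poly_funs_compose_mat[OF P(1)], rule poly_funs_compose_vec[OF G], rule poly_funs_vector, rule poly_funs_coords)
  have HS: "H s \<in> {s. qn (to_ac \<alpha>) ?b s = 1}" if "s \<in> {s. qn ?i ?y s = 1}" for s
    using FG(1)[OF P(5)[of s]] that by (simp add: H_def SL1_def M(3))
  have H'H: "H' (H s) = s" if "s \<in> {s. qn ?i ?y s = 1}" for s
    using FG(2)[OF P(5)[of s]] P(6)[of s] that by (simp add: H_def H'_def MM)
  have Hh: "H (qm ?i ?y s t) = qm (to_ac \<alpha>) ?b (H s) (H t)" if "s \<in> {s. qn ?i ?y s = 1}" "t \<in> {s. qn ?i ?y s = 1}" for s t
  proof -
    have S: "\<Psi> s \<in> ?S" "\<Psi> t \<in> ?S" using that P(5) by simp_all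
    have "\<Phi> (\<Psi> s ** \<Psi> t) = qm ?i ?y s t" using P(7)[OF S] P(6) that by simp
    then have "\<Psi> (qm ?i ?y s t) = \<Psi> s ** \<Psi> t" using P(4) P(7)[OF S] by metis
    then show ?thesis by (simp add: H_def hom[OF S] M(4))
  qed
  have "\<exists>J. \<alpha> * (J 1 1)\<^sup>2 + \<beta>' * (J 2 1)\<^sup>2 + \<alpha> * \<beta>' * (J 3 1)\<^sup>2 = y1 * y2 * y3 \<and>
    \<alpha> * (J 1 2)\<^sup>2 + \<beta>' * (J 2 2)\<^sup>2 + \<alpha> * \<beta>' * (J 3 2)\<^sup>2 = y1 \<and>
    \<alpha> * (J 1 1 + J 1 2)\<^sup>2 + \<beta>' * (J 2 1 + J 2 2)\<^sup>2 + \<alpha> * \<beta>' * (J (3::4) (1::4) + J 3 2)\<^sup>2 = y1 * y2 * y3 + y1"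
    by (rule quaternion_isometry[where \<alpha> = "y1 * y2 * y3" and \<beta> = y1 and \<alpha>' = \<alpha> and \<beta>' = \<beta>' and H = H and H' = H', OF two];
      (rule H H' | (rule HS H'H Hh; assumption)))
  then obtain J :: "4 \<Rightarrow> 4 \<Rightarrow> 'a" where J: "\<alpha> * (J 1 1)\<^sup>2 + \<beta>' * (J 2 1)\<^sup>2 + \<alpha> * \<beta>' * (J 3 1)\<^sup>2 = y1 * y2 * y3"
    "\<alpha> * (J 1 2)\<^sup>2 + \<beta>' * (J 2 2)\<^sup>2 + \<alpha> * \<beta>' * (J 3 2)\<^sup>2 = y1"
    "\<alpha> * (J 1 1 + J 1 2)\<^sup>2 + \<beta>' * (J 2 1 + J 2 2)\<^sup>2 + \<alpha> * \<beta>' * (J 3 1 + J 3 2)\<^sup>2 = y1 * y2 * y3 + y1"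
    by (elim exE conjE) (rule that, assumption+)
  \<comment> \<open>The images of the two generators under the differential, as pure elements of
    Q.\<close>
  let ?u = "quat a b (0, J 1 1, J 2 1, J 3 1)" and ?v = "quat a b (0, J 1 2, J 2 2, J 3 2)"
  define w where "w k = [e, ?u, ?v] ! k" for k
  have w: "w 0 = e" "w 1 = ?u" "w 2 = ?v" by (simp_all add: w_def)
  have e: "e = quat a b (1, 0, 0, 0)" by (simp add: quat_def)
  have nw: "N (w 0) = 1" "N (w 1) = \<alpha>" "N (w 2) = y1"
    unfolding w N_quat[OF triple] qnrm_def using J(1,2) \<alpha> by simp_all
  have "N (?u + ?v) = \<alpha> + y1"
    unfolding quat_linear(1)[symmetric] N_quat[OF triple] qnrm_def using J(3) \<alpha> by simp
  then have uv: "B ?u ?v = 0" "B ?v ?u = 0" using nw(2,3) unfolding w by (simp_all add: polar_def add.commute)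
  have ew: "B e ?u = 0" "B e ?v = 0" "B ?u e = 0" "B ?v e = 0"
    unfolding e B_quat[OF triple] qpol_def by simp_all
  have "orth_family C w 3"
    unfolding orth_family_def all_less_3 nw unfolding w using uv ew nz y by simp
  moreover have "w i \<in> range (quat a b)" if "i < 3" for i
  proof -
    have "\<forall>i<3. w i \<in> range (quat a b)" unfolding all_less_3 w e by blast
    with that show ?thesis by blast
  qed
  ultimately show ?thesis using that nw by blast
qed

text \<open>A triple in Zorn's algebra with the wanted parameters and diagonal quadratic part is
  pulled back along the isomorphism, which preserves norms.\<close>

lemma split_family:
  assumes iso: "alg_iso C UNIV Zorn UNIV \<theta>" "\<theta> ` K = Zorn_diag" and r: "r\<^sup>2 = - (y1 * y2 * y3)"
    and y: "y1 \<noteq> 0" "y2 \<noteq> 0" "y3 \<noteq> 0"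
  obtains a w where "a \<in> K" "B a e = 0" "N a = y1 * y2 * y3" "orth_family C w 5" "N (w 0) = 1" "N (w 1) = y1 * y2 * y3"
    "N (w 2) = y1" "N (w 3) = y1 * y2 * y3 * y1" "N (w 4) = y2"
proof -
  interpret Z: comp_alg "Zorn :: ('a, _) calg" by (rule comp_alg_Zorn[OF two])
  have i: "- r\<^sup>2 = y1 * y2 * y3" using r by simp
  then have "r \<noteq> 0" using y by auto
  from Zorn_triple[OF two this y(1,2)] obtain a' b' c' where t: "cd_triple Zorn a' b' c' (- r\<^sup>2) y1 y2"
    "surj (comp_alg.octo Zorn a' b' c')" "{comp_alg.quat Zorn a' b' (s, t, 0, 0) | s t. True} = Zorn_diag" .
  note triple = t(1)[unfolded i]
  have i0: "y1 * y2 * y3 \<noteq> 0" using y by simp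
  have pres: "nrm Zorn (\<theta> x) = N x" "polar Zorn (\<theta> x) (\<theta> y) = B x y" for x y
    using alg_iso_preserves[OF comp_alg_axioms Z.comp_alg_axioms iso(1)] by auto
  define z where "z k = [unt Zorn, a', b', mul Zorn a' b', c', mul Zorn a' c', mul Zorn b' c', mul Zorn (mul Zorn a' b') c'] ! k" for k
  have z: "orth_family Zorn z 5"
    using orth_family_mono[OF Z.triple_orth_family[OF triple i0 y(1,2)], of 5] by (simp add: z_def[abs_def])
  define w where "w k = inv_into UNIV \<theta> (z k)" for k
  have \<theta>w: "\<theta> (w k) = z k" for k
    unfolding w_def using iso(1) by (intro f_inv_into_f) (auto simp: alg_iso_def bij_betw_def)
  have Bw: "B (w k) (w l) = polar Zorn (z k) (z l)" "N (w k) = nrm Zorn (z k)" for k l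
    by (simp_all flip: pres add: \<theta>w)
  have "orth_family C w 5" using z by (simp add: orth_family_def Bw)
  moreover have "N (w 0) = 1" "N (w 1) = y1 * y2 * y3" "N (w 2) = y1" "N (w 3) = y1 * y2 * y3 * y1" "N (w 4) = y2"
    unfolding Bw using Z.triple_simps(1-3)[OF triple] Z.B_ab(4)[OF triple] by (simp_all add: z_def)
  moreover have "w 1 \<in> K"
  proof -
    have "a' = comp_alg.quat Zorn a' b' (0, 1, 0, 0)" by (simp add: Z.quat_def)
    then have "\<theta> (w 1) \<in> \<theta> ` K" unfolding iso(2) t(3)[symmetric] \<theta>w by (auto simp: z_def)
    then show ?thesis using iso(1) by (auto simp: alg_iso_def bij_betw_def dest: injD)
  qed
  moreover have "B (w 1) e = 0"
  proof -
    have "\<theta> e = unt Zorn" using iso(1) by (simp add: alg_iso_def)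
    then have "B (w 1) e = polar Zorn a' (unt Zorn)" by (simp flip: pres add: \<theta>w z_def)
    then show ?thesis by (simp add: Z.triple_simps[OF triple])
  qed
  ultimately show ?thesis using that by blast
qed

text \<open>The attached 2-flag gives a in K and a family of five vectors in C; the stabilizer gives
  a family of three vectors in Q. These are the inputs of \<open>flag_params_change\<close>.\<close>

lemma represents_imp_params:
  assumes flag: "maximal_flag C K Q" and rep: "represents (x, v) C K Q"
    and x: "x \<in> Xspace" and g: "g \<in> Sp6" "act3 g x = normal_form 0 y1 y2 y3" "g *v v = bv 4"
    and y: "y1 \<noteq> 0" "y2 \<noteq> 0" "y3 \<noteq> 0"
  shows "flag_params C K Q (y1 * y2 * y3) y1 y2"
proof -
  have f1: "f1 x = y1 * y2 * y3"
    using f1_act3[OF two x g(1)] f1_normal_form[OF two, of 0 y1 y2 y3] by (simp add: g(2))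
  have i0: "y1 * y2 * y3 \<noteq> 0" using y by simp
  have K: "composition_subalgebra C K" using flag by (simp add: maximal_flag_def two_flag_def)
  have att: "attached x C K" and iso: "stabilizer_iso_SL1 (x, v) C Q" using rep by (auto simp: represents_def)
  obtain a w where a: "a \<in> K" "B a e = 0" "N a = y1 * y2 * y3" and w: "orth_family C w 5" "N (w 0) = 1" "N (w 1) = y1 * y2 * y3"
    "N (w 2) = y1" "N (w 3) = y1 * y2 * y3 * y1" "N (w 4) = y2"
  proof (cases "\<exists>r. r\<^sup>2 = - f1 x")
    case True
    then obtain r \<theta> where "r\<^sup>2 = - (y1 * y2 * y3)" "alg_iso C UNIV Zorn UNIV \<theta>" "\<theta> ` K = Zorn_diag"
      using att unfolding attached_def f1 by auto
    then show ?thesis using split_family[OF _ _ _ y, of \<theta> K r] that by metis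
  next
    case False
    then obtain \<theta> z0 z1 z2 z3 g' where \<theta>: "alg_iso C K (quad_alg (f1 x)) UNIV \<theta>" and z: "z1 \<noteq> 0" "z2 \<noteq> 0" "z3 \<noteq> 0"
      "z1 * z2 * z3 - 1 / 4 * z0\<^sup>2 = f1 x" and g': "g' \<in> Sp6" "act3 g' x = normal_form z0 z1 z2 z3"
      and nd: "norm_decomposes C K z1 z2 z3"
      using att unfolding attached_def by auto
    obtain a where a: "a \<in> K" "B a e = 0" "N a = f1 x" using quad_alg_generator[OF K \<theta>] .
    show ?thesis
      by (rule norm_family[OF a K nd z g' x g(1,2) y]) (rule that[OF a(1,2) a(3)[unfolded f1]])
  qed
  have "N a \<noteq> 0" using a(3) i0 by simp
  then obtain b c where bc: "b \<in> Q" "N b \<noteq> 0" "N c \<noteq> 0" "cd_triple C a b c (N a) (N b) (N c)"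
    using maximal_flag_params[OF flag a(1,2)] by blast
  have "flag_params C K Q (N a) (N b) (N c)"
    by (rule flag_paramsI[OF bc(4) \<open>N a \<noteq> 0\<close> bc(2,3) flag a(1) bc(1)])
  then obtain a' b' c' where t: "cd_triple C a' b' c' (N a) (N b) (N c)" and Q: "Q = range (quat a' b')"
    unfolding flag_params_def by blast
  obtain u where u: "orth_family C u 3" "\<And>i. i < 3 \<Longrightarrow> u i \<in> Q" "N (u 0) = 1" "N (u 1) = N a" "N (u 2) = y1"
    using stabilizer_family[OF t \<open>N a \<noteq> 0\<close> bc(2,3) a(3) x g y iso[unfolded Q]] unfolding Q by blast
  show ?thesis
    by (rule flag_params_change[OF flag a i0 y(1,2) u(1,2,3) u(4)[unfolded a(3)] u(5) w])
qed

end

section \<open>From orbits to classes of flags\<close>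

lemma normal_form_Vss:
  fixes y1 :: "'a::field"
  assumes "(2::'a) \<noteq> 0" "y1 \<noteq> 0" "y2 \<noteq> 0" "y3 \<noteq> 0"
  shows "(normal_form 0 y1 y2 y3, bv 4) \<in> Vss"
  using assms by (simp add: Vss_def normal_form_Xspace f1_normal_form f2_normal_form bv_def axis_def)

lemma orbit_normal_form:
  assumes p0: "x0 \<in> Xspace" "g0 \<in> Sp6" "act3 g0 x0 = n" "g0 *v v0 = u" and p: "(x, v) \<in> {act g (x0, v0) | g. g \<in> Sp6}"
  obtains g where "x \<in> Xspace" "g \<in> Sp6" "act3 g x = n" "g *v v = u"
proof -
  obtain k where k: "k \<in> Sp6" "x = act3 k x0" "v = k *v v0" using p by (auto simp: act_def)
  obtain h where h: "h \<in> Sp6" "h ** k = mat 1" using Sp6_inverse[OF k(1)] by blast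
  have "act3 h x = x0" by (simp add: k(2) h(2) act3_1 Xspace_homog[OF p0(1)] flip: act3_mult)
  moreover have "h *v v = v0" by (simp add: k(3) matrix_vector_mul_assoc h(2))
  ultimately show ?thesis
    using that[of "g0 ** h"] Xspace_act3[OF k(1) p0(1)] Sp6_mult[OF p0(2) h(1)] p0(3,4)
    by (simp add: k(2)[symmetric] act3_mult flip: matrix_vector_mul_assoc)
qed

text \<open>The representing flag lives on \<open>'a ^ 8\<close>, since an arbitrary type need not
  carry an octonion algebra; the equivalence with \<open>flag_iso\<close> compares it with flags on
  any type.\<close>

theorem theorem4p17:
  assumes "(2::'a::field) \<noteq> 0"
  shows "(\<forall>orb \<in> (Vss_orbits :: (('a ^ (6 set)) \<times> ('a ^ 6)) set set).
            \<exists>(C :: ('a, 'a ^ 8) calg) K Q. maximal_flag C K Q \<and>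
              (\<forall>p\<in>orb. represents p C K Q \<and>
                 (\<forall>(C' :: ('a, 'c::ab_group_add) calg) K' Q'. maximal_flag C' K' Q' \<longrightarrow>
                    (represents p C' K' Q' \<longleftrightarrow> flag_iso C K Q C' K' Q')))) \<and>
         (\<forall>(C :: ('a, 'c) calg) K Q. maximal_flag C K Q \<longrightarrow>
            (\<exists>orb \<in> (Vss_orbits :: (('a ^ (6 set)) \<times> ('a ^ 6)) set set). \<forall>p\<in>orb. represents p C K Q))"
proof (intro conjI ballI allI impI)
  note two = assms
  fix orb :: "(('a ^ (6 set)) \<times> ('a ^ 6)) set"
  assume "orb \<in> Vss_orbits"
  then obtain x0 v0 where p0: "(x0, v0) \<in> Vss" and orb: "orb = {act g (x0, v0) | g. g \<in> Sp6}"
    by (auto simp: Vss_orbits_def)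
  have x0: "x0 \<in> Xspace" "f1 x0 \<noteq> 0" "f2 (x0, v0) \<noteq> 0" using p0 by (auto simp: Vss_def)
  obtain g0 y1 y2 y3 where g0: "g0 \<in> Sp6" "act3 g0 x0 = normal_form 0 y1 y2 y3" "g0 *v v0 = bv 4"
    and y: "y1 \<noteq> 0" "y2 \<noteq> 0" "y3 \<noteq> 0" using normal_form_exists[OF two x0] .
  have i0: "y1 * y2 * y3 \<noteq> 0" using y by simp
  let ?C = "cd_alg (y1 * y2 * y3) y1 y2"
  interpret C: comp_alg ?C by (rule comp_alg_cd[OF two i0 y(1,2)])
  from cd_alg_triple[OF two i0 y(1,2)] obtain a b c where
    "cd_triple ?C a b c (y1 * y2 * y3) y1 y2" "surj (comp_alg.octo ?C a b c)" .
  then obtain K Q where par: "flag_params ?C K Q (y1 * y2 * y3) y1 y2" unfolding flag_params_def by blast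
  have max: "maximal_flag ?C K Q" by (rule C.flag_params_maximal[OF par i0 y(1,2)])
  have "represents p ?C K Q \<and> (\<forall>(C' :: ('a, 'c) calg) K' Q'. maximal_flag C' K' Q' \<longrightarrow>
                    (represents p C' K' Q' \<longleftrightarrow> flag_iso ?C K Q C' K' Q'))" if "p \<in> orb" for p
  proof -
    obtain x v where p: "p = (x, v)" by (cases p)
    have pin: "(x, v) \<in> {act g (x0, v0) | g. g \<in> Sp6}" using that unfolding orb p .
    obtain g where g: "x \<in> Xspace" "g \<in> Sp6" "act3 g x = normal_form 0 y1 y2 y3" "g *v v = bv 4"
      by (rule orbit_normal_form[OF x0(1) g0 pin])
    have "represents p C' K' Q' \<longleftrightarrow> flag_iso ?C K Q C' K' Q'" if max': "maximal_flag C' K' Q'" for C' :: "('a, 'c) calg" and K' Q'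
    proof -
      interpret C': comp_alg C' using comp_alg_flag[OF two] max' by (auto simp: maximal_flag_def)
      \<comment> \<open>Representation and isomorphism with the model are both equivalent to having
        the parameters i, y1, y2.\<close>
      have "represents p C' K' Q' \<longleftrightarrow> flag_params C' K' Q' (y1 * y2 * y3) y1 y2"
        using C'.represents_imp_params[OF max' _ g y] C'.represents_params[OF _ y g] unfolding p by blast
      also have "\<dots> \<longleftrightarrow> flag_iso ?C K Q C' K' Q'"
        using flag_params_iso[OF C.comp_alg_axioms C'.comp_alg_axioms par _ i0 y(1,2)]
          flag_iso_params[OF C.comp_alg_axioms C'.comp_alg_axioms _ par max' i0 y(1,2)] by blast
      finally show ?thesis .
    qed
    then show ?thesis using C.represents_params[OF par y g] unfolding p by blast
  qed
  with max show "\<exists>(C :: ('a, 'a ^ 8) calg) K Q. maximal_flag C K Q \<and>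
              (\<forall>p\<in>orb. represents p C K Q \<and>
                 (\<forall>(C' :: ('a, 'c) calg) K' Q'. maximal_flag C' K' Q' \<longrightarrow>
                    (represents p C' K' Q' \<longleftrightarrow> flag_iso C K Q C' K' Q')))" by blast
next
  note two = assms
  fix C :: "('a, 'c) calg" and K Q
  assume max: "maximal_flag C K Q"
  then have tf: "two_flag C K" by (simp add: maximal_flag_def)
  interpret comp_alg C by (rule comp_alg_flag[OF two tf])
  obtain a where a: "a \<in> K" "polar C a (unt C) = 0" "nrm C a \<noteq> 0" using exists_pure_in_quadratic[OF tf] .
  obtain b c where bc: "b \<in> Q" "nrm C b \<noteq> 0" "nrm C c \<noteq> 0" "cd_triple C a b c (nrm C a) (nrm C b) (nrm C c)"
    using maximal_flag_params[OF max a] .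
  \<comment> \<open>The value of y3 is chosen so that y1 y2 y3 = N(a).\<close>
  define y1 y2 y3 where "y1 = nrm C b" and "y2 = nrm C c" and "y3 = nrm C a / (nrm C b * nrm C c)"
  have y: "y1 \<noteq> 0" "y2 \<noteq> 0" "y3 \<noteq> 0" and i: "nrm C a = y1 * y2 * y3" using a(3) bc(2,3) by (simp_all add: y1_def y2_def y3_def)
  have par: "flag_params C K Q (y1 * y2 * y3) y1 y2"
    using flag_paramsI[OF bc(4) a(3) bc(2,3) max a(1) bc(1)] by (simp add: i flip: y1_def y2_def)
  let ?p = "(normal_form 0 y1 y2 y3, bv 4)" and ?orb = "{act g (normal_form 0 y1 y2 y3, bv 4) | g. g \<in> Sp6}"
  have "represents p C K Q" if p: "p \<in> ?orb" for p
  proof -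
    obtain x v where p': "p = (x, v)" by (cases p)
    obtain g where g: "x \<in> Xspace" "g \<in> Sp6" "act3 g x = normal_form 0 y1 y2 y3" "g *v v = bv 4"
      by (rule orbit_normal_form[OF normal_form_Xspace Sp6_1 act3_1[OF homog_normal_form] matrix_vector_mul_lid p[unfolded p']])
    show ?thesis unfolding p' by (rule represents_params[OF par y g])
  qed
  moreover have "?orb \<in> Vss_orbits" unfolding Vss_orbits_def using normal_form_Vss[OF two y] by (rule imageI)
  ultimately show "\<exists>orb \<in> (Vss_orbits :: (('a ^ (6 set)) \<times> ('a ^ 6)) set set). \<forall>p\<in>orb. represents p C K Q" by blast
qed

end
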